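(* Let $\mathscr{P}_\bullet$ be an irreducible subfactor planar algebra and let $x\in\mathscr{P}_{2,\pm}$. Then: (1) for any $p$ with $0<p\le\infty$ and $1/p<1/2$, $\|\mathfrak{F}_s(x)\|_2=\delta^{1-2/p}\|x\|_p$ if and only if $x$ is a multiple of a unitary element; (2) for any $q$ with $0<q\le\infty$ and $1/q>1/2$, $\|\mathfrak{F}_s(x)\|_q=\delta^{2/q-1}\|x\|_2$ if and only if $\mathfrak{F}_s(x)$ is a multiple of a unitary element.
   Context: Let $\mathscr{P}_\bullet=\{\mathscr{P}_{n,\pm}\}_{n\ge 0}$ be a subfactor planar algebra in the sense of Jones, with $\delta$ the square root of the Jones index (the value of a closed loop). It is irreducible if $\mathscr{P}_{1,\pm}$ is one-dimensional. Each $\mathscr{P}_{n,\pm}$ is a finite-dimensional C$^*$-algebra and $tr_2$ denotes the unnormalized Markov trace on $\mathscr{P}_{2,\pm}$, so $tr_2(1)=\delta^2$. The string Fourier transform $\mathfrak{F}_s:\mathscr{P}_{2,\pm}\to\mathscr{P}_{2,\mp}$ is the clockwise 1-click rotation. For $x\in\mathscr{P}_{2,\pm}$, $|x|=(x^*x)^{1/2}$, $\|x\|_p=(tr_2(|x|^p))^{1/p}$ for $0<p<\infty$, and $\|x\|_\infty$ is the operator norm. Convention: $1/\infty=0$. "Multiple" means scalar multiple. *)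

theory Defs
  imports "HOL-Analysis.Analysis"
begin

text \<open>Shaded planar tangles are taken in the topological category: discs are homeomorphic images
  of the closed unit disc, strings are arcs and simple closed curves, and isotopies are ambient
  isotopies of the plane through homeomorphisms. In dimension two this gives the same isotopy
  classes of tangles as smooth discs, smooth transversal strings and orientation preserving
  diffeomorphisms, and gluing needs no smoothing along the common boundary.\<close>

datatype sign = Pos | Neg

fun opp :: "sign \<Rightarrow> sign" where
  "opp Pos = Neg"
| "opp Neg = Pos"

text \<open>The field \<open>strings\<close> is the union of all strings, \<open>shaded\<close> the union of the shaded regions,
  and \<open>marked\<close> the union of the distinguished boundary intervals, one for each disc.\<close>

record tangle =
  outer_disc :: "complex set"
  inner_discs :: "complex set set"
  strings :: "complex set"
  shaded :: "complex set"
  marked :: "complex set"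

definition discs :: "tangle \<Rightarrow> complex set set" where
  "discs T = insert (outer_disc T) (inner_discs T)"

text \<open>Regions contain the open boundary intervals of the discs they touch, so that the regions of
  a glued tangle are the unions of the regions of its two pieces.\<close>

definition regions :: "tangle \<Rightarrow> complex set" where
  "regions T = outer_disc T - \<Union> (interior ` inner_discs T) - strings T"

definition is_string :: "tangle \<Rightarrow> complex set \<Rightarrow> bool" where
  "is_string T c \<longleftrightarrow> (\<exists>g. path_image g = c \<and>
     (arc g \<and> pathstart g \<in> \<Union> (frontier ` discs T) \<and> pathfinish g \<in> \<Union> (frontier ` discs T) \<and>
        c - {pathstart g, pathfinish g} \<subseteq> interior (outer_disc T) - \<Union> (inner_discs T)
      \<or> simple_path g \<and> pathfinish g = pathstart g \<and>
        c \<subseteq> interior (outer_disc T) - \<Union> (inner_discs T)))"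

text \<open>Every point of a string is required to be a limit of both the shaded and the unshaded part,
  which means that the shading changes across each string. A disc without boundary points has the
  whole boundary circle as its only, hence distinguished, interval.\<close>

definition planar_tangle :: "tangle \<Rightarrow> bool" where
  "planar_tangle T \<longleftrightarrow>
     (\<forall>D\<in>discs T. D homeomorphic cball (0::complex) 1) \<and>
     finite (inner_discs T) \<and> disjoint (inner_discs T) \<and>
     (\<forall>D\<in>inner_discs T. D \<subseteq> interior (outer_disc T)) \<and>
     (\<exists>C. finite C \<and> disjoint C \<and> \<Union> C = strings T \<and> (\<forall>c\<in>C. is_string T c)) \<and>
     (\<forall>D\<in>discs T. even (card (strings T \<inter> frontier D))) \<and>
     openin (top_of_set (regions T)) (shaded T) \<and>
     closedin (top_of_set (regions T)) (shaded T) \<and>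
     strings T \<subseteq> closure (shaded T) \<inter> closure (regions T - shaded T) \<and>
     marked T \<subseteq> \<Union> (frontier ` discs T) \<and>
     (\<forall>D\<in>discs T. marked T \<inter> frontier D \<in> components (frontier D - strings T))"

definition disc_size :: "tangle \<Rightarrow> complex set \<Rightarrow> nat" where
  "disc_size T D = card (strings T \<inter> frontier D) div 2"

definition disc_sign :: "tangle \<Rightarrow> complex set \<Rightarrow> sign" where
  "disc_sign T D = (if marked T \<inter> frontier D \<subseteq> shaded T then Neg else Pos)"

definition map_tangle :: "(complex \<Rightarrow> complex) \<Rightarrow> tangle \<Rightarrow> tangle" where
  "map_tangle h T = \<lparr>outer_disc = h ` outer_disc T, inner_discs = (`) h ` inner_discs T,
     strings = h ` strings T, shaded = h ` shaded T, marked = h ` marked T\<rparr>"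

definition isotopic_to_id :: "(complex \<Rightarrow> complex) \<Rightarrow> bool" where
  "isotopic_to_id h \<longleftrightarrow> (\<exists>H :: real \<Rightarrow> complex \<Rightarrow> complex.
     continuous_on ({0..1} \<times> UNIV) (\<lambda>(t, z). H t z) \<and>
     (\<forall>t\<in>{0..1}. \<exists>k. homeomorphism UNIV UNIV (H t) k) \<and>
     H 0 = id \<and> H 1 = h)"

definition gluable :: "tangle \<Rightarrow> complex set \<Rightarrow> tangle \<Rightarrow> bool" where
  "gluable T D S \<longleftrightarrow> planar_tangle T \<and> planar_tangle S \<and> D \<in> inner_discs T \<and> outer_disc S = D \<and>
     strings T \<inter> frontier D = strings S \<inter> frontier D \<and>
     shaded T \<inter> frontier D = shaded S \<inter> frontier D \<and>
     marked T \<inter> frontier D = marked S \<inter> frontier D"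

definition glue :: "tangle \<Rightarrow> complex set \<Rightarrow> tangle \<Rightarrow> tangle" where
  "glue T D S = \<lparr>outer_disc = outer_disc T, inner_discs = inner_discs T - {D} \<union> inner_discs S,
     strings = strings T \<union> strings S, shaded = shaded T \<union> shaded S,
     marked = (marked T \<union> marked S) - frontier D\<rparr>"

subsection \<open>Particular tangles\<close>

definition rect :: "real \<Rightarrow> real \<Rightarrow> real \<Rightarrow> real \<Rightarrow> complex set" where
  "rect a b c d = {z. a \<le> Re z \<and> Re z \<le> b \<and> c \<le> Im z \<and> Im z \<le> d}"

text \<open>Shading of a region separated by \<open>k\<close> strings from a region of sign \<open>s\<close>.\<close>

definition shade :: "sign \<Rightarrow> nat \<Rightarrow> bool" where
  "shade s k \<longleftrightarrow> (if s = Pos then odd k else even k)"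

definition stack_box :: "nat \<Rightarrow> nat \<Rightarrow> complex set" where
  "stack_box n i = rect (1/4) (real n + 3/4) (2 * real i + 1) (2 * real i + 2)"

text \<open>\<open>k\<close> boxes on top of each other, neighbours being joined by \<open>n\<close> vertical strings; the
  distinguished interval of every box is on the left. For \<open>k = 0, 1, 2\<close> these are the unit, the
  identity and the multiplication tangle, and for \<open>n = k = 0\<close> the empty tangle.\<close>

definition stack_tangle :: "nat \<Rightarrow> sign \<Rightarrow> nat \<Rightarrow> tangle" where
  "stack_tangle n s k =
    (let out = rect (1/8) (real n + 7/8) 0 (2 * real k + 1);
         ins = stack_box n ` {..<k};
         str = {z. \<exists>j\<in>{1..n}. \<exists>i\<le>k. Re z = real j \<and> 2 * real i \<le> Im z \<and> Im z \<le> 2 * real i + 1}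
     in \<lparr>outer_disc = out, inner_discs = ins, strings = str,
         shaded = {z \<in> out - \<Union> (interior ` ins) - str. shade s (nat \<lfloor>Re z\<rfloor>)},
         marked = {z \<in> \<Union> (frontier ` insert out ins). Re z < 1}\<rparr>)"

text \<open>Clockwise rotation by one click: straight strings as in the identity tangle, but the
  distinguished interval of the input box is at its top while that of the output is on the left.
  Here \<open>s\<close> is the sign of the output.\<close>

definition rotation_tangle :: "sign \<Rightarrow> tangle" where
  "rotation_tangle s = (stack_tangle 2 s 1)
     \<lparr>marked := {z \<in> frontier (outer_disc (stack_tangle 2 s 1)). Re z < 1} \<union>
                {z \<in> frontier (stack_box 2 0). Im z = 2 \<and> 1 < Re z \<and> Re z < 2}\<rparr>"

text \<open>The \<open>n\<close> strings at the top of a box are joined to those at its bottom by nested arcs, running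
  along the boundaries of rectangles, around the right of the box.\<close>

definition trace_tangle :: "nat \<Rightarrow> sign \<Rightarrow> tangle" where
  "trace_tangle n s =
    (let out = rect (1/8) (2 * real n + 7/8) (- real n) (real n + 3);
         box = stack_box n 0;
         R = (\<lambda>j. rect (real j) (2 * real n + 1 - real j) (real j - real n) (real n + 3 - real j));
         str = (\<Union>j\<in>{1..n}. frontier (R j)) - interior box
     in \<lparr>outer_disc = out, inner_discs = {box}, strings = str,
         shaded = {z \<in> out - interior box - str. shade s (card {j \<in> {1..n}. z \<in> R j})},
         marked = frontier out \<union> {z \<in> frontier box. Re z < 1}\<rparr>)"

text \<open>The closure of a box with two boundary points around the left; \<open>s\<close> is the sign of the box, so
  that the output has the opposite sign.\<close>

definition left_trace_tangle :: "sign \<Rightarrow> tangle" where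
  "left_trace_tangle s =
    (let out = rect (-1) 2 (-1) 4;
         box = stack_box 1 0;
         R = rect 0 1 0 3;
         str = frontier R - interior box
     in \<lparr>outer_disc = out, inner_discs = {box}, strings = str,
         shaded = {z \<in> out - interior box - str. shade (opp s) (if z \<in> R then 1 else 0)},
         marked = frontier out \<union> {z \<in> frontier box. Re z < 1}\<rparr>)"

definition loop_tangle :: "sign \<Rightarrow> tangle" where
  "loop_tangle s = \<lparr>outer_disc = cball 0 2, inner_discs = {}, strings = sphere 0 1,
     shaded = {z \<in> cball 0 2 - sphere 0 1. shade s (if z \<in> cball 0 1 then 1 else 0)},
     marked = sphere 0 2\<rparr>"

subsection \<open>Planar algebras\<close>

text \<open>The spaces \<open>box_space A n s\<close> are subspaces of one ambient complex vector space; this is no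
  restriction, since any family of spaces embeds into its direct sum, and nothing is assumed about
  their relative position. Elements to be inserted into a tangle are given as a function on its
  inner discs.\<close>

record 'a planar_data =
  scl :: "complex \<Rightarrow> 'a \<Rightarrow> 'a"
  box_space :: "nat \<Rightarrow> sign \<Rightarrow> 'a set"
  act :: "tangle \<Rightarrow> (complex set \<Rightarrow> 'a) \<Rightarrow> 'a"
  adj :: "nat \<Rightarrow> sign \<Rightarrow> 'a \<Rightarrow> 'a"

definition disc_space :: "'a planar_data \<Rightarrow> tangle \<Rightarrow> complex set \<Rightarrow> 'a set" where
  "disc_space A T D = box_space A (disc_size T D) (disc_sign T D)"

definition labelling :: "'a planar_data \<Rightarrow> tangle \<Rightarrow> (complex set \<Rightarrow> 'a) \<Rightarrow> bool" where
  "labelling A T f \<longleftrightarrow> (\<forall>D\<in>inner_discs T. f D \<in> disc_space A T D)"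

locale planar_algebra =
  fixes A :: "'a::ab_group_add planar_data"
  assumes vector_space_scl: "vector_space (scl A)"
    and subspace_box_space: "\<And>n s. module.subspace (scl A) (box_space A n s)"
    and act_closed: "\<And>T f. planar_tangle T \<Longrightarrow> labelling A T f \<Longrightarrow>
          act A T f \<in> disc_space A T (outer_disc T)"
    and act_cong: "\<And>T f g. planar_tangle T \<Longrightarrow> labelling A T f \<Longrightarrow>
          (\<And>D. D \<in> inner_discs T \<Longrightarrow> f D = g D) \<Longrightarrow> act A T f = act A T g"
    and act_add: "\<And>T f D x y. planar_tangle T \<Longrightarrow> labelling A T f \<Longrightarrow> D \<in> inner_discs T \<Longrightarrow>
          x \<in> disc_space A T D \<Longrightarrow> y \<in> disc_space A T D \<Longrightarrow>
          act A T (f(D := x + y)) = act A T (f(D := x)) + act A T (f(D := y))"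
    and act_scale: "\<And>T f D c x. planar_tangle T \<Longrightarrow> labelling A T f \<Longrightarrow> D \<in> inner_discs T \<Longrightarrow>
          x \<in> disc_space A T D \<Longrightarrow>
          act A T (f(D := scl A c x)) = scl A c (act A T (f(D := x)))"
    and act_isotopy: "\<And>T h f. planar_tangle T \<Longrightarrow> isotopic_to_id h \<Longrightarrow>
          labelling A T (\<lambda>D. f (h ` D)) \<Longrightarrow>
          act A (map_tangle h T) f = act A T (\<lambda>D. f (h ` D))"
    and act_glue: "\<And>T D S f. gluable T D S \<Longrightarrow> labelling A S f \<Longrightarrow>
          (\<And>E. E \<in> inner_discs T - {D} \<Longrightarrow> f E \<in> disc_space A T E) \<Longrightarrow>
          act A (glue T D S) f = act A T (f(D := act A S f))"
    and act_identity: "\<And>n s x. x \<in> box_space A n s \<Longrightarrow> act A (stack_tangle n s 1) (\<lambda>_. x) = x"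

text \<open>Up to isotopy, complex conjugation is the only reflection of the plane.\<close>

locale star_planar_algebra = planar_algebra +
  assumes adj_closed: "\<And>n s x. x \<in> box_space A n s \<Longrightarrow> adj A n s x \<in> box_space A n s"
    and adj_adj: "\<And>n s x. x \<in> box_space A n s \<Longrightarrow> adj A n s (adj A n s x) = x"
    and adj_add: "\<And>n s x y. x \<in> box_space A n s \<Longrightarrow> y \<in> box_space A n s \<Longrightarrow>
          adj A n s (x + y) = adj A n s x + adj A n s y"
    and adj_scale: "\<And>n s c x. x \<in> box_space A n s \<Longrightarrow>
          adj A n s (scl A c x) = scl A (cnj c) (adj A n s x)"
    and adj_act: "\<And>T f. planar_tangle T \<Longrightarrow> labelling A T f \<Longrightarrow>
          adj A (disc_size T (outer_disc T)) (disc_sign T (outer_disc T)) (act A T f) =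
          act A (map_tangle cnj T)
            (\<lambda>D. adj A (disc_size T (cnj ` D)) (disc_sign T (cnj ` D)) (f (cnj ` D)))"

text \<open>Tangles without inner discs ignore their argument, for which we take \<open>\<lambda>_. 0\<close>.\<close>

definition box_unit :: "'a::zero planar_data \<Rightarrow> nat \<Rightarrow> sign \<Rightarrow> 'a" where
  "box_unit A n s = act A (stack_tangle n s 0) (\<lambda>_. 0)"

definition box_mult :: "'a planar_data \<Rightarrow> nat \<Rightarrow> sign \<Rightarrow> 'a \<Rightarrow> 'a \<Rightarrow> 'a" where
  "box_mult A n s x y = act A (stack_tangle n s 2) (\<lambda>D. if D = stack_box n 1 then x else y)"

text \<open>Identification of the one-dimensional space of index 0 with the complex numbers, the empty
  tangle being 1.\<close>

definition scalar_of :: "'a::zero planar_data \<Rightarrow> sign \<Rightarrow> 'a \<Rightarrow> complex" where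
  "scalar_of A s v = (THE c. v = scl A c (box_unit A 0 s))"

definition box_trace :: "'a::zero planar_data \<Rightarrow> nat \<Rightarrow> sign \<Rightarrow> 'a \<Rightarrow> complex" where
  "box_trace A n s x = scalar_of A s (act A (trace_tangle n s) (\<lambda>_. x))"

definition left_trace :: "'a::zero planar_data \<Rightarrow> sign \<Rightarrow> 'a \<Rightarrow> complex" where
  "left_trace A s x = scalar_of A (opp s) (act A (left_trace_tangle s) (\<lambda>_. x))"

locale subfactor_planar_algebra = star_planar_algebra +
  assumes finite_dimensional: "\<And>n s. \<exists>B. finite B \<and> module.span (scl A) B = box_space A n s"
    and dim_zero: "\<And>s. vector_space.dim (scl A) (box_space A 0 s) = 1"
    and spherical: "\<And>s x. x \<in> box_space A 1 s \<Longrightarrow> left_trace A s x = box_trace A 1 s x"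
    and positive_definite: "\<And>n s x. x \<in> box_space A n s \<Longrightarrow> x \<noteq> 0 \<Longrightarrow>
          box_trace A n s (box_mult A n s (adj A n s x) x) \<in> \<real> \<and>
          0 < Re (box_trace A n s (box_mult A n s (adj A n s x) x))"

definition irreducible_planar_algebra :: "'a::ab_group_add planar_data \<Rightarrow> bool" where
  "irreducible_planar_algebra A \<longleftrightarrow> (\<forall>s. vector_space.dim (scl A) (box_space A 1 s) = 1)"

text \<open>By sphericality the loop with reversed shading has the same value.\<close>

definition loop_value :: "'a::zero planar_data \<Rightarrow> real" where
  "loop_value A = Re (scalar_of A Pos (act A (loop_tangle Pos) (\<lambda>_. 0)))"

definition fourier :: "'a planar_data \<Rightarrow> sign \<Rightarrow> 'a \<Rightarrow> 'a" where
  "fourier A s x = act A (rotation_tangle (opp s)) (\<lambda>_. x)"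

subsection \<open>The finite-dimensional C*-algebras and their norms\<close>

text \<open>Functional calculus for a self-adjoint element \<open>a\<close>, through a decomposition of \<open>a\<close> as a real
  linear combination of orthogonal projections \<open>e t\<close> with sum 1.\<close>

definition fun_calc ::
    "'a::ab_group_add planar_data \<Rightarrow> nat \<Rightarrow> sign \<Rightarrow> (real \<Rightarrow> real) \<Rightarrow> 'a \<Rightarrow> 'a" where
  "fun_calc A n s \<phi> a = (THE b. \<exists>(L :: real set) e. finite L \<and>
     (\<forall>t\<in>L. e t \<in> box_space A n s \<and> adj A n s (e t) = e t \<and> box_mult A n s (e t) (e t) = e t) \<and>
     (\<forall>t\<in>L. \<forall>u\<in>L. t \<noteq> u \<longrightarrow> box_mult A n s (e t) (e u) = 0) \<and>
     (\<Sum>t\<in>L. e t) = box_unit A n s \<and>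
     a = (\<Sum>t\<in>L. scl A (of_real t) (e t)) \<and>
     b = (\<Sum>t\<in>L. scl A (of_real (\<phi> t)) (e t)))"

definition abs_elem :: "'a::ab_group_add planar_data \<Rightarrow> nat \<Rightarrow> sign \<Rightarrow> 'a \<Rightarrow> 'a" where
  "abs_elem A n s x = fun_calc A n s sqrt (box_mult A n s (adj A n s x) x)"

definition hilbert_norm :: "'a::ab_group_add planar_data \<Rightarrow> nat \<Rightarrow> sign \<Rightarrow> 'a \<Rightarrow> real" where
  "hilbert_norm A n s x = sqrt (Re (box_trace A n s (box_mult A n s (adj A n s x) x)))"

text \<open>Operator norm of left multiplication on the Hilbert space with inner product given by the
  trace; this representation is faithful, so this is the C*-norm.\<close>

definition op_norm :: "'a::ab_group_add planar_data \<Rightarrow> nat \<Rightarrow> sign \<Rightarrow> 'a \<Rightarrow> real" where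
  "op_norm A n s x =
    Sup {hilbert_norm A n s (box_mult A n s x y) |y. y \<in> box_space A n s \<and> hilbert_norm A n s y \<le> 1}"

definition p_norm :: "'a::ab_group_add planar_data \<Rightarrow> sign \<Rightarrow> ereal \<Rightarrow> 'a \<Rightarrow> real" where
  "p_norm A s p x =
    (if p = \<infinity> then op_norm A 2 s x
     else Re (box_trace A 2 s (fun_calc A 2 s (\<lambda>t. t powr real_of_ereal p) (abs_elem A 2 s x)))
            powr (1 / real_of_ereal p))"

definition unitary_elem :: "'a::zero planar_data \<Rightarrow> nat \<Rightarrow> sign \<Rightarrow> 'a \<Rightarrow> bool" where
  "unitary_elem A n s u \<longleftrightarrow> u \<in> box_space A n s \<and>
     box_mult A n s (adj A n s u) u = box_unit A n s \<and> box_mult A n s u (adj A n s u) = box_unit A n s"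

definition multiple_of_unitary :: "'a::zero planar_data \<Rightarrow> nat \<Rightarrow> sign \<Rightarrow> 'a \<Rightarrow> bool" where
  "multiple_of_unitary A n s x \<longleftrightarrow> (\<exists>c u. unitary_elem A n s u \<and> x = scl A c u)"

end

theory Submission
 imports Defs "HOL-Computational_Algebra.Computational_Algebra"
begin

text \<open>
 The partition functions make every box space a finite-dimensional star algebra with a faithful positive
 functional \<open>tr\<close>. Decomposing \<open>x\<^sup>* x = \<Sum> t e\<^sub>t\<close> over its eigenvalues \<open>t\<close> and putting \<open>w\<^sub>t = tr e\<^sub>t\<close>, the
 \<open>p\<close>-norm of \<open>x\<close> becomes \<open>(\<Sum> t\<^bsup>p/2\<^esup> w\<^sub>t)\<^bsup>1/p\<^esup>\<close> and the operator norm becomes the square root of the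
 largest eigenvalue (\<open>norm_formulas\<close>). The weights add up to \<open>tr\<^sub>2 1 = \<delta>\<^sup>2\<close>, which is where the powers
 of \<open>\<delta>\<close> come from: comparing the 2-norm with the \<open>p\<close>-norm is Jensen's inequality, with equality if and
 only if \<open>x\<^sup>* x\<close> has a single eigenvalue, that is, if \<open>x\<close> is a multiple of a unitary
 (\<open>two_norm_equality\<close>, \<open>two_norm_equality_infinity\<close>). The Fourier transform preserves the 2-norm
 (\<open>Fourier_2_norm\<close>), hence the first claim is this equality for \<open>x\<close> and the second one for its
 Fourier transform.

 The work lies in the statements on tangles. Each of them compares two tangles by cutting and
 by isotopies. That the result of gluing is planar rests on \<open>join_curves\<close>. Tangles are given as
 pieces of a pattern of lines and rectangles in the plane (\<open>pat\<close>), so that gluing is the comparison of two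
 patterns on the two sides of a boundary (\<open>glue_pat\<close>), and isotopies are explicit
 homeomorphisms. Most of them move points on parallel lines monotonically, or are radial.

 Algebra laws follow from columns of boxes on parallel strings (\<open>act_two_columns\<close>). For the isometry,
 \<open>tr ((F x)\<^sup>* F x)\<close> and \<open>tr (x\<^sup>* x)\<close> are both drawn with \<open>x\<close> in a right disc and \<open>x\<^sup>*\<close> in a left disc. In the
 first picture the strings form two concentric rings through both discs, in the second one two loops, one
 through the upper and one through the lower halves; the second picture closes one strand to the left and so needs
 sphericality. When the Fourier rotations are absorbed into the discs, four arcs remain
 between the corners of the discs in both pictures, and these agree up to isotopy (\<open>tilt_rotated_rings\<close>,
 \<open>raise_two_loops\<close>).
\<close>

abbreviation bd :: "'a::topological_space set => 'a set" where "bd == frontier"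
abbreviation interiors :: "'a::topological_space set set => 'a set" where "interiors F == \<Union> (interior ` F)"
abbreviation (input) iff_arrow :: "bool => bool => bool" (infixr "<->" 25) where "a <-> b == a = b"

section \<open>Finite-dimensional star algebras with a faithful positive functional\<close>

locale positive_star_algebra = vector_space scl
 for scl :: "complex => 'a::ab_group_add => 'a" +
 fixes V :: "'a set"
  and mult :: "'a => 'a => 'a" (infixl "\<cdot>" 70)
  and star :: "'a => 'a"
  and unit :: 'a
  and tr :: "'a => complex"
 assumes subspace_V: "subspace V"
  and finite_span: "\<exists>B. finite B & span B = V"
  and mult_closed: "x \<in> V ==> y \<in> V ==> x \<cdot> y \<in> V"
  and mult_add_left: "x \<in> V ==> y \<in> V ==> z \<in> V ==> (x + y) \<cdot> z = x \<cdot> z + y \<cdot> z"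
  and mult_add_right: "x \<in> V ==> y \<in> V ==> z \<in> V ==> x \<cdot> (y + z) = x \<cdot> y + x \<cdot> z"
  and mult_scl_left: "x \<in> V ==> y \<in> V ==> scl c x \<cdot> y = scl c (x \<cdot> y)"
  and mult_scl_right: "x \<in> V ==> y \<in> V ==> x \<cdot> scl c y = scl c (x \<cdot> y)"
  and mult_assoc: "x \<in> V ==> y \<in> V ==> z \<in> V ==> x \<cdot> y \<cdot> z = x \<cdot> (y \<cdot> z)"
  and unit_closed: "unit \<in> V"
  and mult_unit_left: "x \<in> V ==> unit \<cdot> x = x"
  and mult_unit_right: "x \<in> V ==> x \<cdot> unit = x"
  and star_closed: "x \<in> V ==> star x \<in> V"
  and star_star: "x \<in> V ==> star (star x) = x"
  and star_add: "x \<in> V ==> y \<in> V ==> star (x + y) = star x + star y"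
  and star_scl: "x \<in> V ==> star (scl c x) = scl (cnj c) (star x)"
  and star_mult: "x \<in> V ==> y \<in> V ==> star (x \<cdot> y) = star y \<cdot> star x"
  and tr_add: "x \<in> V ==> y \<in> V ==> tr (x + y) = tr x + tr y"
  and tr_scl: "x \<in> V ==> tr (scl c x) = c * tr x"
  and tr_real: "x \<in> V ==> x ~= 0 ==> tr (star x \<cdot> x) \<in> \<real>"
  and tr_pos: "x \<in> V ==> x ~= 0 ==> 0 < Re (tr (star x \<cdot> x))"
begin

lemma V_zero [simp, intro]: "0 \<in> V"
 and V_add [simp, intro]: "x \<in> V ==> y \<in> V ==> x + y \<in> V"
 and V_scl [simp, intro]: "x \<in> V ==> scl c x \<in> V"
 and V_sum [simp, intro]: "(!!i. i \<in> I ==> f i \<in> V) ==> sum f I \<in> V"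
 and V_diff [simp, intro]: "x \<in> V ==> y \<in> V ==> x - y \<in> V"
 using subspace_V
 by (auto simp: subspace_0 subspace_add subspace_scale subspace_sum subspace_diff)

declare mult_closed [simp, intro] unit_closed [simp, intro] star_closed [simp, intro]

lemma V_minus [simp, intro]: "x \<in> V ==> - x \<in> V"
 using V_diff[of 0 x] by simp

lemma mult_zero [simp]: "x \<in> V ==> x \<cdot> 0 = 0" "x \<in> V ==> 0 \<cdot> x = 0"
 using mult_scl_right[of x 0 0] mult_scl_left[of 0 x 0] by simp_all

lemma star_zero [simp]: "star 0 = 0"
 using star_scl[of 0 0] by simp

lemma tr_zero [simp]: "tr 0 = 0"
 using tr_scl[of 0 0] by simp

lemma mult_sum_right: "x \<in> V ==> (!!i. i \<in> I ==> f i \<in> V) ==> x \<cdot> sum f I = (\<Sum>i\<in>I. x \<cdot> f i)"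
 by (induction I rule: infinite_finite_induct) (auto simp: mult_add_right)

lemma mult_sum_left: "x \<in> V ==> (!!i. i \<in> I ==> f i \<in> V) ==> sum f I \<cdot> x = (\<Sum>i\<in>I. f i \<cdot> x)"
 by (induction I rule: infinite_finite_induct) (auto simp: mult_add_left)

lemma tr_sum: "(!!i. i \<in> I ==> f i \<in> V) ==> tr (sum f I) = (\<Sum>i\<in>I. tr (f i))"
 by (induction I rule: infinite_finite_induct) (auto simp: tr_add)

lemma mult_diff_left: "x \<in> V ==> y \<in> V ==> z \<in> V ==> (y - z) \<cdot> x = y \<cdot> x - z \<cdot> x"
 by (metis V_diff add_diff_cancel diff_add_cancel mult_add_left)

lemma star_diff: "x \<in> V ==> y \<in> V ==> star (x - y) = star x - star y"
 by (metis V_diff add_diff_cancel diff_add_cancel star_add)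

lemma star_unit: "star unit = unit"
 by (metis mult_unit_left mult_unit_right star_closed star_mult star_star unit_closed)

lemma tr_square_eq_0: "x \<in> V ==> star x \<cdot> x = 0 ==> x = 0"
 using tr_pos by fastforce

lemma tr_square_nonneg: "x \<in> V ==> 0 <= Re (tr (star x \<cdot> x))"
 using tr_pos[of x] by (cases "x = 0") auto

lemma tr_square_of_real: "x \<in> V ==> tr (star x \<cdot> x) = of_real (Re (tr (star x \<cdot> x)))"
 using tr_real[of x] by (cases "x = 0") (auto simp: complex_is_Real_iff complex_eq_iff)

subsection \<open>Polynomial calculus\<close>

definition peval :: "'a => complex poly => 'a" where
 "peval a p = fold_coeffs (%c v. scl c unit + a \<cdot> v) p 0"

lemma peval_0 [simp]: "peval a 0 = 0"
 by (simp add: peval_def)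

lemma peval_pCons [simp]: "a \<in> V ==> peval a (pCons c p) = scl c unit + a \<cdot> peval a p"
 by (cases "p = 0 & c = 0") (auto simp: peval_def)

lemma peval_closed [simp, intro]: "a \<in> V ==> peval a p \<in> V"
 by (induction p) auto

lemma peval_add: "a \<in> V ==> peval a (p + q) = peval a p + peval a q"
proof (induction p arbitrary: q)
 case (pCons c p)
 thus ?case
  by (cases q) (auto simp: mult_add_right scale_left_distrib algebra_simps)
qed simp

lemma peval_smult: "a \<in> V ==> peval a (smult c p) = scl c (peval a p)"
 by (induction p) (auto simp: mult_scl_right scale_right_distrib)

lemma peval_mult: "a \<in> V ==> peval a (p * q) = peval a p \<cdot> peval a q"
 by (induction p) (auto simp: peval_add peval_smult mult_add_left mult_scl_left mult_assoc mult_unit_left)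

lemma peval_sum: "a \<in> V ==> peval a (sum f I) = (\<Sum>i\<in>I. peval a (f i))"
 by (induction I rule: infinite_finite_induct) (auto simp: peval_add)

lemma peval_1: "a \<in> V ==> peval a 1 = unit"
 by (simp add: one_pCons)

lemma peval_monom_sum: "a \<in> V ==> peval a (\<Sum>i\<le>n. monom (f i) i) = (\<Sum>i\<le>n. scl (f i) (peval a (monom 1 i)))"
 by (auto simp: peval_sum peval_smult[symmetric] smult_monom)

lemma annihilating_poly_exists:
 assumes "a \<in> V"
 shows "\<exists>p. p ~= 0 & peval a p = 0"
proof (rule ccontr)
 assume none: "\<not> ?thesis"
 obtain B where B: "finite B" "span B = V" using finite_span by blast
 let ?N = "card B" and ?g = "%i. peval a (monom 1 i)"
 have inj: "inj_on ?g {..?N}"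
 proof (rule inj_onI)
  fix i j assume ij: "?g i = ?g j"
  have "peval a (monom 1 i + smult (-1) (monom 1 j)) = ?g i + scl (-1) (?g j)"
   using assms by (simp only: peval_add peval_smult)
  hence "peval a (monom 1 i - monom 1 j) = 0" using ij by simp
  hence "monom (1::complex) i - monom 1 j = 0" using none by blast
  hence "monom (1::complex) i = monom 1 j" by simp
  thus "i = j" by (simp add: monom_eq_iff')
 qed
 have "independent (?g ` {..?N})"
 proof (rule independent_if_scalars_zero)
  fix f x assume s: "(\<Sum>x\<in>?g ` {..?N}. scl (f x) x) = 0" and x: "x \<in> ?g ` {..?N}"
  have "peval a (\<Sum>i\<le>?N. monom (f (?g i)) i) = 0"
   using s unfolding peval_monom_sum[OF assms] by (subst (asm) sum.reindex[OF inj]) simp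
  hence z: "(\<Sum>i\<le>?N. monom (f (?g i)) i) = 0" using none by blast
  obtain i where i: "i <= ?N" "x = ?g i" using x by auto
  have "coeff (\<Sum>i\<le>?N. monom (f (?g i)) i) i = f (?g i)"
   using i by (simp add: coeff_sum)
  thus "f x = 0" using z i by simp
 qed auto
 hence "card (?g ` {..?N}) <= card B"
  using independent_span_bound[OF B(1), of "?g ` {..?N}"] B(2) assms
  by (simp add: image_subset_iff)
 thus False using card_image[OF inj] by simp
qed

lemma minimal_poly_exists:
 assumes "a \<in> V"
 obtains p where "p ~= 0" "peval a p = 0" "!!q. q ~= 0 ==> peval a q = 0 ==> degree p <= degree q"
proof -
 let ?P = "%p. p ~= 0 & peval a p = 0"
 obtain p0 where "?P p0" using annihilating_poly_exists[OF assms] by blast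
 hence "?P (arg_min degree ?P)" "!!q. ?P q ==> degree (arg_min degree ?P) <= degree q"
  using arg_min_natI[of ?P p0 degree] arg_min_nat_le[of ?P _ degree] by auto
 thus thesis using that by blast
qed

text \<open>The constant term of the minimal polynomial of \<open>u\<close> is not zero: otherwise it could be divided
 by the variable, as \<open>u\<close> has a left inverse. Solving for the constant term gives a right inverse.\<close>

lemma left_inverse_imp_right_inverse:
 assumes "u \<in> V" "v \<in> V" "v \<cdot> u = unit"
 shows "u \<cdot> v = unit"
proof -
 obtain p where p: "p ~= 0" "peval u p = 0"
  and min: "!!q. q ~= 0 ==> peval u q = 0 ==> degree p <= degree q"
  using minimal_poly_exists[OF assms(1)] by blast
 obtain c q where q: "p = pCons c q" by (cases p)
 have eq: "scl c unit + u \<cdot> peval u q = 0" using p q assms by simp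
 have "c ~= 0"
 proof
  assume c: "c = 0"
  hence "u \<cdot> peval u q = 0" using eq by simp
  hence "v \<cdot> (u \<cdot> peval u q) = 0" using assms by simp
  hence "peval u q = 0"
   using assms by (metis mult_assoc mult_unit_left peval_closed)
  moreover have "q ~= 0" using p q c by auto
  ultimately show False using min[of q] q by simp
 qed
 define w where "w = scl (- inverse c) (peval u q)"
 have w: "w \<in> V" using assms by (simp add: w_def)
 have "u \<cdot> peval u q = - scl c unit" using eq by (simp add: add_eq_0_iff)
 hence "u \<cdot> w = unit"
  using assms `c ~= 0` mult_scl_right[of u "peval u q" "- inverse c"] by (simp add: w_def)
 hence "w = v" using assms w by (metis mult_assoc mult_unit_left mult_unit_right)
 thus ?thesis using `u \<cdot> w = unit` by simp
qed

lemma prod_linear_factors_dvd: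
 fixes r :: "complex poly"
 assumes "finite R" "!!z. z \<in> R ==> poly r z = 0"
 shows "(\<Prod>z\<in>R. [:- z, 1:]) dvd r"
 using assms
proof (induction R arbitrary: r rule: finite_induct)
 case (insert z R)
 hence "[:- z, 1:] dvd r" by (simp add: poly_eq_0_iff_dvd)
 then obtain q where q: "r = [:- z, 1:] * q" by (rule dvdE)
 have "poly q w = 0" if "w \<in> R" for w
  using insert.prems[of w] insert.hyps that q by auto
 thus ?case using insert.IH[of q] insert.hyps q by (simp add: mult_dvd_mono del: mult_pCons_left)
qed auto

definition orth_decomp :: "real set => (real => 'a) => bool" where
 "orth_decomp L e <-> finite L &
   (\<forall>t\<in>L. e t \<in> V & star (e t) = e t & e t \<cdot> e t = e t) &
   (\<forall>t\<in>L. \<forall>u\<in>L. t ~= u --> e t \<cdot> e u = 0) & (\<Sum>t\<in>L. e t) = unit"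

text \<open>Roots of the minimal polynomial of \<open>x\<^sup>* x\<close> are eigenvalues of a positive operator, hence
 nonnegative, and they are simple because \<open>((a - t) y)\<^sup>* ((a - t) y) = y\<^sup>* (a - t)\<^sup>2 y\<close>. The Lagrange
 polynomials at the roots then give the spectral projections.\<close>

lemma spectral_decomposition:
 assumes "x \<in> V"
 obtains L e where "orth_decomp L e" "star x \<cdot> x = (\<Sum>t\<in>L. scl (of_real t) (e t))"
  "!!t. t \<in> L ==> 0 <= t"
proof -
 define a where "a = star x \<cdot> x"
 have a: "a \<in> V" "star a = a" using assms by (auto simp: a_def star_mult star_star)
 obtain p where p: "p ~= 0" "peval a p = 0"
  and min: "!!q. q ~= 0 ==> peval a q = 0 ==> degree p <= degree q"
  using minimal_poly_exists[OF a(1)] by blast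
 have lin: "peval a [:- l, 1:] \<cdot> y = a \<cdot> y - scl l y" if "y \<in> V" for l y
  using that a by (simp add: mult_diff_left mult_scl_left mult_unit_left mult_unit_right)
 have root: "l \<in> \<real> & 0 <= Re l" and simple: "\<not> [:- l, 1:] ^ 2 dvd p" if l: "poly p l = 0" for l
 proof -
  have "[:- l, 1:] dvd p" using l by (simp add: poly_eq_0_iff_dvd)
  then obtain q where q: "p = [:- l, 1:] * q" by (rule dvdE)
  have "q ~= 0" using p q by auto
  hence dq: "degree q < degree p" using q by (simp add: degree_mult_eq del: mult_pCons_left)
  define y where "y = peval a q"
  have y: "y \<in> V" "y ~= 0" using min[of q] dq `q ~= 0` a by (auto simp: y_def)
  have "peval a [:- l, 1:] \<cdot> y = 0" using p(2) q peval_mult[OF a(1), of "[:- l, 1:]" q] y_def by simp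
  hence ay: "a \<cdot> y = scl l y" using lin[OF y(1)] by simp
  have "tr (star (x \<cdot> y) \<cdot> (x \<cdot> y)) = tr (star y \<cdot> (a \<cdot> y))"
   using assms y by (simp add: a_def star_mult mult_assoc)
  also have "... = l * tr (star y \<cdot> y)" using y by (simp add: ay mult_scl_right tr_scl)
  finally have eq: "of_real (Re (tr (star (x \<cdot> y) \<cdot> (x \<cdot> y)))) = l * of_real (Re (tr (star y \<cdot> y)))"
   using assms y tr_square_of_real[of y] tr_square_of_real[of "x \<cdot> y"] by simp
  have "l = of_real (Re (tr (star (x \<cdot> y) \<cdot> (x \<cdot> y))) / Re (tr (star y \<cdot> y)))"
   using tr_pos[OF y] eq by (simp add: field_simps)
  thus root: "l \<in> \<real> & 0 <= Re l"
   using tr_square_nonneg[of "x \<cdot> y"] tr_square_nonneg[of y] assms y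
   by (metis Re_complex_of_real Reals_of_real divide_nonneg_nonneg mult_closed)
  show "\<not> [:- l, 1:] ^ 2 dvd p"
  proof
   assume "[:- l, 1:] ^ 2 dvd p"
   then obtain r where "p = [:- l, 1:] * ([:- l, 1:] * r)"
    by (metis dvd_def mult.assoc power2_eq_square)
   hence q': "q = [:- l, 1:] * r" using q
    by (metis mult_cancel_left one_neq_zero pCons_eq_0_iff)
   define b where "b = peval a [:- l, 1:]"
   have b: "b \<in> V" "star b = b"
   proof -
    have "cnj (- l) = - l" using root by (simp add: Reals_cnj_iff)
    thus "b \<in> V" "star b = b"
     using a unfolding b_def by (simp_all add: star_diff star_scl star_unit mult_unit_right)
   qed
   define z where "z = peval a r"
   have z: "z \<in> V" using a z_def by auto
   have yz: "y = b \<cdot> z" by (simp add: y_def q' b_def z_def peval_mult a del: peval_pCons mult_pCons_left)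
   have "star y \<cdot> y = star z \<cdot> (b \<cdot> y)" using b z y by (simp add: yz star_mult mult_assoc)
   also have "... = 0" using ay lin[OF y(1), of l] z by (simp add: b_def)
   finally show False using tr_square_eq_0 y by blast
  qed
 qed
 have "rsquarefree p"
  unfolding rsquarefree_def
 proof (intro conjI allI p(1))
  fix l
  have "\<not> 2 <= order l p" if "poly p l = 0"
   using simple[OF that] order_1[of l p] by (meson dvd_trans le_imp_power_dvd)
  thus "order l p = 0 | order l p = 1" using p(1) by (cases "poly p l = 0") (auto simp: order_root)
 qed
 hence dec: "smult (lead_coeff p) (\<Prod>z | poly p z = 0. [:- z, 1:]) = p"
  by (rule complex_poly_decompose_rsquarefree)
 define R where "R = {z. poly p z = 0}"
 have finR: "finite R" using p poly_roots_finite R_def by auto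
 have vanish: "peval a r = 0" if r: "!!z. z \<in> R ==> poly r z = 0" for r
 proof -
  have "(\<Prod>z\<in>R. [:- z, 1:]) dvd r" using finR r by (rule prod_linear_factors_dvd)
  hence "p dvd r" using dec R_def p by (metis smult_dvd leading_coeff_0_iff)
  thus ?thesis using p a by (auto simp: dvd_def peval_mult)
 qed
 define ell where "ell l = (\<Prod>m\<in>R - {l}. smult (inverse (l - m)) [:- m, 1:])" for l
 have ell: "poly (ell l) m = (if m = l then 1 else 0)" if "l \<in> R" "m \<in> R" for l m
 proof (cases "m = l")
  case False
  hence "m \<in> R - {l}" using that by simp
  thus ?thesis using finR False by (simp add: ell_def poly_prod prod_zero_iff) blast
 next
  case True
  have "poly (smult (inverse (l - x)) [:- x, 1:]) l = 1" if "x ~= l" for x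
   using that left_inverse[of "l - x"] by (simp add: algebra_simps)
  thus ?thesis using True by (auto simp: ell_def poly_prod intro!: prod.neutral simp del: poly_smult poly_pCons)
 qed
 have cong: "peval a f = peval a g" if "!!z. z \<in> R ==> poly f z = poly g z" for f g
 proof -
  have "peval a (f + smult (-1) g) = 0" using that by (intro vanish) auto
  hence "peval a f + scl (-1) (peval a g) = 0" using a by (simp only: peval_add peval_smult)
  thus ?thesis by simp
 qed
 define L where "L = Re ` R"
 have R_eq: "R = of_real ` L" and nonneg: "!!t. t \<in> L ==> 0 <= t"
  using root by (auto simp: L_def R_def image_image complex_is_Real_iff complex_eq_iff)
 have inj: "inj_on complex_of_real L" by (simp add: inj_on_def)
 define e where "e t = peval a (ell (of_real t))" for t
 have finL: "finite L" using finR by (simp add: L_def)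
 have eV: "e t \<in> V" for t using a by (simp add: e_def)
 have sum_ell: "poly (\<Sum>l\<in>R. ell l) z = 1" "poly (\<Sum>l\<in>R. smult l (ell l)) z = z" if "z \<in> R" for z
  using that finR by (simp_all add: poly_sum ell sum.delta' if_distrib[of "%x. _ * x"] cong: if_cong sum.cong)
 have sum_e: "(\<Sum>t\<in>L. e t) = unit"
 proof -
  have "(\<Sum>t\<in>L. e t) = peval a (\<Sum>l\<in>R. ell l)"
   using a by (simp add: peval_sum e_def R_eq sum.reindex[OF inj])
  also have "... = peval a 1" using sum_ell by (intro cong) simp
  finally show ?thesis using a by (simp add: peval_1)
 qed
 have a_sum: "a = (\<Sum>t\<in>L. scl (of_real t) (e t))"
 proof -
  have "(\<Sum>t\<in>L. scl (of_real t) (e t)) = peval a (\<Sum>l\<in>R. smult l (ell l))"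
   using a by (simp add: peval_sum peval_smult e_def R_eq sum.reindex[OF inj])
  also have "... = peval a [:0, 1:]" using sum_ell by (intro cong) simp
  finally show ?thesis using a by (simp add: mult_unit_right)
 qed
 have orth: "e t \<cdot> e u = (if t = u then e t else 0)" if "t \<in> L" "u \<in> L" for t u
 proof -
  have "peval a (ell (of_real t) * ell (of_real u)) = peval a (if t = u then ell (of_real t) else 0)"
   using that by (intro cong) (auto simp: ell R_eq)
  thus ?thesis using a by (auto simp: e_def peval_mult split: if_splits)
 qed
 have ae: "a \<cdot> e t = scl (of_real t) (e t)" if "t \<in> L" for t
 proof -
  have "a \<cdot> e t = (\<Sum>u\<in>L. scl (of_real u) (e u \<cdot> e t))"
   using eV that by (subst a_sum, subst mult_sum_left) (auto simp: mult_scl_left)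
  also have "... = (\<Sum>u\<in>L. if u = t then scl (of_real t) (e t) else 0)"
   using that by (intro sum.cong) (auto simp: orth)
  also have "... = scl (of_real t) (e t)" using finL that by simp
  finally show ?thesis .
 qed
 \<comment> \<open>Eigenspaces of the self-adjoint \<open>a\<close> are orthogonal, so \<open>(e t)\<^sup>* = (e t)\<^sup>* 1 = (e t)\<^sup>* e t\<close>.\<close>
 have star_e: "star (e t) = e t" if t: "t \<in> L" for t
 proof -
  have z: "star (e t) \<cdot> e u = 0" if u: "u \<in> L" "t ~= u" for u
  proof -
   have "scl (of_real t) (star (e t) \<cdot> e u) = star (a \<cdot> e t) \<cdot> e u"
    using eV t by (simp add: ae star_scl mult_scl_left)
   also have "... = star (e t) \<cdot> (a \<cdot> e u)" using eV a by (simp add: star_mult mult_assoc)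
   also have "... = scl (of_real u) (star (e t) \<cdot> e u)" using eV u by (simp add: ae mult_scl_right)
   finally show ?thesis using u(2) by (simp add: scale_cancel_right)
  qed
  have "star (e t) = star (e t) \<cdot> (\<Sum>u\<in>L. e u)" using eV by (simp add: sum_e mult_unit_right)
  also have "... = (\<Sum>u\<in>L. if u = t then star (e t) \<cdot> e t else 0)"
   using eV by (subst mult_sum_right) (auto intro!: sum.cong simp: z)
  also have "... = star (e t) \<cdot> e t" using finL t by simp
  finally have "star (e t) = star (e t) \<cdot> e t" .
  thus ?thesis by (metis eV star_mult star_star star_closed)
 qed
 show thesis
  using that[of L e] finL eV star_e orth sum_e a_sum nonneg
  by (auto simp: orth_decomp_def a_def)
qed

text \<open>The functional calculus does not depend on the decomposition: if
 \<open>\<Sum> t e\<^sub>t = \<Sum> u f\<^sub>u\<close> then multiplying by \<open>e\<^sub>t\<close> and \<open>f\<^sub>u\<close> shows that \<open>e\<^sub>t f\<^sub>u = 0\<close> unless \<open>t = u\<close>.\<close>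

lemma fun_calc_unique:
 assumes L: "orth_decomp L e" and M: "orth_decomp M f"
  and eq: "(\<Sum>t\<in>L. scl (of_real t) (e t)) = (\<Sum>t\<in>M. scl (of_real t) (f t))"
 shows "(\<Sum>t\<in>L. scl (of_real (\<phi> t)) (e t)) = (\<Sum>t\<in>M. scl (of_real (\<phi> t)) (f t))"
proof -
 have V: "!!t. t \<in> L ==> e t \<in> V" "!!t. t \<in> M ==> f t \<in> V"
  and fin: "finite L" "finite M" using L M by (auto simp: orth_decomp_def)
 have e_mult: "e t \<cdot> (\<Sum>u\<in>L. scl (of_real u) (e u)) = scl (of_real t) (e t)" if "t \<in> L" for t
 proof -
  have "e t \<cdot> (\<Sum>u\<in>L. scl (of_real u) (e u)) = (\<Sum>u\<in>L. scl (of_real u) (e t \<cdot> e u))"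
   using V that by (subst mult_sum_right) (auto simp: mult_scl_right)
  also have "... = (\<Sum>u\<in>L. if u = t then scl (of_real t) (e t) else 0)"
   using L that by (intro sum.cong) (auto simp: orth_decomp_def)
  finally show ?thesis using fin that by simp
 qed
 have f_mult: "(\<Sum>u\<in>M. scl (of_real u) (f u)) \<cdot> f t = scl (of_real t) (f t)" if "t \<in> M" for t
 proof -
  have "(\<Sum>u\<in>M. scl (of_real u) (f u)) \<cdot> f t = (\<Sum>u\<in>M. scl (of_real u) (f u \<cdot> f t))"
   using V that by (subst mult_sum_left) (auto simp: mult_scl_left)
  also have "... = (\<Sum>u\<in>M. if u = t then scl (of_real t) (f t) else 0)"
   using M that by (intro sum.cong) (auto simp: orth_decomp_def)
  finally show ?thesis using fin that by simp
 qed
 have ef: "e t \<cdot> f u = 0" if tu: "t \<in> L" "u \<in> M" "t ~= u" for t u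
 proof -
  have "scl (of_real t) (e t \<cdot> f u) = (e t \<cdot> (\<Sum>u\<in>L. scl (of_real u) (e u))) \<cdot> f u"
   using V tu by (simp add: e_mult mult_scl_left)
  also have "... = e t \<cdot> ((\<Sum>u\<in>M. scl (of_real u) (f u)) \<cdot> f u)"
   unfolding eq using V tu by (subst mult_assoc) auto
  also have "... = scl (of_real u) (e t \<cdot> f u)"
   using V tu by (simp add: f_mult mult_scl_right)
  finally show ?thesis using tu(3) by (simp add: scale_cancel_right)
 qed
 have "(\<Sum>t\<in>L. scl (of_real (\<phi> t)) (e t)) = (\<Sum>t\<in>L. scl (of_real (\<phi> t)) (e t \<cdot> (\<Sum>u\<in>M. f u)))"
  using M V by (intro sum.cong) (auto simp: orth_decomp_def mult_unit_right)
 also have "... = (\<Sum>t\<in>L. \<Sum>u\<in>M. scl (of_real (\<phi> t)) (e t \<cdot> f u))"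
  using V by (intro sum.cong refl, subst mult_sum_right) (auto simp: scale_sum_right)
 also have "... = (\<Sum>t\<in>L. \<Sum>u\<in>M. scl (of_real (\<phi> u)) (e t \<cdot> f u))"
  using ef by (intro sum.cong refl) (metis scale_zero_right)
 also have "... = (\<Sum>u\<in>M. \<Sum>t\<in>L. scl (of_real (\<phi> u)) (e t \<cdot> f u))"
  by (rule sum.swap)
 also have "... = (\<Sum>u\<in>M. scl (of_real (\<phi> u)) ((\<Sum>t\<in>L. e t) \<cdot> f u))"
  using V by (intro sum.cong refl, subst mult_sum_left) (auto simp: scale_sum_right)
 also have "... = (\<Sum>u\<in>M. scl (of_real (\<phi> u)) (f u))"
  using L V by (intro sum.cong) (auto simp: orth_decomp_def mult_unit_left)
 finally show ?thesis .
qed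

lemma the_fun_calc:
 assumes L: "orth_decomp L e" and a: "a = (\<Sum>t\<in>L. scl (of_real t) (e t))"
 shows "(THE b. \<exists>(L :: real set) e. finite L &
   (\<forall>t\<in>L. e t \<in> V & star (e t) = e t & e t \<cdot> e t = e t) &
   (\<forall>t\<in>L. \<forall>u\<in>L. t ~= u --> e t \<cdot> e u = 0) &
   (\<Sum>t\<in>L. e t) = unit &
   a = (\<Sum>t\<in>L. scl (of_real t) (e t)) &
   b = (\<Sum>t\<in>L. scl (of_real (\<phi> t)) (e t))) = (\<Sum>t\<in>L. scl (of_real (\<phi> t)) (e t))"
  (is "(THE b. ?P b) = ?b")
proof (rule the_equality)
 show "?P ?b" using L a unfolding orth_decomp_def by blast
next
 fix b assume "?P b"
 then obtain M f where "orth_decomp M f" "a = (\<Sum>t\<in>M. scl (of_real t) (f t))"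
   "b = (\<Sum>t\<in>M. scl (of_real (\<phi> t)) (f t))"
  unfolding orth_decomp_def by blast
 thus "b = ?b" using fun_calc_unique[OF _ L, of M f \<phi>] a by simp
qed

lemma orth_decomp_reindex:
 assumes L: "orth_decomp L e" and inj: "inj_on g L"
 shows "orth_decomp (g ` L) (%t. e (the_inv_into L g t))"
 using L inj unfolding orth_decomp_def
 by (auto simp: the_inv_into_f_f sum.reindex inj_on_eq_iff)

lemma tr_projection:
 assumes "orth_decomp L e" "t \<in> L"
 shows "tr (e t) = of_real (Re (tr (e t)))" "0 <= Re (tr (e t))" "e t ~= 0 ==> 0 < Re (tr (e t))"
proof -
 have "e t \<in> V" "star (e t) \<cdot> e t = e t" using assms by (auto simp: orth_decomp_def)
 thus "tr (e t) = of_real (Re (tr (e t)))" "0 <= Re (tr (e t))" "e t ~= 0 ==> 0 < Re (tr (e t))"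
  using tr_square_of_real[of "e t"] tr_square_nonneg[of "e t"] tr_pos[of "e t"] by auto
qed

lemma tr_fun_calc:
 assumes "orth_decomp L e"
 shows "Re (tr (\<Sum>t\<in>L. scl (of_real (\<phi> t)) (e t))) = (\<Sum>t\<in>L. \<phi> t * Re (tr (e t)))"
 using assms by (subst tr_sum) (auto simp: orth_decomp_def tr_scl)

lemma scalar_iff_single_eigenvalue:
 assumes L: "orth_decomp L e" and a: "a = (\<Sum>t\<in>L. scl (of_real t) (e t))" and u: "unit ~= 0"
 shows "(\<exists>m. a = scl (of_real m) unit) <-> (\<forall>t\<in>{t\<in>L. e t ~= 0}. \<forall>u\<in>{t\<in>L. e t ~= 0}. t = u)"
proof
 assume "\<exists>m. a = scl (of_real m) unit"
 then obtain m where m: "a = scl (of_real m) unit" by blast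
 have "t = m" if t: "t \<in> L" "e t ~= 0" for t
 proof -
  have "scl (of_real m) (e t) = a \<cdot> e t"
   using t L by (simp add: m mult_scl_left mult_unit_left orth_decomp_def)
  also have "... = (\<Sum>u\<in>L. scl (of_real u) (e u \<cdot> e t))"
   unfolding a using L t by (subst mult_sum_left) (auto simp: mult_scl_left orth_decomp_def)
  also have "... = (\<Sum>u\<in>L. if u = t then scl (of_real t) (e t) else 0)"
   using L t by (intro sum.cong) (auto simp: orth_decomp_def)
  also have "... = scl (of_real t) (e t)" using L t by (simp add: orth_decomp_def)
  finally show "t = m" using t by (simp add: scale_cancel_right)
 qed
 thus "\<forall>t\<in>{t\<in>L. e t ~= 0}. \<forall>u\<in>{t\<in>L. e t ~= 0}. t = u" by blast
next
 assume all: "\<forall>t\<in>{t\<in>L. e t ~= 0}. \<forall>u\<in>{t\<in>L. e t ~= 0}. t = u"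
 obtain m where m: "!!t. t \<in> L ==> e t ~= 0 ==> t = m" using all by blast
 have "a = (\<Sum>t\<in>L. scl (of_real m) (e t))" unfolding a
  using m by (intro sum.cong refl) (metis scale_zero_right)
 also have "... = scl (of_real m) unit" using L by (simp add: scale_sum_right[symmetric] orth_decomp_def)
 finally show "\<exists>m. a = scl (of_real m) unit" by blast
qed

text \<open>In finite dimension, \<open>x\<close> is a multiple of a unitary as soon as \<open>x\<^sup>* x\<close> is a scalar.\<close>

lemma multiple_of_unitary_iff:
 assumes "x \<in> V"
 shows "(\<exists>c u. u \<in> V & star u \<cdot> u = unit & u \<cdot> star u = unit & x = scl c u) <->
  (\<exists>m. star x \<cdot> x = scl (of_real m) unit)" (is "?l <-> ?r")
proof
 assume ?l
 then obtain c u where u: "u \<in> V" "star u \<cdot> u = unit" "x = scl c u" by blast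
 hence "star x \<cdot> x = scl (cnj c * c) unit"
  by (simp add: star_scl mult_scl_left mult_scl_right mult.commute)
 moreover have "cnj c * c = of_real ((cmod c)\<^sup>2)"
  by (simp add: complex_norm_square mult.commute del: of_real_power)
 ultimately show ?r by metis
next
 assume ?r
 then obtain m where m: "star x \<cdot> x = scl (of_real m) unit" by blast
 show ?l
 proof (cases "x = 0")
  case True
  thus ?thesis
   using star_unit mult_unit_left[of unit] by (intro exI[of _ 0] exI[of _ unit]) auto
 next
  case False
  have unit0: "unit ~= 0" using False assms mult_unit_left by fastforce
  have "0 < Re (tr (star x \<cdot> x))" using tr_pos assms False by blast
  hence "0 < m * Re (tr unit)" by (simp add: m tr_scl)
  moreover have "0 < Re (tr unit)"
   using tr_pos[of unit] unit0 by (simp add: star_unit mult_unit_left)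
  ultimately have m0: "m > 0" by (simp add: zero_less_mult_iff)
  define c where "c = sqrt m"
  define u where "u = scl (of_real (inverse c)) x"
  have c: "c > 0" "c * c = m" using m0 by (auto simp: c_def)
  have uV: "u \<in> V" using assms by (simp add: u_def)
  have "star u \<cdot> u = scl (of_real (inverse c * inverse c * m)) unit"
   using assms m by (simp add: u_def star_scl mult_scl_left mult_scl_right)
  also have "inverse c * inverse c * m = 1" using c(1) by (simp add: c(2)[symmetric] field_simps)
  finally have uu: "star u \<cdot> u = unit" by simp
  have "x = scl (of_real c) u" using c by (simp add: u_def)
  thus ?thesis using uV uu left_inverse_imp_right_inverse[OF uV _ uu] by blast
 qed
qed

lemma square_norm_decomp:
 assumes x: "x \<in> V" and y: "y \<in> V" and L: "orth_decomp L e"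
  and a: "star x \<cdot> x = (\<Sum>t\<in>L. scl (of_real t) (e t))"
 shows "Re (tr (star (x \<cdot> y) \<cdot> (x \<cdot> y))) = (\<Sum>t\<in>L. t * Re (tr (star (e t \<cdot> y) \<cdot> (e t \<cdot> y))))"
  and "Re (tr (star y \<cdot> y)) = (\<Sum>t\<in>L. Re (tr (star (e t \<cdot> y) \<cdot> (e t \<cdot> y))))"
proof -
 have eV: "e t \<in> V" and ee: "star (e t \<cdot> y) \<cdot> (e t \<cdot> y) = star y \<cdot> (e t \<cdot> y)" if "t \<in> L" for t
 proof -
  show eV: "e t \<in> V" using that L by (auto simp: orth_decomp_def)
  have "star (e t \<cdot> y) \<cdot> (e t \<cdot> y) = star y \<cdot> ((star (e t) \<cdot> e t) \<cdot> y)"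
   using y eV by (simp add: star_mult mult_assoc)
  thus "star (e t \<cdot> y) \<cdot> (e t \<cdot> y) = star y \<cdot> (e t \<cdot> y)"
   using that L by (simp add: orth_decomp_def)
 qed
 have "star (x \<cdot> y) \<cdot> (x \<cdot> y) = star y \<cdot> ((star x \<cdot> x) \<cdot> y)"
  using x y by (simp add: star_mult mult_assoc)
 also have "... = (\<Sum>t\<in>L. scl (of_real t) (star y \<cdot> (e t \<cdot> y)))"
  unfolding a using eV y
  by (simp add: mult_sum_left mult_sum_right mult_scl_left mult_scl_right)
 finally show "Re (tr (star (x \<cdot> y) \<cdot> (x \<cdot> y))) = (\<Sum>t\<in>L. t * Re (tr (star (e t \<cdot> y) \<cdot> (e t \<cdot> y))))"
  using eV y ee by (simp add: tr_sum tr_scl)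
 have "star y \<cdot> y = star y \<cdot> ((\<Sum>t\<in>L. e t) \<cdot> y)"
  using L y by (simp add: orth_decomp_def mult_unit_left)
 also have "... = (\<Sum>t\<in>L. star y \<cdot> (e t \<cdot> y))"
  using eV y by (simp add: mult_sum_left mult_sum_right)
 finally show "Re (tr (star y \<cdot> y)) = (\<Sum>t\<in>L. Re (tr (star (e t \<cdot> y) \<cdot> (e t \<cdot> y))))"
  using eV y ee by (simp add: tr_sum)
qed

lemma operator_norm_eq_Max:
 assumes x: "x \<in> V" and L: "orth_decomp L e" and u: "unit ~= 0"
  and a: "star x \<cdot> x = (\<Sum>t\<in>L. scl (of_real t) (e t))"
 shows "Sup {sqrt (Re (tr (star (x \<cdot> y) \<cdot> (x \<cdot> y)))) |y. y \<in> V & sqrt (Re (tr (star y \<cdot> y))) <= 1}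
  = sqrt (Max {t\<in>L. e t ~= 0})"
proof -
 let ?L = "{t\<in>L. e t ~= 0}" and ?M = "Max {t\<in>L. e t ~= 0}"
 have fin: "finite ?L" using L by (auto simp: orth_decomp_def)
 have ne: "?L ~= {}"
 proof
  assume "?L = {}"
  hence "(\<Sum>t\<in>L. e t) = 0" by (intro sum.neutral) auto
  thus False using u L by (simp add: orth_decomp_def)
 qed
 have M: "?M \<in> L" "e ?M ~= 0" using Max_in[OF fin ne] by auto
 have eV: "t \<in> L ==> e t \<in> V" for t using L by (auto simp: orth_decomp_def)
 note w = tr_projection(3)[OF L M]
 define y where "y = scl (of_real (1 / sqrt (Re (tr (e ?M))))) (e ?M)"
 have yV: "y \<in> V" using eV M by (simp add: y_def)
 have eM: "star (e ?M) = e ?M" "e ?M \<cdot> e ?M = e ?M" using L M by (auto simp: orth_decomp_def)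
 have ey: "e t \<cdot> y = (if t = ?M then y else 0)" if "t \<in> L" for t
  using L M that eV by (auto simp: y_def mult_scl_right orth_decomp_def)
 define r where "r = 1 / sqrt (Re (tr (e ?M)))"
 have r: "r * r = 1 / Re (tr (e ?M))" using w by (simp add: r_def)
 have "star y \<cdot> y = scl (of_real r * of_real r) (e ?M)"
  using eV[OF M(1)] eM unfolding y_def r_def[symmetric] by (simp add: star_scl mult_scl_left mult_scl_right)
 hence "star y \<cdot> y = scl (of_real (1 / Re (tr (e ?M)))) (e ?M)"
  by (simp only: of_real_mult[symmetric] r)
 hence y1: "Re (tr (star y \<cdot> y)) = 1" using eV[OF M(1)] w by (simp add: tr_scl)
 have "Re (tr (star (x \<cdot> y) \<cdot> (x \<cdot> y))) = (\<Sum>t\<in>L. if t = ?M then ?M else 0)"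
  unfolding square_norm_decomp(1)[OF x yV L a] using y1 by (intro sum.cong refl) (auto simp: ey)
 also have "... = ?M" using L M by (simp add: orth_decomp_def)
 finally have yM: "Re (tr (star (x \<cdot> y) \<cdot> (x \<cdot> y))) = ?M" .
 hence att: "sqrt ?M \<in> {sqrt (Re (tr (star (x \<cdot> y) \<cdot> (x \<cdot> y)))) |y. y \<in> V & sqrt (Re (tr (star y \<cdot> y))) <= 1}"
  using yV y1 by (intro CollectI exI[of _ y]) simp
 have M0: "?M \<ge> 0"
  using tr_square_nonneg[of "x \<cdot> y"] yM x yV by simp
 have bound: "sqrt (Re (tr (star (x \<cdot> z) \<cdot> (x \<cdot> z)))) <= sqrt ?M"
  if z: "z \<in> V" "sqrt (Re (tr (star z \<cdot> z))) <= 1" for z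
 proof -
  have "Re (tr (star (x \<cdot> z) \<cdot> (x \<cdot> z))) <= (\<Sum>t\<in>L. ?M * Re (tr (star (e t \<cdot> z) \<cdot> (e t \<cdot> z))))"
   unfolding square_norm_decomp(1)[OF x z(1) L a]
  proof (rule sum_mono)
   fix t assume t: "t \<in> L"
   show "t * Re (tr (star (e t \<cdot> z) \<cdot> (e t \<cdot> z))) <= ?M * Re (tr (star (e t \<cdot> z) \<cdot> (e t \<cdot> z)))"
   proof (cases "e t = 0")
    case False
    hence "t <= ?M" using t fin by simp
    thus ?thesis using t z eV by (intro mult_right_mono tr_square_nonneg) auto
   qed (use z in auto)
  qed
  also have "... = ?M * Re (tr (star z \<cdot> z))"
   by (simp add: square_norm_decomp(2)[OF x z(1) L a] sum_distrib_left)
  also have "... <= ?M * 1" using z M0 by (intro mult_left_mono) auto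
  finally show ?thesis by simp
 qed
 show ?thesis by (rule cSup_eq_maximum) (use att bound in auto)
qed

end

subsection \<open>The equality case of Jensen's inequality for powers\<close>

lemma powr_less_tangent_concave:
 fixes y r :: real
 assumes "0 <= y" "y ~= 1" "0 < r" "r < 1"
 shows "y powr r < 1 + r * (y - 1)"
proof (cases "y = 0")
 case False
 define c where "c = r * y + (1 - r)"
 have y: "y > 0" using False assms by simp
 hence c: "c > 0" using assms by (simp add: c_def add_pos_pos)
 have l1: "ln (y / c) <= y / c - 1" "ln (1 / c) <= 1 / c - 1"
  using y c by (auto intro!: ln_le_minus_one divide_pos_pos)
 have "y / c ~= 1 | 1 / c ~= 1" using assms c by auto
 hence strict: "ln (y / c) < y / c - 1 | ln (1 / c) < 1 / c - 1"
  using l1 ln_eq_minus_one[of "y / c"] ln_eq_minus_one[of "1 / c"] y c by (metis divide_pos_pos less_eq_real_def zero_less_one)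
 have "r * ln (y / c) + (1 - r) * ln (1 / c) < r * (y / c - 1) + (1 - r) * (1 / c - 1)"
  using strict
 proof
  assume "ln (y / c) < y / c - 1"
  thus ?thesis using l1 assms by (intro add_less_le_mono mult_strict_left_mono mult_left_mono) auto
 next
  assume "ln (1 / c) < 1 / c - 1"
  thus ?thesis using l1 assms by (intro add_le_less_mono mult_strict_left_mono mult_left_mono) auto
 qed
 also have "... = 0" using c by (simp add: c_def field_simps)
 finally have "r * ln y < ln c" using y c by (simp add: ln_div algebra_simps)
 hence "exp (r * ln y) < c" using c by (metis exp_less_mono exp_ln)
 thus ?thesis using y by (simp add: powr_def c_def algebra_simps)
qed (use assms in auto)

lemma powr_greater_tangent_convex:
 fixes y r :: real
 assumes "0 <= y" "y ~= 1" "1 < r"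
 shows "y powr r > 1 + r * (y - 1)"
proof -
 have "y powr r ~= 1" using assms by (auto simp: powr_def split: if_splits)
 hence "(y powr r) powr (1 / r) < 1 + (1 / r) * (y powr r - 1)"
  using assms by (intro powr_less_tangent_concave) auto
 hence "y < 1 + (1 / r) * (y powr r - 1)" using assms by (simp add: powr_powr)
 thus ?thesis using assms by (simp add: field_simps)
qed

lemma powr_tangent_scaled:
 fixes t m r :: real
 assumes "0 <= t" "0 < m"
 shows "t powr r - m powr r - r * m powr (r - 1) * (t - m) = m powr r * ((t / m) powr r - (1 + r * (t / m - 1)))"
 using assms by (simp add: powr_divide powr_diff field_simps)

text \<open>Each term \<open>t\<^bsup>r\<^esup>\<close> lies on one side of the tangent at the weighted mean, and the tangent terms add
 up to the mean; so equality forces every \<open>t i\<close> to be the point of contact.\<close>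

lemma Jensen_powr_equality:
 fixes w t :: "'i => real"
 assumes I: "finite I" "I ~= {}" and w: "!!i. i \<in> I ==> 0 < w i" and t: "!!i. i \<in> I ==> 0 <= t i"
  and r: "0 < r" "r ~= 1"
 shows "(\<Sum>i\<in>I. t i * w i) = sum w I powr (1 - 1 / r) * (\<Sum>i\<in>I. t i powr r * w i) powr (1 / r) <->
  (\<forall>i\<in>I. \<forall>j\<in>I. t i = t j)" (is "?S = ?R <-> _")
proof
 let ?W = "sum w I" and ?Sr = "\<Sum>i\<in>I. t i powr r * w i"
 have W: "?W > 0" using I w by (simp add: sum_pos)
 have Sr: "?Sr \<ge> 0" using w by (intro sum_nonneg) (simp add: less_imp_le)
 assume eq: "?S = ?R"
 show "\<forall>i\<in>I. \<forall>j\<in>I. t i = t j"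
 proof (cases "?S = 0")
  case True
  hence "\<forall>i\<in>I. t i * w i = 0" using I w t by (subst (asm) sum_nonneg_eq_0_iff) (auto simp: less_imp_le)
  hence "t i = 0" if "i \<in> I" for i using w[OF that] that by auto
  thus ?thesis by simp
 next
  case False
  define m where "m = ?S / ?W"
  have "?S \<ge> 0" using w t by (intro sum_nonneg) (simp add: less_imp_le)
  hence S: "?S > 0" using False by linarith
  hence m: "m > 0" using W by (simp add: m_def)
  have "?S powr r = ?W powr (r - 1) * ?Sr"
   using W Sr r by (subst eq) (simp add: powr_mult powr_powr algebra_simps)
  hence Sr_eq: "?Sr = ?W * m powr r"
   using W S by (simp add: m_def powr_divide powr_diff field_simps)
  have S_eq: "?S = ?W * m" using W by (simp add: m_def)
  define \<phi> where "\<phi> i = t i powr r - m powr r - r * m powr (r - 1) * (t i - m)" for i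
  have "(\<Sum>i\<in>I. w i * \<phi> i) = ?Sr - ?W * m powr r - r * m powr (r - 1) * (?S - ?W * m)"
   by (simp add: \<phi>_def algebra_simps sum.distrib sum_subtractf sum_distrib_left sum_distrib_right)
  hence zero: "(\<Sum>i\<in>I. w i * \<phi> i) = 0" using Sr_eq S_eq by simp
  have phi: "\<phi> i = m powr r * ((t i / m) powr r - (1 + r * (t i / m - 1)))" if "i \<in> I" for i
   using powr_tangent_scaled[OF t[OF that] m] by (simp add: \<phi>_def)
  have phi0: "\<phi> i = 0" if "i \<in> I" for i
  proof (cases "r < 1")
   case True
   have "0 <= - (w i * \<phi> i)" if "i \<in> I" for i
    using powr_less_tangent_concave[of "t i / m" r] that t[OF that] m r True w[OF that]
    by (cases "t i / m = 1") (auto simp: phi mult_le_0_iff less_imp_le)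
   moreover have "(\<Sum>i\<in>I. - (w i * \<phi> i)) = 0" using zero by (simp add: sum_negf)
   ultimately have "- (w i * \<phi> i) = 0" using I that by (subst (asm) sum_nonneg_eq_0_iff) auto
   thus ?thesis using w[OF that] by simp
  next
   case False
   have "0 <= w i * \<phi> i" if "i \<in> I" for i
    using powr_greater_tangent_convex[of "t i / m" r] that t[OF that] m r False w[OF that]
    by (cases "t i / m = 1") (auto simp: phi intro!: mult_nonneg_nonneg less_imp_le)
   hence "w i * \<phi> i = 0" using I that zero by (subst (asm) sum_nonneg_eq_0_iff) auto
   thus ?thesis using w[OF that] by simp
  qed
  have "t i = m" if "i \<in> I" for i
  proof -
   have "(t i / m) powr r = 1 + r * (t i / m - 1)" using phi0[OF that] phi[OF that] m by simp
   hence "t i / m = 1"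
    using powr_less_tangent_concave[of "t i / m" r] powr_greater_tangent_convex[of "t i / m" r] t[OF that] m r
    by (metis divide_nonneg_pos less_irrefl linorder_neqE_linordered_idom)
   thus ?thesis using m by simp
  qed
  thus ?thesis by simp
 qed
next
 let ?W = "sum w I"
 have W: "?W > 0" using I w by (simp add: sum_pos)
 assume all: "\<forall>i\<in>I. \<forall>j\<in>I. t i = t j"
 obtain c where c: "!!i. i \<in> I ==> t i = c" using all by blast
 have c0: "c \<ge> 0" using c t I by fastforce
 have "?S = c * ?W" using c by (simp add: sum_distrib_left)
 moreover have "(\<Sum>i\<in>I. t i powr r * w i) = c powr r * ?W" using c by (simp add: sum_distrib_left)
 moreover have "?W powr (1 - 1 / r) * (c powr r * ?W) powr (1 / r) = c * ?W"
  using W c0 r by (simp add: powr_mult powr_powr powr_diff)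
 ultimately show "?S = ?R" by simp
qed

section \<open>Homeomorphisms of the plane\<close>

definition plane_homeo :: "(complex => complex) => bool" where
 "plane_homeo h <-> (\<exists>k. homeomorphism UNIV UNIV h k)"

text \<open>By invariance of domain, continuity of the inverse is automatic.\<close>

lemma plane_homeoI:
 assumes "continuous_on UNIV h" "inj h" "!!w. \<exists>z. h z = w"
 shows "plane_homeo h"
proof -
 have "surj h" using assms(3) by (metis surjI)
 obtain g where "homeomorphism UNIV (h ` UNIV) h g"
  using invariance_of_domain_homeomorphism[of UNIV h] assms by auto
 thus ?thesis using `surj h` by (auto simp: plane_homeo_def)
qed

lemma plane_homeo_bij: "plane_homeo h ==> bij h"
 unfolding plane_homeo_def homeomorphism_def bij_def inj_def by (metis UNIV_I)

lemma plane_homeo_continuous: "plane_homeo h ==> continuous_on S h"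
 unfolding plane_homeo_def homeomorphism_def by (metis continuous_on_subset subset_UNIV)

lemma plane_homeo_inv: "plane_homeo h ==> plane_homeo (inv h)"
 unfolding plane_homeo_def using homeomorphism_symD
 by (metis (no_types, opaque_lifting) UNIV_I ext homeomorphism_def inv_equality)

lemma isotopic_homeo: "isotopic_to_id h ==> plane_homeo h"
 unfolding isotopic_to_id_def plane_homeo_def by force

lemma isotopic_to_id_comp:
 assumes "isotopic_to_id h" "isotopic_to_id k"
 shows "isotopic_to_id (%z. h (k z))"
proof -
 obtain H where H: "continuous_on ({0..1} \<times> UNIV) (%(t, z). H t z)"
   "\<forall>t\<in>{0..1}. plane_homeo (H t)" "H (0::real) = id" "H 1 = h"
  using assms(1) unfolding isotopic_to_id_def plane_homeo_def by blast
 obtain K where K: "continuous_on ({0..1} \<times> UNIV) (%(t, z). K t z)"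
   "\<forall>t\<in>{0..1}. plane_homeo (K t)" "K (0::real) = id" "K 1 = k"
  using assms(2) unfolding isotopic_to_id_def plane_homeo_def by blast
 have "continuous_on ({0..1} \<times> UNIV) ((%(t, z). H t z) \<circ> (%p. (fst p, K (fst p) (snd p))))"
  using K(1)
  by (intro continuous_on_compose continuous_on_subset[OF H(1)] continuous_intros)
   (auto simp: case_prod_unfold)
 hence "continuous_on ({0..1} \<times> UNIV) (%(t, z). (H t \<circ> K t) z)"
  by (simp add: o_def case_prod_unfold)
 moreover have "\<forall>t\<in>{0..1}. \<exists>g. homeomorphism UNIV UNIV (H t \<circ> K t) g"
  using H(2) K(2) unfolding plane_homeo_def by (meson homeomorphism_compose)
 ultimately show ?thesis
  unfolding isotopic_to_id_def using H(3,4) K(3,4)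
  by (intro exI[of _ "%t. H t \<circ> K t"]) (auto simp: o_def)
qed

lemma isotopic_to_idI:
 assumes "continuous_on ({0..1} \<times> UNIV) (%(t, z). H t z)"
  and "!!t. 0 <= t ==> t <= 1 ==> inj (H t)" "!!t w. 0 <= t ==> t <= 1 ==> \<exists>z. H t z = w"
  and "!!z. H 0 z = z" "!!z. H (1::real) z = h z"
 shows "isotopic_to_id h"
 unfolding isotopic_to_id_def
proof (intro exI[of _ H] conjI ballI)
 fix t :: real assume t: "t \<in> {0..1}"
 have "continuous_on UNIV ((%(t, z). H t z) \<circ> (%z. (t, z)))"
  using t by (intro continuous_on_compose continuous_on_subset[OF assms(1)] continuous_intros) auto
 hence "plane_homeo (H t)"
  using t assms(2,3) by (intro plane_homeoI) (auto simp: o_def)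
 thus "\<exists>k. homeomorphism UNIV UNIV (H t) k" by (simp add: plane_homeo_def)
qed (use assms in auto)

text \<open>A map that preserves all horizontal lines and is an increasing bijection on each of them is
 isotopic to the identity by linear interpolation.\<close>

lemma isotopic_level_map:
 fixes f :: "complex => real"
 assumes cont: "continuous_on UNIV f"
  and mono: "!!x x' y. x < x' ==> f (Complex x y) < f (Complex x' y)"
  and upper: "!!M y. \<exists>x. M <= f (Complex x y)" and lower: "!!M y. \<exists>x. f (Complex x y) <= M"
 shows "isotopic_to_id (%z. Complex (f z) (Im z))"
proof (rule isotopic_to_idI[of "%t z. Complex ((1 - t) * Re z + t * f z) (Im z)"])
 have f': "continuous_on ({0..1::real} \<times> UNIV) (%x. f (snd x))"
  by (rule continuous_on_compose2[OF cont]) (auto intro: continuous_intros)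
 show "continuous_on ({0..1} \<times> UNIV) (%(t, z). Complex ((1 - t) * Re z + t * f z) (Im z))"
  unfolding case_prod_unfold Complex_eq by (intro continuous_intros f')
 fix t :: real assume t: "0 <= t" "t <= 1"
 let ?g = "%x y. (1 - t) * x + t * f (Complex x y)"
 have m: "?g x y < ?g x' y" if "x < x'" for x x' y
 proof (cases "t = 0")
  case False
  hence "t * f (Complex x y) < t * f (Complex x' y)" using t mono[OF that] by simp
  moreover have "(1 - t) * x <= (1 - t) * x'" using t that by (intro mult_left_mono) auto
  ultimately show ?thesis by linarith
 qed (use that in auto)
 show "inj (%z. Complex ((1 - t) * Re z + t * f z) (Im z))"
 proof (rule injI)
  fix z w assume eq: "Complex ((1 - t) * Re z + t * f z) (Im z) = Complex ((1 - t) * Re w + t * f w) (Im w)"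
  hence "?g (Re z) (Im z) = ?g (Re w) (Im z)" by (metis complex.sel complex.collapse)
  hence "Re z = Re w" using m by (metis less_irrefl linorder_neqE_linordered_idom)
  thus "z = w" using eq by (simp add: complex_eq_iff)
 qed
 fix w :: complex
 let ?v = "Re w" and ?y = "Im w"
 obtain a where a: "f (Complex a ?y) <= ?v" using lower by blast
 obtain b where b: "?v <= f (Complex b ?y)" using upper by blast
 have fm: "f (Complex x ?y) <= f (Complex x' ?y)" if "x <= x'" for x x'
  using mono[of x x' ?y] that by (cases "x = x'") auto
 define a' b' where "a' = min a ?v" and "b' = max b ?v"
 have "?g a' ?y <= (1 - t) * ?v + t * ?v"
  using a fm[of a' a] t by (intro add_mono mult_left_mono) (auto simp: a'_def)
 moreover have "(1 - t) * ?v + t * ?v <= ?g b' ?y"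
  using b fm[of b b'] t by (intro add_mono mult_left_mono) (auto simp: b'_def)
 moreover have "continuous_on {a'..b'} (%x. ?g x ?y)"
  unfolding Complex_eq
  by (intro continuous_intros continuous_on_compose2[OF cont]) auto
 moreover have "a' <= b'" by (auto simp: a'_def b'_def)
 ultimately obtain x where "?g x ?y = ?v"
  using IVT'[of "%x. ?g x ?y" a' ?v b'] by (auto simp: algebra_simps)
 thus "\<exists>z. Complex ((1 - t) * Re z + t * f z) (Im z) = w"
  by (intro exI[of _ "Complex x ?y"]) (simp add: complex_eq_iff)
qed auto

text \<open>A logarithm of \<open>c\<close> connects 1 to \<open>c\<close> through nonzero numbers, so rotations are isotopies too.\<close>

lemma isotopic_affine:
 assumes "c ~= 0"
 shows "isotopic_to_id (%z. c * z + b)"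
proof (rule isotopic_to_idI[of "%t z. exp (of_real t * Ln c) * z + of_real t * b"])
 show "continuous_on ({0..1} \<times> UNIV) (%(t, z). exp (of_real t * Ln c) * z + of_real t * b)"
  unfolding case_prod_unfold by (intro continuous_intros)
 fix t :: real and w
 show "inj (%z. exp (of_real t * Ln c) * z + of_real t * b)" by (auto simp: inj_def)
 show "\<exists>z. exp (of_real t * Ln c) * z + of_real t * b = w"
  by (intro exI[of _ "(w - of_real t * b) / exp (of_real t * Ln c)"]) simp
qed (use assms in auto)

lemma isotopic_vertical_map:
 fixes f :: "complex => real"
 assumes cont: "continuous_on UNIV f"
  and mono: "!!x y y'. y < y' ==> f (Complex x y) < f (Complex x y')"
  and upper: "!!M x. \<exists>y. M <= f (Complex x y)" and lower: "!!M x. \<exists>y. f (Complex x y) <= M"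
 shows "isotopic_to_id (%z. Complex (Re z) (f z))"
proof -
 have eq: "\<i> * Complex x y = Complex (- y) x" for x y by (simp add: complex_eq_iff)
 have "isotopic_to_id (%z. Complex (f (\<i> * z)) (Im z))"
 proof (rule isotopic_level_map)
  show "continuous_on UNIV (%z. f (\<i> * z))"
   by (rule continuous_on_compose2[OF cont]) (auto intro: continuous_intros)
 qed (use mono upper lower in \<open>auto simp: eq\<close>)
 from isotopic_to_id_comp[OF isotopic_affine[of \<i> 0] isotopic_to_id_comp[OF this isotopic_affine[of "- \<i>" 0]]]
 have "isotopic_to_id (%z. \<i> * Complex (f (\<i> * (- \<i> * z))) (Im (- \<i> * z)))" by simp
 thus ?thesis by (simp add: eq mult.assoc[symmetric])
qed

text \<open>Radial rescaling, which turns the balls of one gauge into those of another one.\<close>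

lemma isotopic_radial:
 fixes p q :: "complex => real"
 assumes cont: "continuous_on UNIV p" "continuous_on UNIV q"
  and pos: "!!z. z ~= 0 ==> 0 < p z" "!!z. z ~= 0 ==> 0 < q z"
  and hom: "!!r z. 0 < r ==> p (of_real r * z) = r * p z" "!!r z. 0 < r ==> q (of_real r * z) = r * q z"
 shows "isotopic_to_id (%z. of_real (p z / q z) * z)"
proof (rule isotopic_to_idI[of "%t z. of_real ((1 - t) + t * (p z / q z)) * z"])
 define s where "s t z = (1 - t) + t * (p z / q z)" for t z
 have s_hom: "s t (of_real r * z) = s t z" if "0 < r" for t r z
  using that by (simp add: s_def hom)
 have s_pos: "0 < s t z" if "0 <= t" "t <= 1" "z ~= 0" for t z
 proof (cases "t = 0")
  case False
  hence "0 < t * (p z / q z)" using that pos by (intro mult_pos_pos divide_pos_pos) auto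
  thus ?thesis using that by (simp add: s_def)
 qed (simp add: s_def)
 obtain C where C: "!!z. z ~= 0 ==> p z / q z <= C"
 proof -
  have q0: "q z ~= 0" if "z \<in> sphere 0 1" for z using that pos(2)[of z] by (cases "z = 0") auto
  have "continuous_on (sphere 0 1) (%z. p z / q z)"
   using q0 by (intro continuous_on_divide continuous_on_subset[OF cont(1)] continuous_on_subset[OF cont(2)]) auto
  hence "bounded ((%z. p z / q z) ` sphere 0 1)"
   by (intro compact_imp_bounded compact_continuous_image) auto
  then obtain C where "!!x. x \<in> (%z. p z / q z) ` sphere 0 1 ==> norm x <= C"
   unfolding bounded_iff by blast
  hence C': "norm (p z / q z) <= C" if "z \<in> sphere 0 1" for z using that by blast
  have C: "p z / q z <= C" if "z \<in> sphere 0 1" for z using C'[OF that] by (simp only: real_norm_def abs_le_iff)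
  have "p z / q z <= C" if "z ~= 0" for z
  proof -
   have z: "of_real (norm z) * sgn z = z" using that by (simp add: sgn_eq)
   have "p z = norm z * p (sgn z)" "q z = norm z * q (sgn z)"
    using hom[of "norm z" "sgn z"] that unfolding z by auto
   hence "p z / q z = p (sgn z) / q (sgn z)" using that by simp
   thus ?thesis using C[of "sgn z"] that by (simp add: norm_sgn)
  qed
  thus thesis using that by blast
 qed
 show "continuous_on ({0..1} \<times> UNIV) (%(t, z). of_real ((1 - t) + t * (p z / q z)) * z)"
  unfolding continuous_on_eq_continuous_within
 proof (intro ballI)
  fix a :: "real \<times> complex" assume "a \<in> {0..1} \<times> UNIV"
  then obtain t z where a: "a = (t, z)" "0 <= t" "t <= 1" by auto
  let ?H = "%(t, z). of_real ((1 - t) + t * (p z / q z)) * z"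
  show "continuous (at a within {0..1} \<times> UNIV) ?H"
  proof (cases "z = 0")
   case False
   have "isCont (%x. p (snd x)) a" "isCont (%x. q (snd x)) a"
   proof -
    have "continuous_on UNIV (%x::real \<times> complex. p (snd x))" "continuous_on UNIV (%x::real \<times> complex. q (snd x))"
     by (rule continuous_on_compose2[OF cont(1)] continuous_on_compose2[OF cont(2)]; simp add: continuous_on_snd)+
    thus "isCont (%x. p (snd x)) a" "isCont (%x. q (snd x)) a"
     by (simp_all only: continuous_on_eq_continuous_at[OF open_UNIV] UNIV_I ball_UNIV simp_thms)
   qed
   moreover have "q (snd a) ~= 0" using pos(2)[OF False] a by simp
   ultimately have "isCont ?H a" unfolding case_prod_unfold by (intro continuous_intros)
   thus ?thesis by (rule continuous_at_imp_continuous_at_within)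
  next
   case True
   have bound: "norm (?H x) <= (1 + \<bar>C\<bar>) * norm (snd x)" if "x \<in> {0..1} \<times> UNIV" for x
   proof (cases "snd x = 0")
    case False
    have x: "0 <= fst x" "fst x <= 1" using that by (auto simp: mem_Times_iff)
    have "s (fst x) (snd x) <= 1 + \<bar>C\<bar>"
    proof -
     have "fst x * (p (snd x) / q (snd x)) <= 1 * \<bar>C\<bar>"
      using x C[OF False] pos[OF False] by (intro mult_mono) auto
     thus ?thesis using x by (simp add: s_def)
    qed
    moreover have "norm (?H x) = \<bar>s (fst x) (snd x)\<bar> * norm (snd x)"
     by (simp add: case_prod_unfold s_def norm_mult del: of_real_add of_real_diff of_real_mult of_real_divide)
    ultimately show ?thesis
     using s_pos[OF x False] by (simp add: mult_right_mono)
   qed (simp add: case_prod_unfold)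
   have z: "snd a = 0" "?H a = 0" using a True by auto
   have "((%x. (1 + \<bar>C\<bar>) * norm (snd x)) \<longlongrightarrow> (1 + \<bar>C\<bar>) * norm (snd a)) (at a within {0..1} \<times> UNIV)"
    by (intro tendsto_intros)
   hence lim: "((%x. (1 + \<bar>C\<bar>) * norm (snd x)) \<longlongrightarrow> 0) (at a within {0..1} \<times> UNIV)" using z by simp
   have "\<forall>\<^sub>F x in at a within {0..1} \<times> UNIV. norm (?H x) <= (1 + \<bar>C\<bar>) * norm (snd x)"
    unfolding eventually_at_filter by (rule always_eventually) (use bound in blast)
   hence "(?H \<longlongrightarrow> ?H a) (at a within {0..1} \<times> UNIV)"
    unfolding z by (rule Lim_null_comparison[OF _ lim])
   thus ?thesis unfolding continuous_within .
  qed
 qed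
 fix t :: real assume t: "0 <= t" "t <= 1"
 show "inj (%z. of_real ((1 - t) + t * (p z / q z)) * z)"
  unfolding s_def[symmetric]
 proof (rule injI)
  fix z w assume eq: "of_real (s t z) * z = of_real (s t w) * w"
  show "z = w"
  proof (cases "z = 0 | w = 0")
   case True
   thus ?thesis using eq s_pos[OF t, of z] s_pos[OF t, of w] by force
  next
   case False
   hence sz: "0 < s t z" "0 < s t w" using s_pos[OF t] by auto
   hence w: "w = of_real (s t z / s t w) * z" using eq by (simp add: field_simps)
   hence "s t w = s t z" using s_hom[of "s t z / s t w" t z] sz by simp
   thus ?thesis using w sz by simp
  qed
 qed
 fix w :: complex
 show "\<exists>z. of_real ((1 - t) + t * (p z / q z)) * z = w"
  unfolding s_def[symmetric]
 proof (cases "w = 0")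
  case False
  hence "0 < s t w" using s_pos[OF t] by auto
  thus "\<exists>z. of_real (s t z) * z = w"
   using s_hom[of "inverse (s t w)" t w] by (intro exI[of _ "of_real (inverse (s t w)) * w"]) simp
 qed (intro exI[of _ 0], simp)
qed auto

text \<open>Products of increasing homeomorphisms of the line. An increasing homeomorphism can be
 prescribed at finitely many points.\<close>

definition incr_homeo :: "(real => real) => bool" where
 "incr_homeo f <-> strict_mono f & surj f"

definition prod_map :: "(real => real) => (real => real) => complex => complex" where
 "prod_map f g z = Complex (f (Re z)) (g (Im z))"

lemma prod_map_sel [simp]: "Re (prod_map f g z) = f (Re z)" "Im (prod_map f g z) = g (Im z)"
 by (simp_all add: prod_map_def)

lemma incr_homeo_continuous: "incr_homeo f ==> continuous_on S f"
 by (metis continuous_onI_mono incr_homeo_def open_UNIV strict_mono_less_eq continuous_on_subset subset_UNIV)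

lemma isotopic_prod_map:
 assumes f: "incr_homeo f" and g: "incr_homeo g"
 shows "isotopic_to_id (prod_map f g)"
proof -
 have c: "continuous_on UNIV (%z. h (Re z))" "continuous_on UNIV (%z. h (Im z))" if "incr_homeo h" for h
  by (rule continuous_on_compose2[OF incr_homeo_continuous[OF that, of UNIV]], auto intro: continuous_intros)+
 have "isotopic_to_id (%z. Complex (f (Re z)) (Im z))"
  using f unfolding incr_homeo_def
  by (intro isotopic_level_map c f) (auto simp: strict_mono_def | metis order_refl surjD complex.sel)+
 moreover have "isotopic_to_id (%z. Complex (Re z) (g (Im z)))"
  using g unfolding incr_homeo_def
  by (intro isotopic_vertical_map c g) (auto simp: strict_mono_def | metis order_refl surjD complex.sel)+
 ultimately have "isotopic_to_id (%z. Complex (f (Re (Complex (Re z) (g (Im z))))) (Im (Complex (Re z) (g (Im z)))))"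
  by (rule isotopic_to_id_comp)
 thus ?thesis by (simp add: prod_map_def[abs_def])
qed

lemma incr_homeo_through:
 fixes xs ys :: "real list"
 assumes "sorted_wrt (<) xs" "sorted_wrt (<) ys" "length xs = length ys"
 obtains f where "incr_homeo f" "map f xs = ys"
proof -
 have "\<exists>f. incr_homeo f & map f xs = ys"
  using assms(3,1,2)
 proof (induction xs ys rule: list_induct2)
  case Nil
  show ?case by (intro exI[of _ id]) (auto simp: incr_homeo_def strict_mono_def)
 next
  case (Cons x xs y ys)
  then obtain f where f: "incr_homeo f" "map f xs = ys" by auto
  show ?case
  proof (cases xs)
   case Nil
   have "incr_homeo (%t. t + (y - x))"
    unfolding incr_homeo_def strict_mono_def surj_def by (auto, metis add.commute diff_add_cancel)
   thus ?thesis using Nil Cons.hyps by (intro exI[of _ "%t. t + (y - x)"]) auto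
  next
   case (Cons x' xs')
   then obtain ys' where ys: "ys = f x' # ys'" using f by auto
   have less: "x < x'" "y < f x'" using Cons.prems Cons ys `sorted_wrt (<) (x # xs)` `sorted_wrt (<) (y # ys)` by auto
   define m where "m = (f x' - y) / (x' - x)"
   have m: "m > 0" using less by (simp add: m_def)
   define g where "g t = (if x' <= t then f t else f x' + m * (t - x'))" for t
   have "strict_mono g"
    unfolding strict_mono_def
   proof (intro allI impI)
    fix a b :: real assume ab: "a < b"
    have fm: "x' <= b ==> f x' <= f b" and "a < b ==> f a < f b"
     using f(1) by (auto simp: incr_homeo_def strict_mono_less_eq strict_mono_less)
    moreover have "a < x' ==> m * (a - x') < 0" using m by (simp add: mult_less_0_iff)
    moreover have "m * (a - x') < m * (b - x')" using ab m by simp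
    ultimately show "g a < g b" using ab by (auto simp: g_def)
   qed
   moreover have "\<exists>t. w = g t" for w
   proof (cases "f x' <= w")
    case True
    obtain t where t: "w = f t" using f(1) by (auto simp: incr_homeo_def surj_def)
    hence "x' <= t" using True f(1) by (simp add: incr_homeo_def strict_mono_less_eq)
    thus ?thesis using t by (auto simp: g_def intro!: exI[of _ t])
   next
    case False
    hence "(w - f x') / m < 0" using m by (simp add: divide_less_0_iff)
    thus ?thesis using m by (intro exI[of _ "x' + (w - f x') / m"]) (simp add: g_def)
   qed
   ultimately have "incr_homeo g" by (auto simp: incr_homeo_def surj_def)
   moreover have "m * (x - x') = - (f x' - y)" using less by (simp add: m_def divide_simps) (simp add: algebra_simps)
   hence "g x = y" using less by (simp add: g_def)
   moreover have "g t = f t" if "t \<in> set xs" for t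
    using that Cons `sorted_wrt (<) (x # xs)` by (auto simp: g_def)
   ultimately show ?thesis using f(2) by (intro exI[of _ g]) (auto cong: map_cong)
  qed
 qed
 thus thesis using that by blast
qed

lemma incr_homeo_obtain:
 "(!!f. incr_homeo f ==> map f xs = ys ==> thesis) ==> sorted_wrt (<) (xs :: real list) ==>
  sorted_wrt (<) (ys :: real list) ==> length xs = length ys ==> thesis"
 by (rule incr_homeo_through)

lemma incr_homeo_compare:
 assumes "incr_homeo f"
 shows "f a < f b <-> a < b" "f a <= f b <-> a <= b" "f a = f b <-> a = b"
 using assms by (auto simp: incr_homeo_def strict_mono_less strict_mono_less_eq strict_mono_eq)

section \<open>Homeomorphic images of tangles\<close>

lemma
 assumes "plane_homeo h"
 shows interior_homeo_image: "interior (h ` S) = h ` interior S"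
  and closure_homeo_image: "closure (h ` S) = h ` closure S"
  and frontier_homeo_image: "bd (h ` S) = h ` bd S"
proof -
 have bij: "bij h" using assms by (rule plane_homeo_bij)
 have open_image: "open (k ` U)" if "plane_homeo k" "open U" for k U
 proof -
  have "k ` U = inv k -` U" using plane_homeo_bij[OF that(1)] by (simp add: bij_vimage_eq_inv_image bij_imp_bij_inv inv_inv_eq)
  thus ?thesis
   using that plane_homeo_continuous[OF plane_homeo_inv[OF that(1)], of UNIV] by (simp add: open_vimage)
 qed
 have int: "interior (h ` S) = h ` interior S" for S
 proof (rule interior_unique)
  show "h ` interior S \<subseteq> h ` S" using interior_subset by blast
  show "open (h ` interior S)" using open_image[OF assms] by simp
  fix U assume U: "U \<subseteq> h ` S" "open U"
  have "inv h ` U \<subseteq> inv h ` h ` S" using U(1) by (rule image_mono)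
  hence "inv h ` U \<subseteq> S" by (simp only: image_inv_f_f[OF bij_is_inj[OF bij]])
  hence "inv h ` U \<subseteq> interior S"
   using open_image[OF plane_homeo_inv[OF assms] U(2)] by (rule interior_maximal)
  hence "h ` inv h ` U \<subseteq> h ` interior S" by (rule image_mono)
  thus "U \<subseteq> h ` interior S" by (simp only: image_f_inv_f[OF bij_is_surj[OF bij]])
 qed
 show "interior (h ` S) = h ` interior S" by (rule int)
 show cl: "closure (h ` S) = h ` closure S" for S
  using int[of "- S"] by (simp only: closure_interior bij_image_Compl_eq[OF bij])
 show "bd (h ` S) = h ` bd S"
  by (simp only: frontier_def image_set_diff[OF bij_is_inj[OF bij]] int cl)
qed

lemma components_homeo_image:
 assumes h: "plane_homeo h" and C: "C \<in> components S"
 shows "h ` C \<in> components (h ` S)"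
proof -
 have bij: "bij h" using h by (rule plane_homeo_bij)
 have C': "C ~= {}" "C \<subseteq> S" "connected C" "!!D. D ~= {} ==> C \<subseteq> D ==> D \<subseteq> S ==> connected D ==> D = C"
  using C unfolding in_components_maximal by auto
 show ?thesis
  unfolding in_components_maximal
 proof (intro conjI allI impI)
  show "connected (h ` C)"
   using C' plane_homeo_continuous[OF h] by (blast intro: connected_continuous_image)
  fix D assume D: "D ~= {} & h ` C \<subseteq> D & D \<subseteq> h ` S & connected D"
  have "inv h ` D = C"
  proof (rule C'(4))
   show "connected (inv h ` D)"
    using D plane_homeo_continuous[OF plane_homeo_inv[OF h]] by (blast intro: connected_continuous_image)
   have "inv h ` h ` C \<subseteq> inv h ` D" "inv h ` D \<subseteq> inv h ` h ` S" using D by (auto intro: image_mono)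
   thus "C \<subseteq> inv h ` D" "inv h ` D \<subseteq> S" by (simp_all only: image_inv_f_f[OF bij_is_inj[OF bij]])
  qed (use D in auto)
  thus "D = h ` C" using image_f_inv_f[OF bij_is_surj[OF bij], of D] by simp
 qed (use C' in auto)
qed

lemma map_tangle_sel [simp]:
 "outer_disc (map_tangle h T) = h ` outer_disc T" "inner_discs (map_tangle h T) = (`) h ` inner_discs T"
 "strings (map_tangle h T) = h ` strings T" "shaded (map_tangle h T) = h ` shaded T"
 "marked (map_tangle h T) = h ` marked T"
 by (simp_all add: map_tangle_def)

lemma discs_map_tangle: "discs (map_tangle h T) = (`) h ` discs T"
 by (simp add: discs_def)

lemma regions_map_tangle: "plane_homeo h ==> regions (map_tangle h T) = h ` regions T"
proof -
 assume h: "plane_homeo h"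
 hence inj: "inj h" using plane_homeo_bij bij_is_inj by blast
 have "\<Union> (interior ` (`) h ` inner_discs T) = h ` interiors (inner_discs T)"
  by (simp add: image_image interior_homeo_image[OF h] image_UN)
 thus ?thesis by (simp add: regions_def image_set_diff[OF inj])
qed

lemma disc_size_map_tangle: "plane_homeo h ==> disc_size (map_tangle h T) (h ` D) = disc_size T D"
proof -
 assume h: "plane_homeo h"
 hence inj: "inj h" using plane_homeo_bij bij_is_inj by blast
 have "strings (map_tangle h T) Int bd (h ` D) = h ` (strings T Int bd D)"
  by (simp add: frontier_homeo_image[OF h] image_Int[OF inj])
 thus ?thesis using card_image[OF inj_on_subset[OF inj]] by (simp add: disc_size_def)
qed

lemma disc_sign_map_tangle: "plane_homeo h ==> disc_sign (map_tangle h T) (h ` D) = disc_sign T D"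
proof -
 assume h: "plane_homeo h"
 hence inj: "inj h" using plane_homeo_bij bij_is_inj by blast
 show ?thesis
  unfolding disc_sign_def map_tangle_sel frontier_homeo_image[OF h] image_Int[OF inj, symmetric]
   inj_image_subset_iff[OF inj] ..
qed

lemma arc_injective_image: "arc g ==> continuous_on (path_image g) h ==> inj_on h (path_image g) ==> arc (h \<circ> g)"
 by (simp add: arc_def path_continuous_image path_image_def comp_inj_on)

lemma is_string_map_tangle:
 assumes h: "plane_homeo h" and c: "is_string T c"
 shows "is_string (map_tangle h T) (h ` c)"
proof -
 have inj: "inj h" using plane_homeo_bij[OF h] by (rule bij_is_inj)
 obtain g where g: "path_image g = c"
  and cases: "arc g & pathstart g \<in> \<Union> (bd ` discs T) & pathfinish g \<in> \<Union> (bd ` discs T) &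
    c - {pathstart g, pathfinish g} \<subseteq> interior (outer_disc T) - \<Union> (inner_discs T)
   | simple_path g & pathfinish g = pathstart g & c \<subseteq> interior (outer_disc T) - \<Union> (inner_discs T)"
  using c unfolding is_string_def by blast
 have cont: "continuous_on (path_image g) h" "inj_on h (path_image g)"
  using plane_homeo_continuous[OF h] inj by (auto intro: inj_on_subset)
 have ends: "pathstart (h \<circ> g) = h (pathstart g)" "pathfinish (h \<circ> g) = h (pathfinish g)"
  by (simp_all add: pathstart_def pathfinish_def)
 have fr: "\<Union> (bd ` discs (map_tangle h T)) = h ` \<Union> (bd ` discs T)"
  by (simp add: discs_map_tangle image_image frontier_homeo_image[OF h] image_Union)
 have int: "interior (outer_disc (map_tangle h T)) - \<Union> (inner_discs (map_tangle h T))
   = h ` (interior (outer_disc T) - \<Union> (inner_discs T))"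
  by (simp add: interior_homeo_image[OF h] image_set_diff[OF inj] image_Union image_image)
 show ?thesis
  unfolding is_string_def fr int
 proof (intro exI[of _ "h \<circ> g"] conjI)
  show "path_image (h \<circ> g) = h ` c" using g by (simp add: path_image_compose)
  show "arc (h \<circ> g) & pathstart (h \<circ> g) \<in> h ` \<Union> (bd ` discs T) &
   pathfinish (h \<circ> g) \<in> h ` \<Union> (bd ` discs T) &
   h ` c - {pathstart (h \<circ> g), pathfinish (h \<circ> g)} \<subseteq> h ` (interior (outer_disc T) - \<Union> (inner_discs T)) |
   simple_path (h \<circ> g) & pathfinish (h \<circ> g) = pathstart (h \<circ> g) &
   h ` c \<subseteq> h ` (interior (outer_disc T) - \<Union> (inner_discs T))"
   using cases
  proof (elim disjE conjE, goal_cases)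
   case 1
   have "h ` c - {h (pathstart g), h (pathfinish g)} = h ` (c - {pathstart g, pathfinish g})"
    using inj by (auto simp: inj_eq)
   thus ?case using 1 cont arc_injective_image[of g h] unfolding ends by blast
  next
   case 2
   hence "simple_path (h \<circ> g)" using cont by (intro simple_path_continuous_image) auto
   moreover have "h ` c \<subseteq> h ` (interior (outer_disc T) - \<Union> (inner_discs T))" using 2 by (intro image_mono)
   ultimately show ?case using 2 unfolding ends by metis
  qed
 qed
qed

lemma planar_map_tangle:
 assumes h: "plane_homeo h" and T: "planar_tangle T"
 shows "planar_tangle (map_tangle h T)"
proof -
 have bij: "bij h" and inj: "inj h" using plane_homeo_bij[OF h] by (auto simp: bij_def)
 obtain k where k: "homeomorphism UNIV UNIV h k" using h by (auto simp: plane_homeo_def)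
 have sub: "homeomorphism S (h ` S) h k" for S
  using k by (rule homeomorphism_of_subsets) auto
 let ?T = "map_tangle h T"
 have reg: "regions ?T = h ` regions T" by (rule regions_map_tangle[OF h])
 have P: "!!D. D \<in> discs T ==> D homeomorphic cball (0::complex) 1"
   "finite (inner_discs T)" "disjoint (inner_discs T)"
   "!!D. D \<in> inner_discs T ==> D \<subseteq> interior (outer_disc T)"
   "\<exists>C. finite C & disjoint C & \<Union> C = strings T & (\<forall>c\<in>C. is_string T c)"
   "!!D. D \<in> discs T ==> even (card (strings T Int bd D))"
   "openin (top_of_set (regions T)) (shaded T)" "closedin (top_of_set (regions T)) (shaded T)"
   "strings T \<subseteq> closure (shaded T) Int closure (regions T - shaded T)"
   "marked T \<subseteq> \<Union> (bd ` discs T)"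
   "!!D. D \<in> discs T ==> marked T Int bd D \<in> components (bd D - strings T)"
  using T unfolding planar_tangle_def by blast+
 have 1: "\<forall>D\<in>discs ?T. D homeomorphic cball (0::complex) 1"
 proof
  fix D assume "D \<in> discs ?T"
  then obtain E where "E \<in> discs T" "D = h ` E" by (auto simp: discs_map_tangle)
  thus "D homeomorphic cball (0::complex) 1"
   using P(1)[of E] sub[of E] by (meson homeomorphic_def homeomorphic_sym homeomorphic_trans)
 qed
 have 2: "disjoint (inner_discs ?T)"
  using P(3) inj by (simp add: disjoint_image inj_on_subset)
 have 3: "\<forall>D\<in>inner_discs ?T. D \<subseteq> interior (outer_disc ?T)"
  using P(4) by (simp add: interior_homeo_image[OF h]) blast
 have 4: "\<exists>C. finite C & disjoint C & \<Union> C = strings ?T & (\<forall>c\<in>C. is_string ?T c)"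
 proof -
  obtain C where "finite C" "disjoint C" "\<Union> C = strings T" "\<forall>c\<in>C. is_string T c"
   using P(5) by blast
  thus ?thesis using inj is_string_map_tangle[OF h]
   by (intro exI[of _ "(`) h ` C"]) (simp add: disjoint_image inj_on_subset image_Union[symmetric])
 qed
 have 5: "\<forall>D\<in>discs ?T. even (card (strings ?T Int bd D))"
 proof
  fix D assume "D \<in> discs ?T"
  then obtain E where E: "E \<in> discs T" "D = h ` E" by (auto simp: discs_map_tangle)
  have "card (strings ?T Int bd D) = card (strings T Int bd E)"
   unfolding E map_tangle_sel frontier_homeo_image[OF h] image_Int[OF inj, symmetric]
   by (rule card_image[OF inj_on_subset[OF inj subset_UNIV]])
  thus "even (card (strings ?T Int bd D))" using P(6)[OF E(1)] by simp
 qed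
 have 6: "openin (top_of_set (regions ?T)) (shaded ?T)" "closedin (top_of_set (regions ?T)) (shaded ?T)"
  unfolding reg map_tangle_sel
  using homeomorphism_imp_open_map[OF sub P(7)] homeomorphism_imp_closed_map[OF sub P(8)] by auto
 have 7: "strings ?T \<subseteq> closure (shaded ?T) Int closure (regions ?T - shaded ?T)"
  unfolding reg map_tangle_sel image_set_diff[OF inj, symmetric] closure_homeo_image[OF h]
   image_Int[OF inj, symmetric] using P(9) by (rule image_mono)
 have 8: "marked ?T \<subseteq> \<Union> (bd ` discs ?T)"
 proof -
  have "\<Union> (bd ` discs ?T) = h ` \<Union> (bd ` discs T)"
   by (simp add: discs_map_tangle image_image frontier_homeo_image[OF h] image_Union)
  thus ?thesis using P(10) by (simp add: image_mono)
 qed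
 have 9: "\<forall>D\<in>discs ?T. marked ?T Int bd D \<in> components (bd D - strings ?T)"
 proof
  fix D assume "D \<in> discs ?T"
  then obtain E where E: "E \<in> discs T" "D = h ` E" by (auto simp: discs_map_tangle)
  from components_homeo_image[OF h P(11)[OF E(1)]]
  show "marked ?T Int bd D \<in> components (bd D - strings ?T)"
   by (simp add: E frontier_homeo_image[OF h] image_set_diff[OF inj] image_Int[OF inj])
 qed
 have 10: "finite (inner_discs ?T)" using P(2) by simp
 show ?thesis unfolding planar_tangle_def using 1 2 3 4 5 6 7 8 9 10 by blast
qed

section \<open>Gluing planar tangles\<close>

text \<open>Curves meeting at finitely many junction points \<open>P\<close>, two at each of them, can be joined to arcs
 with end points in \<open>F\<close> and to closed curves, all in the region \<open>U\<close>. The induction removes the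
 junctions one at a time; two arcs that meet at both ends form a closed curve.\<close>

definition is_curve :: "complex set => complex set => complex set => complex set => bool" where
 "is_curve F U P c <-> (\<exists>g. path_image g = c &
   (arc g & pathstart g \<in> F Un P & pathfinish g \<in> F Un P & c - {pathstart g, pathfinish g} \<subseteq> U - P
   | simple_path g & pathfinish g = pathstart g & c \<subseteq> U - P))"

lemma is_curve_arc_ending_at:
 assumes "is_curve F U P c" "p \<in> P" "p \<in> c"
 obtains g where "arc g" "path_image g = c" "pathstart g = p" "pathfinish g \<in> F Un P"
  "c - {p, pathfinish g} \<subseteq> U - P"
proof -
 obtain g where g: "path_image g = c" "arc g" "pathstart g \<in> F Un P" "pathfinish g \<in> F Un P"
   "c - {pathstart g, pathfinish g} \<subseteq> U - P"
  using assms unfolding is_curve_def by blast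
 hence "p = pathstart g | p = pathfinish g" using assms by blast
 thus thesis
 proof
  assume "p = pathstart g"
  thus thesis using that[of g] g by simp
 next
  assume "p = pathfinish g"
  thus thesis using that[of "reversepath g"] g by (simp add: arc_reversepath insert_commute)
 qed
qed

lemma join_curves:
 assumes "finite P" "finite C" "P \<subseteq> U" "!!c. c \<in> C ==> is_curve F U P c"
  and "!!c d. c \<in> C ==> d \<in> C ==> c ~= d ==> c Int d \<subseteq> P"
  and "!!p. p \<in> P ==> \<exists>c d. c ~= d & {c \<in> C. p \<in> c} = {c, d}"
 shows "\<exists>C'. finite C' & disjoint C' & \<Union> C' = \<Union> C & (\<forall>c\<in>C'. is_curve F U {} c)"
 using assms
proof (induction "card P" arbitrary: P C rule: less_induct)
 case less
 show ?case
 proof (cases "P = {}")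
  case True
  thus ?thesis using less.prems by (intro exI[of _ C]) (auto simp: disjoint_def)
 next
  case False
  then obtain p where p: "p \<in> P" by blast
  then obtain c1 c2 where c12: "c1 ~= c2" "{c \<in> C. p \<in> c} = {c1, c2}" using less.prems(6)[OF p] by metis
  hence C: "c1 \<in> C" "c2 \<in> C" "p \<in> c1" "p \<in> c2" and onlyp: "!!c. c \<in> C ==> p \<in> c ==> c = c1 | c = c2"
   by blast+
  obtain g1 where g1: "arc g1" "path_image g1 = c1" "pathstart g1 = p" "pathfinish g1 \<in> F Un P"
    "c1 - {p, pathfinish g1} \<subseteq> U - P"
   using is_curve_arc_ending_at[OF less.prems(4)[OF C(1)] p C(3)] by blast
  obtain g2 where g2: "arc g2" "path_image g2 = c2" "pathstart g2 = p" "pathfinish g2 \<in> F Un P"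
    "c2 - {p, pathfinish g2} \<subseteq> U - P"
   using is_curve_arc_ending_at[OF less.prems(4)[OF C(2)] p C(4)] by blast
  define a where "a = pathfinish g1"
  define b where "b = pathfinish g2"
  have ab: "a \<in> c1" "b \<in> c2" "a ~= p" "b ~= p"
   using g1 g2 arc_distinct_ends[of g1] arc_distinct_ends[of g2] by (auto simp: a_def b_def pathfinish_in_path_image)
  have sub: "c1 - {p, a} \<subseteq> U - P" "c2 - {p, b} \<subseteq> U - P" "a \<in> F Un P" "b \<in> F Un P"
   using g1 g2 by (auto simp: a_def b_def)
  have inter: "c1 Int c2 \<subseteq> P" using less.prems(5)[OF C(1,2) c12(1)] .
  hence inter': "c1 Int c2 \<subseteq> {p, a} Int {p, b}" using sub by blast
  let ?g = "reversepath g1 +++ g2"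
  have img: "path_image ?g = c1 Un c2" using g1 g2 by (simp add: path_image_join)
  have ends: "pathstart ?g = a" "pathfinish ?g = b" by (simp_all add: a_def b_def)
  let ?C = "insert (c1 Un c2) (C - {c1, c2})"
  have union: "\<Union> ?C = \<Union> C" using C by blast
  have fin: "finite ?C" using less.prems by simp
  have notin: "c1 Un c2 ~: C - {c1, c2}" using onlyp C by blast
  show ?thesis
  proof (cases "a = b")
   case True
   let ?P = "P - {p, a}"
   have aP: "a \<in> P" using ab inter True by blast
   have onlya: "c = c1 | c = c2" if "c \<in> C" "a \<in> c" for c
   proof -
    obtain d e where "{c \<in> C. a \<in> c} = {d, e}" using less.prems(6)[OF aP] by blast
    hence "c \<in> {d, e}" "c1 \<in> {d, e}" "c2 \<in> {d, e}" using that C ab True by blast+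
    thus ?thesis using c12(1) by blast
   qed
   have "simple_path ?g"
    using g1 g2 inter' True
    by (intro simple_path_join_loop) (auto simp: arc_reversepath a_def b_def)
   moreover have "c1 Un c2 \<subseteq> U - ?P"
   proof
    fix z assume z: "z \<in> c1 Un c2"
    show "z \<in> U - ?P"
    proof (cases "z = p | z = a")
     case True
     thus ?thesis using p aP less.prems(3) by blast
    next
     case False
     hence "z \<in> U - P" using z sub(1,2) True by blast
     thus ?thesis by blast
    qed
   qed
   ultimately have new: "is_curve F U ?P (c1 Un c2)"
    unfolding is_curve_def using img ends True by (intro exI[of _ ?g]) metis
   have old: "is_curve F U ?P c" if c: "c \<in> C - {c1, c2}" for c
   proof -
    have "p ~: c" "a ~: c" using c onlyp onlya by blast+
    moreover obtain g where g: "path_image g = c" "arc g & pathstart g \<in> F Un P & pathfinish g \<in> F Un P &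
      c - {pathstart g, pathfinish g} \<subseteq> U - P | simple_path g & pathfinish g = pathstart g & c \<subseteq> U - P"
     using less.prems(4) c unfolding is_curve_def by blast
    moreover have "pathstart g \<in> c" "pathfinish g \<in> c" using g(1) by auto
    ultimately show ?thesis unfolding is_curve_def by (intro exI[of _ g]) blast
   qed
   have "card ?P < card P" using p less.prems(1) by (intro psubset_card_mono) auto
   hence "\<exists>C'. finite C' & disjoint C' & \<Union> C' = \<Union> ?C & (\<forall>c\<in>C'. is_curve F U {} c)"
   proof (rule less.hyps)
    show "finite ?P" "finite ?C" "?P \<subseteq> U" using less.prems fin by auto
    show "is_curve F U ?P c" if "c \<in> ?C" for c using that old new by blast
    have mix: "c Int (c1 Un c2) \<subseteq> ?P" if c: "c \<in> C - {c1, c2}" for c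
    proof -
     have "c Int c1 \<subseteq> P" "c Int c2 \<subseteq> P" using c C less.prems(5) by auto
     moreover have "p ~: c" "a ~: c" using c onlyp onlya by blast+
     ultimately show ?thesis by blast
    qed
    show "c Int d \<subseteq> ?P" if cd: "c \<in> ?C" "d \<in> ?C" "c ~= d" for c d
    proof (cases "c = c1 Un c2 | d = c1 Un c2")
     case True
     thus ?thesis using cd mix by blast
    next
     case False
     hence c: "c \<in> C" "d \<in> C" "c ~= c1" "c ~= c2" using cd by blast+
     hence "c Int d \<subseteq> P" using cd(3) less.prems(5) by simp
     moreover have "p ~: c" "a ~: c" using c onlyp[of c] onlya[of c] by blast+
     ultimately show ?thesis by blast
    qed
    fix q assume q: "q \<in> ?P"
    hence "q ~: c1 Un c2" using sub True by blast
    hence "{c \<in> ?C. q \<in> c} = {c \<in> C. q \<in> c}" by blast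
    thus "\<exists>c d. c ~= d & {c \<in> ?C. q \<in> c} = {c, d}" using less.prems(6) q by simp
   qed
   thus ?thesis using union by simp
  next
   case False
   let ?P = "P - {p}"
   have "arc ?g"
    using g1 g2 inter' False
    by (intro arc_join) (auto simp: arc_reversepath a_def b_def)
   moreover have "c1 Un c2 - {a, b} \<subseteq> U - ?P"
   proof
    fix z assume z: "z \<in> c1 Un c2 - {a, b}"
    show "z \<in> U - ?P"
    proof (cases "z = p")
     case True
     thus ?thesis using p less.prems(3) by blast
    next
     case False
     hence "z \<in> U - P" using z sub(1,2) by blast
     thus ?thesis by blast
    qed
   qed
   moreover have "a \<in> F Un ?P" "b \<in> F Un ?P" using sub(3,4) ab by blast+
   ultimately have new: "is_curve F U ?P (c1 Un c2)"
    unfolding is_curve_def using img ends by (intro exI[of _ ?g]) metis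
   have old: "is_curve F U ?P c" if c: "c \<in> C - {c1, c2}" for c
   proof -
    have "p ~: c" using c onlyp by blast
    moreover obtain g where g: "path_image g = c" "arc g & pathstart g \<in> F Un P & pathfinish g \<in> F Un P &
      c - {pathstart g, pathfinish g} \<subseteq> U - P | simple_path g & pathfinish g = pathstart g & c \<subseteq> U - P"
     using less.prems(4) c unfolding is_curve_def by blast
    moreover have "pathstart g \<in> c" "pathfinish g \<in> c" using g(1) by auto
    ultimately show ?thesis unfolding is_curve_def by (intro exI[of _ g]) blast
   qed
   have "card ?P < card P" using p less.prems(1) by (intro psubset_card_mono) auto
   hence "\<exists>C'. finite C' & disjoint C' & \<Union> C' = \<Union> ?C & (\<forall>c\<in>C'. is_curve F U {} c)"
   proof (rule less.hyps)
    show "finite ?P" "finite ?C" "?P \<subseteq> U" using less.prems fin by auto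
    show "is_curve F U ?P c" if "c \<in> ?C" for c using that old new by blast
    have mix: "c Int (c1 Un c2) \<subseteq> ?P" if c: "c \<in> C - {c1, c2}" for c
    proof -
     have "c Int c1 \<subseteq> P" "c Int c2 \<subseteq> P" using c C less.prems(5) by auto
     moreover have "p ~: c" using c onlyp by blast
     ultimately show ?thesis by blast
    qed
    show "c Int d \<subseteq> ?P" if cd: "c \<in> ?C" "d \<in> ?C" "c ~= d" for c d
    proof (cases "c = c1 Un c2 | d = c1 Un c2")
     case True
     thus ?thesis using cd mix by blast
    next
     case False
     hence c: "c \<in> C" "d \<in> C" "c ~= c1" "c ~= c2" using cd by blast+
     hence "c Int d \<subseteq> P" using cd(3) less.prems(5) by simp
     moreover have "p ~: c" using c onlyp[of c] by blast
     ultimately show ?thesis by blast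
    qed
    fix q assume q: "q \<in> ?P"
    then obtain d e where de: "d ~= e" "{c \<in> C. q \<in> c} = {d, e}" using less.prems(6)[of q] by blast
    have notboth: "\<not> (q \<in> c1 & q \<in> c2)" using q inter' False by blast
    show "\<exists>c d. c ~= d & {c \<in> ?C. q \<in> c} = {c, d}"
    proof (cases "q \<in> c1 Un c2")
     case True
     then obtain ci where ci: "ci \<in> {c1, c2}" "q \<in> ci" by blast
     have cj: "x = ci" if "x \<in> {c1, c2}" "q \<in> x" for x using that notboth ci by blast
     have "ci \<in> {c \<in> C. q \<in> c}" using ci C by blast
     hence "ci = d | ci = e" unfolding de(2) by blast
     then obtain d' where d': "{d, e} = {ci, d'}" "d' ~= ci" using de(1) by blast
     have mem: "x \<in> C & q \<in> x <-> x = ci | x = d'" for x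
     proof -
      have "x \<in> {c \<in> C. q \<in> c} <-> x \<in> {ci, d'}" unfolding de(2) d'(1) ..
      thus ?thesis by simp
     qed
     have d'C: "d' \<in> C" "q \<in> d'" "d' ~: {c1, c2}" using mem[of d'] cj[of d'] d'(2) by blast+
     have "x \<in> {c \<in> ?C. q \<in> c} <-> x \<in> {c1 Un c2, d'}" for x
     proof (cases "x = c1 Un c2 | x \<in> {c1, c2}")
      case True
      thus ?thesis using `q \<in> c1 Un c2` notin d'C by auto
     next
      case False
      thus ?thesis using mem[of x] ci(1) by auto
     qed
     hence "{c \<in> ?C. q \<in> c} = {c1 Un c2, d'}" by (rule set_eqI)
     moreover have "c1 Un c2 ~= d'" using notin d'C by blast
     ultimately show ?thesis by metis
    next
     case False
     hence "x \<in> {c \<in> ?C. q \<in> c} <-> x \<in> {c \<in> C. q \<in> c}" for x by blast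
     hence "{c \<in> ?C. q \<in> c} = {d, e}" unfolding de(2)[symmetric] by (rule set_eqI)
     thus ?thesis using de(1) by metis
    qed
   qed
   thus ?thesis using union by simp
  qed
 qed
qed

lemma planar_tangleD:
 assumes "planar_tangle T"
 shows "!!D. D \<in> discs T ==> D homeomorphic cball (0::complex) 1"
  and "finite (inner_discs T)" and "disjoint (inner_discs T)"
  and "!!D. D \<in> inner_discs T ==> D \<subseteq> interior (outer_disc T)"
  and "\<exists>C. finite C & disjoint C & \<Union> C = strings T & (\<forall>c\<in>C. is_string T c)"
  and "!!D. D \<in> discs T ==> even (card (strings T Int bd D))"
  and "openin (top_of_set (regions T)) (shaded T)" and "closedin (top_of_set (regions T)) (shaded T)"
  and "strings T \<subseteq> closure (shaded T) Int closure (regions T - shaded T)"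
  and "marked T \<subseteq> \<Union> (bd ` discs T)"
  and "!!D. D \<in> discs T ==> marked T Int bd D \<in> components (bd D - strings T)"
 using assms unfolding planar_tangle_def by blast+

lemma planar_disc_closed: "planar_tangle T ==> D \<in> discs T ==> closed D"
 using planar_tangleD(1) homeomorphic_compactness[of D "cball (0::complex) 1"] compact_cball compact_imp_closed
 by blast

lemma planar_frontier_subset: "planar_tangle T ==> D \<in> discs T ==> bd D \<subseteq> D"
 by (simp add: planar_disc_closed frontier_subset_closed)

lemma is_string_point:
 assumes T: "planar_tangle T" and c: "is_string T c" and z: "z \<in> c"
 shows "z \<in> outer_disc T" and "!!D. D \<in> inner_discs T ==> z \<in> D ==> z \<in> bd D"
proof -
 have z': "z \<in> interior (outer_disc T) - \<Union> (inner_discs T) | z \<in> \<Union> (bd ` discs T)"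
  using c z unfolding is_string_def by blast
 have sub: "interior (outer_disc T) \<subseteq> outer_disc T" by (rule interior_subset)
 have fr: "bd E \<subseteq> outer_disc T" if "E \<in> discs T" for E
  using that planar_frontier_subset[OF T that] planar_tangleD(4)[OF T, of E] sub by (auto simp: discs_def)
 show "z \<in> outer_disc T" using z' sub fr by blast
 fix D assume D: "D \<in> inner_discs T" "z \<in> D"
 then obtain E where E: "E \<in> discs T" "z \<in> bd E" using z' by blast
 have "E ~= outer_disc T" using D E planar_tangleD(4)[OF T D(1)] by (auto simp: frontier_def)
 hence "E \<in> inner_discs T" using E by (auto simp: discs_def)
 moreover have "z \<in> E" using E planar_frontier_subset[OF T] by blast
 ultimately have "E = D" using D planar_tangleD(3)[OF T] by (auto simp: disjoint_def)
 thus "z \<in> bd D" using E by simp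
qed

lemma strings_subset_outer: "planar_tangle T ==> strings T \<subseteq> outer_disc T"
 using planar_tangleD(5)[of T] is_string_point(1)[of T] by blast

lemma strings_inter_inner: "planar_tangle T ==> D \<in> inner_discs T ==> strings T Int D \<subseteq> bd D"
 using planar_tangleD(5)[of T] is_string_point(2)[of T] by blast

lemma finite_boundary_points:
 assumes T: "planar_tangle T" and D: "D \<in> discs T"
 shows "finite (strings T Int bd D)"
proof -
 obtain C where C: "finite C" "\<Union> C = strings T" "!!c. c \<in> C ==> is_string T c"
  using planar_tangleD(5)[OF T] by blast
 have "finite (c Int bd D)" if c: "c \<in> C" for c
 proof -
  have avoid: "(interior (outer_disc T) - \<Union> (inner_discs T)) Int bd D = {}"
   using D planar_frontier_subset[OF T D] by (auto simp: discs_def frontier_def)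
  obtain g where "c - {pathstart g, pathfinish g} \<subseteq> interior (outer_disc T) - \<Union> (inner_discs T)
    | c \<subseteq> interior (outer_disc T) - \<Union> (inner_discs T)"
   using C(3)[OF c] unfolding is_string_def by blast
  hence "c Int bd D \<subseteq> {pathstart g, pathfinish g}" using avoid by blast
  thus ?thesis using finite_subset by blast
 qed
 hence "finite (\<Union>c\<in>C. c Int bd D)" using C(1) by blast
 moreover have "strings T Int bd D = (\<Union>c\<in>C. c Int bd D)" using C(2) by blast
 ultimately show ?thesis by simp
qed

lemma shaded_subset_regions: "planar_tangle T ==> shaded T \<subseteq> regions T"
 using planar_tangleD(7)[of T] openin_imp_subset by blast

text \<open>The union \<open>G\<close> of \<open>T\<close> outside \<open>D\<close> and \<open>S\<close> inside. Its regions are cut by the circle \<open>bd D\<close> into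
 those of \<open>T\<close> and of \<open>S\<close>; its strings are the curves of both, joined at the boundary points of \<open>D\<close>.\<close>

locale gluing =
 fixes T :: tangle and D :: "complex set" and S :: tangle
 assumes gluable: "gluable T D S"
begin

lemma planarT: "planar_tangle T" and planarS: "planar_tangle S" and D_inner: "D \<in> inner_discs T"
 and outerS: "outer_disc S = D" and strings_D: "strings T Int bd D = strings S Int bd D"
 and shaded_D: "shaded T Int bd D = shaded S Int bd D"
 and marked_D: "marked T Int bd D = marked S Int bd D"
 using gluable by (auto simp: gluable_def)

lemma D_discs: "D \<in> discs T" "D \<in> discs S"
 using D_inner outerS by (auto simp: discs_def)

lemma D_sub: "D \<subseteq> interior (outer_disc T)" and D_closed: "closed D" and frontier_D: "bd D \<subseteq> D"
 using planar_tangleD(4)[OF planarT D_inner] planar_disc_closed[OF planarT D_discs(1)]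
  planar_frontier_subset[OF planarT D_discs(1)] by auto

lemma inner_S_sub: "E \<in> inner_discs S ==> E \<subseteq> interior D"
 using planar_tangleD(4)[OF planarS] outerS by simp

lemma other_disjoint: "E \<in> inner_discs T ==> E ~= D ==> E Int D = {}"
 using planar_tangleD(3)[OF planarT] D_inner by (auto simp: disjoint_def)

lemma stringsS_sub: "strings S \<subseteq> D" and stringsT_D: "strings T Int D \<subseteq> bd D"
 using strings_subset_outer[OF planarS] strings_inter_inner[OF planarT D_inner] outerS by auto

lemma outer_far: "E \<in> discs T ==> E ~= D ==> bd E Int D = {}"
proof -
 assume E: "E \<in> discs T" "E ~= D"
 show "bd E Int D = {}"
 proof (cases "E = outer_disc T")
  case True
  thus ?thesis using D_sub by (auto simp: frontier_def)
 next
  case False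
  hence "E \<in> inner_discs T" using E by (auto simp: discs_def)
  thus ?thesis using other_disjoint[of E] E planar_frontier_subset[OF planarT E(1)] by blast
 qed
qed

lemma inner_S_frontier: "E \<in> inner_discs S ==> bd E \<subseteq> interior D"
 using planar_frontier_subset[OF planarS, of E] inner_S_sub[of E] by (auto simp: discs_def)

lemma outer_not_D: "outer_disc T ~= D"
proof
 assume "outer_disc T = D"
 hence "bd D = {}" using D_sub interior_subset[of D] D_closed
  by (metis closure_closed frontier_def interior_eq Diff_cancel subset_antisym)
 moreover have "marked T Int bd D ~= {}"
  using planar_tangleD(11)[OF planarT D_discs(1)] in_components_nonempty by blast
 ultimately show False by simp
qed

abbreviation "G == glue T D S"

lemma G_sel [simp]: "outer_disc G = outer_disc T" "inner_discs G = inner_discs T - {D} Un inner_discs S"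
 "strings G = strings T Un strings S" "shaded G = shaded T Un shaded S"
 "marked G = (marked T Un marked S) - bd D"
 by (simp_all add: glue_def)

lemma discs_G: "discs G = (discs T - {D}) Un inner_discs S"
 using outer_not_D by (auto simp: discs_def)

lemma regions_G: "regions G = regions T Un regions S"
proof (rule set_eqI)
 fix z
 have iS: "interiors (inner_discs S) \<subseteq> interior D"
  using inner_S_sub interior_subset by blast
 have iT: "interiors (inner_discs T - {D}) Int D = {}"
  using other_disjoint interior_subset by blast
 have "interior D \<subseteq> D" by (rule interior_subset)
 have eq: "regions G = outer_disc T - interiors (inner_discs T - {D}) - interiors (inner_discs S)
   - strings T - strings S"
  by (auto simp: regions_def)
 have rT: "regions T = outer_disc T - interiors (inner_discs T - {D}) - interior D - strings T"
  using D_inner by (auto simp: regions_def)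
 have rS: "regions S = D - interiors (inner_discs S) - strings S"
  using outerS by (auto simp: regions_def)
 have OD: "D \<subseteq> outer_disc T" using D_sub interior_subset by blast
 have fr: "bd D = D - interior D" using D_closed by (simp add: frontier_def)
 have z: "z \<in> interiors (inner_discs S) --> z \<in> interior D"
  "\<not> (z \<in> interiors (inner_discs T - {D}) & z \<in> D)" "z \<in> D --> z \<in> outer_disc T"
  "z \<in> strings S --> z \<in> D" "z \<in> strings T & z \<in> D --> z ~: interior D"
  "z \<in> interior D --> z \<in> D" "z \<in> D & z ~: interior D --> (z \<in> strings T <-> z \<in> strings S)"
  subgoal using iS by blast
  subgoal using iT by blast
  subgoal using OD by blast
  subgoal using stringsS_sub by blast
  subgoal using stringsT_D fr by blast
  subgoal using `interior D \<subseteq> D` by blast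
  subgoal using strings_D fr by blast
  done
 show "z \<in> regions G <-> z \<in> regions T Un regions S"
  unfolding eq rT rS Un_iff Diff_iff using z by argo
qed

lemma regions_closedin:
 "closedin (top_of_set (regions G)) (regions T)" "closedin (top_of_set (regions G)) (regions S)"
proof -
 have fr: "bd D = D - interior D" using D_closed by (simp add: frontier_def)
 have iS: "interiors (inner_discs S) \<subseteq> interior D"
  using inner_S_sub interior_subset by blast
 have iT: "interiors (inner_discs T - {D}) Int D = {}"
  using other_disjoint interior_subset by blast
 have OD: "D \<subseteq> outer_disc T" using D_sub interior_subset by blast
 have rT: "regions T = outer_disc T - interiors (inner_discs T - {D}) - interior D - strings T"
  using D_inner by (auto simp: regions_def)
 have rS: "regions S = D - interiors (inner_discs S) - strings S"
  using outerS by (auto simp: regions_def)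
 have st: "z \<in> D & z ~: interior D --> (z \<in> strings T <-> z \<in> strings S)" for z
  using strings_D unfolding fr by blast
 have "regions S \<subseteq> D" unfolding rS by blast
 moreover have "regions T Int interior D = {}" unfolding rT by blast
 moreover have "z \<in> regions T & z \<in> D --> z \<in> regions S" for z
  unfolding rT rS Diff_iff using iS st[of z] by blast
 moreover have "z \<in> regions S & z ~: interior D --> z \<in> regions T" for z
  unfolding rT rS Diff_iff using iT OD st[of z] by blast
 ultimately have eq: "regions T = regions G Int (- interior D)" "regions S = regions G Int D"
  unfolding regions_G using interior_subset[of D] by blast+
 thus "closedin (top_of_set (regions G)) (regions T)" "closedin (top_of_set (regions G)) (regions S)"
  using D_closed by (metis closed_Compl closedin_closed_Int open_interior, metis closedin_closed_Int)
qed

lemma unshaded_G: "regions G - shaded G = (regions T - shaded T) Un (regions S - shaded S)"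
proof -
 have "regions T Int D \<subseteq> bd D"
  using D_inner D_closed by (auto simp: regions_def frontier_def)
 moreover have "regions S \<subseteq> D" using outerS by (auto simp: regions_def)
 ultimately show ?thesis
  using shaded_D shaded_subset_regions[OF planarT] shaded_subset_regions[OF planarS]
  unfolding regions_G G_sel by blast
qed

lemma shaded_G_clopen:
 "openin (top_of_set (regions G)) (shaded G)" "closedin (top_of_set (regions G)) (shaded G)"
proof -
 show cl: "closedin (top_of_set (regions G)) (shaded G)"
  unfolding G_sel
  by (intro closedin_Un closedin_trans[OF planar_tangleD(8)[OF planarT] regions_closedin(1)]
    closedin_trans[OF planar_tangleD(8)[OF planarS] regions_closedin(2)])
 have "closedin (top_of_set (regions X)) (regions X - shaded X)" if "planar_tangle X" for X
  using planar_tangleD(7)[OF that] closedin_diff[OF closedin_subtopology_refl[THEN iffD2]]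
  by (metis closedin_def double_diff openin_imp_subset order_refl topspace_euclidean_subtopology Diff_subset)
 hence "closedin (top_of_set (regions G)) (regions G - shaded G)"
  unfolding unshaded_G
  by (intro closedin_Un closedin_trans[OF _ regions_closedin(1)]
    closedin_trans[OF _ regions_closedin(2)]) (auto simp: planarT planarS)
 moreover have "shaded G \<subseteq> regions G" using closedin_imp_subset[OF cl] .
 ultimately show "openin (top_of_set (regions G)) (shaded G)"
  by (simp add: openin_closedin_eq)
qed

lemma frontier_G:
 assumes "E \<in> discs T" "E ~= D"
 shows "strings G Int bd E = strings T Int bd E" "shaded G Int bd E = shaded T Int bd E"
  "marked G Int bd E = marked T Int bd E"
proof -
 have "bd E Int D = {}" using outer_far assms by blast
 moreover have "shaded S \<subseteq> D" using shaded_subset_regions[OF planarS] outerS by (auto simp: regions_def)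
 moreover have "marked S \<subseteq> D"
  using planar_tangleD(10)[OF planarS] planar_frontier_subset[OF planarS] inner_S_sub interior_subset[of D] outerS
  unfolding discs_def by blast
 ultimately show "strings G Int bd E = strings T Int bd E" "shaded G Int bd E = shaded T Int bd E"
  "marked G Int bd E = marked T Int bd E"
  using stringsS_sub frontier_D unfolding G_sel by blast+
qed

lemma frontier_G_inner:
 assumes "E \<in> inner_discs S"
 shows "strings G Int bd E = strings S Int bd E" "shaded G Int bd E = shaded S Int bd E"
  "marked G Int bd E = marked S Int bd E"
proof -
 have E: "bd E \<subseteq> interior D" "interior D \<subseteq> D" using inner_S_frontier[OF assms] interior_subset by auto
 have fr: "bd D Int interior D = {}" by (auto simp: frontier_def)
 have "shaded T Int interior D = {}"
  using shaded_subset_regions[OF planarT] D_inner by (auto simp: regions_def)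
 moreover have "marked T Int interior D \<subseteq> bd D"
  using planar_tangleD(10)[OF planarT] outer_far E(2) by blast
 ultimately show "strings G Int bd E = strings S Int bd E" "shaded G Int bd E = shaded S Int bd E"
  "marked G Int bd E = marked S Int bd E"
  using stringsT_D E fr unfolding G_sel by blast+
qed

text \<open>Every boundary point of \<open>D\<close> lies on one string from outside and on one from inside, so the
 points play the role of the junctions in \<open>join_curves\<close>.\<close>

lemma strings_G_decomposition:
 "\<exists>C. finite C & disjoint C & \<Union> C = strings G & (\<forall>c\<in>C. is_string G c)"
proof -
 obtain CT where CT: "finite CT" "disjoint CT" "\<Union> CT = strings T" "!!c. c \<in> CT ==> is_string T c"
  using planar_tangleD(5)[OF planarT] by blast
 obtain CS where CS: "finite CS" "disjoint CS" "\<Union> CS = strings S" "!!c. c \<in> CS ==> is_string S c"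
  using planar_tangleD(5)[OF planarS] by blast
 define P where "P = strings T Int bd D"
 define F where "F = \<Union> (bd ` discs G)"
 define U where "U = interior (outer_disc G) - \<Union> (inner_discs G)"
 have intD: "interior D \<subseteq> D" by (rule interior_subset)
 have fr: "bd D = D - interior D" using D_closed by (simp add: frontier_def)
 have UT: "interior (outer_disc T) - \<Union> (inner_discs T) \<subseteq> U - P"
  unfolding U_def P_def G_sel using inner_S_sub intD D_inner frontier_D by blast
 have US: "interior (outer_disc S) - \<Union> (inner_discs S) \<subseteq> U - P"
  unfolding U_def P_def G_sel outerS fr using intD D_sub other_disjoint by blast
 have PU: "P \<subseteq> U"
  unfolding U_def P_def G_sel fr using D_sub other_disjoint inner_S_sub by blast
 have curveT: "is_curve F U P c" if c: "c \<in> CT" for c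
 proof -
  have "c \<subseteq> strings T" using c CT by blast
  have FT: "\<Union> (bd ` discs T) Int c \<subseteq> F Un P"
   using `c \<subseteq> strings T` unfolding F_def P_def discs_G by blast
  obtain g where g: "path_image g = c" "arc g & pathstart g \<in> \<Union> (bd ` discs T) & pathfinish g \<in> \<Union> (bd ` discs T) &
    c - {pathstart g, pathfinish g} \<subseteq> interior (outer_disc T) - \<Union> (inner_discs T)
   | simple_path g & pathfinish g = pathstart g & c \<subseteq> interior (outer_disc T) - \<Union> (inner_discs T)"
   using CT(4)[OF c] unfolding is_string_def by blast
  moreover have "pathstart g \<in> c" "pathfinish g \<in> c" using g(1) by auto
  ultimately show ?thesis unfolding is_curve_def using UT FT by (intro exI[of _ g]) blast
 qed
 have curveS: "is_curve F U P c" if c: "c \<in> CS" for c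
 proof -
  have "c \<subseteq> strings S" using c CS by blast
  have "discs S = insert D (inner_discs S)" using outerS by (simp add: discs_def)
  hence FS: "\<Union> (bd ` discs S) Int c \<subseteq> F Un P"
  proof -
   have "bd D Int c \<subseteq> P" using `c \<subseteq> strings S` strings_D unfolding P_def by blast
   moreover have "\<Union> (bd ` inner_discs S) \<subseteq> F" unfolding F_def discs_G by blast
   ultimately show ?thesis unfolding `discs S = insert D (inner_discs S)` by blast
  qed
  obtain g where g: "path_image g = c" "arc g & pathstart g \<in> \<Union> (bd ` discs S) & pathfinish g \<in> \<Union> (bd ` discs S) &
    c - {pathstart g, pathfinish g} \<subseteq> interior (outer_disc S) - \<Union> (inner_discs S)
   | simple_path g & pathfinish g = pathstart g & c \<subseteq> interior (outer_disc S) - \<Union> (inner_discs S)"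
   using CS(4)[OF c] unfolding is_string_def by blast
  moreover have "pathstart g \<in> c" "pathfinish g \<in> c" using g(1) by auto
  ultimately show ?thesis unfolding is_curve_def using US FS by (intro exI[of _ g]) blast
 qed
 have TS: "c Int d \<subseteq> P" if "c \<in> CT" "d \<in> CS" for c d
  using that CT CS stringsS_sub stringsT_D unfolding P_def by blast
 have ne: "c ~= d" if cd: "c \<in> CT" "d \<in> CS" for c d
 proof
  assume "c = d"
  hence "c \<subseteq> P" using TS[OF cd] by blast
  moreover have "infinite c"
  proof -
   obtain g where g: "path_image g = c" "simple_path g"
    using CT(4)[OF cd(1)] arc_imp_simple_path unfolding is_string_def by blast
   have "connected c" using g connected_simple_path_image by blast
   moreover have "c - {pathstart g, pathfinish g} ~= {}" "pathstart g \<in> c"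
    using nonempty_simple_path_endless[OF g(2)] g(1) by auto
   ultimately show ?thesis using connected_finite_iff_sing[of c] by auto
  qed
  ultimately show False
   using finite_boundary_points[OF planarT D_discs(1)] finite_subset unfolding P_def by blast
 qed
 have "\<exists>C'. finite C' & disjoint C' & \<Union> C' = \<Union> (CT Un CS) & (\<forall>c\<in>C'. is_curve F U {} c)"
 proof (rule join_curves)
  show "finite P" unfolding P_def by (rule finite_boundary_points[OF planarT D_discs(1)])
  show "finite (CT Un CS)" using CT CS by blast
  show "P \<subseteq> U" by (rule PU)
  show "is_curve F U P c" if "c \<in> CT Un CS" for c using that curveT curveS by blast
  show "c Int d \<subseteq> P" if cd: "c \<in> CT Un CS" "d \<in> CT Un CS" "c ~= d" for c d
   using cd TS[of c d] TS[of d c] CT(2) CS(2) unfolding disjoint_def by blast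
  fix p assume p: "p \<in> P"
  obtain c where c: "c \<in> CT" "p \<in> c" using p CT(3) unfolding P_def by blast
  obtain d where d: "d \<in> CS" "p \<in> d" using p CS(3) strings_D unfolding P_def by blast
  have "{x \<in> CT Un CS. p \<in> x} = {c, d}"
   using c d CT(2) CS(2) unfolding disjoint_def by blast
  thus "\<exists>c d. c ~= d & {x \<in> CT Un CS. p \<in> x} = {c, d}" using ne[OF c(1) d(1)] by blast
 qed
 then obtain C where C: "finite C" "disjoint C" "\<Union> C = \<Union> (CT Un CS)" "!!c. c \<in> C ==> is_curve F U {} c" by blast
 have "is_string G c" if "c \<in> C" for c
  using C(4)[OF that] unfolding is_curve_def is_string_def F_def U_def by simp
 moreover have "\<Union> C = strings G" using C(3) CT(3) CS(3) by simp
 ultimately show ?thesis using C by blast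
qed

lemma planar_G: "planar_tangle G"
proof -
 have discsG: "E \<in> discs T & E ~= D | E \<in> inner_discs S" if "E \<in> discs G" for E
  using that discs_G by blast
 have 1: "\<forall>E\<in>discs G. E homeomorphic cball (0::complex) 1"
 proof
  fix E assume "E \<in> discs G"
  then consider "E \<in> discs T" | "E \<in> discs S" using discsG[of E] by (auto simp: discs_def)
  thus "E homeomorphic cball (0::complex) 1"
   using planar_tangleD(1)[OF planarT] planar_tangleD(1)[OF planarS] by metis
 qed
 have 2: "finite (inner_discs G)"
  using planar_tangleD(2)[OF planarT] planar_tangleD(2)[OF planarS] by simp
 have 3: "disjoint (inner_discs G)"
  unfolding disjoint_def
 proof (intro ballI impI)
  fix E E' assume E: "E \<in> inner_discs G" "E' \<in> inner_discs G" "E ~= E'"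
  have mix: "X Int Y = {}" if "X \<in> inner_discs T" "X ~= D" "Y \<in> inner_discs S" for X Y
   using other_disjoint[OF that(1,2)] inner_S_sub[OF that(3)] interior_subset[of D] by blast
  have "E \<in> inner_discs T & E ~= D | E \<in> inner_discs S" "E' \<in> inner_discs T & E' ~= D | E' \<in> inner_discs S"
   using E by auto
  thus "E Int E' = {}"
   using mix[of E E'] mix[of E' E] planar_tangleD(3)[OF planarT] planar_tangleD(3)[OF planarS] E(3)
   unfolding disjoint_def by (metis Int_commute)
 qed
 have 4: "\<forall>E\<in>inner_discs G. E \<subseteq> interior (outer_disc G)"
 proof
  fix E assume "E \<in> inner_discs G"
  then consider "E \<in> inner_discs T" | "E \<in> inner_discs S" by auto
  thus "E \<subseteq> interior (outer_disc G)"
  proof cases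
   case 2
   thus ?thesis using inner_S_sub interior_subset[of D] D_sub unfolding G_sel by blast
  qed (simp add: planar_tangleD(4)[OF planarT])
 qed
 have 6: "\<forall>E\<in>discs G. even (card (strings G Int bd E))"
 proof
  fix E assume "E \<in> discs G"
  then consider "E \<in> discs T" "E ~= D" | "E \<in> inner_discs S" using discsG by blast
  thus "even (card (strings G Int bd E))"
  proof cases
   case 1
   thus ?thesis using frontier_G(1) planar_tangleD(6)[OF planarT] by simp
  next
   case 2
   thus ?thesis using frontier_G_inner(1) planar_tangleD(6)[OF planarS] by (simp add: discs_def)
  qed
 qed
 have 9: "strings G \<subseteq> closure (shaded G) Int closure (regions G - shaded G)"
  unfolding unshaded_G closure_Un unfolding G_sel closure_Un
  using planar_tangleD(9)[OF planarT] planar_tangleD(9)[OF planarS] by blast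
 have 10: "marked G \<subseteq> \<Union> (bd ` discs G)"
  using planar_tangleD(10)[OF planarT] planar_tangleD(10)[OF planarS] outerS
  unfolding discs_G G_sel discs_def by blast
 have 11: "\<forall>E\<in>discs G. marked G Int bd E \<in> components (bd E - strings G)"
 proof
  fix E assume "E \<in> discs G"
  then consider "E \<in> discs T" "E ~= D" | "E \<in> inner_discs S" using discsG by blast
  thus "marked G Int bd E \<in> components (bd E - strings G)"
  proof cases
   case 1
   have "bd E - strings G = bd E - strings T" using frontier_G(1)[OF 1] by blast
   thus ?thesis using frontier_G(3)[OF 1] planar_tangleD(11)[OF planarT 1(1)] by simp
  next
   case 2
   have "bd E - strings G = bd E - strings S" using frontier_G_inner(1)[OF 2] by blast
   thus ?thesis using frontier_G_inner(3)[OF 2] planar_tangleD(11)[OF planarS] 2 by (simp add: discs_def)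
  qed
 qed
 show ?thesis
  unfolding planar_tangle_def using 1 2 3 4 strings_G_decomposition 6 shaded_G_clopen 9 10 11 by blast
qed

lemma disc_space_G: "E \<in> discs T ==> E ~= D ==> disc_size G E = disc_size T E & disc_sign G E = disc_sign T E"
proof -
 assume E: "E \<in> discs T" "E ~= D"
 have "marked G Int bd E \<subseteq> shaded G <-> marked T Int bd E \<subseteq> shaded T"
  using frontier_G(2,3)[OF E] by blast
 thus ?thesis using frontier_G(1)[OF E] by (simp only: disc_size_def disc_sign_def)
qed

lemma disc_space_G_inner: "E \<in> inner_discs S ==> disc_size G E = disc_size S E & disc_sign G E = disc_sign S E"
proof -
 assume E: "E \<in> inner_discs S"
 have "marked G Int bd E \<subseteq> shaded G <-> marked S Int bd E \<subseteq> shaded S"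
  using frontier_G_inner(2,3)[OF E] by blast
 thus ?thesis using frontier_G_inner(1)[OF E] by (simp only: disc_size_def disc_sign_def)
qed

end

section \<open>Tangles cut out of a pattern\<close>

text \<open>The tangle with the given discs whose strings and shading are those of a pattern in the plane,
 consisting of curves \<open>X\<close> and a coloured region \<open>Y\<close>, which is shaded if and only if \<open>b\<close> holds. The
 pattern continues across the inner discs, so that gluing amounts to comparing patterns.\<close>

definition pat :: "complex set => complex set set => complex set => complex set => bool => complex set => tangle" where
 "pat out I X Y b M = \<lparr>outer_disc = out, inner_discs = I, strings = X Int (out - interiors I),
   shaded = {z \<in> out - interiors I - X. z \<in> Y <-> b}, marked = M\<rparr>"

lemma pat_sel [simp]:
 "outer_disc (pat out I X Y b M) = out" "inner_discs (pat out I X Y b M) = I"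
 "strings (pat out I X Y b M) = X Int (out - interiors I)"
 "shaded (pat out I X Y b M) = {z \<in> out - interiors I - X. z \<in> Y <-> b}"
 "marked (pat out I X Y b M) = M"
 by (simp_all add: pat_def)

lemma regions_pat: "regions (pat out I X Y b M) = out - interiors I - X"
 by (auto simp: regions_def)

lemma pat_cong:
 assumes "!!z. z \<in> out ==> z ~: interiors I ==> z \<in> X <-> z \<in> X'"
  "!!z. z \<in> out ==> z ~: interiors I ==> z ~: X ==> (z \<in> Y <-> b) <-> (z \<in> Y' <-> b')"
 shows "pat out I X Y b M = pat out I X' Y' b' M"
 unfolding pat_def using assms by auto

lemma map_pat:
 assumes h: "plane_homeo h" and "h ` out = out'" "(`) h ` I = I'" "h ` M = M'"
  and X: "!!z. z \<in> out ==> z ~: interiors I ==> h z \<in> X' <-> z \<in> X"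
  and Y: "!!z. z \<in> out ==> z ~: interiors I ==> z ~: X ==> h z \<in> Y' <-> z \<in> Y"
 shows "map_tangle h (pat out I X Y b M) = pat out' I' X' Y' b M'"
proof -
 have inj: "inj h" using plane_homeo_bij[OF h] by (rule bij_is_inj)
 let ?R = "out - interiors I"
 have "interiors I' = h ` interiors I"
  using assms(3) by (auto simp: interior_homeo_image[OF h] image_UN image_image)
 hence R: "out' - interiors I' = h ` ?R"
  using assms(2) by (simp add: image_set_diff[OF inj])
 have "h ` (X Int ?R) = X' Int h ` ?R" using X by auto
 moreover have "h ` {z \<in> ?R - X. z \<in> Y <-> b} = {z \<in> h ` ?R - X'. z \<in> Y' <-> b}"
  using X Y by auto
 ultimately show ?thesis
  using assms(2-4) R by (simp add: map_tangle_def pat_def)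
qed

lemma glue_pat:
 assumes D: "D \<in> I" "D \<subseteq> out" and disj: "!!E. E \<in> I ==> E ~= D ==> E Int D = {}"
  and J: "!!E. E \<in> J ==> E \<subseteq> interior D" and cl: "closed D"
  and X1: "!!z. z \<in> out ==> z ~: interiors I ==> z \<in> X1 <-> z \<in> X"
  and X2: "!!z. z \<in> D ==> z ~: interiors J ==> z \<in> X2 <-> z \<in> X"
  and Y1: "!!z. z \<in> out ==> z ~: interiors I ==> z ~: X ==> (z \<in> Y1 <-> b1) <-> (z \<in> Y <-> b)"
  and Y2: "!!z. z \<in> D ==> z ~: interiors J ==> z ~: X ==> (z \<in> Y2 <-> b2) <-> (z \<in> Y <-> b)"
  and M: "M' = (M Un N) - bd D" and I': "I' = I - {D} Un J"
 shows "glue (pat out I X1 Y1 b1 M) D (pat D J X2 Y2 b2 N) = pat out I' X Y b M'"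
  and "M Int bd D = N Int bd D ==> planar_tangle (pat out I X1 Y1 b1 M) ==>
   planar_tangle (pat D J X2 Y2 b2 N) ==> gluable (pat out I X1 Y1 b1 M) D (pat D J X2 Y2 b2 N)"
proof -
 have intD: "interior D \<subseteq> D" by (rule interior_subset)
 let ?R1 = "out - interiors I" and ?R2 = "D - interiors J"
 have JD: "interiors J \<subseteq> interior D" using J interior_subset by blast
 have ID: "interiors (I - {D}) Int D = {}" using disj interior_subset by blast
 have I1: "interiors I = interiors (I - {D}) Un interior D" using D by blast
 have I2: "interiors (I - {D} Un J) = interiors (I - {D}) Un interiors J" by blast
 have R: "out - interiors (I - {D} Un J) = ?R1 Un ?R2"
 proof (rule set_eqI)
  fix z
  have "z \<in> D --> z \<in> out" "z \<in> interiors J --> z \<in> interior D" "z \<in> interior D --> z \<in> D"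
   "\<not> (z \<in> interiors (I - {D}) & z \<in> D)"
   using D(2) JD ID intD by blast+
  thus "z \<in> out - interiors (I - {D} Un J) <-> z \<in> ?R1 Un ?R2"
   unfolding I1 I2 Diff_iff Un_iff by argo
 qed
 have s: "X Int (?R1 Un ?R2) = X1 Int ?R1 Un X2 Int ?R2" using X1 X2 by blast
 have sh: "{z \<in> ?R1 Un ?R2 - X. z \<in> Y <-> b} = {z \<in> ?R1 - X1. z \<in> Y1 <-> b1} Un {z \<in> ?R2 - X2. z \<in> Y2 <-> b2}"
  using X1 X2 Y1 Y2 by auto
 show "glue (pat out I X1 Y1 b1 M) D (pat D J X2 Y2 b2 N) = pat out I' X Y b M'"
  unfolding I' M by (simp only: glue_def pat_def tangle.simps R s sh)
 assume mn: "M Int bd D = N Int bd D"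
  and pl: "planar_tangle (pat out I X1 Y1 b1 M)" "planar_tangle (pat D J X2 Y2 b2 N)"
 have fr: "bd D \<subseteq> ?R1" "bd D \<subseteq> ?R2"
  unfolding frontier_def closure_closed[OF cl] I1 using D(2) JD ID by blast+
 show "gluable (pat out I X1 Y1 b1 M) D (pat D J X2 Y2 b2 N)"
  unfolding gluable_def pat_sel
 proof (intro conjI pl D(1) mn refl)
  show "X1 Int ?R1 Int bd D = X2 Int ?R2 Int bd D"
  proof (rule set_eqI)
   fix z
   have "z \<in> bd D --> z \<in> ?R1 & z \<in> ?R2" using fr by blast
   thus "z \<in> X1 Int ?R1 Int bd D <-> z \<in> X2 Int ?R2 Int bd D"
    unfolding Int_iff using X1[of z] X2[of z] by blast
  qed
  show "{z \<in> ?R1 - X1. z \<in> Y1 <-> b1} Int bd D = {z \<in> ?R2 - X2. z \<in> Y2 <-> b2} Int bd D"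
  proof (rule set_eqI)
   fix z
   show "z \<in> {z \<in> ?R1 - X1. z \<in> Y1 <-> b1} Int bd D <-> z \<in> {z \<in> ?R2 - X2. z \<in> Y2 <-> b2} Int bd D"
   proof -
    have "z \<in> bd D --> z \<in> ?R1 & z \<in> ?R2" using fr by blast
    thus ?thesis using X1[of z] X2[of z] Y1[of z] Y2[of z] by blast
   qed
  qed
 qed
qed

section \<open>Rectangles\<close>

lemma rect_cbox: "rect a b c d = cbox (Complex a c) (Complex b d)"
 by (auto simp: rect_def in_cbox_complex_iff)

lemma in_rect: "z \<in> rect a b c d <-> a <= Re z & Re z <= b & c <= Im z & Im z <= d"
 by (simp add: rect_def)

lemma interior_rect: "interior (rect a b c d) = {z. a < Re z & Re z < b & c < Im z & Im z < d}"
 unfolding rect_cbox interior_cbox by (auto simp: in_box_complex_iff)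

lemma in_int_rect: "z \<in> interior (rect a b c d) <-> a < Re z & Re z < b & c < Im z & Im z < d"
 by (simp add: interior_rect)

lemma closed_rect: "closed (rect a b c d)"
 unfolding rect_cbox by (rule closed_cbox)

lemma in_bd_rect: "z \<in> bd (rect a b c d) <->
  z \<in> rect a b c d & \<not> (a < Re z & Re z < b & c < Im z & Im z < d)"
 by (simp add: frontier_def closure_closed[OF closed_rect] in_int_rect)

lemmas rect_simps = in_rect in_bd_rect in_int_rect

lemma rect_homeomorphic_cball:
 assumes "a < b" "c < d"
 shows "rect a b c d homeomorphic cball (0::complex) 1"
proof (rule homeomorphic_convex_compact_cball)
 show "convex (rect a b c d)" "compact (rect a b c d)" unfolding rect_cbox by auto
 have "Complex ((a + b) / 2) ((c + d) / 2) \<in> interior (rect a b c d)"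
  using assms by (simp add: in_int_rect)
 thus "interior (rect a b c d) ~= {}" by blast
qed simp

lemma connected_frontier_rect:
 assumes "a < b" "c < d"
 shows "connected (bd (rect a b c d))"
proof -
 have "Complex ((a + b) / 2) ((c + d) / 2) \<in> interior (rect a b c d)"
  using assms by (simp add: in_int_rect)
 hence ne: "interior (rect a b c d) ~= {}" by blast
 have "rel_frontier (rect a b c d) = bd (rect a b c d)"
  using ne by (rule rel_frontier_nonempty_interior)
 moreover have "connected (rel_frontier (rect a b c d))"
 proof (rule connected_sphere_gen)
  show "convex (rect a b c d)" "bounded (rect a b c d)" unfolding rect_cbox by auto
  show "aff_dim (rect a b c d) ~= 1" using ne by (simp add: aff_dim_nonempty_interior)
 qed
 ultimately show ?thesis by simp
qed

lemma prod_map_rect: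
 assumes f: "incr_homeo f" and g: "incr_homeo g"
 shows "prod_map f g ` rect a b c d = rect (f a) (f b) (g c) (g d)"
proof (rule set_eqI)
 fix w
 obtain x y where xy: "Re w = f x" "Im w = g y"
  using f g unfolding incr_homeo_def by (meson surjD)
 hence w: "w = prod_map f g (Complex x y)" by (simp add: complex_eq_iff)
 have inj: "inj (prod_map f g)"
  using plane_homeo_bij[OF isotopic_homeo[OF isotopic_prod_map[OF f g]]] bij_is_inj by blast
 have "w \<in> prod_map f g ` rect a b c d <-> Complex x y \<in> rect a b c d"
  unfolding w by (rule inj_image_mem_iff[OF inj])
 thus "w \<in> prod_map f g ` rect a b c d <-> w \<in> rect (f a) (f b) (g c) (g d)"
  by (simp add: in_rect xy incr_homeo_compare[OF f] incr_homeo_compare[OF g])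
qed

section \<open>Planarity of basic tangles\<close>

lemma component_if_clopen:
 assumes "connected C" "C ~= {}" "C \<subseteq> S" "openin (top_of_set S) C" "closedin (top_of_set S) C"
 shows "C \<in> components S"
 unfolding in_components_maximal
proof (intro conjI allI impI assms(1-3))
 fix D assume D: "D ~= {} & C \<subseteq> D & D \<subseteq> S & connected D"
 obtain U K where UK: "open U" "C = S Int U" "closed K" "C = S Int K"
  using assms(4,5) unfolding openin_open closedin_closed by blast
 have "D Int C = D Int U" "D Int C = D Int K" using D UK(2,4) by blast+
 hence "openin (top_of_set D) (D Int C)" "closedin (top_of_set D) (D Int C)"
  using UK(1,3) by (metis openin_open_Int, metis closedin_closed_Int)
 hence "D Int C = {} | D Int C = D" using D connected_clopen[of D] by blast
 thus "D = C" using D assms(2) by blast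
qed

lemma component_if_separated:
 assumes "connected C" "C ~= {}" "C = S Int U" "open U" "C = S Int K" "closed K"
 shows "C \<in> components S"
proof (rule component_if_clopen)
 show "openin (top_of_set S) C" using assms(3,4) by (auto simp: openin_open)
 show "closedin (top_of_set S) C" using assms(5,6) by (auto simp: closedin_closed)
qed (use assms in auto)

text \<open>The two conditions on the colour \<open>Y\<close> say that it is locally constant off the curves and changes
 across each of them; this is all that a shading requires.\<close>

lemma planar_patI:
 fixes out I X Y b M
 defines "R == out - interiors I"
 assumes discs: "!!D. D \<in> insert out I ==> D homeomorphic cball (0::complex) 1"
  and I: "finite I" "disjoint I" "!!D. D \<in> I ==> D \<subseteq> interior out"
  and C: "finite C" "disjoint C" "\<Union> C = X Int R" "!!c. c \<in> C ==> is_string (pat out I X Y b M) c"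
  and even: "!!D. D \<in> insert out I ==> even (card (X Int R Int bd D))"
  and loc: "!!z. z \<in> R - X ==> \<forall>\<^sub>F w in nhds z. w \<in> R - X --> (w \<in> Y <-> z \<in> Y)"
  and both: "!!z. z \<in> X Int R ==> z \<in> closure ((R - X) Int Y) & z \<in> closure ((R - X) - Y)"
  and M: "M \<subseteq> \<Union> (bd ` insert out I)"
  and comp: "!!D. D \<in> insert out I ==> M Int bd D \<in> components (bd D - X Int R)"
 shows "planar_tangle (pat out I X Y b M)"
proof -
 let ?T = "pat out I X Y b M"
 have R: "regions ?T = R - X" by (simp add: regions_pat R_def)
 have op: "openin (top_of_set (R - X)) {z \<in> R - X. z \<in> Y <-> c}" for c
  unfolding openin_open
 proof (intro exI conjI)
  let ?U = "interior {w. w \<in> R - X --> (w \<in> Y <-> c)}"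
  show "open ?U" by simp
  show "{z \<in> R - X. z \<in> Y <-> c} = (R - X) Int ?U"
  proof (intro equalityI subsetI)
   fix z assume z: "z \<in> {z \<in> R - X. z \<in> Y <-> c}"
   then obtain V where "open V" "z \<in> V" "!!w. w \<in> V ==> w \<in> R - X --> (w \<in> Y <-> z \<in> Y)"
    using loc[of z] unfolding eventually_nhds by blast
   hence "z \<in> ?U" using z by (intro interiorI[of V]) auto
   thus "z \<in> (R - X) Int ?U" using z by blast
  next
   fix z assume "z \<in> (R - X) Int ?U"
   thus "z \<in> {z \<in> R - X. z \<in> Y <-> c}" using interior_subset by blast
  qed
 qed
 have compl: "R - X - {z \<in> R - X. z \<in> Y <-> b} = {z \<in> R - X. z \<in> Y <-> \<not> b}" by blast
 have sh: "shaded ?T = {z \<in> R - X. z \<in> Y <-> b}" by (simp add: R_def)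
 have st: "strings ?T = X Int R" by (simp add: R_def)
 have ds: "discs ?T = insert out I" by (simp add: discs_def)
 have cl: "closedin (top_of_set (R - X)) {z \<in> R - X. z \<in> Y <-> b}"
  using op[of "\<not> b"] compl unfolding closedin_def by auto
 have dif: "(R - X) Int Y = {z \<in> R - X. z \<in> Y}" "(R - X) - Y = {z \<in> R - X. z ~: Y}" by blast+
 have both': "X Int R \<subseteq> closure {z \<in> R - X. z \<in> Y <-> b} Int closure {z \<in> R - X. z \<in> Y <-> \<not> b}"
  using both unfolding dif by (cases b) auto
 have "\<forall>D\<in>discs ?T. D homeomorphic cball (0::complex) 1" using discs ds by blast
 moreover have "\<forall>D\<in>inner_discs ?T. D \<subseteq> interior (outer_disc ?T)" using I by simp
 moreover have "\<exists>C. finite C & disjoint C & \<Union> C = strings ?T & (\<forall>c\<in>C. is_string ?T c)"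
  unfolding st using C by blast
 moreover have "\<forall>D\<in>discs ?T. even (card (strings ?T Int bd D))" unfolding ds st using even by blast
 moreover have "openin (top_of_set (regions ?T)) (shaded ?T)" unfolding R sh by (rule op)
 moreover have "closedin (top_of_set (regions ?T)) (shaded ?T)" unfolding R sh by (rule cl)
 moreover have "strings ?T \<subseteq> closure (shaded ?T) Int closure (regions ?T - shaded ?T)"
  unfolding R sh st compl by (rule both')
 moreover have "marked ?T \<subseteq> \<Union> (bd ` discs ?T)" unfolding ds using M by simp
 moreover have "\<forall>D\<in>discs ?T. marked ?T Int bd D \<in> components (bd D - strings ?T)"
  unfolding ds st using comp by simp
 ultimately show ?thesis unfolding planar_tangle_def using I(1,2) by simp
qed

lemma planar_change_marked:
 assumes T: "planar_tangle T" and M: "M \<subseteq> \<Union> (bd ` discs T)"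
  "!!D. D \<in> discs T ==> M Int bd D \<in> components (bd D - strings T)"
 shows "planar_tangle (T\<lparr>marked := M\<rparr>)"
proof -
 have "discs (T\<lparr>marked := M\<rparr>) = discs T" "regions (T\<lparr>marked := M\<rparr>) = regions T"
  "is_string (T\<lparr>marked := M\<rparr>) c = is_string T c" for c
  by (simp_all add: discs_def regions_def is_string_def)
 thus ?thesis using T M unfolding planar_tangle_def by simp
qed

text \<open>The common skeleton of the tangles of multiplication, unit and partial traces: \<open>n\<close> vertical
 lines with \<open>k\<close> boxes on them and, if \<open>r\<close> holds and \<open>k = 1\<close>, a rectangular closed curve whose left
 side passes through the right part of the box. The colour of a point is the parity of the number of
 lines to its left, changed inside the closed curve.\<close>

definition base_out :: "nat => nat => bool => complex set" where
 "base_out n k r = rect (1/8) (real n + 7/8 + (if r then 2 else 0)) 0 (2 * real k + 1)"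

definition base_box :: "nat => bool => nat => complex set" where
 "base_box n r i = rect (1/4) (real n + 3/4 + (if r then 1 else 0)) (2 * real i + 1) (2 * real i + 2)"

definition base_ring :: "nat => complex set" where
 "base_ring n = rect (real n + 1) (real n + 2) (1/4) (11/4)"

definition base_curves :: "nat => bool => complex set" where
 "base_curves n r = {z. \<exists>j\<in>{1..n}. Re z = real j} Un (if r then bd (base_ring n) else {})"

definition lines_left :: "nat => complex => nat" where
 "lines_left n z = card {j \<in> {1..n}. real j <= Re z}"

definition base_colour :: "nat => bool => complex set" where
 "base_colour n r = {z. odd (lines_left n z + (if r & z \<in> base_ring n then 1 else 0))}"

definition base_marks :: "nat => nat => bool => complex set" where
 "base_marks n k r = {z \<in> bd (base_out n k r). n = 0 | Re z < 1} Un
   {z \<in> \<Union> (bd ` base_box n r ` {..<k}). Re z < 1}"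

definition base_tangle :: "nat => nat => bool => bool => tangle" where
 "base_tangle n k r b = pat (base_out n k r) (base_box n r ` {..<k}) (base_curves n r) (base_colour n r) b
   (base_marks n k r)"

lemma lines_left_less_1: "Re z < 1 ==> lines_left n z = 0"
proof -
 assume "Re z < 1"
 hence "{j \<in> {1..n}. real j <= Re z} = {}" by auto
 thus ?thesis unfolding lines_left_def by (simp only: card.empty)
qed

lemma lines_left_eq: "real m <= Re z ==> Re z < real m + 1 ==> m <= n ==> lines_left n z = m"
proof -
 assume "real m <= Re z" "Re z < real m + 1" "m <= n"
 hence "{j \<in> {1..n}. real j <= Re z} = {1..m}" by auto
 thus ?thesis by (simp only: lines_left_def) simp
qed

lemma lines_left_max: "real n <= Re z ==> lines_left n z = n"
proof -
 assume "real n <= Re z"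
 hence "{j \<in> {1..n}. real j <= Re z} = {1..n}" by auto
 thus ?thesis by (simp only: lines_left_def) simp
qed

lemma notin_open_boxes:
 assumes "0 <= y" "y <= 2 * real k + 1" "!!i. i < k ==> \<not> (2 * real i + 1 < y & y < 2 * real i + 2)"
 obtains i where "i <= k" "2 * real i <= y" "y <= 2 * real i + 1"
proof -
 define i where "i = nat \<lfloor>y / 2\<rfloor>"
 have i: "2 * real i <= y" "y < 2 * real i + 2"
  using assms(1) by (auto simp: i_def; linarith)+
 hence "i <= k" using assms(2) by linarith
 moreover have "y <= 2 * real i + 1"
  using assms(2) assms(3)[of i] i `i <= k` by (cases "i = k") auto
 ultimately show thesis using that i by blast
qed

lemma between_boxes:
 assumes "2 * real i < y" "y < 2 * real i + 1"
 shows "\<not> (2 * real j + 1 <= y & y <= 2 * real j + 2)"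
proof
 assume "2 * real j + 1 <= y & y <= 2 * real j + 2"
 hence "2 * real j + 1 < 2 * real i + 1" "2 * real i < 2 * real j + 2" using assms by linarith+
 hence "j < i" "i < j + 1" by linarith+
 thus False by simp
qed

lemma base_box_subset: "i < k ==> base_box n r i \<subseteq> interior (base_out n k r)"
 unfolding base_box_def base_out_def by (auto simp: in_rect in_int_rect)

lemma base_box_disjoint: "i ~= j ==> base_box n r i Int base_box n r j = {}"
proof -
 have "base_box n r i Int base_box n r j = {}" if "i < j" for i j
 proof -
  have "real i + 1 <= real j" using that by linarith
  thus ?thesis unfolding base_box_def by (auto simp: in_rect)
 qed
 thus "i ~= j ==> ?thesis" by (metis Int_commute linorder_neqE_nat)
qed

lemma base_box_frontier_sub: "bd (base_box n r i) \<subseteq> base_box n r i"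
 unfolding base_box_def by (rule frontier_subset_closed[OF closed_rect])

lemma vertical_segment: "x = Re a ==> Re b = Re a ==> Im a <= Im b ==>
  closed_segment a b = {z. Re z = x & Im a <= Im z & Im z <= Im b}"
 by (auto simp: closed_segment_same_Re closed_segment_eq_real_ivl)

lemma horizontal_segment: "y = Im a ==> Im b = Im a ==> Re a <= Re b ==>
  closed_segment a b = {z. Im z = y & Re a <= Re z & Re z <= Re b}"
 by (auto simp: closed_segment_same_Im closed_segment_eq_real_ivl)

lemma open_side_connected:
 assumes "a < e" "e < b" "c < d"
 shows "connected {z \<in> bd (rect a b c d). Re z < e}"
proof -
 let ?A = "{z. Im z = c & a <= Re z & Re z < e}" and ?B = "{z. Re z = a & c <= Im z & Im z <= d}"
  and ?C = "{z. Im z = d & a <= Re z & Re z < e}"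
 have conv: "convex ?A" "convex ?B" "convex ?C"
 proof -
  have A: "?A = {z. Im z \<ge> c} Int {z. Im z <= c} Int {z. Re z \<ge> a} Int {z. Re z < e}"
   and B: "?B = {z. Re z \<ge> a} Int {z. Re z <= a} Int {z. Im z \<ge> c} Int {z. Im z <= d}"
   and C: "?C = {z. Im z \<ge> d} Int {z. Im z <= d} Int {z. Re z \<ge> a} Int {z. Re z < e}" by auto
  show "convex ?A" "convex ?B" "convex ?C" unfolding A B C
   by (intro convex_Int convex_halfspace_Re_ge convex_halfspace_Re_le convex_halfspace_Re_lt convex_halfspace_Im_ge
     convex_halfspace_Im_le)+
 qed
 have "Complex a c \<in> ?A Int ?B" "Complex a d \<in> (?A Un ?B) Int ?C" using assms by auto
 hence ne: "?A Int ?B ~= {}" "(?A Un ?B) Int ?C ~= {}" by blast+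
 have "connected (?A Un ?B)" using conv ne(1) by (intro connected_Un convex_connected)
 hence "connected (?A Un ?B Un ?C)" using connected_Un[OF `connected (?A Un ?B)` convex_connected[OF conv(3)] ne(2)] by simp
 moreover have "{z \<in> bd (rect a b c d). Re z < e} = ?A Un ?B Un ?C"
  using assms by (auto simp: in_bd_rect in_rect)
 ultimately show ?thesis by simp
qed

lemma left_mark_component:
 assumes "a < 1" "1 < b" "c < d" "Complex 1 c \<in> S" "Complex 1 d \<in> S"
  and "!!z. z \<in> S ==> z \<in> bd (rect a b c d) ==> 1 <= Re z"
 shows "{z \<in> bd (rect a b c d). Re z < 1} \<in> components (bd (rect a b c d) - S)"
proof (rule component_if_separated)
 let ?F = "bd (rect a b c d)"
 show "connected {z \<in> ?F. Re z < 1}" using assms by (intro open_side_connected) auto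
 have "Complex a c \<in> {z \<in> ?F. Re z < 1}" using assms by (simp add: in_bd_rect in_rect)
 thus "{z \<in> ?F. Re z < 1} ~= {}" by blast
 show "{z \<in> ?F. Re z < 1} = (?F - S) Int {z. Re z < 1}" using assms(6) by force
 show "{z \<in> ?F. Re z < 1} = (?F - S) Int {z. Re z <= 1}"
 proof -
  have "z \<in> S" if "z \<in> ?F" "Re z = 1" for z
  proof -
   have "Im z = c | Im z = d" using that assms by (auto simp: in_bd_rect in_rect)
   hence "z = Complex 1 c | z = Complex 1 d" using that by (auto simp: complex_eq_iff)
   thus ?thesis using assms by blast
  qed
  thus ?thesis using assms(6) by force
 qed
 show "open {z. Re z < 1}" by (rule open_halfspace_Re_lt)
 show "closed {z. Re z <= 1}" by (rule closed_halfspace_Re_le)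
qed

lemma card_boundary_points: "card ((%(j, y). Complex (real j) y) ` ({1..m} \<times> {y0, y1})) = m * card {y0, y1}"
 by (subst card_image) (auto simp: inj_on_def card_cartesian_product)

definition ring_path :: "real => real => real => real => real => real => real => complex" where
 "ring_path p q c d b1 b2 = linepath (Complex p b2) (Complex p d) +++ linepath (Complex p d) (Complex q d) +++
   linepath (Complex q d) (Complex q c) +++ linepath (Complex q c) (Complex p c) +++
   linepath (Complex p c) (Complex p b1)"

lemma ring_path:
 assumes "p < q" "c < b1" "b1 < b2" "b2 < d"
 shows "arc (ring_path p q c d b1 b2)" "pathstart (ring_path p q c d b1 b2) = Complex p b2"
  "pathfinish (ring_path p q c d b1 b2) = Complex p b1"
  "path_image (ring_path p q c d b1 b2) = bd (rect p q c d) - {z. Re z = p & b1 < Im z & Im z < b2}"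
proof -
 have seg: "closed_segment (Complex p b2) (Complex p d) = {z. Re z = p & b2 <= Im z & Im z <= d}"
  "closed_segment (Complex p d) (Complex q d) = {z. Im z = d & p <= Re z & Re z <= q}"
  "closed_segment (Complex q d) (Complex q c) = {z. Re z = q & c <= Im z & Im z <= d}"
  "closed_segment (Complex q c) (Complex p c) = {z. Im z = c & p <= Re z & Re z <= q}"
  "closed_segment (Complex p c) (Complex p b1) = {z. Re z = p & c <= Im z & Im z <= b1}"
 proof -
  show "closed_segment (Complex p b2) (Complex p d) = {z. Re z = p & b2 <= Im z & Im z <= d}"
   using assms by (subst vertical_segment[of p]) auto
  show "closed_segment (Complex p d) (Complex q d) = {z. Im z = d & p <= Re z & Re z <= q}"
   using assms by (subst horizontal_segment[of d]) auto
  show "closed_segment (Complex q d) (Complex q c) = {z. Re z = q & c <= Im z & Im z <= d}"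
   using assms by (subst closed_segment_commute, subst vertical_segment[of q]) auto
  show "closed_segment (Complex q c) (Complex p c) = {z. Im z = c & p <= Re z & Re z <= q}"
   using assms by (subst closed_segment_commute, subst horizontal_segment[of c]) auto
  show "closed_segment (Complex p c) (Complex p b1) = {z. Re z = p & c <= Im z & Im z <= b1}"
   using assms by (subst vertical_segment[of p]) auto
 qed
 let ?l1 = "linepath (Complex p b2) (Complex p d)" and ?l2 = "linepath (Complex p d) (Complex q d)"
  and ?l3 = "linepath (Complex q d) (Complex q c)" and ?l4 = "linepath (Complex q c) (Complex p c)"
  and ?l5 = "linepath (Complex p c) (Complex p b1)"
 have 4: "arc (?l4 +++ ?l5)"
 proof (rule arc_join)
  show "path_image ?l4 Int path_image ?l5 \<subseteq> {pathstart ?l5}" using assms by (auto simp: seg complex_eq_iff)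
 qed (use assms in auto)
 have p4: "path_image (?l4 +++ ?l5) = {z. Im z = c & p <= Re z & Re z <= q} Un {z. Re z = p & c <= Im z & Im z <= b1}"
  by (simp add: path_image_join seg)
 have 3: "arc (?l3 +++ ?l4 +++ ?l5)"
 proof (rule arc_join[OF _ 4])
  show "path_image ?l3 Int path_image (?l4 +++ ?l5) \<subseteq> {pathstart (?l4 +++ ?l5)}"
   unfolding p4 using assms by (auto simp: seg complex_eq_iff)
 qed (use assms in auto)
 have p3: "path_image (?l3 +++ ?l4 +++ ?l5) = {z. Re z = q & c <= Im z & Im z <= d} Un
   ({z. Im z = c & p <= Re z & Re z <= q} Un {z. Re z = p & c <= Im z & Im z <= b1})"
  by (simp add: path_image_join seg)
 have 2: "arc (?l2 +++ ?l3 +++ ?l4 +++ ?l5)"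
 proof (rule arc_join[OF _ 3])
  show "path_image ?l2 Int path_image (?l3 +++ ?l4 +++ ?l5) \<subseteq> {pathstart (?l3 +++ ?l4 +++ ?l5)}"
   unfolding p3 using assms by (auto simp: seg complex_eq_iff)
 qed (use assms in auto)
 have p2: "path_image (?l2 +++ ?l3 +++ ?l4 +++ ?l5) = {z. Im z = d & p <= Re z & Re z <= q} Un ({z. Re z = q & c <= Im z & Im z <= d} Un
   ({z. Im z = c & p <= Re z & Re z <= q} Un {z. Re z = p & c <= Im z & Im z <= b1}))"
  by (simp add: path_image_join seg)
 show "arc (ring_path p q c d b1 b2)"
  unfolding ring_path_def
 proof (rule arc_join[OF _ 2])
  show "path_image ?l1 Int path_image (?l2 +++ ?l3 +++ ?l4 +++ ?l5) \<subseteq> {pathstart (?l2 +++ ?l3 +++ ?l4 +++ ?l5)}"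
   unfolding p2 using assms by (auto simp: seg complex_eq_iff)
 qed (use assms in auto)
 show "pathstart (ring_path p q c d b1 b2) = Complex p b2" "pathfinish (ring_path p q c d b1 b2) = Complex p b1"
  by (simp_all add: ring_path_def)
 have "path_image (ring_path p q c d b1 b2) = {z. Re z = p & b2 <= Im z & Im z <= d} Un ({z. Im z = d & p <= Re z & Re z <= q} Un ({z. Re z = q & c <= Im z & Im z <= d} Un
   ({z. Im z = c & p <= Re z & Re z <= q} Un {z. Re z = p & c <= Im z & Im z <= b1})))"
  unfolding ring_path_def by (simp add: path_image_join seg)
 also have "... = bd (rect p q c d) - {z. Re z = p & b1 < Im z & Im z < b2}" (is "?l = ?r")
 proof (intro equalityI subsetI)
  fix z assume "z \<in> ?l"
  thus "z \<in> ?r" using assms by (elim UnE) (simp_all add: in_bd_rect in_rect)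
 next
  fix z assume "z \<in> ?r"
  hence z: "z \<in> rect p q c d" "\<not> (Re z = p & b1 < Im z & Im z < b2)"
   and "Re z = p | Re z = q | Im z = c | Im z = d" by (auto simp: in_bd_rect in_rect)
  from this(3) show "z \<in> ?l" using z by (elim disjE) (auto simp: in_rect not_less)
 qed
 finally show "path_image (ring_path p q c d b1 b2) = bd (rect p q c d) - {z. Re z = p & b1 < Im z & Im z < b2}" .
qed

lemma in_closureI:
 fixes z v :: complex
 assumes "!!t. 0 < t ==> t < 1/8 ==> z + of_real t * v \<in> S" "norm v <= 2"
 shows "z \<in> closure S"
 unfolding closure_approachable
proof (intro allI impI)
 fix e :: real assume e: "0 < e"
 define t where "t = min (1/16) (e / 4)"
 have t: "0 < t" "t < 1/8" "t <= e / 4" using e by (auto simp: t_def)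
 have "norm (of_real t * v) <= t * 2" using t assms(2) by (simp add: norm_mult)
 hence "dist (z + of_real t * v) z < e" using t e by (simp add: dist_norm)
 thus "\<exists>y\<in>S. dist y z < e" using assms(1)[of t] t by blast
qed

lemma base_curves_out:
 assumes r: "r --> k = 1"
 shows "base_curves n r Int (base_out n k r - interiors (base_box n r ` {..<k})) Int bd (base_out n k r)
  = (%(j, y). Complex (real j) y) ` ({1..n} \<times> {0, 2 * real k + 1})" (is "?L = ?P")
proof (intro equalityI subsetI)
 fix z assume "z \<in> ?L"
 hence z: "z \<in> base_curves n r" "z \<in> bd (base_out n k r)" by blast+
 have "z ~: bd (base_ring n)" if "r"
  using z(2) that r by (auto simp: base_out_def base_ring_def in_bd_rect in_rect)
 then obtain j where j: "j \<in> {1..n}" "Re z = real j" using z(1) by (auto simp: base_curves_def split: if_splits)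
 have "1/8 < real j" "real j < real n + 7/8 + (if r then 2 else 0)" using j(1) by auto
 hence "Im z = 0 | Im z = 2 * real k + 1"
  using z(2) j(2) by (auto simp: base_out_def in_bd_rect in_rect)
 thus "z \<in> ?P" using j by (intro image_eqI[of _ _ "(j, Im z)"]) (auto simp: complex_eq_iff)
next
 fix z assume "z \<in> ?P"
 then obtain j where j: "j \<in> {1..n}" "Re z = real j" "Im z = 0 | Im z = 2 * real k + 1" by auto
 hence "z \<in> bd (base_out n k r)" by (auto simp: base_out_def in_bd_rect in_rect)
 moreover have "z \<in> base_out n k r" using j by (auto simp: base_out_def in_rect)
 moreover have "z ~: interior (base_box n r i)" if "i < k" for i
  using that j(3) by (auto simp: base_box_def in_int_rect)
 moreover have "z \<in> base_curves n r" using j by (auto simp: base_curves_def)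
 ultimately show "z \<in> ?L" by auto
qed

lemma base_curves_box:
 assumes r: "r --> k = 1" and i: "i < k"
 shows "base_curves n r Int (base_out n k r - interiors (base_box n r ` {..<k})) Int bd (base_box n r i)
  = (%(j, y). Complex (real j) y) ` ({1..n + (if r then 1 else 0)} \<times> {2 * real i + 1, 2 * real i + 2})" (is "?L = ?P")
proof (intro equalityI subsetI)
 fix z assume "z \<in> ?L"
 hence z: "z \<in> base_curves n r" "z \<in> bd (base_box n r i)" by blast+
 have "\<exists>j\<in>{1..n + (if r then 1 else 0)}. Re z = real j"
 proof (cases "r & z \<in> bd (base_ring n)")
  case True
  hence "i = 0" using r i by simp
  hence "Re z = real (n + 1)"
   using z(2) True by (auto simp: base_box_def base_ring_def in_bd_rect in_rect)
  thus ?thesis using True by (intro bexI[of _ "n + 1"]) auto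
 next
  case False
  then obtain j where "j \<in> {1..n}" "Re z = real j" using z(1) by (auto simp: base_curves_def split: if_splits)
  thus ?thesis by (intro bexI[of _ j]) auto
 qed
 then obtain j where j: "j \<in> {1..n + (if r then 1 else 0)}" "Re z = real j" by blast
 have "real j < real n + 3/4 + (if r then 1 else 0)" "1/4 < real j" using j(1) by (auto split: if_splits)
 hence "Im z = 2 * real i + 1 | Im z = 2 * real i + 2"
  using z(2) j(2) by (auto simp: base_box_def in_bd_rect in_rect)
 thus "z \<in> ?P" using j by (intro image_eqI[of _ _ "(j, Im z)"]) (auto simp: complex_eq_iff)
next
 fix z assume "z \<in> ?P"
 then obtain j where j: "j \<in> {1..n + (if r then 1 else 0)}" "Re z = real j" "Im z = 2 * real i + 1 | Im z = 2 * real i + 2" by auto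
 have jr: "real j < real n + 3/4 + (if r then 1 else 0)" "1/4 < real j" using j(1) by (auto split: if_splits)
 have fr: "z \<in> bd (base_box n r i)" using jr j(2,3) by (auto simp: base_box_def in_bd_rect in_rect)
 have out: "z \<in> base_out n k r"
  using fr base_box_frontier_sub base_box_subset[OF i] interior_subset by blast
 moreover have "z ~: interior (base_box n r i')" if "i' < k" for i'
 proof
  assume "z \<in> interior (base_box n r i')"
  hence z: "2 * real i' + 1 < Im z" "Im z < 2 * real i' + 2" by (auto simp: base_box_def in_int_rect)
  hence "real i' < real i + 1" "real i < real i' + 1" using j(3) by auto
  hence "i = i'" by linarith
  thus False using z j(3) by auto
 qed
 moreover have "z \<in> base_curves n r"
 proof (cases "j <= n")
  case True
  thus ?thesis using j by (auto simp: base_curves_def)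
 next
  case False
  hence jn: "r" "j = n + 1" using j(1) by (auto split: if_splits)
  hence "i = 0" using r i by simp
  hence "z \<in> bd (base_ring n)" using j jn by (auto simp: base_ring_def in_bd_rect in_rect)
  thus ?thesis using jn by (simp add: base_curves_def)
 qed
 ultimately show "z \<in> ?L" using fr by auto
qed

lemma base_frontiers_disjoint:
 assumes "i < k"
 shows "bd (base_out n k r) Int bd (base_box n r i) = {}"
proof -
 have "bd (base_box n r i) \<subseteq> interior (base_out n k r)"
  using base_box_frontier_sub base_box_subset[OF assms] by (rule subset_trans)
 thus ?thesis unfolding frontier_def[of "base_out n k r"] by blast
qed

lemma base_marks_box:
 assumes "i < k"
 shows "base_marks n k r Int bd (base_box n r i) = {z \<in> bd (base_box n r i). Re z < 1}"
proof -
 have "bd (base_out n k r) Int bd (base_box n r i) = {}"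
  by (rule base_frontiers_disjoint[OF assms])
 moreover have "bd (base_box n r j) Int bd (base_box n r i) = {}" if "j ~= i" for j
  using base_box_disjoint[OF that] base_box_frontier_sub by blast
 ultimately show ?thesis using assms unfolding base_marks_def by blast
qed

lemma base_marks_out:
 "base_marks n k r Int bd (base_out n k r) = {z \<in> bd (base_out n k r). n = 0 | Re z < 1}"
proof -
 have "bd (base_out n k r) Int bd (base_box n r i) = {}" if "i < k" for i
  by (rule base_frontiers_disjoint[OF that])
 thus ?thesis unfolding base_marks_def by blast
qed

lemma base_strings:
 fixes n k :: nat and r b :: bool
 assumes r: "r --> k = 1"
 defines "seg == %(j, i). {z. Re z = real j & 2 * real i <= Im z & Im z <= 2 * real i + 1}"
  and "ring == bd (base_ring n) - {z. Re z = real n + 1 & 1 < Im z & Im z < 2}"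
 defines "C == seg ` ({1..n} \<times> {..k}) Un (if r then {ring} else {})"
 shows "finite C" "disjoint C" "\<Union> C = base_curves n r Int (base_out n k r - interiors (base_box n r ` {..<k}))"
  "!!c. c \<in> C ==> is_string (base_tangle n k r b) c"
proof -
 show "finite C" by (simp add: C_def)
 have d1: "seg (j, i) Int seg (j', i') = {}" if "(j, i) ~= (j', i')" for j i j' i'
 proof (rule ccontr)
  assume "seg (j, i) Int seg (j', i') ~= {}"
  then obtain z where z: "Re z = real j" "Re z = real j'" "2 * real i <= Im z" "Im z <= 2 * real i + 1"
   "2 * real i' <= Im z" "Im z <= 2 * real i' + 1" by (auto simp: seg_def)
  hence "j = j'" "real i < real i' + 1" "real i' < real i + 1" by auto
  thus False using that by auto
 qed
 have d2: "seg (j, i) Int ring = {}" if "j \<in> {1..n}" for j i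
  using that by (auto simp: seg_def ring_def base_ring_def in_bd_rect in_rect)
 have d2': "c Int ring = {}" if "c \<in> seg ` ({1..n} \<times> {..k})" for c
 proof -
  from that obtain x where "c = seg x" "x \<in> {1..n} \<times> {..k}" by (rule imageE)
  thus ?thesis using d2[of "fst x" "snd x"] by (simp add: mem_Times_iff)
 qed
 show "disjoint C"
  unfolding disjoint_def
 proof (intro ballI impI)
  fix c d assume cd: "c \<in> C" "d \<in> C" "c ~= d"
  show "c Int d = {}"
  proof (cases "c \<in> seg ` ({1..n} \<times> {..k}) & d \<in> seg ` ({1..n} \<times> {..k})")
   case True
   then obtain j i j' i' where "c = seg (j, i)" "d = seg (j', i')" by auto
   thus ?thesis using d1[of j i j' i'] cd(3) by auto
  next
   case False
   thus ?thesis using cd d2'[of c] d2'[of d] unfolding C_def by (auto split: if_splits)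
  qed
 qed
 show "\<Union> C = base_curves n r Int (base_out n k r - interiors (base_box n r ` {..<k}))" (is "_ = ?L")
 proof (intro equalityI subsetI)
  fix z assume "z \<in> \<Union> C"
  then consider j i where "j \<in> {1..n}" "i <= k" "z \<in> seg (j, i)" | "r" "z \<in> ring"
   by (auto simp: C_def split: if_splits)
  thus "z \<in> ?L"
  proof cases
   case 1
   hence z: "Re z = real j" "2 * real i <= Im z" "Im z <= 2 * real i + 1" by (auto simp: seg_def)
   have "z \<in> base_out n k r" using z 1 by (auto simp: base_out_def in_rect)
   moreover have "z ~: interior (base_box n r i')" for i'
   proof
    assume "z \<in> interior (base_box n r i')"
    hence "2 * real i' + 1 < Im z" "Im z < 2 * real i' + 2" by (auto simp: base_box_def in_int_rect)
    hence "real i' < real i" "real i < real i' + 1" using z by linarith+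
    hence "i' < i" "i < i' + 1" by linarith+
    thus False by simp
   qed
   ultimately show ?thesis using z 1 by (auto simp: base_curves_def)
  next
   case 2
   hence "z ~: interior (base_box n r 0)" "z \<in> base_out n k r" "z \<in> base_curves n r"
    using r by (auto simp: ring_def base_ring_def base_box_def base_out_def base_curves_def
      in_bd_rect in_int_rect in_rect)
   thus ?thesis using r 2(1) by auto
  qed
 next
  fix z assume "z \<in> ?L"
  hence z: "z \<in> base_curves n r" "z \<in> base_out n k r" "!!i. i < k ==> z ~: interior (base_box n r i)" by auto
  show "z \<in> \<Union> C"
  proof (cases "r & z \<in> bd (base_ring n)")
   case True
   hence "z ~: interior (base_box n r 0)" using r z(3) by simp
   hence "z \<in> ring" using True by (auto simp: ring_def base_box_def in_int_rect)
   thus ?thesis using True by (auto simp: C_def)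
  next
   case False
   then obtain j where j: "j \<in> {1..n}" "Re z = real j" using z(1) by (auto simp: base_curves_def split: if_splits)
   have "\<not> (2 * real i + 1 < Im z & Im z < 2 * real i + 2)" if "i < k" for i
    using z(3)[OF that] j by (auto simp: base_box_def in_int_rect)
   then obtain i where "i <= k" "2 * real i <= Im z" "Im z <= 2 * real i + 1"
    using z(2) notin_open_boxes[of "Im z" k] by (auto simp: base_out_def in_rect)
   hence "z \<in> seg (j, i)" "i <= k" using j by (auto simp: seg_def)
   thus ?thesis using j by (auto simp: C_def)
  qed
 qed
 have discs: "discs (base_tangle n k r b) = insert (base_out n k r) (base_box n r ` {..<k})"
  by (simp add: base_tangle_def discs_def)
 have sel: "outer_disc (base_tangle n k r b) = base_out n k r" "inner_discs (base_tangle n k r b) = base_box n r ` {..<k}"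
  by (simp_all add: base_tangle_def)
 fix c assume "c \<in> C"
 then consider j i where "j \<in> {1..n}" "i <= k" "c = seg (j, i)" | "r" "c = ring"
  by (auto simp: C_def split: if_splits)
 thus "is_string (base_tangle n k r b) c"
 proof cases
  case 1
  let ?p = "Complex (real j) (2 * real i)" and ?q = "Complex (real j) (2 * real i + 1)"
  have c: "c = closed_segment ?p ?q" using 1 by (subst vertical_segment[of "real j"]) (auto simp: seg_def)
  have j: "1 <= real j" "real j <= real n" using 1 by auto
  have "?p \<in> \<Union> (bd ` discs (base_tangle n k r b))"
  proof (cases "i = 0")
   case True
   hence "?p \<in> bd (base_out n k r)" using j by (auto simp: base_out_def in_bd_rect in_rect)
   thus ?thesis by (auto simp: discs)
  next
   case False
   hence "?p \<in> bd (base_box n r (i - 1))" "i - 1 < k"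
    using 1 j by (auto simp: base_box_def in_bd_rect in_rect of_nat_diff)
   thus ?thesis by (auto simp: discs)
  qed
  moreover have "?q \<in> \<Union> (bd ` discs (base_tangle n k r b))"
  proof (cases "i = k")
   case True
   hence "?q \<in> bd (base_out n k r)" using j by (auto simp: base_out_def in_bd_rect in_rect)
   thus ?thesis by (auto simp: discs)
  next
   case False
   hence "?q \<in> bd (base_box n r i)" "i < k"
    using 1 j by (auto simp: base_box_def in_bd_rect in_rect)
   thus ?thesis by (auto simp: discs)
  qed
  moreover have "c - {?p, ?q} \<subseteq> interior (base_out n k r) - \<Union> (base_box n r ` {..<k})"
  proof
   fix z assume "z \<in> c - {?p, ?q}"
   hence z: "Re z = real j" "2 * real i < Im z" "Im z < 2 * real i + 1"
    using 1 by (auto simp: seg_def complex_eq_iff order_less_le)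
   have "real i <= real k" using 1 by simp
   hence "z \<in> interior (base_out n k r)" using z j unfolding base_out_def in_int_rect by auto
   moreover have "z ~: base_box n r i'" for i'
    using between_boxes[OF z(2,3), of i'] by (auto simp: base_box_def in_rect)
   ultimately show "z \<in> interior (base_out n k r) - \<Union> (base_box n r ` {..<k})" by blast
  qed
  ultimately show ?thesis
   unfolding is_string_def sel by (intro exI[of _ "linepath ?p ?q"]) (simp add: c)
 next
  case 2
  let ?g = "ring_path (real n + 1) (real n + 2) (1/4) (11/4) 1 2"
  have k: "k = 1" using r 2 by simp
  note g = ring_path[of "real n + 1" "real n + 2" "1/4" 1 2 "11/4", simplified]
  have fr: "Complex (real n + 1) y \<in> bd (base_box n r 0)" if "y = 1 | y = 2" for y
   using that 2 by (auto simp: base_box_def in_bd_rect in_rect)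
  have "c - {Complex (real n + 1) 2, Complex (real n + 1) 1} \<subseteq> interior (base_out n k r) - \<Union> (base_box n r ` {..<k})"
  proof
   fix z assume "z \<in> c - {Complex (real n + 1) 2, Complex (real n + 1) 1}"
   hence z: "z \<in> bd (base_ring n)" "\<not> (Re z = real n + 1 & 1 <= Im z & Im z <= 2)"
    using 2 by (auto simp: ring_def complex_eq_iff order_less_le)
   have "z \<in> interior (base_out n k r)"
    using z(1) 2 k by (auto simp: base_ring_def base_out_def rect_simps)
   moreover have "z ~: base_box n r 0"
    using z 2 by (auto simp: base_ring_def base_box_def in_bd_rect in_rect)
   ultimately show "z \<in> interior (base_out n k r) - \<Union> (base_box n r ` {..<k})" using k by auto
  qed
  moreover have "path_image ?g = c" using g(4) 2 by (simp add: ring_def base_ring_def)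
  ultimately show ?thesis
   unfolding is_string_def sel discs using g(1-3) fr[of 1] fr[of 2] k
   by (intro exI[of _ ?g]) auto
 qed
qed

lemma base_colour_local:
 assumes z: "z ~: base_curves n r"
 shows "\<forall>\<^sub>F w in nhds z. (w \<in> base_colour n r <-> z \<in> base_colour n r)"
proof -
 have lines: "\<forall>\<^sub>F w in nhds z. (real j <= Re w) = (real j <= Re z)" if j: "j \<in> {1..n}" for j
 proof -
  have "Re z ~= real j" using z j by (auto simp: base_curves_def)
  then consider "z \<in> {w. Re w < real j}" | "z \<in> {w. Re w > real j}" by fastforce
  thus ?thesis
  proof cases
   case 1
   hence "\<forall>\<^sub>F w in nhds z. w \<in> {w. Re w < real j}"
    by (intro eventually_nhds_in_open open_halfspace_Re_lt)
   thus ?thesis by eventually_elim (use 1 in auto)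
  next
   case 2
   hence "\<forall>\<^sub>F w in nhds z. w \<in> {w. Re w > real j}"
    by (intro eventually_nhds_in_open open_halfspace_Re_gt)
   thus ?thesis by eventually_elim (use 2 in auto)
  qed
 qed
 have "\<forall>\<^sub>F w in nhds z. \<forall>j\<in>{1..n}. (real j <= Re w) = (real j <= Re z)"
  using lines by (intro eventually_ball_finite) auto
 moreover have "\<forall>\<^sub>F w in nhds z. r --> (w \<in> base_ring n <-> z \<in> base_ring n)"
 proof (cases r)
  case True
  hence "z ~: bd (base_ring n)" using z by (auto simp: base_curves_def)
  then consider "z \<in> interior (base_ring n)" | "z \<in> - base_ring n"
   using closed_rect[of "real n + 1" "real n + 2" "1/4" "11/4"] by (auto simp: frontier_def base_ring_def)
  thus ?thesis
  proof cases
   case 1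
   hence "\<forall>\<^sub>F w in nhds z. w \<in> interior (base_ring n)" by (intro eventually_nhds_in_open) auto
   thus ?thesis by eventually_elim (use 1 interior_subset in blast)
  next
   case 2
   hence "\<forall>\<^sub>F w in nhds z. w \<in> - base_ring n"
    by (intro eventually_nhds_in_open) (auto simp: base_ring_def closed_rect)
   thus ?thesis by eventually_elim (use 2 in auto)
  qed
 qed auto
 ultimately show ?thesis
 proof eventually_elim
  case (elim w)
  hence "lines_left n w = lines_left n z" unfolding lines_left_def by (intro arg_cong[of _ _ card]) auto
  thus ?case using elim by (auto simp: base_colour_def)
 qed
qed

lemma base_colour_both:
 assumes r: "r --> k = 1" and z: "z \<in> base_curves n r"
  and zR: "z \<in> base_out n k r - interiors (base_box n r ` {..<k})"
 defines "S == %c. {w \<in> base_out n k r - interiors (base_box n r ` {..<k}) - base_curves n r. w \<in> base_colour n r <-> c}"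
 shows "z \<in> closure (S c)"
proof -
 have zO: "z \<in> base_out n k r" and zB: "!!i. i < k ==> z ~: interior (base_box n r i)" using zR by auto
 have SI: "w \<in> S c" if "w \<in> base_out n k r" "!!i. i < k ==> w ~: interior (base_box n r i)" "w ~: base_curves n r"
   "w \<in> base_colour n r <-> c" for w c
  using that by (auto simp: S_def)
 show ?thesis
 proof (cases "r & z \<in> bd (base_ring n)")
  case False
  then obtain j where j: "j \<in> {1..n}" "Re z = real j" using z by (auto simp: base_curves_def split: if_splits)
  have sides: "z + of_real t * v \<in> S (odd (if v = 1 then j else j - 1))" if "0 < t" "t < 1/8" "v = 1 | v = -1" for t v
  proof (rule SI)
   let ?w = "z + of_real t * v"
   have w: "Im ?w = Im z" "Re ?w = real j + t * Re v" using j that(3) by auto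
   have b: "real j - 1/8 < Re ?w" "Re ?w < real j + 1/8" "Re ?w ~= real j" using that w by auto
   have jn: "1 <= real j" "real j <= real n" using j(1) by auto
   have "1/8 <= Re ?w" "Re ?w <= real n + 7/8" using b jn by linarith+
   thus "?w \<in> base_out n k r" using zO w(1) by (auto simp: base_out_def in_rect)
   show "?w ~: interior (base_box n r i)" if "i < k" for i
    using zB[OF that] w(1) jn j(2) by (auto simp: base_box_def in_int_rect)
   have "Re ?w ~= real i" for i
   proof
    assume "Re ?w = real i"
    hence "real i < real j + 1" "real j < real i + 1" using b by linarith+
    thus False using b(3) `Re ?w = real i` by simp
   qed
   moreover have out: "?w ~: base_ring n" using b jn by (auto simp: base_ring_def in_rect)
   moreover have "bd (base_ring n) \<subseteq> base_ring n"
    unfolding base_ring_def by (rule frontier_subset_closed[OF closed_rect])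
   ultimately show "?w ~: base_curves n r" by (auto simp: base_curves_def split: if_splits)
   have "lines_left n ?w = (if v = 1 then j else j - 1)"
   proof (cases "v = 1")
    case True
    thus ?thesis using lines_left_eq[of j ?w n] w that jn by auto
   next
    case False
    hence "v = -1" using that by blast
    thus ?thesis using lines_left_eq[of "j - 1" ?w n] w that jn j(1) False by (auto simp: of_nat_diff)
   qed
   thus "?w \<in> base_colour n r <-> odd (if v = 1 then j else j - 1)"
    using out by (simp add: base_colour_def)
  qed
  have "z \<in> closure (S (odd j))" using sides[of _ 1] by (intro in_closureI[of z 1]) auto
  moreover have "z \<in> closure (S (odd (j - 1)))" using sides[of _ "-1"] by (intro in_closureI[of z "-1"]) auto
  moreover have "odd (j - 1) <-> \<not> odd j" using j(1) by auto
  ultimately show ?thesis by (cases c; cases "odd j") auto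
 next
  case True
  have k: "k = 1" using r True by simp
  have ring: "z \<in> bd (base_ring n)" and rT: "r" using True by auto
  have lines: "lines_left n w = n" if "real n + 1/2 < Re w" for w using that by (intro lines_left_max) simp
  have notline: "\<not> (\<exists>j\<in>{1..n}. Re w = real j)" if "real n + 1/2 < Re w" for w using that by auto
  have inside: "w \<in> S (odd (n + 1))"
   if "real n + 1 < Re w" "Re w < real n + 2" "1/4 < Im w" "Im w < 11/4" "\<not> (Re w < real n + 7/4 & 1 < Im w & Im w < 2)" for w
  proof (rule SI)
   show "w \<in> base_out n k r" using that rT k by (auto simp: base_out_def in_rect)
   show "w ~: interior (base_box n r i)" if "i < k" for i
    using that `\<not> (Re w < real n + 7/4 & 1 < Im w & Im w < 2)` rT k by (auto simp: base_box_def in_int_rect)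
   show "w ~: base_curves n r" using that notline[of w] rT
    by (auto simp: base_curves_def base_ring_def in_bd_rect)
   show "w \<in> base_colour n r <-> odd (n + 1)" using that lines[of w] rT
    by (simp add: base_colour_def base_ring_def in_rect)
  qed
  have outside: "w \<in> S (odd n)"
   if "real n + 3/4 < Re w" "Re w < real n + 9/4" "0 < Im w" "Im w < 3"
    "\<not> (real n + 1 <= Re w & Re w <= real n + 2 & 1/4 <= Im w & Im w <= 11/4)"
    "\<not> (Re w < real n + 7/4 & 1 < Im w & Im w < 2)" for w
  proof (rule SI)
   show "w \<in> base_out n k r" using that rT k by (auto simp: base_out_def in_rect)
   show "w ~: interior (base_box n r i)" if "i < k" for i
    using that `\<not> (Re w < real n + 7/4 & 1 < Im w & Im w < 2)` rT k by (auto simp: base_box_def in_int_rect)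
   show "w ~: base_curves n r" using that notline[of w] rT
    by (auto simp: base_curves_def base_ring_def in_bd_rect in_rect)
   show "w \<in> base_colour n r <-> odd n" using that lines[of w] rT
    by (auto simp: base_colour_def base_ring_def in_rect)
  qed
  have zr: "real n + 1 <= Re z" "Re z <= real n + 2" "1/4 <= Im z" "Im z <= 11/4"
   "\<not> (real n + 1 < Re z & Re z < real n + 2 & 1/4 < Im z & Im z < 11/4)"
   using ring by (auto simp: base_ring_def in_bd_rect in_rect)
  have zb: "\<not> (Re z < real n + 7/4 & 1 < Im z & Im z < 2)"
   using zB[of 0] k rT zr(1) by (auto simp: base_box_def in_int_rect)
  \<comment> \<open>A direction into the closed curve, and its opposite out of it; on the vertical sides they are horizontal
   so that the box is avoided.\<close>
  have "z \<in> closure (S (odd (n + 1))) & z \<in> closure (S (odd n))"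
  proof (cases "1/4 < Im z & Im z < 11/4")
   case True
   define v :: complex where "v = (if Re z = real n + 1 then 1 else -1)"
   have v: "Re v = (if Re z = real n + 1 then 1 else -1)" "Im v = 0" "norm v <= 2" by (auto simp: v_def)
   have e: "Re z = real n + 1 | Re z = real n + 2" using True zr by auto
   have "z + of_real t * v \<in> S (odd (n + 1))" if "0 < t" "t < 1/8" for t
    using that e v True zb by (intro inside) (auto split: if_splits)
   moreover have "z + of_real t * (- v) \<in> S (odd n)" if "0 < t" "t < 1/8" for t
    using that e v True zb by (intro outside) (auto split: if_splits)
   ultimately show ?thesis using v(3) in_closureI[of z v] in_closureI[of z "- v"] by simp
  next
   case False
   hence y: "Im z = 1/4 | Im z = 11/4" using zr by auto
   define s :: real where "s = (if Im z = 1/4 then 1 else -1)"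
   define v where "v = Complex (real n + 3/2 - Re z) s"
   have s: "s = 1 & Im z = 1/4 | s = -1 & Im z = 11/4" using y by (auto simp: s_def)
   have nv: "norm v <= 2"
   proof -
    have "norm v <= \<bar>Re v\<bar> + \<bar>Im v\<bar>" by (rule cmod_le)
    also have "\<bar>Re v\<bar> <= 1/2" unfolding v_def complex.sel abs_le_iff using zr(1,2) by linarith
    also have "\<bar>Im v\<bar> <= 1" using s by (auto simp: v_def)
    finally show ?thesis by simp
   qed
   have "z + of_real t * v \<in> S (odd (n + 1))" if t: "0 < t" "t < 1/8" for t
   proof (rule inside)
    have 1: "Re (z + of_real t * v) = (1 - t) * Re z + t * (real n + 3/2)" by (simp add: v_def algebra_simps)
    have "(1 - t) * (real n + 1) <= (1 - t) * Re z" "(1 - t) * Re z <= (1 - t) * (real n + 2)"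
     using t zr by (auto intro: mult_left_mono)
    thus "real n + 1 < Re (z + of_real t * v)" "Re (z + of_real t * v) < real n + 2"
     using t unfolding 1 by (simp_all add: algebra_simps)
    show "1/4 < Im (z + of_real t * v)" "Im (z + of_real t * v) < 11/4"
     "\<not> (Re (z + of_real t * v) < real n + 7/4 & 1 < Im (z + of_real t * v) & Im (z + of_real t * v) < 2)"
     using t s by (auto simp: v_def)
   qed
   moreover have "z + of_real t * (- Complex 0 s) \<in> S (odd n)" if t: "0 < t" "t < 1/8" for t
    using t s zr by (intro outside) auto
   ultimately show ?thesis
    using nv in_closureI[of z v] in_closureI[of z "- Complex 0 s"] s by (auto simp: cmod_def)
  qed
  moreover have "odd (n + 1) <-> \<not> odd n" by simp
  ultimately show ?thesis by (cases c; cases "odd n") auto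
 qed
qed

lemma planar_base_tangle:
 assumes r: "r --> k = 1"
 shows "planar_tangle (base_tangle n k r b)"
proof -
 let ?R = "base_out n k r - interiors (base_box n r ` {..<k})"
 let ?X = "base_curves n r"
 show ?thesis
  unfolding base_tangle_def
 proof (rule planar_patI)
  fix D assume D: "D \<in> insert (base_out n k r) (base_box n r ` {..<k})"
  show "D homeomorphic cball (0::complex) 1"
   using D by (auto simp: base_out_def base_box_def intro!: rect_homeomorphic_cball)
  show "even (card (?X Int ?R Int bd D))"
  proof (cases "D = base_out n k r")
   case True
   have "card {0, 2 * real k + 1} = 2" by simp
   thus ?thesis unfolding True base_curves_out[OF r] card_boundary_points by simp
  next
   case False
   then obtain i where i: "i < k" "D = base_box n r i" using D by auto
   have "card {2 * real i + 1, 2 * real i + 2} = 2" by simp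
   thus ?thesis unfolding i base_curves_box[OF r i(1)] card_boundary_points by simp
  qed
  show "base_marks n k r Int bd D \<in> components (bd D - ?X Int ?R)"
  proof (cases "D = base_out n k r")
   case True
   note pts = base_curves_out[OF r, where n = n]
   show ?thesis
   proof (cases "n = 0")
    case True
    have "bd D - ?X Int ?R = bd D" using pts True unfolding `D = base_out n k r` by auto
    moreover have "base_marks n k r Int bd D = bd D"
     unfolding `D = base_out n k r` base_marks_out using True by simp
    moreover have "connected (bd D)" unfolding `D = base_out n k r` base_out_def
     by (intro connected_frontier_rect) auto
    moreover have "bd D ~= {}"
    proof -
     have "Complex (1/8) 0 \<in> bd D" unfolding `D = base_out n k r` base_out_def
      by (simp add: in_bd_rect in_rect)
     thus ?thesis by blast
    qed
    ultimately show ?thesis by (metis in_components_self)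
   next
    case False
    have "Complex 1 0 \<in> ?X Int ?R Int bd D" "Complex 1 (2 * real k + 1) \<in> ?X Int ?R Int bd D"
     unfolding `D = base_out n k r` pts using False by (auto intro!: image_eqI[of _ _ "(1, _)"])
    moreover have "1 <= Re z" if "z \<in> ?X Int ?R" "z \<in> bd D" for z
    proof -
     have "z \<in> ?X Int ?R Int bd D" using that by blast
     thus ?thesis unfolding `D = base_out n k r` pts by auto
    qed
    moreover have De: "D = rect (1/8) (real n + 7/8 + (if r then 2 else 0)) 0 (2 * real k + 1)"
     using True by (simp add: base_out_def)
    moreover have "base_marks n k r Int bd D = {z \<in> bd D. Re z < 1}"
     unfolding True base_marks_out using False by simp
    moreover have "1 < real n + 7/8 + (if r then 2 else 0)" using False by (cases n) auto
    moreover have "0 < 2 * real k + 1" "(1/8::real) < 1" by simp_all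
    ultimately show ?thesis
     using left_mark_component[of "1/8" "real n + 7/8 + (if r then 2 else 0)" 0 "2 * real k + 1" "?X Int ?R", folded De]
     by (metis (no_types, lifting) IntD1)
   qed
  next
   case False
   then obtain i where i: "i < k" "D = base_box n r i" using D by auto
   note pts = base_curves_box[OF r i(1), where n = n]
   show ?thesis
   proof (cases "n = 0 & \<not> r")
    case True
    have "bd D - ?X Int ?R = bd D" using pts True unfolding i by auto
    moreover have "base_marks n k r Int bd D = bd D"
     unfolding i base_marks_box[OF i(1)] using True by (auto simp: base_box_def in_bd_rect in_rect)
    moreover have "connected (bd D)" unfolding i base_box_def
     by (intro connected_frontier_rect) auto
    moreover have "bd D ~= {}"
    proof -
     have "Complex (1/4) (2 * real i + 1) \<in> bd D" unfolding i base_box_def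
      by (simp add: in_bd_rect in_rect)
     thus ?thesis by blast
    qed
    ultimately show ?thesis by (metis in_components_self)
   next
    case False
    hence "1 \<in> {1..n + (if r then 1 else 0)}" by auto
    hence "Complex 1 (2 * real i + 1) \<in> ?X Int ?R Int bd D" "Complex 1 (2 * real i + 2) \<in> ?X Int ?R Int bd D"
     unfolding i pts by (auto intro!: image_eqI[of _ _ "(1, _)"])
    moreover have "1 <= Re z" if "z \<in> ?X Int ?R" "z \<in> bd D" for z
    proof -
     have "z \<in> ?X Int ?R Int bd D" using that by blast
     thus ?thesis unfolding i pts by auto
    qed
    moreover have De: "D = rect (1/4) (real n + 3/4 + (if r then 1 else 0)) (2 * real i + 1) (2 * real i + 2)"
     using i by (simp add: base_box_def)
    moreover have "base_marks n k r Int bd D = {z \<in> bd D. Re z < 1}"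
     unfolding i base_marks_box[OF i(1)] by simp
    moreover have "1 < real n + 3/4 + (if r then 1 else 0)" using False by (cases r; cases n) auto
    moreover have "2 * real i + 1 < 2 * real i + 2" "(1/4::real) < 1" by simp_all
    ultimately show ?thesis
     using left_mark_component[of "1/4" "real n + 3/4 + (if r then 1 else 0)" "2 * real i + 1" "2 * real i + 2" "?X Int ?R", folded De]
     by (metis (no_types, lifting) IntD1)
   qed
  qed
 next
  show "disjoint (base_box n r ` {..<k})"
   unfolding disjoint_def
  proof (intro ballI impI)
   fix D E assume "D \<in> base_box n r ` {..<k}" "E \<in> base_box n r ` {..<k}" "D ~= E"
   then obtain i j where "D = base_box n r i" "E = base_box n r j" "i ~= j" by blast
   thus "D Int E = {}" using base_box_disjoint by simp
  qed
  show "D \<subseteq> interior (base_out n k r)" if "D \<in> base_box n r ` {..<k}" for D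
  proof -
   obtain i where "i < k" "D = base_box n r i" using \<open>D \<in> base_box n r ` {..<k}\<close> by blast
   thus ?thesis using base_box_subset by simp
  qed
  show "finite (base_box n r ` {..<k})" by simp
  show "\<forall>\<^sub>F w in nhds z. w \<in> ?R - ?X --> (w \<in> base_colour n r) = (z \<in> base_colour n r)" if "z \<in> ?R - ?X" for z
   using base_colour_local[of z n r] that by (auto elim: eventually_mono)
  show "z \<in> closure ((?R - ?X) Int base_colour n r) & z \<in> closure (?R - ?X - base_colour n r)" if "z \<in> ?X Int ?R" for z
  proof -
   have e: "(?R - ?X) Int base_colour n r = {w \<in> ?R - ?X. w \<in> base_colour n r <-> True}"
    "?R - ?X - base_colour n r = {w \<in> ?R - ?X. w \<in> base_colour n r <-> False}" by blast+
   show ?thesis unfolding e using that by (intro conjI base_colour_both r) auto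
  qed
  show "base_marks n k r \<subseteq> \<Union> (bd ` insert (base_out n k r) (base_box n r ` {..<k}))"
   by (auto simp: base_marks_def)
 next
  note C = base_strings[OF r, where n = n]
  show "finite ((%(j, i). {z. Re z = real j & 2 * real i <= Im z & Im z <= 2 * real i + 1}) ` ({1..n} \<times> {..k}) Un
   (if r then {bd (base_ring n) - {z. Re z = real n + 1 & 1 < Im z & Im z < 2}} else {}))" (is "finite ?C")
   by (rule C(1))
  show "disjoint ?C" by (rule C(2))
  show "\<Union> ?C = ?X Int ?R" by (rule C(3))
  show "is_string (pat (base_out n k r) (base_box n r ` {..<k}) ?X (base_colour n r) b (base_marks n k r)) c"
   if "c \<in> ?C" for c using C(4)[OF that] by (simp add: base_tangle_def)
 qed
qed

section \<open>Evaluating tangles\<close>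

lemma (in planar_algebra) disc_space_map_tangle:
 "plane_homeo h ==> disc_space A (map_tangle h T) (h ` D) = disc_space A T D"
 by (simp add: disc_space_def disc_size_map_tangle disc_sign_map_tangle)

lemma (in planar_algebra) act_map_eq:
 assumes T: "planar_tangle T" and h: "isotopic_to_id h" and eq: "map_tangle h T = T'"
  and g: "!!D. D \<in> inner_discs T ==> g D \<in> disc_space A T D" and fg: "!!D. D \<in> inner_discs T ==> f (h ` D) = g D"
 shows "act A T' f = act A T g"
proof -
 have lab: "labelling A T (%D. f (h ` D))" using g fg by (simp add: labelling_def)
 hence "act A T' f = act A T (%D. f (h ` D))"
  unfolding eq[symmetric] by (rule act_isotopy[OF T h])
 also have "... = act A T g" using fg by (intro act_cong[OF T lab]) auto
 finally show ?thesis .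
qed

lemma (in planar_algebra) act_glue_eq:
 assumes gl: "gluable T D S" and eq: "glue T D S = G"
  and f: "!!E. E \<in> inner_discs S ==> f E \<in> disc_space A S E"
  and g: "!!E. E \<in> inner_discs T ==> E ~= D ==> g E \<in> disc_space A T E" "!!E. E \<in> inner_discs T ==> E ~= D ==> f E = g E"
  and gD: "act A S f = g D"
 shows "act A G f = act A T g"
proof -
 interpret gluing T D S by unfold_locales (rule gl)
 have labS: "labelling A S f" using f by (simp add: labelling_def)
 have "act A G f = act A T (f(D := act A S f))"
  unfolding eq[symmetric] using g by (intro act_glue[OF gl labS]) auto
 moreover have "disc_space A S (outer_disc S) = disc_space A T D"
 proof -
  have "marked T Int bd D \<subseteq> shaded T <-> marked S Int bd D \<subseteq> shaded S"
   using marked_D shaded_D by blast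
  thus ?thesis using strings_D marked_D unfolding disc_space_def disc_size_def disc_sign_def outerS by simp
 qed
 hence "labelling A T (f(D := act A S f))"
  using act_closed[OF planarS labS] g unfolding labelling_def by auto
 hence "act A T (f(D := act A S f)) = act A T g"
  using g gD by (intro act_cong[OF planarT]) auto
 ultimately show ?thesis by simp
qed

lemma (in gluing) disc_space_glue:
 "E \<in> discs T ==> E ~= D ==> disc_space A G E = disc_space A T E"
 "E \<in> inner_discs S ==> disc_space A G E = disc_space A S E"
 using disc_space_G disc_space_G_inner by (simp_all add: disc_space_def)

lemma (in planar_algebra) planar_disc_space_map:
 assumes "planar_tangle T" "isotopic_to_id h" "map_tangle h T = T'"
 shows "planar_tangle T'" "disc_space A T' (h ` D) = disc_space A T D"
 using planar_map_tangle[OF isotopic_homeo[OF assms(2)] assms(1)]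
  disc_space_map_tangle[OF isotopic_homeo[OF assms(2)], of T D] assms(3) by simp_all

section \<open>Columns of boxes\<close>

text \<open>Boxes of equal width on \<open>n\<close> vertical strings, at the heights given by a list of intervals.\<close>

definition line_curves :: "nat => complex set" where
 "line_curves n = {z. \<exists>j\<in>{1..n}. Re z = real j}"

definition line_colour :: "nat => complex set" where
 "line_colour n = {z. odd (lines_left n z)}"

definition col_box :: "nat => real => real \<times> real => complex set" where
 "col_box n a I = rect a (real n + 1 - a) (fst I) (snd I)"

definition col :: "nat => bool => real => real => real => real => (real \<times> real) list => tangle" where
 "col n b a c d e Is = pat (col_box n a (c, d)) (col_box n e ` set Is) (line_curves n) (line_colour n) b
   {z \<in> \<Union> (bd ` insert (col_box n a (c, d)) (col_box n e ` set Is)). Re z < 1}"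

fun heights :: "(real \<times> real) list => real list" where
 "heights [] = []"
| "heights ((p, q) # Is) = p # q # heights Is"

definition col_ok :: "real => real => real => real => (real \<times> real) list => bool" where
 "col_ok a c d e Is <-> 0 < a & a < e & e < 1/2 & sorted_wrt (<) (c # heights Is @ [d])"

lemma length_heights [simp]: "length (heights Is) = 2 * length Is"
 by (induction Is rule: heights.induct) auto

lemma heights_append [simp]: "heights (Is @ Js) = heights Is @ heights Js"
 by (induction Is rule: heights.induct) auto

lemma map_heights_eq:
 "map g (heights Is) = heights Js ==> Js = map (%(p, q). (g p, g q)) Is"
proof (induction Is arbitrary: Js rule: heights.induct)
 case 1
 thus ?case by (cases Js) auto
next
 case (2 p q Is)
 thus ?case by (cases Js) auto
qed

lemma in_set_heights: "I \<in> set Is ==> fst I \<in> set (heights Is) & snd I \<in> set (heights Is)"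
 by (induction Is rule: heights.induct) auto

lemma heights_sorted_interval: "sorted_wrt (<) (heights Is) ==> I \<in> set Is ==> fst I < snd I"
 by (induction Is rule: heights.induct) auto

definition stack_intervals :: "nat => (real \<times> real) list" where
 "stack_intervals k = map (%i. (2 * real i + 1, 2 * real i + 2)) [0..<k]"

lemma stack_box_col_box: "stack_box n i = col_box n (1/4) (2 * real i + 1, 2 * real i + 2)"
 by (simp add: stack_box_def col_box_def add.commute)

lemma base_box_stack_box: "base_box n False i = stack_box n i"
 by (simp add: base_box_def stack_box_def)

lemma col_base_tangle:
 "col n b (1/8) 0 (2 * real k + 1) (1/4) (stack_intervals k) = base_tangle n k False b"
proof -
 have o: "col_box n (1/8) (0, 2 * real k + 1) = base_out n k False"
  by (simp add: col_box_def base_out_def add.commute)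
 have i: "col_box n (1/4) ` set (stack_intervals k) = base_box n False ` {..<k}"
  by (simp add: stack_intervals_def image_image stack_box_col_box[symmetric] base_box_stack_box atLeast0LessThan)
 have m: "{z \<in> \<Union> (bd ` insert (base_out n k False) (base_box n False ` {..<k})). Re z < 1} = base_marks n k False"
  by (auto simp: base_marks_def base_out_def in_bd_rect in_rect)
 show ?thesis
  unfolding col_def o i m base_tangle_def
  by (simp add: base_curves_def line_curves_def base_colour_def line_colour_def)
qed

lemma shade_odd: "shade s m <-> (odd m <-> s = Pos)"
 by (cases s) (auto simp: shade_def)

lemma stack_tangle_base: "stack_tangle n s k = base_tangle n k False (s = Pos)"
proof -
 let ?out = "rect (1/8) (real n + 7/8) 0 (2 * real k + 1)"
 have o: "base_out n k False = ?out" by (simp add: base_out_def)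
 have str: "{z. \<exists>j\<in>{1..n}. \<exists>i\<le>k. Re z = real j & 2 * real i <= Im z & Im z <= 2 * real i + 1} =
   base_curves n False Int (base_out n k False - interiors (base_box n False ` {..<k}))"
 proof -
  have "{z. \<exists>j\<in>{1..n}. \<exists>i\<le>k. Re z = real j & 2 * real i <= Im z & Im z <= 2 * real i + 1} =
   \<Union> ((%(j, i). {z. Re z = real j & 2 * real i <= Im z & Im z <= 2 * real i + 1}) ` ({1..n} \<times> {..k}) Un (if False then {} else {}))"
   by auto
  thus ?thesis using base_strings(3)[of False k n] by simp
 qed
 have floor: "nat \<lfloor>Re z\<rfloor> = lines_left n z" if "z \<in> ?out" for z
 proof -
  have z: "0 <= Re z" "Re z < real n + 1" using that by (auto simp: in_rect)
  define m where "m = nat \<lfloor>Re z\<rfloor>"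
  have m: "real m <= Re z" "Re z < real m + 1" using z by (auto simp: m_def; linarith)+
  hence "m <= n" using z by linarith
  thus ?thesis using lines_left_eq[OF m] m_def by simp
 qed
 have sh: "{z \<in> ?out - interiors (stack_box n ` {..<k}) - (base_curves n False Int (base_out n k False - interiors (base_box n False ` {..<k}))).
   shade s (nat \<lfloor>Re z\<rfloor>)} = {z \<in> base_out n k False - interiors (base_box n False ` {..<k}) - base_curves n False.
   (z \<in> base_colour n False) = (s = Pos)}"
  using floor by (auto simp: base_box_stack_box o base_colour_def shade_odd)
 have ins: "stack_box n ` {..<k} = base_box n False ` {..<k}" by (simp add: base_box_stack_box)
 have m: "{z \<in> \<Union> (bd ` insert ?out (stack_box n ` {..<k})). Re z < 1} = base_marks n k False"
  by (auto simp: base_marks_def base_out_def in_bd_rect in_rect base_box_stack_box)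
 show ?thesis
  unfolding stack_tangle_def Let_def str sh m base_tangle_def pat_def
  by (simp add: o ins)
qed

lemma stack_tangle_col: "stack_tangle n s k = col n (s = Pos) (1/8) 0 (2 * real k + 1) (1/4) (stack_intervals k)"
 by (simp add: col_base_tangle stack_tangle_base)

lemma planar_stack_tangle: "planar_tangle (stack_tangle n s k)"
 unfolding stack_tangle_base by (rule planar_base_tangle) simp

lemma col_box_prod_map:
 assumes "incr_homeo f" "incr_homeo g" "f a = a'" "f (real n + 1 - a) = real n + 1 - a'" "g p = p'" "g q = q'"
 shows "prod_map f g ` col_box n a (p, q) = col_box n a' (p', q')"
 using assms by (simp add: col_box_def prod_map_rect)

lemma map_col:
 assumes f: "incr_homeo f" and g: "incr_homeo g" and fixj: "!!j. j \<in> {1..n} ==> f (real j) = real j"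
  and a: "f a = a'" "f (real n + 1 - a) = real n + 1 - a'" and e: "f e = e'" "f (real n + 1 - e) = real n + 1 - e'"
  and cd: "g c = c'" "g d = d'" and pos: "0 < a" "0 < a'" "a < e" "a' < e'" "e < 1/2" "e' < 1/2"
 shows "map_tangle (prod_map f g) (col n b a c d e Is) = col n b a' c' d' e' (map (%(p, q). (g p, g q)) Is)"
proof -
 have h: "plane_homeo (prod_map f g)" using isotopic_prod_map[OF f g] by (rule isotopic_homeo)
 have inj: "inj (prod_map f g)" using plane_homeo_bij[OF h] by (rule bij_is_inj)
 note cmp = incr_homeo_compare[OF f]
 have out: "prod_map f g ` col_box n a (c, d) = col_box n a' (c', d')"
  using col_box_prod_map[OF f g a cd] .
 have ins: "(`) (prod_map f g) ` col_box n e ` set Is = col_box n e' ` set (map (%(p, q). (g p, g q)) Is)"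
 proof -
  have "prod_map f g ` col_box n e I = col_box n e' (case I of (p, q) => (g p, g q))" for I
   by (cases I) (simp add: col_box_prod_map[OF f g e refl refl])
  thus ?thesis by (simp add: image_image)
 qed
 let ?F = "\<Union> (bd ` insert (col_box n a (c, d)) (col_box n e ` set Is))"
 let ?F' = "\<Union> (bd ` insert (col_box n a' (c', d')) (col_box n e' ` set (map (%(p, q). (g p, g q)) Is)))"
 have F: "prod_map f g ` ?F = ?F'"
  unfolding ins[symmetric] out[symmetric]
  by (simp add: image_Un image_UN image_image frontier_homeo_image[OF h])
 have less1: "f (Re z) < 1 <-> Re z < 1" if z: "z \<in> ?F" for z
 proof (cases "n = 0")
  case True
  have fr: "bd (col_box n u I) \<subseteq> {z. Re z <= 1 - u}" for u I
  proof -
   have "bd (col_box n u I) \<subseteq> col_box n u I" unfolding col_box_def by (rule frontier_subset_closed[OF closed_rect])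
   thus ?thesis using True by (auto simp: col_box_def in_rect)
  qed
  obtain u I where "z \<in> bd (col_box n u I)" "0 < u" using z pos by auto
  hence "Re z <= 1 - u" using fr[of u I] by (simp add: subset_iff)
  hence "Re z < 1" using `0 < u` by linarith
  moreover have "prod_map f g z \<in> ?F'" using imageI[OF z, of "prod_map f g"] unfolding F .
  then obtain u I where "prod_map f g z \<in> bd (col_box n u I)" "0 < u" using pos by auto
  hence "Re (prod_map f g z) <= 1 - u" using fr[of u I] by (simp only: subset_iff mem_Collect_eq)
  hence "Re (prod_map f g z) < 1" using `0 < u` by linarith
  ultimately show ?thesis by simp
 next
  case False
  hence "f 1 = 1" using fixj[of 1] by simp
  thus ?thesis using cmp(1)[of "Re z" 1] by simp
 qed
 show ?thesis
  unfolding col_def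
 proof (rule map_pat[OF h out ins])
  show "prod_map f g ` {z \<in> ?F. Re z < 1} = {z \<in> ?F'. Re z < 1}"
  proof (intro equalityI subsetI)
   fix w assume "w \<in> prod_map f g ` {z \<in> ?F. Re z < 1}"
   then obtain z where z: "z \<in> ?F" "Re z < 1" "w = prod_map f g z" by blast
   hence "w \<in> ?F'" unfolding F[symmetric] by blast
   thus "w \<in> {z \<in> ?F'. Re z < 1}" using z less1[OF z(1)] by simp
  next
   fix w assume w: "w \<in> {z \<in> ?F'. Re z < 1}"
   then obtain z where z: "z \<in> ?F" "w = prod_map f g z" unfolding F[symmetric] by blast
   thus "w \<in> prod_map f g ` {z \<in> ?F. Re z < 1}" using less1[OF z(1)] w by auto
  qed
  fix z
  show "prod_map f g z \<in> line_curves n <-> z \<in> line_curves n"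
  proof -
   have "f (Re z) = real j <-> Re z = real j" if "j \<in> {1..n}" for j
    using fixj[OF that] cmp(3)[of "Re z" "real j"] by simp
   thus ?thesis by (auto simp: line_curves_def)
  qed
  have "real j <= f (Re z) <-> real j <= Re z" if "j \<in> {1..n}" for j
   using fixj[OF that] cmp(2)[of "real j" "Re z"] by simp
  hence "{j \<in> {1..n}. real j <= f (Re z)} = {j \<in> {1..n}. real j <= Re z}" by blast
  thus "prod_map f g z \<in> line_colour n <-> z \<in> line_colour n"
   by (simp add: line_colour_def lines_left_def)
 qed
qed

lemma width_homeo:
 assumes "0 < a" "a < e" "e < 1/2" "0 < a'" "a' < e'" "e' < 1/2"
 obtains f where "incr_homeo f" "!!j. j \<in> {1..n} ==> f (real j) = real j" "f a = a'" "f e = e'"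
  "f (real n + 1 - a) = real n + 1 - a'" "f (real n + 1 - e) = real n + 1 - e'"
proof -
 let ?L = "%a e. [a, e] @ map real [1..<Suc n] @ [real n + 1 - e, real n + 1 - a]"
 have "sorted_wrt (<) (?L a e)" if "0 < a" "a < e" "e < 1/2" for a e :: real
  using that by (auto simp: sorted_wrt_append sorted_wrt_map)
 hence s: "sorted_wrt (<) (?L a e)" "sorted_wrt (<) (?L a' e')" using assms by blast+
 obtain f where f: "incr_homeo f" "map f (?L a e) = ?L a' e'"
  by (rule incr_homeo_through[OF s]) simp_all
 have "map f (map real [1..<Suc n]) = map real [1..<Suc n]" using f(2) by (simp del: upt_Suc)
 hence "f (real j) = real j" if "j \<in> {1..n}" for j
  using that by (auto simp: map_eq_conv simp del: upt_Suc)
 thus thesis using that f by simp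
qed

lemma col_isotopy:
 assumes ok: "col_ok a c d e Is" "col_ok a' c' d' e' Js" and len: "length Is = length Js"
 obtains h where "isotopic_to_id h" "map_tangle h (col n b a c d e Is) = col n b a' c' d' e' Js"
  "h ` col_box n a (c, d) = col_box n a' (c', d')"
  "!!i. i < length Is ==> h ` col_box n e (Is ! i) = col_box n e' (Js ! i)"
proof -
 obtain f where f: "incr_homeo f" "!!j. j \<in> {1..n} ==> f (real j) = real j" "f a = a'" "f e = e'"
  "f (real n + 1 - a) = real n + 1 - a'" "f (real n + 1 - e) = real n + 1 - e'"
  using width_homeo[of a e a' e' n] ok unfolding col_ok_def by blast
 obtain g where g: "incr_homeo g" "map g (c # heights Is @ [d]) = c' # heights Js @ [d']"
  using incr_homeo_through[of "c # heights Is @ [d]" "c' # heights Js @ [d']"] ok len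
  unfolding col_ok_def by auto
 hence gg: "g c = c'" "g d = d'" "map g (heights Is) = heights Js" using len by auto
 hence Js: "Js = map (%(p, q). (g p, g q)) Is" using map_heights_eq by blast
 have "map_tangle (prod_map f g) (col n b a c d e Is) = col n b a' c' d' e' Js"
  unfolding Js using ok unfolding col_ok_def by (intro map_col f g gg) auto
 moreover have "prod_map f g ` col_box n e (Is ! i) = col_box n e' (Js ! i)" if "i < length Is" for i
  using that unfolding Js by (cases "Is ! i") (simp add: col_box_prod_map[OF f(1) g(1) f(4) f(6) refl refl])
 ultimately show thesis
  using that[OF isotopic_prod_map[OF f(1) g(1)]] col_box_prod_map[OF f(1) g(1) f(3) f(5) gg(1,2)] by blast
qed

lemma col_ok_stack: "col_ok (1/8) 0 (2 * real k + 1) (1/4) (stack_intervals k)"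
proof -
 have "sorted_wrt (<) (heights (stack_intervals k)) & (\<forall>x\<in>set (heights (stack_intervals k)). 0 < x & x < 2 * real k + 1)"
 proof (induction k)
  case (Suc k)
  thus ?case by (auto simp: stack_intervals_def sorted_wrt_append)
 qed (simp add: stack_intervals_def)
 thus ?thesis by (auto simp: col_ok_def sorted_wrt_append)
qed

lemma length_stack_intervals [simp]: "length (stack_intervals k) = k"
 by (simp add: stack_intervals_def)

lemma stack_intervals_nth: "i < k ==> col_box n (1/4) (stack_intervals k ! i) = stack_box n i"
 by (simp add: stack_intervals_def stack_box_col_box)

lemma stack_box_inj: "stack_box n i = stack_box n j ==> i = j"
proof -
 assume eq: "stack_box n i = stack_box n j"
 have "Complex 1 (2 * real i + 1) \<in> stack_box n i | n = 0" by (auto simp: stack_box_def in_rect)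
 have "base_box n False i ~= {}" unfolding base_box_def
  by (auto simp: rect_def intro!: exI[of _ "Complex (1/4) (2 * real i + 1)"])
 thus "i = j" using base_box_disjoint[of i j n False] eq by (auto simp: base_box_stack_box)
qed

lemma planar_col: "col_ok a c d e Is ==> planar_tangle (col n b a c d e Is)"
proof -
 assume ok: "col_ok a c d e Is"
 obtain h where h: "isotopic_to_id h" "map_tangle h (base_tangle n (length Is) False b) = col n b a c d e Is"
  unfolding col_base_tangle[symmetric] by (rule col_isotopy[OF col_ok_stack ok, where n = n and b = b]) simp_all
 thus ?thesis
  using planar_map_tangle[OF isotopic_homeo[OF h(1)] planar_base_tangle[of False "length Is" n b]] by simp
qed

lemma base_disc_size:
 assumes "r --> k = 1"
 shows "disc_size (base_tangle n k r b) (base_out n k r) = n"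
  and "i < k ==> disc_size (base_tangle n k r b) (base_box n r i) = n + (if r then 1 else 0)"
proof -
 have "card {0, 2 * real k + 1} = 2" "card {2 * real i + 1, 2 * real i + 2} = 2" by simp_all
 thus "disc_size (base_tangle n k r b) (base_out n k r) = n"
  and "i < k ==> disc_size (base_tangle n k r b) (base_box n r i) = n + (if r then 1 else 0)"
  using base_curves_out[OF assms, of n] base_curves_box[OF assms, of i n]
  by (simp_all add: disc_size_def base_tangle_def card_boundary_points del: One_nat_def)
qed

lemma base_disc_sign:
 assumes r: "r --> k = 1"
 shows "disc_sign (base_tangle n k r b) (base_out n k r) = (if b then Pos else Neg)"
  and "i < k ==> disc_sign (base_tangle n k r b) (base_box n r i) = (if b then Pos else Neg)"
proof -
 let ?T = "base_tangle n k r b"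
 have pl: "planar_tangle ?T" by (rule planar_base_tangle[OF r])
 have sign: "disc_sign ?T D = (if b then Pos else Neg)"
  if D: "D \<in> discs ?T" and left: "!!z. z \<in> base_marks n k r Int bd D ==> z ~: base_colour n r" for D
 proof -
  have "base_marks n k r Int bd D \<in> components (bd D - strings ?T)"
   using planar_tangleD(11)[OF pl D] by (simp add: base_tangle_def)
  hence ne: "base_marks n k r Int bd D ~= {}" and sub: "base_marks n k r Int bd D \<subseteq> bd D - strings ?T"
   using in_components_nonempty in_components_subset by blast+
  have "bd D \<subseteq> outer_disc ?T - interiors (inner_discs ?T)"
  proof -
   have "bd D Int interior E = {}" if E: "E \<in> inner_discs ?T" for E
   proof (cases "D = E")
    case False
    have "bd D Int E = {}"
    proof (cases "D = outer_disc ?T")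
     case True
     thus ?thesis using planar_tangleD(4)[OF pl E] by (auto simp: frontier_def)
    next
     case F: False
     hence "D \<in> inner_discs ?T" using D by (auto simp: discs_def)
     thus ?thesis using planar_frontier_subset[OF pl D] planar_tangleD(3)[OF pl] E False
      by (auto simp: disjoint_def)
    qed
    thus ?thesis using interior_subset by blast
   qed (auto simp: frontier_def)
   moreover have "D \<subseteq> outer_disc ?T"
    using D planar_tangleD(4)[OF pl, of D] interior_subset by (auto simp: discs_def)
   ultimately show ?thesis using planar_frontier_subset[OF pl D] by blast
  qed
  hence "shaded ?T Int (base_marks n k r Int bd D) = (if b then {} else base_marks n k r Int bd D)"
   using sub left by (auto simp: base_tangle_def)
  hence "base_marks n k r Int bd D \<subseteq> shaded ?T <-> \<not> b" using ne by (auto split: if_splits)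
  moreover have "marked ?T = base_marks n k r" by (simp add: base_tangle_def)
  ultimately show ?thesis by (simp add: disc_sign_def)
 qed
 have out: "base_out n k r \<in> discs ?T" and box: "i < k ==> base_box n r i \<in> discs ?T"
  by (auto simp: discs_def base_tangle_def)
 have l: "z ~: base_colour n r" if "Re z < 1" for z
  using that lines_left_less_1[OF that, of n] by (simp add: base_colour_def base_ring_def in_rect)
 show "disc_sign ?T (base_out n k r) = (if b then Pos else Neg)"
 proof (rule sign[OF out])
  fix z assume "z \<in> base_marks n k r Int bd (base_out n k r)"
  hence z: "z \<in> bd (base_out n k r)" "n = 0 | Re z < 1" unfolding base_marks_out by auto
  show "z ~: base_colour n r"
  proof (cases "Re z < 1")
   case False
   hence "n = 0" using z by simp
   moreover have "r ==> z ~: base_ring n"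
    using z r `n = 0` by (auto simp: base_out_def base_ring_def in_bd_rect in_rect)
   ultimately show ?thesis by (auto simp: base_colour_def lines_left_def)
  qed (rule l)
 qed
 show "i < k ==> disc_sign ?T (base_box n r i) = (if b then Pos else Neg)"
  using l by (intro sign box) (auto simp: base_marks_box)
qed

context planar_algebra
begin

lemma base_disc_space:
 assumes "r --> k = 1"
 shows "disc_space A (base_tangle n k r (s = Pos)) (base_out n k r) = box_space A n s"
  and "i < k ==> disc_space A (base_tangle n k r (s = Pos)) (base_box n r i) = box_space A (n + (if r then 1 else 0)) s"
 using base_disc_size[OF assms] base_disc_sign[OF assms]
 by (cases s; simp add: disc_space_def)+

lemma col_disc_space:
 assumes ok: "col_ok a c d e Is"
 shows "disc_space A (col n (s = Pos) a c d e Is) (col_box n a (c, d)) = box_space A n s"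
  and "I \<in> set Is ==> disc_space A (col n (s = Pos) a c d e Is) (col_box n e I) = box_space A n s"
proof -
 obtain h where h: "isotopic_to_id h" "map_tangle h (base_tangle n (length Is) False (s = Pos)) = col n (s = Pos) a c d e Is"
  "h ` col_box n (1/8) (0, 2 * real (length Is) + 1) = col_box n a (c, d)"
  "!!i. i < length Is ==> h ` col_box n (1/4) (stack_intervals (length Is) ! i) = col_box n e (Is ! i)"
  unfolding col_base_tangle[symmetric]
  by (rule col_isotopy[OF col_ok_stack[of "length Is"] ok length_stack_intervals, where n = n and b = "s = Pos"])
   (simp only: length_stack_intervals)
 note sp = planar_disc_space_map(2)[OF planar_base_tangle h(1,2)]
 have "col_box n (1/8) (0, 2 * real (length Is) + 1) = base_out n (length Is) False" by (simp add: col_box_def base_out_def add.commute)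
 thus "disc_space A (col n (s = Pos) a c d e Is) (col_box n a (c, d)) = box_space A n s"
  using sp[of "base_out n (length Is) False"] base_disc_space(1)[of False "length Is" n s] h(3) by simp
 assume "I \<in> set Is"
 then obtain i where i: "i < length Is" "I = Is ! i" by (metis in_set_conv_nth)
 show "disc_space A (col n (s = Pos) a c d e Is) (col_box n e I) = box_space A n s"
  using sp[of "base_box n False i"] base_disc_space(2)[of False "length Is" i n s] h(4)[OF i(1)] i
  by (simp add: stack_intervals_nth base_box_stack_box)
qed

text \<open>The value of a column depends on the contents of its boxes only.\<close>

lemma act_col_eq_stack:
 assumes ok: "col_ok a c d e Is"
  and g: "!!i. i < length Is ==> g (stack_box n i) \<in> box_space A n s"
  and fg: "!!i. i < length Is ==> f (col_box n e (Is ! i)) = g (stack_box n i)"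
 shows "act A (col n (s = Pos) a c d e Is) f = act A (stack_tangle n s (length Is)) g"
proof -
 obtain h where h: "isotopic_to_id h" "map_tangle h (stack_tangle n s (length Is)) = col n (s = Pos) a c d e Is"
  "!!i. i < length Is ==> h ` col_box n (1/4) (stack_intervals (length Is) ! i) = col_box n e (Is ! i)"
  unfolding stack_tangle_col
  by (rule col_isotopy[OF col_ok_stack[of "length Is"] ok length_stack_intervals, where n = n and b = "s = Pos"])
   (simp only: length_stack_intervals)
 have D: "\<exists>i<length Is. D = stack_box n i" if "D \<in> inner_discs (stack_tangle n s (length Is))" for D
  using that unfolding stack_tangle_base by (auto simp: base_tangle_def base_box_stack_box)
 show ?thesis
 proof (rule act_map_eq[OF planar_stack_tangle h(1,2)])
  fix D assume "D \<in> inner_discs (stack_tangle n s (length Is))"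
  then obtain i where i: "i < length Is" "D = stack_box n i" using D by blast
  show "f (h ` D) = g D" using h(3)[OF i(1)] fg[OF i(1)] i by (simp add: stack_intervals_nth)
  show "g D \<in> disc_space A (stack_tangle n s (length Is)) D"
   using g[OF i(1)] base_disc_space(2)[of False "length Is" i n s] i
   by (simp add: stack_tangle_base base_box_stack_box)
 qed
qed

lemma labelling_stackI:
 "(!!i. i < k ==> g (stack_box n i) \<in> box_space A n s) ==> D \<in> inner_discs (stack_tangle n s k) ==>
  g D \<in> disc_space A (stack_tangle n s k) D"
 using base_disc_space(2)[of False k _ n s]
 by (auto simp: stack_tangle_base base_tangle_def base_box_stack_box)

lemma act_stack_closed:
 assumes "!!i. i < k ==> g (stack_box n i) \<in> box_space A n s"
 shows "act A (stack_tangle n s k) g \<in> box_space A n s"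
proof -
 have "act A (stack_tangle n s k) g \<in> disc_space A (stack_tangle n s k) (outer_disc (stack_tangle n s k))"
  using labelling_stackI[of k g n s] assms by (intro act_closed planar_stack_tangle) (auto simp: labelling_def)
 thus ?thesis using base_disc_space(1)[of False k n s] by (simp add: stack_tangle_base base_tangle_def)
qed

end

text \<open>Gluing a column into a box of another column whose other boxes have the width of the new ones.\<close>

lemma glue_col:
 fixes n :: nat
 assumes ok: "col_ok e p q e' Js"
 defines "B == col_box n e (p, q)"
 assumes R: "!!E. E \<in> R ==> E Int B = {}" and BO: "B \<subseteq> interior out"
  and clR: "!!E. E \<in> R ==> closed E" and BR: "B ~: R"
  and pl: "planar_tangle (pat out (insert B R) (line_curves n) (line_colour n) b {z \<in> \<Union> (bd ` insert out (insert B R)). Re z < 1})"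
 shows "glue (pat out (insert B R) (line_curves n) (line_colour n) b {z \<in> \<Union> (bd ` insert out (insert B R)). Re z < 1})
    B (col n b e p q e' Js) =
   pat out (R Un col_box n e' ` set Js) (line_curves n) (line_colour n) b
    {z \<in> \<Union> (bd ` insert out (R Un col_box n e' ` set Js)). Re z < 1}" (is ?glue)
  and "gluable (pat out (insert B R) (line_curves n) (line_colour n) b {z \<in> \<Union> (bd ` insert out (insert B R)). Re z < 1})
    B (col n b e p q e' Js)" (is ?gluable)
  and "!!E. E \<in> col_box n e' ` set Js ==> E \<subseteq> interior B"
proof -
 have Bclosed: "closed B" by (simp add: B_def col_box_def closed_rect)
 have e: "e < e'" "0 < e" "e' < 1/2" using ok by (auto simp: col_ok_def)
 show J: "E \<subseteq> interior B" if "E \<in> col_box n e' ` set Js" for E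
 proof -
  from that obtain K where K: "E = col_box n e' K" "K \<in> set Js" by (rule imageE)
  hence "p < fst K" "snd K < q"
   using ok in_set_heights[of K Js] by (auto simp: col_ok_def sorted_wrt_append)
  thus ?thesis using e unfolding K B_def col_box_def by (auto simp: in_rect in_int_rect)
 qed
 let ?J = "col_box n e' ` set Js"
 have frB: "bd B \<subseteq> B" using Bclosed by (rule frontier_subset_closed)
 have fr1: "(bd out Un \<Union> (bd ` R)) Int bd B = {}"
 proof -
  have "bd out Int bd B = {}" using BO frB by (auto simp: frontier_def)
  moreover have "bd E Int bd B = {}" if "E \<in> R" for E
   using R[OF that] frB frontier_subset_closed[OF clR[OF that]] by blast
  ultimately show ?thesis by blast
 qed
 have frJ: "\<Union> (bd ` ?J) Int bd B = {}"
 proof -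
  have "bd E Int bd B = {}" if "E \<in> ?J" for E
  proof -
   have "closed E" using that by (auto simp: col_box_def closed_rect)
   hence "bd E \<subseteq> interior B" using J[OF that] frontier_subset_closed by blast
   thus ?thesis by (auto simp: frontier_def)
  qed
  thus ?thesis by blast
 qed
 let ?M = "{z \<in> \<Union> (bd ` insert out (insert B R)). Re z < 1}"
 let ?N = "{z \<in> \<Union> (bd ` insert B ?J). Re z < 1}"
 have eqs: "\<Union> (bd ` insert out (R Un ?J)) = (bd out Un \<Union> (bd ` R)) Un \<Union> (bd ` ?J)"
  "\<Union> (bd ` insert out (insert B R)) = (bd out Un \<Union> (bd ` R)) Un bd B"
  "\<Union> (bd ` insert B ?J) = bd B Un \<Union> (bd ` ?J)" by blast+
 have M: "{z \<in> \<Union> (bd ` insert out (R Un ?J)). Re z < 1} = (?M Un ?N) - bd B"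
  unfolding eqs using fr1 frJ by blast
 have I': "R Un ?J = insert B R - {B} Un ?J" using BR by blast
 have S: "col n b e p q e' Js = pat B ?J (line_curves n) (line_colour n) b ?N"
  by (simp add: col_def B_def)
 have BO': "B \<subseteq> out" using BO interior_subset by blast
 have disj: "E Int B = {}" if "E \<in> insert B R" "E ~= B" for E using that R by blast
 note g = glue_pat[OF insertI1 BO' disj J Bclosed refl refl refl refl M I']
 show ?glue unfolding S by (rule g(1))
 have pl2: "planar_tangle (col n b e p q e' Js)" by (rule planar_col[OF ok])
 have "?M Int bd B = ?N Int bd B" unfolding eqs using fr1 frJ by blast
 thus ?gluable using pl pl2 unfolding S by (intro g(2))
qed

context planar_algebra
begin

text \<open>Columns glued into both boxes of the multiplication tangle. Filling in a column with one box,
 which acts as the identity, equalises the widths of all boxes; associativity and the unit laws are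
 then comparisons of columns with the same number of boxes.\<close>

lemma act_two_columns:
 assumes ok: "col_ok (1/4) 3 4 (3/8) Is" "col_ok (1/4) 1 2 (3/8) Js"
  and f: "!!I. I \<in> set Is Un set Js ==> f (col_box n (3/8) I) \<in> box_space A n s"
  and x: "act A (col n (s = Pos) (1/4) 3 4 (3/8) Is) f = x"
  and y: "act A (col n (s = Pos) (1/4) 1 2 (3/8) Js) f = y"
 shows "box_mult A n s x y = act A (col n (s = Pos) (1/8) 0 5 (3/8) (Js @ Is)) f"
  and "col_ok (1/8) 0 5 (3/8) (Js @ Is)"
proof -
 let ?b = "s = Pos"
 let ?out = "col_box n (1/8) (0, 5)" and ?B0 = "stack_box n 0" and ?B1 = "stack_box n 1"
 let ?Is = "col_box n (3/8) ` set Is" and ?Js = "col_box n (3/8) ` set Js"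
 have B: "?B0 = col_box n (1/4) (1, 2)" "?B1 = col_box n (1/4) (3, 4)" by (simp_all add: stack_box_col_box)
 have si: "stack_intervals 2 = [(1, 2), (3, 4)]" by (simp add: stack_intervals_def numeral_2_eq_2)
 have ok0: "col_ok (1/8) 0 5 (1/4) [(1, 2), (3, 4)]" by (simp add: col_ok_def)
 show ok1: "col_ok (1/8) 0 5 (3/8) (Js @ Is)"
 proof -
  have "\<forall>p\<in>set (heights Is). 3 < p & p < 4" "\<forall>p\<in>set (heights Js). 1 < p & p < 2"
   using ok by (auto simp: col_ok_def sorted_wrt_append)
  thus ?thesis using ok by (fastforce simp: col_ok_def sorted_wrt_append)
 qed
 let ?T = "stack_tangle n s 2"
 let ?mk = "%R. {z \<in> \<Union> (bd ` insert ?out R). Re z < 1}"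
 have T: "?T = pat ?out (insert ?B1 {?B0}) (line_curves n) (line_colour n) ?b (?mk (insert ?B1 {?B0}))"
  unfolding stack_tangle_col si col_def B by (simp add: insert_commute)
 have sub: "?B0 \<subseteq> interior ?out" "?B1 \<subseteq> interior ?out" "?B0 Int ?B1 = {}"
  unfolding B col_box_def by (auto simp: in_rect in_int_rect)
 let ?S1 = "col n ?b (1/4) 3 4 (3/8) Is" and ?S0 = "col n ?b (1/4) 1 2 (3/8) Js"
 have ne: "?B1 ~= ?B0" using stack_box_inj[of n 1 0] by auto
 have plT: "planar_tangle ?T" by (rule planar_stack_tangle)
 let ?G1 = "pat ?out ({?B0} Un ?Is) (line_curves n) (line_colour n) ?b (?mk ({?B0} Un ?Is))"
 have c0: "closed ?B0" by (simp add: stack_box_def closed_rect)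
 have g1: "glue ?T ?B1 ?S1 = ?G1" "gluable ?T ?B1 ?S1" "!!E. E \<in> ?Is ==> E \<subseteq> interior ?B1"
  using glue_col[OF ok(1), of "{?B0}" n ?out ?b] sub ne c0 plT unfolding B(2)[symmetric] T by blast+
 interpret g1: gluing ?T ?B1 ?S1 by unfold_locales (rule g1(2))
 have plG1: "planar_tangle ?G1" using g1.planar_G g1(1) by simp
 let ?G = "pat ?out (?Is Un ?Js) (line_curves n) (line_colour n) ?b (?mk (?Is Un ?Js))"
 have R1: "E Int ?B0 = {}" if "E \<in> ?Is" for E
  using g1(3)[OF that] sub interior_subset[of ?B1] by blast
 have "Complex (1/4) 1 \<in> ?B0" by (simp add: stack_box_def in_rect)
 hence notin: "?B0 ~: ?Is" using R1 by blast
 have cI: "closed E" if "E \<in> ?Is" for E using that by (auto simp: col_box_def closed_rect)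
 have eI: "{?B0} Un ?Is = insert ?B0 ?Is" by simp
 have g0: "glue ?G1 ?B0 ?S0 = ?G" "gluable ?G1 ?B0 ?S0"
  using glue_col(1,2)[OF ok(2), of ?Is n ?out ?b] R1 sub(1) cI notin plG1 unfolding B(1)[symmetric] eI by blast+
 interpret g0: gluing ?G1 ?B0 ?S0 by unfold_locales (rule g0(2))
 have G: "?G = col n ?b (1/8) 0 5 (3/8) (Js @ Is)"
  by (simp add: col_def image_Un Un_commute)
 have fS0: "f E \<in> disc_space A ?S0 E" if "E \<in> inner_discs ?S0" for E
  using that f col_disc_space(2)[OF ok(2), of _ n s] by (auto simp: col_def[of _ _ _ _ _ _ Js])
 have fS1: "f E \<in> disc_space A ?S1 E" if "E \<in> inner_discs ?S1" for E
  using that f col_disc_space(2)[OF ok(1), of _ n s] by (auto simp: col_def[of _ _ _ _ _ _ Is])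
 let ?f1 = "f(?B0 := y)"
 have yV: "y \<in> box_space A n s"
 proof -
  have "act A ?S0 f \<in> disc_space A ?S0 (outer_disc ?S0)"
   using fS0 by (intro act_closed planar_col[OF ok(2)]) (simp add: labelling_def)
  thus ?thesis using y col_disc_space(1)[OF ok(2), of n s] by (simp add: col_def)
 qed
 have "act A ?G f = act A ?G1 ?f1"
 proof (rule act_glue_eq[OF g0(2,1) fS0])
  fix E assume E: "E \<in> inner_discs ?G1" "E ~= ?B0"
  hence "E \<in> ?Is" by simp
  hence "disc_space A ?G1 E = disc_space A ?S1 E"
   using g1.disc_space_glue(2)[of E A] g1(1) by (simp add: col_def)
  thus "?f1 E \<in> disc_space A ?G1 E" using fS1[of E] E `E \<in> ?Is` by (simp add: col_def)
 qed (use y in auto)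
 also have "act A ?G1 ?f1 = act A ?T (%D. if D = ?B1 then x else y)"
 proof (rule act_glue_eq[OF g1(2,1)])
  show "?f1 E \<in> disc_space A ?S1 E" if "E \<in> inner_discs ?S1" for E
   using fS1[OF that] that notin by (auto simp: col_def)
  show "(if E = ?B1 then x else y) \<in> disc_space A ?T E" if "E \<in> inner_discs ?T" "E ~= ?B1" for E
   using that yV labelling_stackI[of 2 "%_. y" n s E] by auto
  show "?f1 E = (if E = ?B1 then x else y)" if "E \<in> inner_discs ?T" "E ~= ?B1" for E
   using that unfolding T by simp
  have "act A ?S1 ?f1 = act A ?S1 f"
   using fS1 notin by (intro act_cong[OF planar_col[OF ok(1)], symmetric]) (auto simp: labelling_def col_def)
  thus "act A ?S1 ?f1 = (if ?B1 = ?B1 then x else y)" using x by simp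
 qed
 also have "... = box_mult A n s x y" by (simp add: box_mult_def)
 finally show "box_mult A n s x y = act A (col n (s = Pos) (1/8) 0 5 (3/8) (Js @ Is)) f" unfolding G by simp
qed

lemma act_stack_1: "g (stack_box n 0) \<in> box_space A n s ==> act A (stack_tangle n s 1) g = g (stack_box n 0)"
proof -
 assume g: "g (stack_box n 0) \<in> box_space A n s"
 have "act A (stack_tangle n s 1) g = act A (stack_tangle n s 1) (%_. g (stack_box n 0))"
  using g labelling_stackI[of 1 g n s]
  by (intro act_cong planar_stack_tangle) (auto simp: labelling_def stack_tangle_base base_tangle_def base_box_stack_box)
 thus ?thesis using act_identity[OF g] by simp
qed

lemma act_col_nil: "col_ok a c d e [] ==> act A (col n (s = Pos) a c d e []) f = box_unit A n s"
 using act_col_eq_stack[of a c d e "[]" "%_. 0" n s f] by (simp add: box_unit_def)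

lemma act_col_one:
 "col_ok a c d e [I] ==> f (col_box n e I) \<in> box_space A n s ==> act A (col n (s = Pos) a c d e [I]) f = f (col_box n e I)"
 using act_col_eq_stack[of a c d e "[I]" "%_. f (col_box n e I)" n s f] act_stack_1[of "%_. f (col_box n e I)" n s] by simp

lemma act_col_two:
 assumes ok: "col_ok a c d e [I, J]" and f: "f (col_box n e I) \<in> box_space A n s" "f (col_box n e J) \<in> box_space A n s"
 shows "act A (col n (s = Pos) a c d e [I, J]) f = box_mult A n s (f (col_box n e J)) (f (col_box n e I))"
proof -
 let ?g = "%D. if D = stack_box n 1 then f (col_box n e J) else f (col_box n e I)"
 have ne: "stack_box n 0 ~= stack_box n 1" using stack_box_inj[of n 0 1] by auto
 have "act A (col n (s = Pos) a c d e [I, J]) f = act A (stack_tangle n s (length [I, J])) ?g"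
 proof (rule act_col_eq_stack[OF ok])
  fix i assume "i < length [I, J]"
  then consider "i = 0" | "i = 1" by fastforce
  thus "?g (stack_box n i) \<in> box_space A n s" "f (col_box n e ([I, J] ! i)) = ?g (stack_box n i)"
   using f ne by (cases; simp)+
 qed
 thus ?thesis by (simp add: box_mult_def numeral_2_eq_2)
qed

lemma act_col_three:
 assumes ok: "col_ok a c d e [I, J, K]" and f: "f (col_box n e I) = z" "f (col_box n e J) = y" "f (col_box n e K) = x"
  and V: "x \<in> box_space A n s" "y \<in> box_space A n s" "z \<in> box_space A n s"
 shows "act A (col n (s = Pos) a c d e [I, J, K]) f =
  act A (stack_tangle n s 3) (%D. if D = stack_box n 0 then z else if D = stack_box n 1 then y else x)"
proof -
 let ?g = "%D. if D = stack_box n 0 then z else if D = stack_box n 1 then y else x"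
 have ne: "stack_box n 1 ~= stack_box n 0" "stack_box n 2 ~= stack_box n 0" "stack_box n 2 ~= stack_box n 1"
  using stack_box_inj[of n 1 0] stack_box_inj[of n 2 0] stack_box_inj[of n 2 1] by auto
 have "act A (col n (s = Pos) a c d e [I, J, K]) f = act A (stack_tangle n s (length [I, J, K])) ?g"
 proof (rule act_col_eq_stack[OF ok])
  fix i assume "i < length [I, J, K]"
  then consider "i = 0" | "i = 1" | "i = 2" by fastforce
  thus "?g (stack_box n i) \<in> box_space A n s" "f (col_box n e ([I, J, K] ! i)) = ?g (stack_box n i)"
   using f V ne by (cases; simp)+
 qed
 thus ?thesis by (simp add: numeral_3_eq_3)
qed

lemma box_unit_closed: "box_unit A n s \<in> box_space A n s"
 unfolding box_unit_def by (rule act_stack_closed) simp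

lemma box_mult_closed: "x \<in> box_space A n s ==> y \<in> box_space A n s ==> box_mult A n s x y \<in> box_space A n s"
 unfolding box_mult_def by (rule act_stack_closed) simp

lemma box_mult_unit_left:
 assumes x: "x \<in> box_space A n s"
 shows "box_mult A n s (box_unit A n s) x = x"
proof -
 let ?J = "(5/4, 7/4) :: real \<times> real"
 have ok: "col_ok (1/4) 3 4 (3/8) []" "col_ok (1/4) 1 2 (3/8) [?J]" by (simp_all add: col_ok_def)
 note t = act_two_columns[OF ok, of "%_. x" n s "box_unit A n s" x]
 have "box_mult A n s (box_unit A n s) x = act A (col n (s = Pos) (1/8) 0 5 (3/8) ([?J] @ [])) (%_. x)"
  using x act_col_nil[OF ok(1), of n s] act_col_one[OF ok(2), of "%_. x" n s] by (intro t) auto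
 also have "... = x" using x by (simp add: act_col_one col_ok_def)
 finally show ?thesis .
qed

lemma box_mult_unit_right:
 assumes x: "x \<in> box_space A n s"
 shows "box_mult A n s x (box_unit A n s) = x"
proof -
 let ?J = "(13/4, 15/4) :: real \<times> real"
 have ok: "col_ok (1/4) 3 4 (3/8) [?J]" "col_ok (1/4) 1 2 (3/8) []" by (simp_all add: col_ok_def)
 note t = act_two_columns[OF ok, of "%_. x" n s x "box_unit A n s"]
 have "box_mult A n s x (box_unit A n s) = act A (col n (s = Pos) (1/8) 0 5 (3/8) ([] @ [?J])) (%_. x)"
  using x act_col_nil[OF ok(2), of n s] act_col_one[OF ok(1), of "%_. x" n s] by (intro t) auto
 also have "... = x" using x by (simp add: act_col_one col_ok_def)
 finally show ?thesis .
qed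

lemma col_box_inj: "col_ok a c d e Is ==> I \<in> set Is ==> J \<in> set Is ==> col_box n e I = col_box n e J ==> I = J"
proof -
 assume ok: "col_ok a c d e Is" and IJ: "I \<in> set Is" "J \<in> set Is" and eq: "col_box n e I = col_box n e J"
 have e: "e < 1/2" and less: "fst I < snd I" "fst J < snd J"
  using ok IJ heights_sorted_interval[of Is] by (auto simp: col_ok_def sorted_wrt_append)
 have "Complex e (fst K) \<in> col_box n e K" "Complex e (snd K) \<in> col_box n e K" if "fst K < snd K" for K
  using e that by (simp_all add: col_box_def in_rect)
 hence "Complex e (fst I) \<in> col_box n e J" "Complex e (snd I) \<in> col_box n e J"
  "Complex e (fst J) \<in> col_box n e I" "Complex e (snd J) \<in> col_box n e I"
  using less eq by metis+
 thus "I = J" by (auto simp: col_box_def in_rect prod_eq_iff)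
qed

lemma box_mult_assoc:
 assumes x: "x \<in> box_space A n s" and y: "y \<in> box_space A n s" and z: "z \<in> box_space A n s"
 shows "box_mult A n s (box_mult A n s x y) z = box_mult A n s x (box_mult A n s y z)"
proof -
 let ?a = "(9/8, 10/8) :: real \<times> real" and ?b = "(11/8, 12/8) :: real \<times> real"
  and ?c = "(25/8, 26/8) :: real \<times> real" and ?d = "(27/8, 28/8) :: real \<times> real"
 let ?B = "col_box n (3/8)"
 have neq: "?B I ~= ?B J" if "I \<in> set [?a, ?b, ?c, ?d]" "J \<in> set [?a, ?b, ?c, ?d]" "I ~= J" for I J
  using col_box_inj[of "1/8" 0 5 "3/8" "[?a, ?b, ?c, ?d]" I J n] that by (auto simp: col_ok_def)
 have okl: "col_ok (1/4) 3 4 (3/8) [?c, ?d]" "col_ok (1/4) 1 2 (3/8) [?a]" by (simp_all add: col_ok_def)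
 have okr: "col_ok (1/4) 3 4 (3/8) [?c]" "col_ok (1/4) 1 2 (3/8) [?a, ?b]" by (simp_all add: col_ok_def)
 obtain f where f: "f (?B ?a) = z" "f (?B ?c) = y" "f (?B ?d) = x"
 proof
  let ?f = "%D. if D = ?B ?a then z else if D = ?B ?c then y else x"
  have "?B ?c ~= ?B ?a" "?B ?d ~= ?B ?a" "?B ?d ~= ?B ?c" by (intro neq; simp)+
  thus "?f (?B ?a) = z" "?f (?B ?c) = y" "?f (?B ?d) = x" by presburger+
 qed
 obtain g where g: "g (?B ?a) = z" "g (?B ?b) = y" "g (?B ?c) = x"
 proof
  let ?f = "%D. if D = ?B ?a then z else if D = ?B ?b then y else x"
  have "?B ?b ~= ?B ?a" "?B ?c ~= ?B ?a" "?B ?c ~= ?B ?b" by (intro neq; simp)+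
  thus "?f (?B ?a) = z" "?f (?B ?b) = y" "?f (?B ?c) = x" by presburger+
 qed
 have ok3: "col_ok (1/8) 0 5 (3/8) [?a, ?c, ?d]" "col_ok (1/8) 0 5 (3/8) [?a, ?b, ?c]" by (simp_all add: col_ok_def)
 have fV: "f (?B I) \<in> box_space A n s" if "I \<in> set [?c, ?d] Un set [?a]" for I using that f x y z by auto
 have gV: "g (?B I) \<in> box_space A n s" if "I \<in> set [?c] Un set [?a, ?b]" for I using that g x y z by auto
 have "box_mult A n s (box_mult A n s x y) z = act A (col n (s = Pos) (1/8) 0 5 (3/8) ([?a] @ [?c, ?d])) f"
 proof (rule act_two_columns(1)[OF okl, where f = f, OF fV])
  show "act A (col n (s = Pos) (1/4) 3 4 (3/8) [?c, ?d]) f = box_mult A n s x y"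
   using act_col_two[OF okl(1), of f n s] f x y by simp
  show "act A (col n (s = Pos) (1/4) 1 2 (3/8) [?a]) f = z"
   using act_col_one[OF okl(2), of f n s] f z by simp
 qed
 also have "... = act A (col n (s = Pos) (1/8) 0 5 (3/8) ([?a, ?b] @ [?c])) g"
  using act_col_three[OF ok3(1) f x y z] act_col_three[OF ok3(2) g x y z] by simp
 also have "... = box_mult A n s x (box_mult A n s y z)"
 proof (rule act_two_columns(1)[OF okr, where f = g, OF gV, symmetric])
  show "act A (col n (s = Pos) (1/4) 3 4 (3/8) [?c]) g = x"
   using act_col_one[OF okr(1), of g n s] g x by simp
  show "act A (col n (s = Pos) (1/4) 1 2 (3/8) [?a, ?b]) g = box_mult A n s y z"
   using act_col_two[OF okr(2), of g n s] g y z by simp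
 qed
 finally show ?thesis .
qed

end

section \<open>The star structure\<close>

lemma plane_homeo_cnj: "plane_homeo cnj"
proof (rule plane_homeoI)
 show "continuous_on UNIV cnj" by (intro continuous_intros)
 show "inj cnj" by (auto simp: inj_def)
 show "\<exists>z. cnj z = w" for w by (rule exI[of _ "cnj w"]) simp
qed

lemma cnj_image_iff: "z \<in> cnj ` S <-> cnj z \<in> S"
 by (metis complex_cnj_cnj image_iff)

lemma cnj_rect: "cnj ` rect a b c d = rect a b (- d) (- c)"
 by (rule set_eqI) (auto simp: cnj_image_iff in_rect)

lemma cnj_col_box: "cnj ` col_box n a (p, q) = col_box n a (- q, - p)"
 by (simp add: col_box_def cnj_rect)

lemma map_cnj_col:
 assumes "set Js = (%(p, q). (- q, - p)) ` set Is"
 shows "map_tangle cnj (col n b a c d e Is) = col n b a (- d) (- c) e Js"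
proof -
 have ins: "(`) cnj ` col_box n e ` set Is = col_box n e ` set Js"
 proof -
  have "cnj ` col_box n e I = col_box n e (case I of (p, q) => (- q, - p))" for I
   by (cases I) (simp add: cnj_col_box)
  thus ?thesis by (simp add: assms image_image)
 qed
 have out: "cnj ` col_box n a (c, d) = col_box n a (- d, - c)" by (rule cnj_col_box)
 let ?F = "\<Union> (bd ` insert (col_box n a (c, d)) (col_box n e ` set Is))"
 let ?F' = "\<Union> (bd ` insert (col_box n a (- d, - c)) (col_box n e ` set Js))"
 have F: "cnj ` ?F = ?F'"
  unfolding ins[symmetric] out[symmetric]
  by (simp add: image_Un image_UN image_image frontier_homeo_image[OF plane_homeo_cnj])
 show ?thesis
  unfolding col_def
 proof (rule map_pat[OF plane_homeo_cnj out ins])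
  show "cnj ` {z \<in> ?F. Re z < 1} = {z \<in> ?F'. Re z < 1}"
   unfolding F[symmetric] by (auto simp: cnj_image_iff)
 qed (simp_all add: line_curves_def line_colour_def lines_left_def)
qed

context star_planar_algebra
begin

lemma stack_disc_size_sign:
 assumes "i < k"
 shows "disc_size (stack_tangle n s k) (stack_box n i) = n" "disc_sign (stack_tangle n s k) (stack_box n i) = s"
 using base_disc_size(2)[of False k i n] base_disc_sign(2)[of False k i n] assms
 by (cases s; simp add: stack_tangle_base base_box_stack_box)+

lemma stack_outer_size_sign:
 "disc_size (stack_tangle n s k) (outer_disc (stack_tangle n s k)) = n"
 "disc_sign (stack_tangle n s k) (outer_disc (stack_tangle n s k)) = s"
 using base_disc_size(1)[of False k n] base_disc_sign(1)[of False k n]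
 by (cases s; simp add: stack_tangle_base base_tangle_def)+

lemma adj_act_stack:
 assumes "!!i. i < k ==> f (stack_box n i) \<in> box_space A n s"
 shows "adj A n s (act A (stack_tangle n s k) f) = act A (map_tangle cnj (stack_tangle n s k))
  (%D. adj A (disc_size (stack_tangle n s k) (cnj ` D)) (disc_sign (stack_tangle n s k) (cnj ` D)) (f (cnj ` D)))"
 using adj_act[OF planar_stack_tangle[of n s k], of f] labelling_stackI[of k f n s] assms
 unfolding stack_outer_size_sign by (simp add: labelling_def)

lemma adj_box_mult:
 assumes x: "x \<in> box_space A n s" and y: "y \<in> box_space A n s"
 shows "adj A n s (box_mult A n s x y) = box_mult A n s (adj A n s y) (adj A n s x)"
proof -
 let ?T = "stack_tangle n s 2" and ?f = "%D. if D = stack_box n 1 then x else y"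
 let ?I = "(- 4, - 3) :: real \<times> real" and ?J = "(- 2, - 1) :: real \<times> real"
 have m: "map_tangle cnj ?T = col n (s = Pos) (1/8) (- 5) 0 (1/4) [?I, ?J]"
  unfolding stack_tangle_col using map_cnj_col[of "[?I, ?J]" "stack_intervals 2" n "s = Pos" "1/8" 0 5 "1/4"]
  by (simp add: stack_intervals_def numeral_2_eq_2 insert_commute)
 have ne: "stack_box n 0 ~= stack_box n 1" using stack_box_inj[of n 0 1] by auto
 have im: "cnj ` col_box n (1/4) ?I = stack_box n 1" "cnj ` col_box n (1/4) ?J = stack_box n 0"
  by (simp_all add: cnj_col_box stack_box_col_box)
 let ?g = "%D. adj A (disc_size ?T (cnj ` D)) (disc_sign ?T (cnj ` D)) (?f (cnj ` D))"
 have g: "?g (col_box n (1/4) ?I) = adj A n s x" "?g (col_box n (1/4) ?J) = adj A n s y"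
  unfolding im using ne by (simp_all add: stack_disc_size_sign)
 have "adj A n s (box_mult A n s x y) = act A (col n (s = Pos) (1/8) (- 5) 0 (1/4) [?I, ?J]) ?g"
  unfolding box_mult_def m[symmetric] using x y by (intro adj_act_stack) auto
 also have "... = box_mult A n s (?g (col_box n (1/4) ?J)) (?g (col_box n (1/4) ?I))"
 proof (rule act_col_two[where f = ?g])
  show "col_ok (1/8) (- 5) 0 (1/4) [?I, ?J]" by (simp add: col_ok_def)
  show "?g (col_box n (1/4) ?I) \<in> box_space A n s" "?g (col_box n (1/4) ?J) \<in> box_space A n s"
   unfolding g using x y by (auto intro: adj_closed)
 qed
 finally show ?thesis unfolding g .
qed

end

section \<open>Linearity\<close>

context planar_algebra
begin

interpretation vector_space "scl A" by (rule vector_space_scl)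

lemma box_add: "x \<in> box_space A n s ==> y \<in> box_space A n s ==> x + y \<in> box_space A n s"
 and box_scl: "x \<in> box_space A n s ==> scl A c x \<in> box_space A n s"
 and box_zero: "0 \<in> box_space A n s"
 using subspace_box_space[of n s] by (auto simp: subspace_add subspace_scale subspace_0)

lemma act_one_disc_linear:
 assumes T: "planar_tangle T" "inner_discs T = {D}" and x: "x \<in> disc_space A T D" and y: "y \<in> disc_space A T D"
 shows "act A T (%_. x + y) = act A T (%_. x) + act A T (%_. y)" "act A T (%_. scl A c x) = scl A c (act A T (%_. x))"
proof -
 have lab: "labelling A T (%_. z)" if "z \<in> disc_space A T D" for z using that T by (simp add: labelling_def)
 have upd: "act A T ((%_. x)(D := z)) = act A T (%_. z)" if "z \<in> disc_space A T D" for z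
  by (rule act_cong[OF T(1), symmetric, OF lab[OF that]]) (simp add: T(2))
 have V: "x + y \<in> disc_space A T D" "scl A c x \<in> disc_space A T D"
  using x y by (simp_all add: disc_space_def box_add box_scl)
 show "act A T (%_. x + y) = act A T (%_. x) + act A T (%_. y)"
  using act_add[OF T(1) lab[OF x], of D x y] T(2) x y upd[OF V(1)] upd[OF x] upd[OF y] by simp
 show "act A T (%_. scl A c x) = scl A c (act A T (%_. x))"
  using act_scale[OF T(1) lab[OF x], of D x c] T(2) x upd[OF V(2)] upd[OF x] by simp
qed

lemma stack_2_inner: "inner_discs (stack_tangle n s 2) = {stack_box n 0, stack_box n 1}"
 by (simp add: stack_tangle_base base_tangle_def base_box_stack_box numeral_2_eq_2 lessThan_Suc insert_commute)

lemma box_mult_linear_left: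
 assumes x: "x \<in> box_space A n s" and y: "y \<in> box_space A n s" and z: "z \<in> box_space A n s"
 shows "box_mult A n s (x + y) z = box_mult A n s x z + box_mult A n s y z"
  "box_mult A n s (scl A c x) z = scl A c (box_mult A n s x z)"
proof -
 let ?T = "stack_tangle n s 2"
 have e: "(%D. if D = stack_box n 1 then w else z) = (%_. z)(stack_box n 1 := w)" for w by auto
 have lab: "labelling A ?T (%_. z)" using labelling_stackI[of 2 "%_. z" n s] z by (simp add: labelling_def)
 have D: "stack_box n 1 \<in> inner_discs ?T" by (simp add: stack_2_inner)
 have dx: "disc_space A ?T (stack_box n 1) = box_space A n s"
  using base_disc_space(2)[of False 2 1 n s] by (simp add: stack_tangle_base base_box_stack_box)
 show "box_mult A n s (x + y) z = box_mult A n s x z + box_mult A n s y z"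
  "box_mult A n s (scl A c x) z = scl A c (box_mult A n s x z)"
  unfolding box_mult_def e
  using act_add[OF planar_stack_tangle lab D, of x y] act_scale[OF planar_stack_tangle lab D, of x c] x y
  by (simp_all add: dx del: One_nat_def)
qed

lemma box_mult_linear_right:
 assumes x: "x \<in> box_space A n s" and y: "y \<in> box_space A n s" and z: "z \<in> box_space A n s"
 shows "box_mult A n s z (x + y) = box_mult A n s z x + box_mult A n s z y"
  "box_mult A n s z (scl A c x) = scl A c (box_mult A n s z x)"
proof -
 let ?T = "stack_tangle n s 2"
 have ne: "stack_box n 0 ~= stack_box n 1" using stack_box_inj[of n 0 1] by auto
 have lab: "labelling A ?T (%_. z)" using labelling_stackI[of 2 "%_. z" n s] z by (simp add: labelling_def)
 have e: "box_mult A n s z w = act A ?T ((%_. z)(stack_box n 0 := w))" if "w \<in> box_space A n s" for w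
  unfolding box_mult_def using labelling_stackI[of 2 "%D. if D = stack_box n 1 then z else w" n s] z that ne
  by (intro act_cong planar_stack_tangle) (auto simp: labelling_def stack_2_inner)
 have D: "stack_box n 0 \<in> inner_discs ?T" by (simp add: stack_2_inner)
 have dx: "disc_space A ?T (stack_box n 0) = box_space A n s"
  using base_disc_space(2)[of False 2 0 n s] by (simp add: stack_tangle_base base_box_stack_box)
 show "box_mult A n s z (x + y) = box_mult A n s z x + box_mult A n s z y"
  "box_mult A n s z (scl A c x) = scl A c (box_mult A n s z x)"
  using act_add[OF planar_stack_tangle lab D, of x y] act_scale[OF planar_stack_tangle lab D, of x c] x y
  by (simp_all add: dx e box_add box_scl)
qed

end

section \<open>Scalars\<close>

context subfactor_planar_algebra
begin

interpretation vector_space "scl A" by (rule vector_space_scl)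

lemma unit_nonzero_if_dim:
 assumes "vector_space.dim (scl A) (box_space A n s) = 1"
 shows "box_unit A n s ~= 0"
proof
 assume 0: "box_unit A n s = 0"
 have "x = 0" if x: "x \<in> box_space A n s" for x
 proof -
  have "box_mult A n s 0 x = 0"
   using box_mult_linear_left(2)[OF x x x, of 0] by simp
  thus ?thesis using box_mult_unit_left[OF x] 0 by simp
 qed
 hence "box_space A n s \<subseteq> {0}" by auto
 hence "dim (box_space A n s) = 0"
  by (metis dim_eq_card_independent card.empty dim_span independent_empty span_empty span_mono span_insert_0 subset_antisym
    box_zero insert_subset empty_subsetI)
 thus False using assms by simp
qed

lemma scalar_space:
 assumes v: "v \<in> box_space A 0 s"
 obtains c where "v = scl A c (box_unit A 0 s)"
proof -
 have u: "box_unit A 0 s \<in> box_space A 0 s" "box_unit A 0 s ~= 0"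
  using box_unit_closed unit_nonzero_if_dim[OF dim_zero] by auto
 obtain B where B: "B \<subseteq> box_space A 0 s" "independent B" "box_space A 0 s \<subseteq> span B" "card B = dim (box_space A 0 s)"
  using basis_exists by blast
 then obtain e where e: "B = {e}" using dim_zero[of s] card_1_singletonE by metis
 have sp: "\<exists>k. w = scl A k e" if "w \<in> box_space A 0 s" for w
  using that B(3) unfolding e span_singleton by auto
 obtain k l where kl: "box_unit A 0 s = scl A k e" "v = scl A l e" using sp u v by blast
 hence "k ~= 0" using u by auto
 hence "v = scl A (l / k) (box_unit A 0 s)" using kl by simp
 thus thesis by (rule that)
qed

lemma scalar_of_scl: "scalar_of A s (scl A c (box_unit A 0 s)) = c"
proof -
 have "box_unit A 0 s ~= 0" using unit_nonzero_if_dim[OF dim_zero] .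
 thus ?thesis unfolding scalar_of_def by (intro the_equality) (auto simp: scale_cancel_right)
qed

lemma scalar_of: "v \<in> box_space A 0 s ==> v = scl A (scalar_of A s v) (box_unit A 0 s)"
 using scalar_space[of v s] scalar_of_scl by metis

lemma scalar_of_add: "v \<in> box_space A 0 s ==> w \<in> box_space A 0 s ==>
  scalar_of A s (v + w) = scalar_of A s v + scalar_of A s w"
 by (metis scalar_of scalar_of_scl scale_left_distrib)

lemma scalar_of_scale: "v \<in> box_space A 0 s ==> scalar_of A s (scl A c v) = c * scalar_of A s v"
 by (metis scalar_of scalar_of_scl scale_scale)

lemma adj_box_unit: "adj A n s (box_unit A n s) = box_unit A n s"
 by (metis adj_adj adj_box_mult adj_closed box_mult_unit_left box_mult_unit_right box_unit_closed)

end

section \<open>Traces\<close>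

lemma prod_map_in_rect:
 assumes "incr_homeo f" "incr_homeo g" "f a = a'" "f b = b'" "g c = c'" "g d = d'"
 shows "prod_map f g z \<in> rect a' b' c' d' <-> z \<in> rect a b c d"
  "prod_map f g z \<in> bd (rect a' b' c' d') <-> z \<in> bd (rect a b c d)"
 using incr_homeo_compare(1,2)[OF assms(1)] incr_homeo_compare(1,2)[OF assms(2)]
 by (auto simp: in_rect in_bd_rect simp flip: assms(3-6))

lemma prod_map_rect_image:
 assumes "incr_homeo f" "incr_homeo g" "f a = a'" "f b = b'" "g c = c'" "g d = d'"
 shows "prod_map f g ` rect a b c d = rect a' b' c' d'"
  "prod_map f g ` bd (rect a b c d) = bd (rect a' b' c' d')"
 using prod_map_rect[OF assms(1,2), of a b c d] assms(3-6)
  frontier_homeo_image[OF isotopic_homeo[OF isotopic_prod_map[OF assms(1,2)]], of "rect a b c d"] by simp_all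

lemma trace_tangle_1: "trace_tangle 1 s = pat (rect (1/8) (23/8) (-1) 4) {stack_box 1 0} (bd (rect 1 2 0 3)) (rect 1 2 0 3)
  (s = Pos) (bd (rect (1/8) (23/8) (-1) 4) Un {z \<in> bd (stack_box 1 0). Re z < 1})"
proof -
 have "bd (rect 1 2 0 3) \<subseteq> rect (1/8) (23/8) (-1) 4" by (auto simp: in_bd_rect in_rect)
 hence "bd (rect 1 2 0 3) - interior (stack_box 1 0) =
   bd (rect 1 2 0 3) Int (rect (1/8) (23/8) (-1) 4 - interior (stack_box 1 0))" by blast
 moreover have "(\<Union>j\<in>{1..1}. bd (rect (real j) (2 * real 1 + 1 - real j) (real j - real 1) (real 1 + 3 - real j))) = bd (rect 1 2 0 3)"
  by simp
 ultimately have str: "(\<Union>j\<in>{1..1}. bd (rect (real j) (2 * real 1 + 1 - real j) (real j - real 1) (real 1 + 3 - real j)))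
   - interior (stack_box 1 0) = bd (rect 1 2 0 3) Int (rect (1/8) (23/8) (-1) 4 - interior (stack_box 1 0))" by simp
 have "{j \<in> {1..1}. z \<in> rect (real j) (2 * real 1 + 1 - real j) (real j - real 1) (real 1 + 3 - real j)} = (if z \<in> rect 1 2 0 3 then {1} else {})" for z
  by auto
 note one = this
 have card: "odd (card {j \<in> {1..1}. z \<in> rect (real j) (2 * real 1 + 1 - real j) (real j - real 1) (real 1 + 3 - real j)}) <-> z \<in> rect 1 2 0 3" for z
  by (subst one) simp
 have out: "rect (1/8) (2 * real 1 + 7/8) (- real 1) (real 1 + 3) = rect (1/8) (23/8) (-1) 4" by simp
 show ?thesis
  unfolding trace_tangle_def Let_def pat_def shade_odd str card out by auto
qed

lemma trace_tangle_2: "trace_tangle 2 s = pat (rect (1/8) (39/8) (-2) 5) {stack_box 2 0}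
  (bd (rect 1 4 (-1) 4) Un bd (rect 2 3 0 3)) (rect 1 4 (-1) 4 - rect 2 3 0 3)
  (s = Pos) (bd (rect (1/8) (39/8) (-2) 5) Un {z \<in> bd (stack_box 2 0). Re z < 1})"
proof -
 let ?R = "%j. rect (real j) (2 * real 2 + 1 - real j) (real j - real 2) (real 2 + 3 - real j)"
 have R: "?R (1::nat) = rect 1 4 (-1) 4" "?R (2::nat) = rect 2 3 0 3" by simp_all
 have two: "{1..2::nat} = {1, 2}" by auto
 have "bd (rect 1 4 (-1) 4) Un bd (rect 2 3 0 3) \<subseteq> rect (1/8) (39/8) (-2) 5"
  by (auto simp: in_bd_rect in_rect)
 hence str: "(\<Union>j\<in>{1..2}. bd (?R j)) - interior (stack_box 2 0) =
   (bd (rect 1 4 (-1) 4) Un bd (rect 2 3 0 3)) Int (rect (1/8) (39/8) (-2) 5 - interior (stack_box 2 0))"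
  unfolding two UN_insert UN_empty R by blast
 have "{j \<in> {1..2}. z \<in> ?R j} = (if z \<in> ?R 1 then {1} else {}) Un (if z \<in> ?R 2 then {2} else {})" for z :: complex
  unfolding two by (auto simp del: of_nat_numeral)
 hence c: "{j \<in> {1..2}. z \<in> ?R j} = (if z \<in> rect 1 4 (-1) 4 then {1} else {}) Un (if z \<in> rect 2 3 0 3 then {2} else {})" for z :: complex
  unfolding R .
 have card: "odd (card {j \<in> {1..2}. z \<in> ?R j}) <-> z \<in> rect 1 4 (-1) 4 - rect 2 3 0 3" for z :: complex
  unfolding c by (auto simp: in_rect)
 have out: "rect (1/8) (2 * real 2 + 7/8) (- real 2) (real 2 + 3) = rect (1/8) (39/8) (-2) 5" by simp
 show ?thesis
  unfolding trace_tangle_def Let_def pat_def shade_odd str card out by auto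
qed

lemma left_trace_tangle: "left_trace_tangle s = pat (rect (-1) 2 (-1) 4) {stack_box 1 0} (bd (rect 0 1 0 3)) (rect 0 1 0 3)
  (opp s = Pos) (bd (rect (-1) 2 (-1) 4) Un {z \<in> bd (stack_box 1 0). Re z < 1})"
proof -
 have "bd (rect 0 1 0 3) \<subseteq> rect (-1) 2 (-1) 4" by (auto simp: in_bd_rect in_rect)
 hence "bd (rect 0 1 0 3) - interior (stack_box 1 0) =
   bd (rect 0 1 0 3) Int (rect (-1) 2 (-1) 4 - interior (stack_box 1 0))" by blast
 thus ?thesis
  by (auto simp: left_trace_tangle_def Let_def pat_def shade_odd)
qed

text \<open>Gluing for patterns with a single inner disc.\<close>

lemma glue_pat_single:
 assumes B: "B \<subseteq> interior out" "closed B" and pl: "planar_tangle (pat out {B} X1 Y1 b1 M)" "planar_tangle (pat B J X2 Y2 b2 N)"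
  and MN: "M = M0 Un {z \<in> bd B. P z}" "M0 Int B = {}" "N = {z \<in> bd B. P z} Un N0" "N0 Int bd B = {}"
  and X1: "!!z. z \<in> out ==> z ~: interior B ==> z \<in> X1 <-> z \<in> X"
  and X2: "!!z. z \<in> B ==> z ~: interiors J ==> z \<in> X2 <-> z \<in> X"
  and Y1: "!!z. z \<in> out ==> z ~: interior B ==> z ~: X ==> (z \<in> Y1 <-> b1) <-> (z \<in> Y <-> b)"
  and Y2: "!!z. z \<in> B ==> z ~: interiors J ==> z ~: X ==> (z \<in> Y2 <-> b2) <-> (z \<in> Y <-> b)"
 shows "glue (pat out {B} X1 Y1 b1 M) B (pat B J X2 Y2 b2 N) = pat out J X Y b (M0 Un N0)"
  and "gluable (pat out {B} X1 Y1 b1 M) B (pat B J X2 Y2 b2 N)"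
proof -
 have J: "E \<subseteq> interior B" if "E \<in> J" for E using planar_tangleD(4)[OF pl(2)] that by simp
 have fr: "bd B \<subseteq> B" using B by (simp add: frontier_subset_closed)
 have M': "M0 Un N0 = (M Un N) - bd B" using MN fr by blast
 have I': "J = {B} - {B} Un J" by simp
 have B': "B \<subseteq> out" using B interior_subset by blast
 note g = glue_pat[OF singletonI B' _ J B(2) _ X2 _ Y2 M' I', of X1 Y1 b1]
 show "glue (pat out {B} X1 Y1 b1 M) B (pat B J X2 Y2 b2 N) = pat out J X Y b (M0 Un N0)"
  by (rule g(1)) (use X1 Y1 in auto)
 have "M Int bd B = N Int bd B" using MN fr by blast
 thus "gluable (pat out {B} X1 Y1 b1 M) B (pat B J X2 Y2 b2 N)"
  using pl by (intro g(2)) (use X1 Y1 in auto)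
qed

text \<open>The partial trace from two strings to one.\<close>

abbreviation "expectation_tangle s == base_tangle 1 1 True (s = Pos)"

lemma base_pat_0: "base_tangle 0 1 True b = pat (rect (1/8) (23/8) 0 3) {stack_box 1 0} (bd (rect 1 2 (1/4) (11/4)))
  (rect 1 2 (1/4) (11/4)) b (bd (rect (1/8) (23/8) 0 3) Un {z \<in> bd (stack_box 1 0). Re z < 1})"
proof -
 have "lines_left 0 z = 0" for z by (simp add: lines_left_def)
 thus ?thesis
  by (auto simp: base_tangle_def base_out_def base_box_def stack_box_def base_curves_def base_ring_def base_colour_def
    base_marks_def lessThan_Suc intro!: arg_cong[of _ _ "pat _ _ _ _ _"] pat_cong)
qed

lemma base_pat_1: "base_tangle 1 1 True b = pat (rect (1/8) (31/8) 0 3) {stack_box 2 0} ({z. Re z = 1} Un bd (rect 2 3 (1/4) (11/4)))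
  ({z. 1 <= Re z} - rect 2 3 (1/4) (11/4)) b ({z \<in> bd (rect (1/8) (31/8) 0 3). Re z < 1} Un {z \<in> bd (stack_box 2 0). Re z < 1})"
proof -
 have l: "lines_left 1 z = (if 1 <= Re z then 1 else 0)" for z
  using lines_left_max[of 1 z] lines_left_less_1[of z 1] by auto
 have c: "base_colour 1 True = {z. 1 <= Re z} - rect 2 3 (1/4) (11/4)"
  by (auto simp: base_colour_def l base_ring_def in_rect simp del: One_nat_def split: if_splits)
 have "base_curves 1 True = {z. Re z = 1} Un bd (rect 2 3 (1/4) (11/4))"
  by (auto simp: base_curves_def base_ring_def)
 moreover have "base_box 1 True ` {..<1} = {stack_box 2 0}" by (simp add: base_box_def stack_box_def lessThan_Suc)
 moreover have "base_out 1 1 True = rect (1/8) (31/8) 0 3" by (simp add: base_out_def)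
 moreover have "base_marks 1 1 True = {z \<in> bd (rect (1/8) (31/8) 0 3). Re z < 1} Un {z \<in> bd (stack_box 2 0). Re z < 1}"
  using calculation(2,3) by (auto simp: base_marks_def)
 ultimately show ?thesis by (simp add: base_tangle_def c del: One_nat_def)
qed

lemma trace_tangle_1_from_base:
 obtains h where "isotopic_to_id h" "map_tangle h (base_tangle 0 1 True (s = Pos)) = trace_tangle 1 s"
  "h ` stack_box 1 0 = stack_box 1 0" "h ` base_out 0 1 True = rect (1/8) (23/8) (-1) 4"
proof -
 obtain g where g: "incr_homeo g" "map g [0, 1/4, 1, 2, 11/4, 3] = [-1, 0, 1, 2, 3, 4]" by (rule incr_homeo_obtain, erule (1) that) auto
 have f: "incr_homeo (%x. x)" by (auto simp: incr_homeo_def strict_mono_def)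
 let ?h = "prod_map (%x. x) g"
 have iso: "isotopic_to_id ?h" by (rule isotopic_prod_map[OF f g(1)])
 have pl: "plane_homeo ?h" by (rule isotopic_homeo[OF iso])
 have gg: "g 0 = -1" "g (1/4) = 0" "g 1 = 1" "g 2 = 2" "g (11/4) = 3" "g 3 = 4" using g(2) by simp_all
 have box: "?h ` stack_box 1 0 = stack_box 1 0"
  unfolding stack_box_def by (rule prod_map_rect_image(1)[OF f g(1)]) (simp_all add: gg)
 have out: "?h ` rect (1/8) (23/8) 0 3 = rect (1/8) (23/8) (-1) 4" "?h ` bd (rect (1/8) (23/8) 0 3) = bd (rect (1/8) (23/8) (-1) 4)"
  by (rule prod_map_rect_image[OF f g(1)]; simp add: gg)+
 have mk: "?h ` {z \<in> S. Re z < 1} = {z \<in> ?h ` S. Re z < 1}" for S by auto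
 have fb: "?h ` bd (stack_box 1 0) = bd (stack_box 1 0)"
  using frontier_homeo_image[OF pl, of "stack_box 1 0"] box by simp
 have "map_tangle ?h (base_tangle 0 1 True (s = Pos)) = trace_tangle 1 s"
  unfolding base_pat_0 trace_tangle_1
 proof (rule map_pat[OF pl out(1)])
  show "(`) ?h ` {stack_box 1 0} = {stack_box 1 0}" using box by simp
  show "?h ` (bd (rect (1/8) (23/8) 0 3) Un {z \<in> bd (stack_box 1 0). Re z < 1}) =
   bd (rect (1/8) (23/8) (-1) 4) Un {z \<in> bd (stack_box 1 0). Re z < 1}"
   unfolding image_Un out(2) mk fb ..
  fix z
  show "?h z \<in> bd (rect 1 2 0 3) <-> z \<in> bd (rect 1 2 (1/4) (11/4))"
   "?h z \<in> rect 1 2 0 3 <-> z \<in> rect 1 2 (1/4) (11/4)"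
   by (rule prod_map_in_rect[OF f g(1)]; simp add: gg)+
 qed
 thus thesis using that[OF iso _ box] out(1) by (simp add: base_out_def)
qed

lemma planar_trace_tangle_1: "planar_tangle (trace_tangle 1 s)"
 using trace_tangle_1_from_base[of s] planar_base_tangle[of True 1 0 "s = Pos"]
 by (metis isotopic_homeo planar_map_tangle)

text \<open>The partial trace tangle shrunk into a box with one string.\<close>

definition small_expectation :: "sign => tangle" where
 "small_expectation s = pat (stack_box 1 0) {rect (3/8) (11/8) (7/5) (8/5)}
   ({z. Re z = 1} Un bd (rect (5/4) (3/2) (11/10) (19/10))) ({z. 1 <= Re z} - rect (5/4) (3/2) (11/10) (19/10)) (s = Pos)
   ({z \<in> bd (stack_box 1 0). Re z < 1} Un {z \<in> bd (rect (3/8) (11/8) (7/5) (8/5)). Re z < 1})"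

lemma small_expectation:
 obtains h where "isotopic_to_id h" "map_tangle h (expectation_tangle s) = small_expectation s"
  "h ` stack_box 2 0 = rect (3/8) (11/8) (7/5) (8/5)" "h ` base_out 1 1 True = stack_box 1 0"
proof -
 obtain f where f: "incr_homeo f" "map f [1/8, 1/4, 1, 2, 11/4, 3, 31/8] = [1/4, 3/8, 1, 5/4, 11/8, 3/2, 7/4]" by (rule incr_homeo_obtain, erule (1) that) auto
 obtain g where g: "incr_homeo g" "map g [0, 1/4, 1, 2, 11/4, 3] = [1, 11/10, 7/5, 8/5, 19/10, 2]" by (rule incr_homeo_obtain, erule (1) that) auto
 let ?h = "prod_map f g"
 have iso: "isotopic_to_id ?h" by (rule isotopic_prod_map[OF f(1) g(1)])
 have pl: "plane_homeo ?h" by (rule isotopic_homeo[OF iso])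
 note ff = f(2)[unfolded list.map list.inject] and gg = g(2)[unfolded list.map list.inject]
 have box: "?h ` stack_box 2 0 = rect (3/8) (11/8) (7/5) (8/5)"
  unfolding stack_box_def by (rule prod_map_rect_image(1)[OF f(1) g(1)]) (simp_all add: ff gg)
 have out: "?h ` rect (1/8) (31/8) 0 3 = stack_box 1 0" "?h ` bd (rect (1/8) (31/8) 0 3) = bd (stack_box 1 0)"
  unfolding stack_box_def by (rule prod_map_rect_image[OF f(1) g(1)]; simp add: ff gg)+
 have f1: "f x < 1 <-> x < 1" "f x = 1 <-> x = 1" "1 <= f x <-> 1 <= x" for x
  using incr_homeo_compare[OF f(1), of x 1] incr_homeo_compare[OF f(1), of 1 x] ff by simp_all
 have mk: "?h ` {z \<in> S. Re z < 1} = {z \<in> ?h ` S. Re z < 1}" for S by (auto simp: f1)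
 have fb: "?h ` bd (stack_box 2 0) = bd (rect (3/8) (11/8) (7/5) (8/5))"
  using frontier_homeo_image[OF pl, of "stack_box 2 0"] box by simp
 have "map_tangle ?h (expectation_tangle s) = small_expectation s"
  unfolding base_pat_1 small_expectation_def
 proof (rule map_pat[OF pl out(1)])
  show "(`) ?h ` {stack_box 2 0} = {rect (3/8) (11/8) (7/5) (8/5)}" using box by simp
  show "?h ` ({z \<in> bd (rect (1/8) (31/8) 0 3). Re z < 1} Un {z \<in> bd (stack_box 2 0). Re z < 1}) =
   {z \<in> bd (stack_box 1 0). Re z < 1} Un {z \<in> bd (rect (3/8) (11/8) (7/5) (8/5)). Re z < 1}"
   unfolding image_Un mk out(2) fb ..
  fix z
  have "?h z \<in> bd (rect (5/4) (3/2) (11/10) (19/10)) <-> z \<in> bd (rect 2 3 (1/4) (11/4))"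
   "?h z \<in> rect (5/4) (3/2) (11/10) (19/10) <-> z \<in> rect 2 3 (1/4) (11/4)"
   by (rule prod_map_in_rect[OF f(1) g(1)]; simp add: ff gg)+
  thus "?h z \<in> {z. Re z = 1} Un bd (rect (5/4) (3/2) (11/10) (19/10)) <-> z \<in> {z. Re z = 1} Un bd (rect 2 3 (1/4) (11/4))"
   "?h z \<in> {z. 1 <= Re z} - rect (5/4) (3/2) (11/10) (19/10) <-> z \<in> {z. 1 <= Re z} - rect 2 3 (1/4) (11/4)"
   by (auto simp: f1)
 qed
 thus thesis using that[OF iso _ box] out(1) by (simp add: base_out_def)
qed

lemma planar_small_expectation: "planar_tangle (small_expectation s)"
 using small_expectation[of s] planar_base_tangle[of True 1 1 "s = Pos"]
 by (metis isotopic_homeo planar_map_tangle)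

text \<open>Closing the partial trace on the right or on the left.\<close>

lemma glue_trace_expectation:
 fixes s :: sign
 defines "G == pat (rect (1/8) (23/8) (-1) 4) {rect (3/8) (11/8) (7/5) (8/5)} (bd (rect 1 2 0 3) Un bd (rect (5/4) (3/2) (11/10) (19/10)))
   (rect 1 2 0 3 - rect (5/4) (3/2) (11/10) (19/10)) (s = Pos)
   (bd (rect (1/8) (23/8) (-1) 4) Un {z \<in> bd (rect (3/8) (11/8) (7/5) (8/5)). Re z < 1})"
 shows "glue (trace_tangle 1 s) (stack_box 1 0) (small_expectation s) = G"
  "gluable (trace_tangle 1 s) (stack_box 1 0) (small_expectation s)"
proof -
 have B: "stack_box 1 0 \<subseteq> interior (rect (1/8) (23/8) (-1) 4)" "closed (stack_box 1 0)"
  by (auto simp: stack_box_def in_rect in_int_rect closed_rect)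
 have d: "bd (rect (1/8) (23/8) (-1) 4) Int stack_box 1 0 = {}"
  "{z \<in> bd (rect (3/8) (11/8) (7/5) (8/5)). Re z < 1} Int bd (stack_box 1 0) = {}"
  by (auto simp: stack_box_def rect_simps)
 note pl = planar_trace_tangle_1[of s, unfolded trace_tangle_1] planar_small_expectation[of s, unfolded small_expectation_def]
 note g = glue_pat_single[OF B pl refl d(1) refl d(2), where X = "bd (rect 1 2 0 3) Un bd (rect (5/4) (3/2) (11/10) (19/10))"
   and Y = "rect 1 2 0 3 - rect (5/4) (3/2) (11/10) (19/10)" and b = "s = Pos"]
 show "glue (trace_tangle 1 s) (stack_box 1 0) (small_expectation s) = G"
  unfolding G_def trace_tangle_1 small_expectation_def
  by (rule g(1); simp add: stack_box_def rect_simps; argo)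
 show "gluable (trace_tangle 1 s) (stack_box 1 0) (small_expectation s)"
  unfolding trace_tangle_1 small_expectation_def
  by (rule g(2); simp add: stack_box_def rect_simps; argo)
qed

declare One_nat_def [simp del]

lemma map_pat_prod:
 assumes f: "incr_homeo f" and g: "incr_homeo g" and out: "f a = a'" "f b = b'" "g c = c'" "g d = d'"
  and B: "B = (%(p, q, u, v). rect p q u v) ` J" "B' = (%(p, q, u, v). rect (f p) (f q) (g u) (g v)) ` J"
  and X: "!!z. prod_map f g z \<in> X' <-> z \<in> X" and Y: "!!z. prod_map f g z \<in> Y' <-> z \<in> Y"
  and M: "M = {z \<in> bd (rect a b c d). P z} Un {z \<in> \<Union> (bd ` B). Q z}"
   "M' = {z \<in> bd (rect a' b' c' d'). P' z} Un {z \<in> \<Union> (bd ` B'). Q' z}"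
  and P: "!!z. P' (prod_map f g z) <-> P z" and Q: "!!z. Q' (prod_map f g z) <-> Q z"
 shows "map_tangle (prod_map f g) (pat (rect a b c d) B X Y e M) = pat (rect a' b' c' d') B' X' Y' e M'"
proof (rule map_pat)
 show pl: "plane_homeo (prod_map f g)" by (rule isotopic_homeo[OF isotopic_prod_map[OF f g]])
 note r = prod_map_rect[OF f g]
 note fr = frontier_homeo_image[OF pl, symmetric]
 show "prod_map f g ` rect a b c d = rect a' b' c' d'" by (simp add: r out)
 show "(`) (prod_map f g) ` B = B'" by (simp add: B image_image r split_def)
 have im: "prod_map f g ` {z \<in> S. R z} = {z \<in> prod_map f g ` S. R' z}" if "!!z. R' (prod_map f g z) <-> R z" for S R R'
  using that by auto
 have "prod_map f g ` \<Union> (bd ` B) = \<Union> (bd ` B')"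
  by (simp add: B image_UN image_image fr r split_def)
 note BB = this
 show "prod_map f g ` M = M'"
  unfolding M image_Un im[where R = P and R' = P', OF P] im[where R = Q and R' = Q', OF Q] unfolding fr r out BB ..
qed (use X Y in auto)

abbreviation "right_closed_expectation s == pat (rect (1/8) (23/8) (-1) 4) {rect (3/8) (11/8) (7/5) (8/5)}
   (bd (rect 1 2 0 3) Un bd (rect (5/4) (3/2) (11/10) (19/10)))
   (rect 1 2 0 3 - rect (5/4) (3/2) (11/10) (19/10)) (s = Pos)
   (bd (rect (1/8) (23/8) (-1) 4) Un {z \<in> bd (rect (3/8) (11/8) (7/5) (8/5)). Re z < 1})"

lemma trace_tangle_2_from_1:
 obtains h where "isotopic_to_id h" "map_tangle h (right_closed_expectation s) = trace_tangle 2 s"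
  "h ` rect (3/8) (11/8) (7/5) (8/5) = stack_box 2 0" "h ` rect (1/8) (23/8) (-1) 4 = rect (1/8) (39/8) (-2) 5"
proof -
 obtain f where f: "incr_homeo f" "map f [1/8, 3/8, 1, 5/4, 11/8, 3/2, 2, 23/8] = [1/8, 1/4, 1, 2, 11/4, 3, 4, 39/8]" by (rule incr_homeo_obtain, erule (1) that) auto
 obtain g where g: "incr_homeo g" "map g [-1, 0, 11/10, 7/5, 8/5, 19/10, 3, 4] = [-2, -1, 0, 1, 2, 3, 4, 5]" by (rule incr_homeo_obtain, erule (1) that) auto
 note ff = f(2)[unfolded list.map list.inject] and gg = g(2)[unfolded list.map list.inject]
 have f1: "f x < 1 <-> x < 1" for x using incr_homeo_compare(1)[OF f(1), of x 1] ff by simp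
 let ?X = "bd (rect 1 2 0 3) Un bd (rect (5/4) (3/2) (11/10) (19/10))"
 let ?Y = "rect 1 2 0 3 - rect (5/4) (3/2) (11/10) (19/10)"
 let ?X' = "bd (rect 1 4 (-1) 4) Un bd (rect 2 3 0 3)"
 let ?Y' = "rect 1 4 (-1) 4 - rect 2 3 0 3"
 have "prod_map f g z \<in> bd (rect 1 4 (-1) 4) <-> z \<in> bd (rect 1 2 0 3)"
  "prod_map f g z \<in> rect 1 4 (-1) 4 <-> z \<in> rect 1 2 0 3"
  "prod_map f g z \<in> bd (rect 2 3 0 3) <-> z \<in> bd (rect (5/4) (3/2) (11/10) (19/10))"
  "prod_map f g z \<in> rect 2 3 0 3 <-> z \<in> rect (5/4) (3/2) (11/10) (19/10)" for z
  by (rule prod_map_in_rect[OF f(1) g(1)]; simp add: ff gg)+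
 hence XY: "prod_map f g z \<in> ?X' <-> z \<in> ?X" "prod_map f g z \<in> ?Y' <-> z \<in> ?Y" for z by simp_all
 have m: "map_tangle (prod_map f g) (right_closed_expectation s) = trace_tangle 2 s"
  unfolding trace_tangle_2
  by (rule map_pat_prod[OF f(1) g(1), where J = "{(3/8, 11/8, 7/5, 8/5)}" and P = "%_. True" and P' = "%_. True"
     and Q = "%z. Re z < 1" and Q' = "%z. Re z < 1"])
   (simp_all only: XY, simp_all add: f1 ff gg stack_box_def)
 show thesis
  by (rule that[OF isotopic_prod_map[OF f(1) g(1)] m]) (simp_all add: prod_map_rect[OF f(1) g(1)] ff gg stack_box_def)
qed

lemma gluable_outer_disc:
 assumes "gluable T D S"
 shows "disc_space A T D = disc_space A S D"
proof -
 have "marked S Int bd D \<subseteq> shaded T <-> marked S Int bd D \<subseteq> shaded S"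
  using assms unfolding gluable_def by blast
 thus ?thesis using assms by (simp add: gluable_def disc_space_def disc_size_def disc_sign_def)
qed

context planar_algebra
begin

definition expectation :: "sign => 'a => 'a" where
 "expectation s x = act A (expectation_tangle s) (%_. x)"

lemma base_one_inner: "inner_discs (base_tangle n 1 True b) = {stack_box (n + 1) 0}"
 by (simp add: base_tangle_def base_box_def stack_box_def lessThan_Suc One_nat_def add.commute)

lemma act_expectation_tangle:
 assumes x: "x \<in> box_space A 2 s"
 shows "expectation s x \<in> box_space A 1 s" "act A (small_expectation s) (%_. x) = expectation s x"
  "disc_space A (small_expectation s) (stack_box 1 0) = box_space A 1 s"
  "disc_space A (small_expectation s) (rect (3/8) (11/8) (7/5) (8/5)) = box_space A 2 s"
proof -
 have box: "base_box 1 True 0 = stack_box 2 0" by (simp add: base_box_def stack_box_def)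
 have d: "disc_space A (expectation_tangle s) (stack_box 2 0) = box_space A 2 s"
  "disc_space A (expectation_tangle s) (base_out 1 1 True) = box_space A 1 s"
  using base_disc_space(1)[where r = True and k = 1 and n = 1 and s = s]
   base_disc_space(2)[where r = True and k = 1 and n = 1 and s = s and i = 0] by (simp_all add: box)
 have pl: "planar_tangle (expectation_tangle s)" by (rule planar_base_tangle) simp
 have out: "outer_disc (expectation_tangle s) = base_out 1 1 True" by (simp add: base_tangle_def)
 have inn: "inner_discs (expectation_tangle s) = {stack_box 2 0}"
  using base_one_inner[of 1] by simp
 show "expectation s x \<in> box_space A 1 s"
  using act_closed[OF pl, of "%_. x"] d x out by (simp add: expectation_def labelling_def inn)
 obtain h where h: "isotopic_to_id h" "map_tangle h (expectation_tangle s) = small_expectation s"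
  "h ` stack_box 2 0 = rect (3/8) (11/8) (7/5) (8/5)" "h ` base_out 1 1 True = stack_box 1 0" by (rule small_expectation)
 show "act A (small_expectation s) (%_. x) = expectation s x"
  unfolding expectation_def by (rule act_map_eq[OF pl h(1,2)]) (use x in \<open>simp_all add: inn d\<close>)
 show "disc_space A (small_expectation s) (stack_box 1 0) = box_space A 1 s"
  "disc_space A (small_expectation s) (rect (3/8) (11/8) (7/5) (8/5)) = box_space A 2 s"
  using planar_disc_space_map(2)[OF pl h(1,2)] h(3,4) d by metis+
qed

lemma small_expectation_inner: "inner_discs (small_expectation s) = {rect (3/8) (11/8) (7/5) (8/5)}"
 by (simp add: small_expectation_def)

lemma trace_tangle_inner: "inner_discs (trace_tangle n s) = {stack_box n 0}"
 by (simp add: trace_tangle_def Let_def)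

lemma trace_tangle_1_spaces:
 "disc_space A (trace_tangle 1 s) (outer_disc (trace_tangle 1 s)) = box_space A 0 s"
 "disc_space A (trace_tangle 1 s) (stack_box 1 0) = box_space A 1 s"
proof -
 obtain h where h: "isotopic_to_id h" "map_tangle h (base_tangle 0 1 True (s = Pos)) = trace_tangle 1 s"
  "h ` stack_box 1 0 = stack_box 1 0" "h ` base_out 0 1 True = rect (1/8) (23/8) (-1) 4" by (rule trace_tangle_1_from_base)
 have pl: "planar_tangle (base_tangle 0 1 True (s = Pos))" by (rule planar_base_tangle) simp
 have box: "base_box 0 True 0 = stack_box 1 0" by (simp add: base_box_def stack_box_def)
 show "disc_space A (trace_tangle 1 s) (outer_disc (trace_tangle 1 s)) = box_space A 0 s"
  "disc_space A (trace_tangle 1 s) (stack_box 1 0) = box_space A 1 s"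
  using planar_disc_space_map(2)[OF pl h(1,2), of "base_out 0 1 True"] planar_disc_space_map(2)[OF pl h(1,2), of "stack_box 1 0"]
   base_disc_space(1)[where r = True and k = 1 and n = 0 and s = s]
   base_disc_space(2)[where r = True and k = 1 and n = 0 and s = s and i = 0]
  by (simp_all add: h(3,4) box trace_tangle_1)
qed

lemma act_trace_1_closed: "x \<in> box_space A 1 s ==> act A (trace_tangle 1 s) (%_. x) \<in> box_space A 0 s"
 using act_closed[OF planar_trace_tangle_1, of s "%_. x"] trace_tangle_1_spaces[of s]
 by (simp add: labelling_def trace_tangle_inner del: One_nat_def)

lemma trace_2_spaces:
 "planar_tangle (trace_tangle 2 s)"
 "disc_space A (trace_tangle 2 s) (stack_box 2 0) = box_space A 2 s"
 "x \<in> box_space A 2 s ==> act A (trace_tangle 2 s) (%_. x) = act A (trace_tangle 1 s) (%_. expectation s x)"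
proof -
 interpret gluing "trace_tangle 1 s" "stack_box 1 0" "small_expectation s"
  by unfold_locales (rule glue_trace_expectation(2))
 obtain h where h: "isotopic_to_id h" "map_tangle h (right_closed_expectation s) = trace_tangle 2 s"
  "h ` rect (3/8) (11/8) (7/5) (8/5) = stack_box 2 0" by (rule trace_tangle_2_from_1)
 note h = h(1) h(2)[folded glue_trace_expectation(1)] h(3)
 show "planar_tangle (trace_tangle 2 s)" by (rule planar_disc_space_map(1)[OF planar_G h(1,2)])
 have inn: "inner_discs G = {rect (3/8) (11/8) (7/5) (8/5)}"
  by (simp add: glue_trace_expectation(1))
 have d: "disc_space A G (rect (3/8) (11/8) (7/5) (8/5)) = box_space A 2 s"
  using disc_space_glue(2)[of "rect (3/8) (11/8) (7/5) (8/5)" A] act_expectation_tangle(4)[OF box_zero, of s]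
  unfolding small_expectation_inner by simp
 thus "disc_space A (trace_tangle 2 s) (stack_box 2 0) = box_space A 2 s"
  using planar_disc_space_map(2)[OF planar_G h(1,2)] h(3) by metis
 assume x: "x \<in> box_space A 2 s"
 have "act A (trace_tangle 2 s) (%_. x) = act A G (%_. x)"
  by (rule act_map_eq[OF planar_G h(1,2)]) (use x d in \<open>simp_all only: inn singleton_iff\<close>)
 also have "... = act A (trace_tangle 1 s) (%_. expectation s x)"
  by (rule act_glue_eq[OF gluable refl])
   (use act_expectation_tangle[OF x] x in \<open>simp_all add: small_expectation_inner trace_tangle_inner\<close>)
 finally show "act A (trace_tangle 2 s) (%_. x) = act A (trace_tangle 1 s) (%_. expectation s x)" .
qed

end

context subfactor_planar_algebra
begin

lemma box_trace_2: "x \<in> box_space A 2 s ==> box_trace A 2 s x = box_trace A 1 s (expectation s x)"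
 by (simp add: box_trace_def trace_2_spaces(3))

lemma box_trace_linear:
 assumes x: "x \<in> box_space A 2 s" and y: "y \<in> box_space A 2 s"
 shows "box_trace A 2 s (x + y) = box_trace A 2 s x + box_trace A 2 s y" "box_trace A 2 s (scl A c x) = c * box_trace A 2 s x"
proof -
 have V: "act A (trace_tangle 2 s) (%_. z) \<in> box_space A 0 s" if "z \<in> box_space A 2 s" for z
  using act_trace_1_closed act_expectation_tangle(1) trace_2_spaces(3) that by metis
 note l = act_one_disc_linear[OF trace_2_spaces(1) trace_tangle_inner, unfolded trace_2_spaces(2), OF x y]
 show "box_trace A 2 s (x + y) = box_trace A 2 s x + box_trace A 2 s y"
  unfolding box_trace_def l(1) by (rule scalar_of_add[OF V[OF x] V[OF y]])
 show "box_trace A 2 s (scl A c x) = c * box_trace A 2 s x"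
  unfolding box_trace_def l(2) by (rule scalar_of_scale[OF V[OF x]])
qed

end

lemma homeo_image_eq:
 assumes "plane_homeo h" "!!z. h z \<in> B <-> z \<in> A"
 shows "h ` A = B"
 using plane_homeo_bij[OF assms(1)] assms(2) by (metis (no_types, lifting) bij_pointE image_eqI subsetI image_subsetI subset_antisym)

lemma planar_left_trace_tangle: "planar_tangle (left_trace_tangle s)"
proof -
 let ?b = "opp s = Pos" and ?R = "rect (-1) 2 (-1) 4" and ?X = "bd (rect 0 1 0 3)" and ?Y = "rect 0 1 0 3"
 obtain f where f: "incr_homeo f" "map f [-(7/8), 0, 1/4, 1, 7/4, 15/8] = [-1, 0, 1/4, 1, 7/4, 2]" by (rule incr_homeo_obtain, erule (1) that) auto
 obtain g where g: "incr_homeo g" "map g [0, 1/4, 1, 2, 11/4, 3] = [-1, 0, 1, 2, 3, 4]" by (rule incr_homeo_obtain, erule (1) that) auto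
 note ff = f(2)[unfolded list.map list.inject] and gg = g(2)[unfolded list.map list.inject]
 have f1: "1 < f x <-> 1 < x" for x using incr_homeo_compare(1)[OF f(1), of 1 x] ff by simp
 let ?r = "%z. 2 - cnj z"
 have r: "plane_homeo ?r"
 proof (rule plane_homeoI)
  show "continuous_on UNIV ?r" by (intro continuous_intros)
  show "inj ?r" by (auto simp: inj_def)
  show "\<exists>z. ?r z = w" for w by (rule exI[of _ "2 - cnj w"]) simp
 qed
 have rr: "?r ` rect a b c d = rect (2 - b) (2 - a) c d" for a b c d
  by (rule homeo_image_eq[OF r]) (auto simp: in_rect)
 have rf: "?r ` bd (rect a b c d) = bd (rect (2 - b) (2 - a) c d)" for a b c d
  unfolding rr[symmetric] by (rule frontier_homeo_image[OF r, symmetric])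
 have rm: "?r ` {z \<in> S. Re z < 1} = {z \<in> ?r ` S. 1 < Re z}" for S by auto
 have "map_tangle ?r (base_tangle 0 1 True ?b) = pat (rect (-7/8) (15/8) 0 3) {stack_box 1 0} (bd (rect 0 1 (1/4) (11/4)))
   (rect 0 1 (1/4) (11/4)) ?b (bd (rect (-7/8) (15/8) 0 3) Un {z \<in> bd (stack_box 1 0). 1 < Re z})" (is "_ = ?T1")
  unfolding base_pat_0
 proof (rule map_pat[OF r])
  show "?r ` (bd (rect (1 / 8) (23 / 8) 0 3) Un {z \<in> bd (stack_box 1 0). Re z < 1}) =
   bd (rect (- 7 / 8) (15 / 8) 0 3) Un {z \<in> bd (stack_box 1 0). 1 < Re z}"
   unfolding image_Un rm stack_box_def rf by simp
 qed (auto simp: rr stack_box_def in_rect in_bd_rect)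
 hence T1: "planar_tangle ?T1" using planar_map_tangle[OF r planar_base_tangle[of True 1 0 ?b]] by simp
 have XY: "prod_map f g z \<in> ?X <-> z \<in> bd (rect 0 1 (1/4) (11/4))" "prod_map f g z \<in> ?Y <-> z \<in> rect 0 1 (1/4) (11/4)" for z
  by (rule prod_map_in_rect[OF f(1) g(1)]; simp add: ff gg)+
 have "map_tangle (prod_map f g) ?T1 = pat ?R {stack_box 1 0} ?X ?Y ?b (bd ?R Un {z \<in> bd (stack_box 1 0). 1 < Re z})" (is "_ = ?T2")
  by (rule map_pat_prod[OF f(1) g(1), where J = "{(1/4, 7/4, 1, 2)}" and P = "%_. True" and P' = "%_. True"
     and Q = "%z. 1 < Re z" and Q' = "%z. 1 < Re z"])
   (simp_all only: XY, simp_all add: f1 ff gg stack_box_def)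
 hence T2: "planar_tangle ?T2"
  using planar_map_tangle[OF isotopic_homeo[OF isotopic_prod_map[OF f(1) g(1)]] T1] by simp
 have fd: "bd ?R Int bd (stack_box 1 0) = {}" by (auto simp: stack_box_def rect_simps)
 let ?M = "bd ?R Un {z \<in> bd (stack_box 1 0). Re z < 1}"
 have o: "?M Int bd ?R = marked ?T2 Int bd ?R" using fd by auto
 have b: "?M Int bd (stack_box 1 0) = {z \<in> bd (rect (1/4) (7/4) 1 2). Re z < 1}"
  using fd by (auto simp: stack_box_def)
 have "planar_tangle (?T2\<lparr>marked := ?M\<rparr>)"
 proof (rule planar_change_marked[OF T2])
  fix D assume "D \<in> discs ?T2"
  then consider "D = ?R" | "D = stack_box 1 0" by (auto simp: discs_def)
  thus "?M Int bd D \<in> components (bd D - strings ?T2)"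
  proof cases
   case 1
   thus ?thesis unfolding 1 o using planar_tangleD(11)[OF T2, of ?R] by (simp add: discs_def)
  next
   case 2
   show ?thesis unfolding 2 b unfolding stack_box_def
    by (simp, rule left_mark_component) (auto simp: rect_simps)
  qed
 qed (auto simp: discs_def)
 thus ?thesis unfolding left_trace_tangle by (simp add: pat_def)
qed

abbreviation "left_closed_expectation s == pat (rect (-1) 2 (-1) 4) {rect (3/8) (11/8) (7/5) (8/5)}
   (bd (rect 0 1 0 3) Un bd (rect (5/4) (3/2) (11/10) (19/10)))
   (rect 0 1 0 3 Un rect (5/4) (3/2) (11/10) (19/10)) (opp s = Pos)
   (bd (rect (-1) 2 (-1) 4) Un {z \<in> bd (rect (3/8) (11/8) (7/5) (8/5)). Re z < 1})"

lemma opp_Pos: "opp s = Pos <-> s ~= Pos" by (cases s) auto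

lemma opp_opp: "opp (opp s) = s" by (cases s) auto

lemma glue_left_trace_expectation:
 "glue (left_trace_tangle s) (stack_box 1 0) (small_expectation s) = left_closed_expectation s"
 "gluable (left_trace_tangle s) (stack_box 1 0) (small_expectation s)"
proof -
 have B: "stack_box 1 0 \<subseteq> interior (rect (-1) 2 (-1) 4)" "closed (stack_box 1 0)"
  by (auto simp: stack_box_def in_rect in_int_rect closed_rect)
 have d: "bd (rect (-1) 2 (-1) 4) Int stack_box 1 0 = {}"
  "{z \<in> bd (rect (3/8) (11/8) (7/5) (8/5)). Re z < 1} Int bd (stack_box 1 0) = {}"
  by (auto simp: stack_box_def rect_simps)
 note pl = planar_left_trace_tangle[of s, unfolded left_trace_tangle] planar_small_expectation[of s, unfolded small_expectation_def]
 note g = glue_pat_single[OF B pl refl d(1) refl d(2), where X = "bd (rect 0 1 0 3) Un bd (rect (5/4) (3/2) (11/10) (19/10))"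
   and Y = "rect 0 1 0 3 Un rect (5/4) (3/2) (11/10) (19/10)" and b = "opp s = Pos"]
 show "glue (left_trace_tangle s) (stack_box 1 0) (small_expectation s) = left_closed_expectation s"
  unfolding left_trace_tangle small_expectation_def
  by (rule g(1); simp add: stack_box_def rect_simps opp_Pos; argo)
 show "gluable (left_trace_tangle s) (stack_box 1 0) (small_expectation s)"
  unfolding left_trace_tangle small_expectation_def
  by (rule g(2); simp add: stack_box_def rect_simps opp_Pos; argo)
qed

context planar_algebra
begin

lemma left_trace_spaces:
 "disc_space A (left_trace_tangle s) (outer_disc (left_trace_tangle s)) = box_space A 0 (opp s)"
 "disc_space A (left_trace_tangle s) (stack_box 1 0) = box_space A 1 s"
 "inner_discs (left_trace_tangle s) = {stack_box 1 0}"
proof -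
 let ?T = "left_trace_tangle s" and ?R = "rect (-1) 2 (-1) 4"
 have o: "outer_disc ?T = ?R" by (simp add: left_trace_tangle)
 have "strings ?T Int bd ?R = {}" unfolding left_trace_tangle by (auto simp: in_rect in_bd_rect)
 hence size: "disc_size ?T ?R = 0" by (simp add: disc_size_def)
 have m: "marked ?T Int bd ?R = bd ?R" unfolding left_trace_tangle by (auto simp: stack_box_def rect_simps)
 have fr: "z \<in> shaded ?T <-> s = Pos" if "z \<in> bd ?R" for z
  using that unfolding left_trace_tangle by (auto simp: stack_box_def rect_simps opp_Pos)
 have "Complex (-1) 0 \<in> bd ?R" by (simp add: in_rect in_bd_rect)
 hence "marked ?T Int bd ?R \<subseteq> shaded ?T <-> s = Pos" unfolding m using fr by blast
 hence sgn: "disc_sign ?T ?R = opp s" by (cases s) (simp_all add: disc_sign_def)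
 show "disc_space A ?T (outer_disc ?T) = box_space A 0 (opp s)" by (simp add: o disc_space_def size sgn)
 show "disc_space A ?T (stack_box 1 0) = box_space A 1 s"
  using gluable_outer_disc[OF glue_left_trace_expectation(2)] act_expectation_tangle(3)[OF box_zero] by metis
 show "inner_discs ?T = {stack_box 1 0}" by (simp add: left_trace_tangle)
qed

end

context subfactor_planar_algebra
begin

lemma act_left_trace: "x \<in> box_space A 1 s ==>
  act A (left_trace_tangle s) (%_. x) = scl A (box_trace A 1 s x) (box_unit A 0 (opp s))"
proof -
 assume x: "x \<in> box_space A 1 s"
 hence "act A (left_trace_tangle s) (%_. x) \<in> box_space A 0 (opp s)"
  using act_closed[OF planar_left_trace_tangle, of s "%_. x"] by (simp add: labelling_def left_trace_spaces)
 thus ?thesis using scalar_of[of "act A (left_trace_tangle s) (%_. x)" "opp s"] spherical[OF x] by (simp add: left_trace_def)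
qed

text \<open>The partial trace closes the right string and leaves one string, whose left and right closures
 agree by sphericality.\<close>

lemma left_closed_expectation:
 "planar_tangle (left_closed_expectation s)"
 "disc_space A (left_closed_expectation s) (rect (3/8) (11/8) (7/5) (8/5)) = box_space A 2 s"
 "x \<in> box_space A 2 s ==> act A (left_closed_expectation s) (%_. x) = scl A (box_trace A 2 s x) (box_unit A 0 (opp s))"
proof -
 interpret gluing "left_trace_tangle s" "stack_box 1 0" "small_expectation s"
  by unfold_locales (rule glue_left_trace_expectation(2))
 note G = glue_left_trace_expectation(1)[of s]
 show "planar_tangle (left_closed_expectation s)" using planar_G unfolding G .
 show "disc_space A (left_closed_expectation s) (rect (3/8) (11/8) (7/5) (8/5)) = box_space A 2 s"
  using disc_space_glue(2)[of "rect (3/8) (11/8) (7/5) (8/5)" A] act_expectation_tangle(4)[OF box_zero, of s]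
  unfolding small_expectation_inner G by simp
 assume x: "x \<in> box_space A 2 s"
 have "act A (left_closed_expectation s) (%_. x) = act A (left_trace_tangle s) (%_. expectation s x)"
  by (rule act_glue_eq[OF gluable G])
   (use act_expectation_tangle[OF x] x in \<open>simp_all add: small_expectation_inner left_trace_spaces(3)\<close>)
 thus "act A (left_closed_expectation s) (%_. x) = scl A (box_trace A 2 s x) (box_unit A 0 (opp s))"
  using act_left_trace[OF act_expectation_tangle(1)[OF x]] box_trace_2[OF x] by simp
qed

end

section \<open>The value of a loop\<close>

definition sup_norm :: "complex => real" where
 "sup_norm z = max \<bar>Re z\<bar> \<bar>Im z\<bar>"

lemma sup_norm_continuous [continuous_intros]: "continuous_on S f ==> continuous_on S (%x. sup_norm (f x))"
 unfolding sup_norm_def by (intro continuous_intros)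

lemma sup_norm_scale: "0 <= r ==> sup_norm (of_real r * z) = r * sup_norm z"
 by (simp add: sup_norm_def abs_mult max_mult_distrib_left)

lemma sup_norm_pos: "z ~= 0 ==> 0 < sup_norm z"
 by (auto simp: sup_norm_def less_max_iff_disj complex_eq_iff)

lemma sup_norm_rect: "sup_norm z <= r <-> z \<in> rect (- r) r (- r) r" "sup_norm z = r <-> z \<in> bd (rect (- r) r (- r) r)"
 by (simp_all add: sup_norm_def in_rect in_bd_rect max_def abs_if; argo)+

lemma round_homeo:
 assumes f: "incr_homeo f" and g: "incr_homeo g"
 obtains h where "isotopic_to_id h"
  "\<forall>a b c d r z. f a = - r & f b = r & g c = - r & g d = r -->
    (h z \<in> cball 0 r <-> z \<in> rect a b c d) & (h z \<in> sphere 0 r <-> z \<in> bd (rect a b c d))"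
proof
 let ?k = "%z. of_real (sup_norm z / norm z) * z :: complex"
 let ?h = "%z. ?k (prod_map f g z)"
 have k: "isotopic_to_id ?k"
 proof (rule isotopic_radial)
  show "0 < sup_norm z" if "z ~= 0" for z by (rule sup_norm_pos[OF that])
  show "sup_norm (of_real r * z) = r * sup_norm z" if "0 < r" for r z using that by (simp add: sup_norm_scale)
 qed (auto intro!: continuous_intros simp: norm_mult)
 show "isotopic_to_id ?h" by (rule isotopic_to_id_comp[OF k isotopic_prod_map[OF f g]])
 have n: "norm (?k z) = sup_norm z" for z
  using sup_norm_pos[of z] by (cases "z = 0") (auto simp: norm_mult norm_divide sup_norm_def)
 show "\<forall>a b c d r z. f a = - r & f b = r & g c = - r & g d = r -->
    (?h z \<in> cball 0 r <-> z \<in> rect a b c d) & (?h z \<in> sphere 0 r <-> z \<in> bd (rect a b c d))"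
  using prod_map_in_rect[OF f g] n by (simp add: sup_norm_rect)
qed

definition circle_tangle :: "bool => tangle" where
 "circle_tangle b = pat (cball 0 2) {} (sphere 0 1) (cball 0 1) b (sphere 0 2)"

lemma loop_tangle: "loop_tangle s = circle_tangle (s = Pos)"
 by (auto simp: loop_tangle_def circle_tangle_def pat_def shade_odd)

lemma rect_circle:
 assumes "a < a'" "a' < b'" "b' < b" "c < c'" "c' < d'" "d' < d"
 obtains h where "isotopic_to_id h" "map_tangle h (pat (rect a b c d) {} (bd (rect a' b' c' d')) (rect a' b' c' d') e
   (bd (rect a b c d))) = circle_tangle e"
proof -
 obtain f where f: "incr_homeo f" "map f [a, a', b', b] = [-2, -1, 1, 2]" by (rule incr_homeo_obtain, erule (1) that) (use assms in auto)
 obtain g where g: "incr_homeo g" "map g [c, c', d', d] = [-2, -1, 1, 2]" by (rule incr_homeo_obtain, erule (1) that) (use assms in auto)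
 obtain h where h: "isotopic_to_id h"
  "\<forall>a b c d r z. f a = - r & f b = r & g c = - r & g d = r -->
    (h z \<in> cball 0 r <-> z \<in> rect a b c d) & (h z \<in> sphere 0 r <-> z \<in> bd (rect a b c d))"
  by (rule round_homeo[OF f(1) g(1)])
 have hh: "h z \<in> cball 0 1 <-> z \<in> rect a' b' c' d'" "h z \<in> cball 0 2 <-> z \<in> rect a b c d"
  "h z \<in> sphere 0 1 <-> z \<in> bd (rect a' b' c' d')" "h z \<in> sphere 0 2 <-> z \<in> bd (rect a b c d)" for z
  using f(2) g(2) h(2)[rule_format, of a' 1 b' c' d' z] h(2)[rule_format, of a 2 b c d z] by simp_all
 note pl = isotopic_homeo[OF h(1)]
 show thesis
  by (rule that[OF h(1)], unfold circle_tangle_def, rule map_pat[OF pl])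
   (simp_all only: hh homeo_image_eq[OF pl hh(2)] homeo_image_eq[OF pl hh(4)] image_empty)
qed

lemma col_nil_1: "col 1 b (1/4) 1 2 (3/8) [] = pat (stack_box 1 0) {} {z. Re z = 1} {z. 1 <= Re z} b
  {z \<in> bd (stack_box 1 0). Re z < 1}"
proof -
 have "lines_left 1 z = (if 1 <= Re z then 1 else 0)" for z
  using lines_left_max[of 1 z] lines_left_less_1[of z 1] by auto
 hence "line_colour 1 = {z. 1 <= Re z}" by (auto simp: line_colour_def)
 moreover have "line_curves 1 = {z. Re z = 1}" by (auto simp: line_curves_def)
 ultimately show ?thesis by (simp add: col_def col_box_def stack_box_def)
qed

lemma col_nil_2: "col 2 b (1/4) 1 2 (3/8) [] = pat (stack_box 2 0) {} {z. Re z = 1 | Re z = 2} {z. 1 <= Re z & Re z < 2} b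
  {z \<in> bd (stack_box 2 0). Re z < 1}"
proof -
 have "lines_left 2 z = (if 2 <= Re z then 2 else if 1 <= Re z then 1 else 0)" for z
  using lines_left_max[of 2 z] lines_left_less_1[of z 2] lines_left_eq[of 1 z 2] by auto
 hence "line_colour 2 = {z. 1 <= Re z & Re z < 2}" by (auto simp: line_colour_def)
 moreover have "{1..2::nat} = {1, 2}" by auto
 hence "line_curves 2 = {z. Re z = 1 | Re z = 2}" by (auto simp: line_curves_def)
 ultimately show ?thesis by (simp add: col_def col_box_def stack_box_def)
qed

lemma planar_col_nil: "planar_tangle (col n b (1/4) 1 2 (3/8) [])"
 by (rule planar_col) (simp add: col_ok_def)

lemma glue_trace_unit:
 defines "S == %n s. col n (s = Pos) (1/4) 1 2 (3/8) []"
 shows "glue (trace_tangle 1 s) (stack_box 1 0) (S 1 s) = pat (rect (1/8) (23/8) (-1) 4) {} (bd (rect 1 2 0 3)) (rect 1 2 0 3)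
   (s = Pos) (bd (rect (1/8) (23/8) (-1) 4))"
  and "gluable (trace_tangle 1 s) (stack_box 1 0) (S 1 s)"
  and "glue (left_trace_tangle s) (stack_box 1 0) (S 1 s) = pat (rect (-1) 2 (-1) 4) {} (bd (rect 0 1 0 3)) (rect 0 1 0 3)
   (opp s = Pos) (bd (rect (-1) 2 (-1) 4))"
  and "gluable (left_trace_tangle s) (stack_box 1 0) (S 1 s)"
proof -
 have B: "stack_box 1 0 \<subseteq> interior (rect (1/8) (23/8) (-1) 4)" "stack_box 1 0 \<subseteq> interior (rect (-1) 2 (-1) 4)" "closed (stack_box 1 0)"
  by (auto simp: stack_box_def in_rect in_int_rect closed_rect)
 have d: "bd (rect (1/8) (23/8) (-1) 4) Int stack_box 1 0 = {}" "bd (rect (-1) 2 (-1) 4) Int stack_box 1 0 = {}"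
  by (auto simp: stack_box_def rect_simps)
 note S = planar_col_nil[of 1 "s = Pos", unfolded col_nil_1]
 note g = glue_pat_single[OF B(1,3) planar_trace_tangle_1[of s, unfolded trace_tangle_1] S refl d(1) Un_empty_right[symmetric] Int_empty_left,
  where X = "bd (rect 1 2 0 3)" and Y = "rect 1 2 0 3" and b = "s = Pos"]
 show "glue (trace_tangle 1 s) (stack_box 1 0) (S 1 s) = pat (rect (1/8) (23/8) (-1) 4) {} (bd (rect 1 2 0 3)) (rect 1 2 0 3)
   (s = Pos) (bd (rect (1/8) (23/8) (-1) 4))"
  unfolding S_def trace_tangle_1 col_nil_1
  by (rule g(1)[unfolded Un_empty_right]; simp add: stack_box_def rect_simps; argo)
 show "gluable (trace_tangle 1 s) (stack_box 1 0) (S 1 s)"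
  unfolding S_def trace_tangle_1 col_nil_1
  by (rule g(2); simp add: stack_box_def rect_simps; argo)
 note g = glue_pat_single[OF B(2,3) planar_left_trace_tangle[of s, unfolded left_trace_tangle] S refl d(2) Un_empty_right[symmetric] Int_empty_left,
  where X = "bd (rect 0 1 0 3)" and Y = "rect 0 1 0 3" and b = "opp s = Pos"]
 show "glue (left_trace_tangle s) (stack_box 1 0) (S 1 s) = pat (rect (-1) 2 (-1) 4) {} (bd (rect 0 1 0 3)) (rect 0 1 0 3)
   (opp s = Pos) (bd (rect (-1) 2 (-1) 4))"
  unfolding S_def left_trace_tangle col_nil_1
  by (rule g(1)[unfolded Un_empty_right]; simp add: stack_box_def rect_simps opp_Pos; argo)
 show "gluable (left_trace_tangle s) (stack_box 1 0) (S 1 s)"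
  unfolding S_def left_trace_tangle col_nil_1
  by (rule g(2); simp add: stack_box_def rect_simps opp_Pos; argo)
qed

lemma planar_circle_tangle: "planar_tangle (circle_tangle b)"
proof -
 define s where "s = (if b then Pos else Neg)"
 hence b: "b <-> s = Pos" by simp
 interpret gluing "trace_tangle 1 s" "stack_box 1 0" "col 1 (s = Pos) (1/4) 1 2 (3/8) []"
  by unfold_locales (rule glue_trace_unit(2))
 obtain h where "isotopic_to_id h" "map_tangle h (pat (rect (1/8) (23/8) (-1) 4) {} (bd (rect 1 2 0 3)) (rect 1 2 0 3)
   b (bd (rect (1/8) (23/8) (-1) 4))) = circle_tangle b" by (rule rect_circle[of "1/8" 1 2 "23/8" "-1" 0 3 4]) auto
 thus ?thesis
  using planar_map_tangle[OF isotopic_homeo planar_G] unfolding glue_trace_unit(1) b by metis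
qed

lemma scaled_circle:
 assumes "0 < r"
 shows "isotopic_to_id (%z. of_real r * z + 0)"
  "map_tangle (%z. of_real r * z + 0) (circle_tangle b) = pat (cball 0 (2 * r)) {} (sphere 0 r) (cball 0 r) b (sphere 0 (2 * r))"
  "planar_tangle (pat (cball 0 (2 * r)) {} (sphere 0 r) (cball 0 r) b (sphere 0 (2 * r)))"
proof -
 show h: "isotopic_to_id (%z. of_real r * z + 0)" by (rule isotopic_affine) (use assms in simp)
 note pl = isotopic_homeo[OF h]
 show m: "map_tangle (%z. of_real r * z + 0) (circle_tangle b) = pat (cball 0 (2 * r)) {} (sphere 0 r) (cball 0 r) b (sphere 0 (2 * r))"
  unfolding circle_tangle_def
 proof (rule map_pat[OF pl])
  show "(%z. of_real r * z + 0 :: complex) ` cball 0 2 = cball 0 (2 * r)" "(%z. of_real r * z + 0 :: complex) ` sphere 0 2 = sphere 0 (2 * r)"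
   by (rule homeo_image_eq[OF pl]; use assms in \<open>simp add: norm_mult\<close>)+
 qed (use assms in \<open>simp_all add: norm_mult\<close>)
 show "planar_tangle (pat (cball 0 (2 * r)) {} (sphere 0 r) (cball 0 r) b (sphere 0 (2 * r)))"
  using planar_map_tangle[OF pl planar_circle_tangle[of b]] unfolding m .
qed

definition ring_around :: "bool => tangle" where
 "ring_around b = pat (cball 0 10) {cball 0 4} (sphere 0 5) (cball 0 5) b (sphere 0 10 Un sphere 0 4)"

lemma connected_sphere_complex: "connected (sphere (0::complex) r)"
 by (rule connected_sphere) simp

lemma planar_ring_around: "planar_tangle (ring_around b)"
proof -
 have "planar_tangle (pat (cball 0 10) {} (sphere 0 5) (cball 0 5) b (sphere 0 10))" (is "planar_tangle ?P")
  using scaled_circle(3)[of 5 b] by simp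
 then obtain C where "finite C" "disjoint C" "\<Union> C = strings ?P" "\<forall>c\<in>C. is_string ?P c"
  using planar_tangleD(5) by blast
 moreover have "strings ?P = sphere 0 5" by auto
 ultimately have C: "finite C" "disjoint C" "\<Union> C = sphere 0 5" "!!c. c \<in> C ==> is_string ?P c" by auto
 show ?thesis
  unfolding ring_around_def
proof (rule planar_patI[where C = C])
 have ball: "cball (0::complex) r homeomorphic cball (0::complex) 1" if "0 < r" for r :: real
  by (rule homeomorphic_balls(2)[OF that zero_less_one])
 show "D homeomorphic cball (0::complex) 1" if "D \<in> insert (cball (0::complex) 10) {cball 0 4}" for D using that by (auto intro: ball)
 show "is_string (pat (cball 0 10) {cball 0 4} (sphere 0 5) (cball 0 5) b (sphere 0 10 Un sphere 0 4)) c" if cC: "c \<in> C" for c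
 proof -
  have c: "c \<subseteq> sphere 0 5" using C(3) cC by auto
  obtain g where g: "path_image g = c" "arc g & pathstart g \<in> \<Union> (bd ` discs ?P) | simple_path g & pathfinish g = pathstart g"
   using C(4)[OF cC] unfolding is_string_def by blast
  have "pathstart g \<in> sphere 0 5" using c g(1) by auto
  hence "pathstart g ~: \<Union> (bd ` discs ?P)" by (auto simp: discs_def)
  moreover have "c \<subseteq> interior (cball 0 10) - cball 0 4" using c by auto
  ultimately show ?thesis unfolding is_string_def using g by auto
 qed
 fix z :: complex
 let ?R = "cball 0 10 - \<Union> (interior ` {cball (0::complex) 4})"
 have R: "w \<in> ?R <-> norm w <= 10 & 4 <= norm w" for w by (auto simp: not_less)
 show "\<forall>\<^sub>F w in nhds z. w \<in> ?R - sphere 0 5 --> (w \<in> cball 0 5 <-> z \<in> cball 0 5)" if "z \<in> ?R - sphere 0 5"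
 proof (cases "norm z < 5")
  case True
  hence "\<forall>\<^sub>F w in nhds z. w \<in> ball 0 5" by (intro eventually_nhds_in_open) auto
  thus ?thesis using True by (auto elim!: eventually_mono)
 next
  case False
  hence "\<forall>\<^sub>F w in nhds z. w \<in> - cball 0 5" using that by (intro eventually_nhds_in_open) (auto intro: open_Compl)
  thus ?thesis using False that by (auto elim!: eventually_mono)
 qed
 show "z \<in> closure ((?R - sphere 0 5) Int cball 0 5) & z \<in> closure ((?R - sphere 0 5) - cball 0 5)" if "z \<in> sphere 0 5 Int ?R"
 proof
  have n: "norm (z + of_real t * (of_real c * z)) = \<bar>1 + t * c\<bar> * 5" for t c :: real
  proof -
   have "z + of_real t * (of_real c * z) = of_real (1 + t * c) * z" by (simp add: algebra_simps)
   thus ?thesis using that by (simp only: norm_mult norm_of_real) simp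
  qed
  show "z \<in> closure ((?R - sphere 0 5) Int cball 0 5)"
  proof (rule in_closureI)
   fix t :: real assume "0 < t" "t < 1/8"
   thus "z + of_real t * (of_real (- 1/5) * z) \<in> (?R - sphere 0 5) Int cball 0 5"
    using n[of t "- 1/5"] unfolding Int_iff Diff_iff[of _ ?R] R mem_sphere_0 mem_cball_0 by simp
  qed (use that in \<open>simp add: norm_mult\<close>)
  show "z \<in> closure ((?R - sphere 0 5) - cball 0 5)"
  proof (rule in_closureI)
   fix t :: real assume "0 < t" "t < 1/8"
   thus "z + of_real t * (of_real (1/5) * z) \<in> (?R - sphere 0 5) - cball 0 5"
    using n[of t "1/5"] unfolding Diff_iff[of _ ?R] Diff_iff[of _ "?R - sphere 0 5"] R mem_sphere_0 mem_cball_0 by simp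
  qed (use that in \<open>simp add: norm_mult\<close>)
 qed
next
 let ?R = "cball 0 10 - \<Union> (interior ` {cball (0::complex) 4})" and ?M = "sphere 0 10 Un sphere (0::complex) 4"
 fix D assume D: "D \<in> insert (cball 0 10) {cball (0::complex) 4}"
 then obtain r where r: "D = cball 0 r" "r = 10 | r = 4" "0 < r" by auto
 have e: "sphere 0 5 Int ?R Int bd D = {}" using r by auto
 thus "even (card (sphere 0 5 Int ?R Int bd D))" by simp
 have fD: "bd D = sphere 0 r" using r by auto
 have M: "?M Int bd D = sphere 0 r" "bd D - sphere 0 5 Int ?R = sphere 0 r" unfolding fD using r by auto
 have "Complex r 0 \<in> sphere 0 r" using r(3) by (simp add: cmod_def)
 thus "?M Int bd D \<in> components (bd D - sphere 0 5 Int ?R)"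
  unfolding M using r(3) by (intro component_if_clopen connected_sphere_complex) auto
qed (use C in \<open>auto simp: disjoint_def pairwise_def\<close>)
qed

lemma round_empty_tangle:
 obtains h where "isotopic_to_id h" "map_tangle h (stack_tangle 0 s 0) = pat (cball 0 4) {} {} {} (s = Pos) (sphere 0 4)"
  "h ` outer_disc (stack_tangle 0 s 0) = cball 0 4"
proof -
 obtain f where f: "incr_homeo f" "map f [1/8, 7/8] = [-4, 4]" by (rule incr_homeo_obtain, erule (1) that) auto
 obtain g where g: "incr_homeo g" "map g [0, 1] = [-4, 4]" by (rule incr_homeo_obtain, erule (1) that) auto
 obtain h where h: "isotopic_to_id h"
  "\<forall>a b c d r z. f a = - r & f b = r & g c = - r & g d = r -->
    (h z \<in> cball 0 r <-> z \<in> rect a b c d) & (h z \<in> sphere 0 r <-> z \<in> bd (rect a b c d))"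
  by (rule round_homeo[OF f(1) g(1)])
 note pl = isotopic_homeo[OF h(1)]
 have hh: "h z \<in> cball 0 4 <-> z \<in> rect (1/8) (7/8) 0 1" "h z \<in> sphere 0 4 <-> z \<in> bd (rect (1/8) (7/8) 0 1)" for z
  using f(2) g(2) h(2)[rule_format, of "1/8" 4 "7/8" 0 1 z] by simp_all
 have e: "stack_tangle 0 s 0 = pat (rect (1/8) (7/8) 0 1) {} {} {} (s = Pos) (bd (rect (1/8) (7/8) 0 1))"
  by (auto simp: stack_tangle_def Let_def pat_def shade_odd in_rect in_bd_rect floor_eq_iff)
 have "map_tangle h (stack_tangle 0 s 0) = pat (cball 0 4) {} {} {} (s = Pos) (sphere 0 4)"
  unfolding e by (rule map_pat[OF pl]) (simp_all only: hh homeo_image_eq[OF pl hh(1)] homeo_image_eq[OF pl hh(2)] image_empty empty_iff)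
 thus thesis by (rule that[OF h(1)]) (simp add: e homeo_image_eq[OF pl hh(1)] del: mem_cball)
qed

abbreviation "nested_circles b == pat (cball 0 10) {} (sphere 0 2 Un sphere 0 5) (cball 0 5 - cball 0 2) b (sphere 0 10)"

lemma glue_ring_around:
 assumes T: "planar_tangle (pat (cball 0 4) {} X Y (\<not> b) (sphere 0 4))" and X: "X Int sphere 0 4 = {}" "Y Int sphere 0 4 = {}"
 shows "glue (ring_around b) (cball 0 4) (pat (cball 0 4) {} X Y (\<not> b) (sphere 0 4)) =
   pat (cball 0 10) {} (X Int cball 0 4 Un sphere 0 5) (cball 0 5 - Y Int cball 0 4) b (sphere 0 10)"
  and "gluable (ring_around b) (cball 0 4) (pat (cball 0 4) {} X Y (\<not> b) (sphere 0 4))"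
proof -
 have M: "sphere (0::complex) 10 Un sphere 0 4 = sphere 0 10 Un {z \<in> bd (cball 0 4). True}" "sphere (0::complex) 10 Int cball 0 4 = {}"
  "sphere (0::complex) 4 = {z \<in> bd (cball 0 4). True} Un {}" by auto
 note g = glue_pat_single[OF _ closed_cball planar_ring_around[of b, unfolded ring_around_def] T M Int_empty_left,
   where X = "X Int cball 0 4 Un sphere 0 5" and Y = "cball 0 5 - Y Int cball 0 4" and b = b]
 have S: "norm z = 4 ==> z ~: X" "norm z = 4 ==> z ~: Y" for z using X by auto
 show "glue (ring_around b) (cball 0 4) (pat (cball 0 4) {} X Y (\<not> b) (sphere 0 4)) =
   pat (cball 0 10) {} (X Int cball 0 4 Un sphere 0 5) (cball 0 5 - Y Int cball 0 4) b (sphere 0 10)"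
  unfolding ring_around_def
  by (rule g(1)[unfolded Un_empty_right]) (use S in \<open>force simp: not_less\<close>)+
 show "gluable (ring_around b) (cball 0 4) (pat (cball 0 4) {} X Y (\<not> b) (sphere 0 4))"
  unfolding ring_around_def by (rule g(2)) (use S in \<open>force simp: not_less\<close>)+
qed

lemma nested_rects:
 obtains h where "isotopic_to_id h" "map_tangle h (pat (rect (1/8) (39/8) (-2) 5) {} (bd (rect 1 4 (-1) 4) Un bd (rect 2 3 0 3))
   (rect 1 4 (-1) 4 - rect 2 3 0 3) b (bd (rect (1/8) (39/8) (-2) 5))) = nested_circles b"
proof -
 obtain f where f: "incr_homeo f" "map f [1/8, 1, 2, 3, 4, 39/8] = [-10, -5, -2, 2, 5, 10]" by (rule incr_homeo_obtain, erule (1) that) auto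
 obtain g where g: "incr_homeo g" "map g [-2, -1, 0, 3, 4, 5] = [-10, -5, -2, 2, 5, 10]" by (rule incr_homeo_obtain, erule (1) that) auto
 obtain h where h: "isotopic_to_id h"
  "\<forall>a b c d r z. f a = - r & f b = r & g c = - r & g d = r -->
    (h z \<in> cball 0 r <-> z \<in> rect a b c d) & (h z \<in> sphere 0 r <-> z \<in> bd (rect a b c d))"
  by (rule round_homeo[OF f(1) g(1)])
 note pl = isotopic_homeo[OF h(1)]
 have hh: "h z \<in> cball 0 10 <-> z \<in> rect (1/8) (39/8) (-2) 5" "h z \<in> sphere 0 10 <-> z \<in> bd (rect (1/8) (39/8) (-2) 5)"
  "h z \<in> cball 0 5 <-> z \<in> rect 1 4 (-1) 4" "h z \<in> sphere 0 5 <-> z \<in> bd (rect 1 4 (-1) 4)"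
  "h z \<in> cball 0 2 <-> z \<in> rect 2 3 0 3" "h z \<in> sphere 0 2 <-> z \<in> bd (rect 2 3 0 3)" for z
  using f(2) g(2) h(2)[rule_format, of "1/8" 10 "39/8" "-2" 5 z] h(2)[rule_format, of 1 5 4 "-1" 4 z]
   h(2)[rule_format, of 2 2 3 0 3 z] by simp_all
 show thesis
  by (rule that[OF h(1)], rule map_pat[OF pl])
   (auto simp only: Un_iff Diff_iff hh homeo_image_eq[OF pl hh(1)] homeo_image_eq[OF pl hh(2)] image_empty)
qed

context planar_algebra
begin

lemma glue_trace_2_unit:
 "glue (trace_tangle 2 s) (stack_box 2 0) (col 2 (s = Pos) (1/4) 1 2 (3/8) []) = pat (rect (1/8) (39/8) (-2) 5) {}
   (bd (rect 1 4 (-1) 4) Un bd (rect 2 3 0 3)) (rect 1 4 (-1) 4 - rect 2 3 0 3) (s = Pos) (bd (rect (1/8) (39/8) (-2) 5))"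
 "gluable (trace_tangle 2 s) (stack_box 2 0) (col 2 (s = Pos) (1/4) 1 2 (3/8) [])"
proof -
 have B: "stack_box 2 0 \<subseteq> interior (rect (1/8) (39/8) (-2) 5)" "closed (stack_box 2 0)"
  by (auto simp: stack_box_def in_rect in_int_rect closed_rect)
 have d: "bd (rect (1/8) (39/8) (-2) 5) Int stack_box 2 0 = {}"
  by (auto simp: stack_box_def rect_simps)
 note S = planar_col_nil[of 2 "s = Pos", unfolded col_nil_2]
 note g = glue_pat_single[OF B trace_2_spaces(1)[of s, unfolded trace_tangle_2] S refl d Un_empty_right[symmetric] Int_empty_left,
  where X = "bd (rect 1 4 (-1) 4) Un bd (rect 2 3 0 3)" and Y = "rect 1 4 (-1) 4 - rect 2 3 0 3" and b = "s = Pos"]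
 show "glue (trace_tangle 2 s) (stack_box 2 0) (col 2 (s = Pos) (1/4) 1 2 (3/8) []) = pat (rect (1/8) (39/8) (-2) 5) {}
   (bd (rect 1 4 (-1) 4) Un bd (rect 2 3 0 3)) (rect 1 4 (-1) 4 - rect 2 3 0 3) (s = Pos) (bd (rect (1/8) (39/8) (-2) 5))"
  unfolding trace_tangle_2 col_nil_2
  by (rule g(1)[unfolded Un_empty_right]; simp add: stack_box_def rect_simps; argo)
 show "gluable (trace_tangle 2 s) (stack_box 2 0) (col 2 (s = Pos) (1/4) 1 2 (3/8) [])"
  unfolding trace_tangle_2 col_nil_2
  by (rule g(2); simp add: stack_box_def rect_simps; argo)
qed

lemma act_glue_unit:
 assumes "gluable T B (col n (s = Pos) (1/4) 1 2 (3/8) [])" "inner_discs T = {B}"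
 shows "act A (glue T B (col n (s = Pos) (1/4) 1 2 (3/8) [])) f = act A T (%_. box_unit A n s)"
proof (rule act_glue_eq[OF assms(1) refl])
 show "act A (col n (s = Pos) (1/4) 1 2 (3/8) []) f = box_unit A n s"
  by (rule act_col_nil) (simp add: col_ok_def)
qed (use assms(2) in \<open>simp_all add: col_def\<close>)

lemma act_map_empty:
 assumes "planar_tangle T" "isotopic_to_id h" "map_tangle h T = T'" "inner_discs T = {}"
 shows "act A T' f = act A T g"
 by (rule act_map_eq[OF assms(1-3)]) (simp_all add: assms(4))

lemma act_loop_tangle:
 "act A (loop_tangle s) (%_. 0) = act A (trace_tangle 1 s) (%_. box_unit A 1 s)"
 "act A (loop_tangle (opp s)) (%_. 0) = act A (left_trace_tangle s) (%_. box_unit A 1 s)"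
proof -
 have pl: "planar_tangle (glue T B S)" if "gluable T B S" for T B S
  by (rule gluing.planar_G) (unfold_locales, rule that)
 obtain h where h: "isotopic_to_id h" "map_tangle h (pat (rect (1/8) (23/8) (-1) 4) {} (bd (rect 1 2 0 3)) (rect 1 2 0 3)
   (s = Pos) (bd (rect (1/8) (23/8) (-1) 4))) = circle_tangle (s = Pos)"
  by (rule rect_circle[of "1/8" 1 2 "23/8" "-1" 0 3 4]) auto
 note h2 = h(2)[folded glue_trace_unit(1)]
 show "act A (loop_tangle s) (%_. 0) = act A (trace_tangle 1 s) (%_. box_unit A 1 s)"
  unfolding loop_tangle
  by (subst act_glue_unit[OF glue_trace_unit(2) trace_tangle_inner, where f = "%_. 0", symmetric],
    rule act_map_empty[OF pl[OF glue_trace_unit(2)] h(1) h2]) (simp add: glue_trace_unit(1))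
 obtain h where h: "isotopic_to_id h" "map_tangle h (pat (rect (-1) 2 (-1) 4) {} (bd (rect 0 1 0 3)) (rect 0 1 0 3)
   (opp s = Pos) (bd (rect (-1) 2 (-1) 4))) = circle_tangle (opp s = Pos)"
  by (rule rect_circle[of "-1" 0 1 2 "-1" 0 3 4]) auto
 note h2 = h(2)[folded glue_trace_unit(3)]
 show "act A (loop_tangle (opp s)) (%_. 0) = act A (left_trace_tangle s) (%_. box_unit A 1 s)"
  unfolding loop_tangle
  by (subst act_glue_unit[OF glue_trace_unit(4) left_trace_spaces(3), where f = "%_. 0", symmetric],
    rule act_map_empty[OF pl[OF glue_trace_unit(4)] h(1) h2]) (simp add: glue_trace_unit(3))
qed

end

context subfactor_planar_algebra
begin

lemma box_trace_1_unit: "act A (loop_tangle s) (%_. 0) = scl A (box_trace A 1 s (box_unit A 1 s)) (box_unit A 0 s)"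
 using scalar_of[OF act_trace_1_closed[OF box_unit_closed]] by (simp add: act_loop_tangle(1) box_trace_def)

lemma box_trace_1_unit_opp: "box_trace A 1 (opp s) (box_unit A 1 (opp s)) = box_trace A 1 s (box_unit A 1 s)"
 using act_left_trace[OF box_unit_closed, of s] box_trace_1_unit[of "opp s"] scalar_of_scl[of "opp s"]
 by (metis act_loop_tangle(2))

lemma loop_value:
 assumes "irreducible_planar_algebra A"
 shows "box_trace A 1 s (box_unit A 1 s) = of_real (loop_value A)" "0 < loop_value A"
proof -
 have u: "box_unit A 1 Pos ~= 0"
  using assms unit_nonzero_if_dim[of 1 Pos] unfolding irreducible_planar_algebra_def by blast
 have v: "loop_value A = Re (box_trace A 1 Pos (box_unit A 1 Pos))"
  by (simp add: loop_value_def box_trace_1_unit scalar_of_scl)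
 have "box_trace A 1 Pos (box_unit A 1 Pos) \<in> \<real>" "0 < Re (box_trace A 1 Pos (box_unit A 1 Pos))"
  using positive_definite[OF box_unit_closed u] by (simp_all add: adj_box_unit box_mult_unit_left[OF box_unit_closed])
 thus "box_trace A 1 s (box_unit A 1 s) = of_real (loop_value A)" "0 < loop_value A"
  using box_trace_1_unit_opp[of Pos] by (cases s; simp add: v of_real_Re)+
qed

lemma act_ring_around:
 assumes T: "planar_tangle (pat (cball 0 4) {} X Y (opp s = Pos) (sphere 0 4))" and X: "X \<subseteq> ball 0 4" "Y \<subseteq> ball 0 4"
 shows "act A (pat (cball 0 10) {} (X Un sphere 0 5) (cball 0 5 - Y) (s = Pos) (sphere 0 10)) (%_. 0) =
   act A (ring_around (s = Pos)) (%_. act A (pat (cball 0 4) {} X Y (opp s = Pos) (sphere 0 4)) (%_. 0))"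
proof -
 note T' = T[unfolded opp_Pos]
 have d: "X Int sphere 0 4 = {}" "Y Int sphere 0 4 = {}" "X Int cball 0 4 = X" "Y Int cball 0 4 = Y" using X by force+
 show ?thesis unfolding opp_Pos
  by (rule act_glue_eq[OF glue_ring_around(2)[OF T' d(1,2)] glue_ring_around(1)[OF T' d(1,2), unfolded d(3,4)]])
   (simp_all add: ring_around_def)
qed

text \<open>The trace of the unit of two strings is a pair of nested circles. The inner circle, in a region of
 the other colour, has the same value by sphericality; taking out this scalar leaves the outer circle.\<close>

lemma box_trace_2_unit:
 "box_trace A 2 s (box_unit A 2 s) = box_trace A 1 s (box_unit A 1 s) * box_trace A 1 s (box_unit A 1 s)"
proof -
 let ?d = "box_trace A 1 s (box_unit A 1 s)" and ?u = "box_unit A 0 (opp s)" and ?V = "ring_around (s = Pos)"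
 let ?E = "pat (cball 0 4) {} {} {} (opp s = Pos) (sphere 0 4)" and ?L = "pat (cball 0 4) {} (sphere 0 2) (cball 0 2) (opp s = Pos) (sphere 0 4)"
 obtain h where h: "isotopic_to_id h" "map_tangle h (stack_tangle 0 (opp s) 0) = ?E" "h ` outer_disc (stack_tangle 0 (opp s) 0) = cball 0 4"
  by (rule round_empty_tangle)
 have E: "planar_tangle ?E" by (rule planar_disc_space_map(1)[OF planar_stack_tangle h(1,2)])
 have actE: "act A ?E (%_. 0) = ?u"
  unfolding box_unit_def by (rule act_map_empty[OF planar_stack_tangle h(1,2)]) (simp add: stack_tangle_def Let_def)
 have "disc_space A ?E (cball 0 4) = box_space A 0 (opp s)"
  using planar_disc_space_map(2)[OF planar_stack_tangle h(1,2), of "outer_disc (stack_tangle 0 (opp s) 0)"]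
  by (simp add: h(3) disc_space_def stack_outer_size_sign)
 hence V: "disc_space A ?V (cball 0 4) = box_space A 0 (opp s)"
  using gluable_outer_disc[OF glue_ring_around(2)[of "{}" "{}" "s = Pos"], of A] E by (simp add: opp_Pos)
 have L: "planar_tangle ?L" using scaled_circle(3)[of 2] by simp
 have actL: "act A ?L (%_. 0) = scl A ?d ?u"
  using act_map_empty[OF planar_circle_tangle scaled_circle(1)[of 2] scaled_circle(2)[of 2], of "opp s = Pos" "%_. 0" "%_. 0"]
   box_trace_1_unit[of "opp s"] by (simp add: loop_tangle box_trace_1_unit_opp circle_tangle_def)
 have "act A (pat (cball 0 10) {} (sphere 0 5) (cball 0 5) (s = Pos) (sphere 0 10)) (%_. 0) = scl A ?d (box_unit A 0 s)"
  using act_map_empty[OF planar_circle_tangle scaled_circle(1)[of 5] scaled_circle(2)[of 5], of "s = Pos" "%_. 0" "%_. 0"]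
   box_trace_1_unit[of s] by (simp add: loop_tangle circle_tangle_def)
 hence actV: "act A ?V (%_. ?u) = scl A ?d (box_unit A 0 s)"
  using act_ring_around[OF E] by (simp add: actE)
 have pl: "planar_tangle (glue (trace_tangle 2 s) (stack_box 2 0) (col 2 (s = Pos) (1/4) 1 2 (3/8) []))"
  by (rule gluing.planar_G) (unfold_locales, rule glue_trace_2_unit(2))
 obtain k where k: "isotopic_to_id k" "map_tangle k (pat (rect (1/8) (39/8) (-2) 5) {} (bd (rect 1 4 (-1) 4) Un bd (rect 2 3 0 3))
   (rect 1 4 (-1) 4 - rect 2 3 0 3) (s = Pos) (bd (rect (1/8) (39/8) (-2) 5))) = nested_circles (s = Pos)" by (rule nested_rects)
 have "act A (trace_tangle 2 s) (%_. box_unit A 2 s) = act A (nested_circles (s = Pos)) (%_. 0)"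
  by (subst act_glue_unit[OF glue_trace_2_unit(2) trace_tangle_inner, where f = "%_. 0", symmetric], rule sym,
    rule act_map_empty[OF pl k(1) k(2)[folded glue_trace_2_unit(1)]]) (simp add: glue_trace_2_unit(1))
 also have "... = act A ?V (%_. scl A ?d ?u)"
  using act_ring_around[OF L] by (simp add: actL subset_iff)
 also have "... = scl A ?d (act A ?V (%_. ?u))"
  by (rule act_one_disc_linear(2)[where D = "cball 0 4" and y = ?u])
   (simp_all add: planar_ring_around V box_unit_closed, simp_all add: ring_around_def)
 also have "... = scl A (?d * ?d) (box_unit A 0 s)"
  unfolding actV using vector_space_scl by (simp add: vector_space_def)
 finally show ?thesis by (simp add: box_trace_def scalar_of_scl)
qed

end

section \<open>The Fourier transform is isometric\<close>

subsection \<open>Moving boxes along a ring\<close>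

text \<open>
 The trace of a product has two boxes on top of each other on two concentric square rings. \<open>carry\<close>
 moves the upper box to the left side of the rings and the lower one to the right side. \<open>squeeze\<close>
 turns both boxes into pieces of cones, one above the left half axis and one below it;
 \<open>bend\<close> contracts the left half plane and shears both half planes so that these cones move to the
 vertical half axes; \<open>unbend\<close> is the radial map that restores the bent squares; finally
 a rotation by a right angle takes the vertical axis to the horizontal one.
\<close>

definition clip :: "real => real => real" where
 "clip r y = max (- r) (min r y)"

lemma clip_continuous [continuous_intros]: "continuous_on S f ==> continuous_on S (%x. clip r (f x))"
 unfolding clip_def by (intro continuous_intros)

definition squeeze_height :: "real => real => real" where
 "squeeze_height c y = 4/15 * c * clip (3/2) y + (4 - 4/5 * c) * (clip 2 y - clip (3/2) y) + (y - clip 2 y)"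

definition squeeze_slope :: "complex => real" where
 "squeeze_slope z = max (3/2) (min (9/2) \<bar>Re z\<bar>)"

definition squeeze :: "complex => complex" where
 "squeeze z = Complex (Re z) (squeeze_height (squeeze_slope z) (Im z))"

lemma squeeze_slope: "3/2 <= squeeze_slope z" "squeeze_slope z <= 9/2"
 by (auto simp: squeeze_slope_def)

lemma squeeze_height_less:
 assumes c: "3/2 <= c" "c <= 9/2" and y: "y < y'"
 shows "squeeze_height c y < squeeze_height c y'"
proof -
 define p where "p = clip (3/2) y' - clip (3/2) y"
 define q where "q = (clip 2 y' - clip (3/2) y') - (clip 2 y - clip (3/2) y)"
 define r where "r = (y' - clip 2 y') - (y - clip 2 y)"
 have n: "0 <= p" "0 <= q" "0 <= r" and s: "p + q + r = y' - y"
  using y by (auto simp: p_def q_def r_def clip_def max_def min_def)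
 have "2/5 <= 4/15 * c" "2/5 <= 4 - 4/5 * c" using c by simp_all
 note a = mult_right_mono[OF this(1) n(1)] mult_right_mono[OF this(2) n(2)]
 have "squeeze_height c y' - squeeze_height c y = 4/15 * c * p + (4 - 4/5 * c) * q + r"
  by (simp add: squeeze_height_def p_def q_def r_def algebra_simps)
 thus ?thesis using a n s y by linarith
qed

lemma squeeze_height_compare:
 assumes "3/2 <= c" "c <= 9/2"
 shows "squeeze_height c y <= squeeze_height c y' <-> y <= y'" "squeeze_height c y < squeeze_height c y' <-> y < y'"
 using squeeze_height_less[OF assms, of y y'] squeeze_height_less[OF assms, of y' y] by (cases y y' rule: linorder_cases; force)+

lemma squeeze_height_values:
 "squeeze_height c (3/2) = 2/5 * c" "squeeze_height c (- 3/2) = - (2/5 * c)"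
 "squeeze_height c (9/8) = 3/10 * c" "squeeze_height c (- 9/8) = - (3/10 * c)"
 "squeeze_height c (3/8) = 1/10 * c" "squeeze_height c (- 3/8) = - (1/10 * c)"
 by (simp_all add: squeeze_height_def clip_def)

lemma squeeze_height_outside: "2 <= \<bar>y\<bar> ==> squeeze_height c y = y"
 by (cases "0 <= y") (simp_all add: squeeze_height_def clip_def algebra_simps)

lemma isotopic_squeeze: "isotopic_to_id squeeze"
proof -
 let ?f = "%z. squeeze_height (squeeze_slope z) (Im z)"
 have s: "squeeze_slope (Complex x y) = squeeze_slope (Complex x 0)" for x y by (simp add: squeeze_slope_def)
 have "isotopic_to_id (%z. Complex (Re z) (?f z))"
 proof (rule isotopic_vertical_map)
  show "continuous_on UNIV ?f" unfolding squeeze_height_def squeeze_slope_def by (intro continuous_intros)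
  show "?f (Complex x y) < ?f (Complex x y')" if "y < y'" for x y y'
   using squeeze_height_less[OF squeeze_slope[of "Complex x 0"] that] s by (metis complex.sel(2))
  show "\<exists>y. M <= ?f (Complex x y)" for M x
   by (rule exI[of _ "max M 2"]) (simp add: squeeze_height_outside)
  show "\<exists>y. ?f (Complex x y) <= M" for M x
   by (rule exI[of _ "min M (-2)"]) (simp add: squeeze_height_outside)
 qed
 thus ?thesis unfolding squeeze_def .
qed

lemma squeeze_sup_norm:
 assumes "2 <= r"
 shows "sup_norm (squeeze z) <= r <-> sup_norm z <= r" "sup_norm (squeeze z) < r <-> sup_norm z < r"
proof -
 let ?c = "squeeze_slope z" and ?y = "Im z"
 have v: "squeeze_height ?c r = r" "squeeze_height ?c (- r) = - r" using assms by (auto intro: squeeze_height_outside)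
 note k = squeeze_height_compare[OF squeeze_slope[of z]]
 have "squeeze_height ?c ?y <= r <-> ?y <= r" "- r <= squeeze_height ?c ?y <-> - r <= ?y"
  "squeeze_height ?c ?y < r <-> ?y < r" "- r < squeeze_height ?c ?y <-> - r < ?y"
  using k[of ?y r] k[of "- r" ?y] v by simp_all
 thus "sup_norm (squeeze z) <= r <-> sup_norm z <= r" "sup_norm (squeeze z) < r <-> sup_norm z < r"
  by (auto simp: sup_norm_def squeeze_def)
qed

definition bend :: "complex => complex" where
 "bend z = Complex (max (3/25 * Re z) (Re z) + 4/5 * \<bar>Im z\<bar>) (Im z)"

lemma isotopic_bend: "isotopic_to_id bend"
proof -
 let ?f = "%z. max (3/25 * Re z) (Re z) + 4/5 * \<bar>Im z\<bar>"
 have "isotopic_to_id (%z. Complex (?f z) (Im z))"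
 proof (rule isotopic_level_map)
  show "continuous_on UNIV ?f" by (intro continuous_intros)
  show "?f (Complex x y) < ?f (Complex x' y)" if "x < x'" for x x' y using that by (auto simp: max_def)
  show "\<exists>x. M <= ?f (Complex x y)" for M y
   by (rule exI[of _ "max M 0"]) auto
  show "\<exists>x. ?f (Complex x y) <= M" for M y
   by (rule exI[of _ "min (9 * (M - 4/5 * \<bar>y\<bar>)) 0"]) (simp add: max_def min_def; argo)
 qed
 thus ?thesis unfolding bend_def .
qed

text \<open>The gauge whose balls are the images of squares under \<open>bend\<close>.\<close>

definition bent_norm :: "complex => real" where
 "bent_norm w = max \<bar>min (25/3 * (Re w - 4/5 * \<bar>Im w\<bar>)) (Re w - 4/5 * \<bar>Im w\<bar>)\<bar> \<bar>Im w\<bar>"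

definition unbend :: "complex => complex" where
 "unbend w = of_real (bent_norm w / sup_norm w) * w"

lemma bent_norm_pos: "w ~= 0 ==> 0 < bent_norm w"
 by (auto simp: bent_norm_def complex_eq_iff less_max_iff_disj)

lemma isotopic_unbend: "isotopic_to_id unbend"
 unfolding unbend_def
proof (rule isotopic_radial)
 show "continuous_on UNIV bent_norm" unfolding bent_norm_def by (intro continuous_intros)
 show "continuous_on UNIV sup_norm" using sup_norm_continuous[of UNIV "%z. z"] by simp
 show "0 < bent_norm z" if "z ~= 0" for z by (rule bent_norm_pos[OF that])
 show "0 < sup_norm z" if "z ~= 0" for z by (rule sup_norm_pos[OF that])
 fix r :: real and z assume r: "0 < r"
 show "sup_norm (of_real r * z) = r * sup_norm z" using r by (simp add: sup_norm_scale)
 have a: "Re (of_real r * z) - 4/5 * \<bar>Im (of_real r * z)\<bar> = r * (Re z - 4/5 * \<bar>Im z\<bar>)"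
  using r by (simp add: abs_mult algebra_simps)
 have m: "min (25/3 * (r * v)) (r * v) = r * min (25/3 * v) v" for v
  using r by (auto simp: min_def mult_le_cancel_left)
 show "bent_norm (of_real r * z) = r * bent_norm z"
  unfolding bent_norm_def a m using r by (simp add: abs_mult max_mult_distrib_left)
qed

lemma bent_norm_bend: "bent_norm (bend z) = sup_norm z"
 by (auto simp: bent_norm_def bend_def sup_norm_def max_def min_def)

lemma unbend_sup_norm: "sup_norm (unbend w) = bent_norm w"
proof (cases "w = 0")
 case False
 thus ?thesis
  using sup_norm_pos[OF False] bent_norm_pos[OF False] unfolding unbend_def by (subst sup_norm_scale) simp_all
qed (simp add: unbend_def sup_norm_def bent_norm_def)

lemma unbend_cone:
 assumes w: "w ~= 0"
 shows "Im (unbend w) < 0 <-> Im w < 0" "0 < Im (unbend w) <-> 0 < Im w"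
  "\<bar>Re (unbend w)\<bar> <= 2/5 * \<bar>Im (unbend w)\<bar> <-> \<bar>Re w\<bar> <= 2/5 * \<bar>Im w\<bar>"
proof -
 define t where "t = bent_norm w / sup_norm w"
 have t: "0 < t" using sup_norm_pos[OF w] bent_norm_pos[OF w] by (simp add: t_def)
 have u: "Re (unbend w) = t * Re w" "Im (unbend w) = t * Im w" by (simp_all add: unbend_def t_def)
 show "Im (unbend w) < 0 <-> Im w < 0" "0 < Im (unbend w) <-> 0 < Im w" using t by (simp_all add: u mult_less_0_iff zero_less_mult_iff)
 have "\<bar>Re (unbend w)\<bar> <= 2/5 * \<bar>Im (unbend w)\<bar> <-> t * \<bar>Re w\<bar> <= t * (2/5 * \<bar>Im w\<bar>)"
  using t by (simp add: u abs_mult)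
 thus "\<bar>Re (unbend w)\<bar> <= 2/5 * \<bar>Im (unbend w)\<bar> <-> \<bar>Re w\<bar> <= 2/5 * \<bar>Im w\<bar>"
  using t by (simp add: mult_le_cancel_left)
qed

definition carry :: "complex => complex" where
 "carry z = \<i> * unbend (bend (squeeze z)) + 0"

lemma isotopic_carry: "isotopic_to_id carry"
 unfolding carry_def
 by (rule isotopic_to_id_comp[OF isotopic_affine isotopic_to_id_comp[OF isotopic_unbend isotopic_to_id_comp[OF isotopic_bend isotopic_squeeze]]]) simp

lemma sup_norm_ii: "sup_norm (\<i> * z + 0) = sup_norm z"
 by (simp add: sup_norm_def max.commute)

lemma carry_sup_norm: "sup_norm (carry z) = sup_norm (squeeze z)"
 unfolding carry_def sup_norm_ii unbend_sup_norm bent_norm_bend ..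

abbreviation "sector == {z. 3/2 <= sup_norm z & sup_norm z <= 9/2 & \<bar>Im z\<bar> <= 2/5 * \<bar>Re z\<bar>}"

lemma squeeze_ends:
 "squeeze z \<in> sector & 0 < Re (squeeze z) <-> z \<in> rect (3/2) (9/2) (- 3/2) (3/2)"
 "squeeze z \<in> sector & Re (squeeze z) < 0 <-> z \<in> rect (- 9/2) (- 3/2) (- 3/2) (3/2)"
proof -
 let ?c = "squeeze_slope z" and ?y = "Im z"
 note k = squeeze_height_compare[OF squeeze_slope[of z]]
 have h: "squeeze_height ?c ?y <= 2/5 * ?c <-> ?y <= 3/2" "- (2/5 * ?c) <= squeeze_height ?c ?y <-> - 3/2 <= ?y"
  using k(1)[of ?y "3/2"] k(1)[of "- 3/2" ?y] unfolding squeeze_height_values by simp_all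
 have c: "?c = \<bar>Re z\<bar>" if "3/2 <= \<bar>Re z\<bar>" "\<bar>Re z\<bar> <= 9/2" using that by (simp add: squeeze_slope_def)
 have s: "squeeze z \<in> sector <-> 3/2 <= \<bar>Re z\<bar> & \<bar>Re z\<bar> <= 9/2 & \<bar>squeeze_height ?c ?y\<bar> <= 2/5 * \<bar>Re z\<bar>"
  by (auto simp: sup_norm_def squeeze_def)
 have "squeeze z \<in> sector <-> 3/2 <= \<bar>Re z\<bar> & \<bar>Re z\<bar> <= 9/2 & - 3/2 <= ?y & ?y <= 3/2"
 proof (cases "3/2 <= \<bar>Re z\<bar> & \<bar>Re z\<bar> <= 9/2")
  case True
  have "\<bar>squeeze_height ?c ?y\<bar> <= 2/5 * ?c <-> - 3/2 <= ?y & ?y <= 3/2" unfolding abs_le_iff using h by argo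
  thus ?thesis unfolding s using True c by simp
 next
  case False
  thus ?thesis unfolding s by argo
 qed
 moreover have "Re (squeeze z) = Re z" by (simp add: squeeze_def)
 ultimately show "squeeze z \<in> sector & 0 < Re (squeeze z) <-> z \<in> rect (3/2) (9/2) (- 3/2) (3/2)"
  "squeeze z \<in> sector & Re (squeeze z) < 0 <-> z \<in> rect (- 9/2) (- 3/2) (- 3/2) (3/2)"
  by (auto simp: in_rect abs_if split: if_splits)
qed

lemma carry_sides:
 "carry z \<in> sector & 0 < Re (carry z) <-> z \<in> rect (- 9/2) (- 3/2) (- 9/8) (- 3/8)"
 "carry z \<in> sector & Re (carry z) < 0 <-> z \<in> rect (- 9/2) (- 3/2) (3/8) (9/8)"
proof -
 let ?c = "squeeze_slope z" and ?y = "Im z" and ?h = "squeeze_height (squeeze_slope z) (Im z)" and ?w = "bend (squeeze z)"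
 have w: "?w ~= 0" if "3/2 <= sup_norm (squeeze z)"
  using that bent_norm_bend[of "squeeze z"] by (auto simp: bent_norm_def)
 have r: "Re (carry z) = - Im (unbend ?w)" "Im (carry z) = Re (unbend ?w)" by (simp_all add: carry_def)
 have sec: "carry z \<in> sector <-> 3/2 <= sup_norm (squeeze z) & sup_norm (squeeze z) <= 9/2 & \<bar>Re ?w\<bar> <= 2/5 * \<bar>Im ?w\<bar>"
  using unbend_cone(3)[OF w] by (auto simp: carry_sup_norm r)
 have A: "carry z \<in> sector & 0 < Re (carry z) <-> 3/2 <= sup_norm (squeeze z) & sup_norm (squeeze z) <= 9/2 & \<bar>Re ?w\<bar> <= 2/5 * \<bar>Im ?w\<bar> & Im ?w < 0"
  unfolding sec r using unbend_cone(1)[OF w] by auto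
 have B: "carry z \<in> sector & Re (carry z) < 0 <-> 3/2 <= sup_norm (squeeze z) & sup_norm (squeeze z) <= 9/2 & \<bar>Re ?w\<bar> <= 2/5 * \<bar>Im ?w\<bar> & 0 < Im ?w"
  unfolding sec r using unbend_cone(2)[OF w] by auto
 have A': "... <-> - 9/2 <= Re z & Re z <= - 3/2 & ?h <= 3/10 * \<bar>Re z\<bar> & 1/10 * \<bar>Re z\<bar> <= ?h"
  by (auto simp: sup_norm_def squeeze_def bend_def max_def abs_if split: if_splits)
 have A'': "(3/2 <= sup_norm (squeeze z) & sup_norm (squeeze z) <= 9/2 & \<bar>Re ?w\<bar> <= 2/5 * \<bar>Im ?w\<bar> & Im ?w < 0) <->
  - 9/2 <= Re z & Re z <= - 3/2 & - (3/10 * \<bar>Re z\<bar>) <= ?h & ?h <= - (1/10 * \<bar>Re z\<bar>)"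
  by (auto simp: sup_norm_def squeeze_def bend_def max_def abs_if split: if_splits)
 note k = squeeze_height_compare[OF squeeze_slope[of z]]
 have h: "?h <= 3/10 * ?c <-> ?y <= 9/8" "- (3/10 * ?c) <= ?h <-> - 9/8 <= ?y"
  "1/10 * ?c <= ?h <-> 3/8 <= ?y" "?h <= - (1/10 * ?c) <-> ?y <= - 3/8"
  using k(1)[of ?y "9/8"] k(1)[of "- 9/8" ?y] k(1)[of "3/8" ?y] k(1)[of ?y "- 3/8"] unfolding squeeze_height_values by simp_all
 have c: "?c = \<bar>Re z\<bar>" if "- 9/2 <= Re z" "Re z <= - 3/2" using that by (simp add: squeeze_slope_def)
 show "carry z \<in> sector & 0 < Re (carry z) <-> z \<in> rect (- 9/2) (- 3/2) (- 9/8) (- 3/8)"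
  unfolding A A'' using c h by (auto simp: in_rect)
 show "carry z \<in> sector & Re (carry z) < 0 <-> z \<in> rect (- 9/2) (- 3/2) (3/8) (9/8)"
  unfolding B A' using c h by (auto simp: in_rect)
qed

definition ring_tangle :: "complex set => complex set => bool => tangle" where
 "ring_tangle B1 B2 b = pat {z. sup_norm z <= 8} {B1, B2} {z. sup_norm z = 2 | sup_norm z = 4} {z. 2 <= sup_norm z & sup_norm z <= 4} b
   ({z. sup_norm z = 8} Un {z \<in> bd B1 Un bd B2. 4 < sup_norm z})"

lemma map_ring_tangle:
 assumes h: "plane_homeo h" and s: "!!r z. 2 <= r ==> sup_norm (h z) <= r <-> sup_norm z <= r"
   "!!r z. 2 <= r ==> sup_norm (h z) < r <-> sup_norm z < r"
  and B: "!!z. h z \<in> C1 <-> z \<in> B1" "!!z. h z \<in> C2 <-> z \<in> B2"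
 shows "map_tangle h (ring_tangle B1 B2 b) = ring_tangle C1 C2 b"
proof -
 have e: "sup_norm (h z) = r <-> sup_norm z = r" if "2 <= r" for r z using s[OF that, of z] by argo
 have im: "h ` B1 = C1" "h ` B2 = C2" using B by (auto intro!: homeo_image_eq[OF h])
 have fr: "h ` bd B1 = bd C1" "h ` bd B2 = bd C2" using im by (simp_all add: frontier_homeo_image[OF h, symmetric])
 show ?thesis
  unfolding ring_tangle_def
 proof (rule map_pat[OF h])
  show "h ` {z. sup_norm z <= 8} = {z. sup_norm z <= 8}" by (rule homeo_image_eq[OF h]) (simp add: s)
  show "(`) h ` {B1, B2} = {C1, C2}" by (simp add: im)
  have "h ` {z. sup_norm z = 8} = {z. sup_norm z = 8}" by (rule homeo_image_eq[OF h]) (simp add: e)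
  moreover have "h ` {z \<in> S. 4 < sup_norm z} = {z \<in> h ` S. 4 < sup_norm z}" for S using s(1)[of 4] by (auto simp: not_le[symmetric])
  ultimately show "h ` ({z. sup_norm z = 8} Un {z \<in> bd B1 Un bd B2. 4 < sup_norm z}) =
   {z. sup_norm z = 8} Un {z \<in> bd C1 Un bd C2. 4 < sup_norm z}"
   by (simp only: image_Un fr)
 qed (use s(2)[of 2] s(1)[of 4] e in \<open>auto simp: not_less[symmetric]\<close>)
qed

lemma ring_tangle_moved:
 defines "C1 == {z \<in> sector. 0 < Re z}" and "C2 == {z \<in> sector. Re z < 0}"
 shows "map_tangle carry (ring_tangle (rect (- 9/2) (- 3/2) (- 9/8) (- 3/8)) (rect (- 9/2) (- 3/2) (3/8) (9/8)) b) = ring_tangle C1 C2 b"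
  "map_tangle squeeze (ring_tangle (rect (3/2) (9/2) (- 3/2) (3/2)) (rect (- 9/2) (- 3/2) (- 3/2) (3/2)) b) = ring_tangle C1 C2 b"
proof -
 show "map_tangle carry (ring_tangle (rect (- 9/2) (- 3/2) (- 9/8) (- 3/8)) (rect (- 9/2) (- 3/2) (3/8) (9/8)) b) = ring_tangle C1 C2 b"
  using carry_sides unfolding C1_def C2_def
  by (intro map_ring_tangle isotopic_homeo[OF isotopic_carry]) (auto simp: carry_sup_norm squeeze_sup_norm)
 show "map_tangle squeeze (ring_tangle (rect (3/2) (9/2) (- 3/2) (3/2)) (rect (- 9/2) (- 3/2) (- 3/2) (3/2)) b) = ring_tangle C1 C2 b"
  using squeeze_ends unfolding C1_def C2_def
  by (intro map_ring_tangle isotopic_homeo[OF isotopic_squeeze]) (auto simp: squeeze_sup_norm)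
qed

lemma line_colour_2: "z \<in> line_colour 2 <-> 1 <= Re z & Re z < 2"
proof -
 have "lines_left 2 z = (if 2 <= Re z then 2 else if 1 <= Re z then 1 else 0)"
  using lines_left_max[of 2 z] lines_left_less_1[of z 2] lines_left_eq[of 1 z 2] by auto
 thus ?thesis by (auto simp: line_colour_def)
qed

lemma line_curves_2: "z \<in> line_curves 2 <-> Re z = 1 | Re z = 2"
proof -
 have "{1..2::nat} = {1, 2}" by auto
 thus ?thesis by (auto simp: line_curves_def)
qed

abbreviation "lower_factor == rect (3/8) (21/8) (11/10) (7/5)"
abbreviation "upper_factor == rect (3/8) (21/8) (8/5) (19/10)"
abbreviation "product_col b == col 2 b (1/4) 1 2 (3/8) [(11/10, 7/5), (8/5, 19/10)]"
abbreviation "trace_product b == pat (rect (1/8) (39/8) (-2) 5) {lower_factor, upper_factor}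
   (bd (rect 1 4 (-1) 4) Un bd (rect 2 3 0 3)) (rect 1 4 (-1) 4 - rect 2 3 0 3) b
   (bd (rect (1/8) (39/8) (-2) 5) Un {z \<in> bd lower_factor Un bd upper_factor. Re z < 1})"

lemma product_col: "product_col b = pat (stack_box 2 0) {lower_factor, upper_factor} (line_curves 2) (line_colour 2) b
  ({z \<in> bd (stack_box 2 0). Re z < 1} Un {z \<in> bd lower_factor Un bd upper_factor. Re z < 1})"
 by (simp add: col_def col_box_def stack_box_def) (auto intro!: arg_cong[where f = "pat _ _ _ _ _"])

lemma planar_product_col: "col_ok (1/4) 1 2 (3/8) [(11/10, 7/5), (8/5, 19/10)]"
 by (simp add: col_ok_def)

context planar_algebra
begin

lemma glue_trace_product:
 "glue (trace_tangle 2 s) (stack_box 2 0) (product_col (s = Pos)) = trace_product (s = Pos)"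
 "gluable (trace_tangle 2 s) (stack_box 2 0) (product_col (s = Pos))"
proof -
 have B: "stack_box 2 0 \<subseteq> interior (rect (1/8) (39/8) (-2) 5)" "closed (stack_box 2 0)"
  by (auto simp: stack_box_def in_rect in_int_rect closed_rect)
 have d: "bd (rect (1/8) (39/8) (-2) 5) Int stack_box 2 0 = {}"
  "{z \<in> bd lower_factor Un bd upper_factor. Re z < 1} Int bd (stack_box 2 0) = {}"
  by (auto simp: stack_box_def rect_simps)
 note g = glue_pat_single[OF B trace_2_spaces(1)[of s, unfolded trace_tangle_2] planar_col[OF planar_product_col, of 2 "s = Pos", unfolded product_col]
   refl d(1) refl d(2),
  where X = "bd (rect 1 4 (-1) 4) Un bd (rect 2 3 0 3)" and Y = "rect 1 4 (-1) 4 - rect 2 3 0 3" and b = "s = Pos"]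
 show "glue (trace_tangle 2 s) (stack_box 2 0) (product_col (s = Pos)) = trace_product (s = Pos)"
  unfolding trace_tangle_2 product_col
  by (rule g(1); simp add: stack_box_def rect_simps line_colour_2 line_curves_2; argo)
 show "gluable (trace_tangle 2 s) (stack_box 2 0) (product_col (s = Pos))"
  unfolding trace_tangle_2 product_col
  by (rule g(2); simp add: stack_box_def rect_simps line_colour_2 line_curves_2; argo)
qed

lemma lower_upper: "lower_factor ~= upper_factor" "col_box 2 (3/8) (11/10, 7/5) = lower_factor" "col_box 2 (3/8) (8/5, 19/10) = upper_factor"
proof -
 have "Complex 1 1.1 \<in> lower_factor" "Complex 1 1.1 ~: upper_factor" by (simp_all add: in_rect)
 thus "lower_factor ~= upper_factor" by metis
qed (simp_all add: col_box_def)

lemma product_glued: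
 assumes gl: "gluable T (stack_box 2 0) (product_col (s = Pos))" and eq: "glue T (stack_box 2 0) (product_col (s = Pos)) = G"
  and inn: "inner_discs T = {stack_box 2 0}"
 shows "planar_tangle G" "disc_space A G lower_factor = box_space A 2 s" "disc_space A G upper_factor = box_space A 2 s"
  "f lower_factor \<in> box_space A 2 s ==> f upper_factor \<in> box_space A 2 s ==>
    act A G f = act A T (%_. box_mult A 2 s (f upper_factor) (f lower_factor))"
proof -
 interpret gluing T "stack_box 2 0" "product_col (s = Pos)" by unfold_locales (rule gl)
 show "planar_tangle G" using planar_G unfolding eq .
 have i: "lower_factor \<in> inner_discs (product_col (s = Pos))" "upper_factor \<in> inner_discs (product_col (s = Pos))"
  unfolding product_col by simp_all
 have d: "disc_space A (product_col (s = Pos)) lower_factor = box_space A 2 s" "disc_space A (product_col (s = Pos)) upper_factor = box_space A 2 s"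
  using col_disc_space(2)[OF planar_product_col, where n = 2 and s = s and I = "(11/10, 7/5)"]
   col_disc_space(2)[OF planar_product_col, where n = 2 and s = s and I = "(8/5, 19/10)"]
  unfolding lower_upper(2,3) by simp_all
 show "disc_space A G lower_factor = box_space A 2 s" "disc_space A G upper_factor = box_space A 2 s"
  using i[THEN disc_space_glue(2), of A] unfolding eq d .
 assume f: "f lower_factor \<in> box_space A 2 s" "f upper_factor \<in> box_space A 2 s"
 show "act A G f = act A T (%_. box_mult A 2 s (f upper_factor) (f lower_factor))"
 proof (rule act_glue_eq[OF gl eq])
  show "act A (product_col (s = Pos)) f = box_mult A 2 s (f upper_factor) (f lower_factor)"
   using act_col_two[OF planar_product_col, where f = f and n = 2 and s = s] f unfolding lower_upper(2,3) by simp
  fix E assume "E \<in> inner_discs (product_col (s = Pos))"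
  hence "E = lower_factor | E = upper_factor" unfolding product_col by simp
  thus "f E \<in> disc_space A (product_col (s = Pos)) E" using d f by metis
 qed (simp_all add: inn)
qed

end

abbreviation "right_disc == rect (3/2) (9/2) (- 3/2) (3/2)"
abbreviation "left_disc == rect (- 9/2) (- 3/2) (- 3/2) (3/2)"

lemma right_left: "right_disc Int left_disc = {}" "right_disc ~= left_disc"
proof -
 show "right_disc Int left_disc = {}" by (auto simp: in_rect)
 moreover have "Complex 2 0 \<in> right_disc" by (simp add: in_rect)
 ultimately show "right_disc ~= left_disc" by auto
qed

lemma trace_product_ring:
 obtains h where "isotopic_to_id h"
  "map_tangle h (trace_product b) = ring_tangle (rect (- 9/2) (- 3/2) (- 9/8) (- 3/8)) (rect (- 9/2) (- 3/2) (3/8) (9/8)) b"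
  "h ` lower_factor = rect (- 9/2) (- 3/2) (- 9/8) (- 3/8)" "h ` upper_factor = rect (- 9/2) (- 3/2) (3/8) (9/8)"
proof -
 obtain f where f: "incr_homeo f" "map f [1/8, 3/8, 1, 2, 21/8, 3, 4, 39/8] = [-8, -9/2, -4, -2, -3/2, 2, 4, 8]" by (rule incr_homeo_obtain, erule (1) that) auto
 obtain g where g: "incr_homeo g" "map g [-2, -1, 0, 11/10, 7/5, 8/5, 19/10, 3, 4, 5] = [-8, -4, -2, -9/8, -3/8, 3/8, 9/8, 2, 4, 8]" by (rule incr_homeo_obtain, erule (1) that) auto
 note ff = f(2)[unfolded list.map list.inject] and gg = g(2)[unfolded list.map list.inject]
 let ?L = "rect (- 9/2) (- 3/2) (- 9/8) (- 3/8)" and ?U = "rect (- 9/2) (- 3/2) (3/8) (9/8)"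
 have f1: "f x < -4 <-> x < 1" for x using incr_homeo_compare(1)[OF f(1), of x 1] ff by simp
 have "prod_map f g z \<in> bd (rect (-4) 4 (-4) 4) <-> z \<in> bd (rect 1 4 (-1) 4)"
  "prod_map f g z \<in> rect (-4) 4 (-4) 4 <-> z \<in> rect 1 4 (-1) 4"
  "prod_map f g z \<in> bd (rect (-2) 2 (-2) 2) <-> z \<in> bd (rect 2 3 0 3)"
  "prod_map f g z \<in> rect (-2) 2 (-2) 2 <-> z \<in> rect 2 3 0 3" for z
  by (rule prod_map_in_rect[OF f(1) g(1)]; simp add: ff gg)+
 hence XY: "prod_map f g z \<in> {z. sup_norm z = 2 | sup_norm z = 4} <-> z \<in> bd (rect 1 4 (-1) 4) Un bd (rect 2 3 0 3)"
  "prod_map f g z \<in> rect (-4) 4 (-4) 4 - rect (-2) 2 (-2) 2 <-> z \<in> rect 1 4 (-1) 4 - rect 2 3 0 3" for z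
  unfolding mem_Collect_eq sup_norm_rect(2) by auto
 have r: "ring_tangle ?L ?U b = pat (rect (-8) 8 (-8) 8) {?L, ?U} {z. sup_norm z = 2 | sup_norm z = 4}
  (rect (-4) 4 (-4) 4 - rect (-2) 2 (-2) 2) b (bd (rect (-8) 8 (-8) 8) Un {z \<in> bd ?L Un bd ?U. Re z < -4})"
 proof -
  have q: "{z \<in> bd ?L Un bd ?U. 4 < sup_norm z} = {z \<in> bd ?L Un bd ?U. Re z < -4}"
   by (auto simp: in_bd_rect in_rect sup_norm_def less_max_iff_disj)
  have o: "{z. sup_norm z <= 8} = rect (-8) 8 (-8) 8" "{z. sup_norm z = 8} = bd (rect (-8) 8 (-8) 8)"
   using sup_norm_rect[of _ 8] by auto
  have y: "z \<in> {z. 2 <= sup_norm z & sup_norm z <= 4} <-> z \<in> rect (-4) 4 (-4) 4 - rect (-2) 2 (-2) 2"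
   if "z ~: {z. sup_norm z = 2 | sup_norm z = 4}" for z
   using that unfolding Diff_iff mem_Collect_eq sup_norm_rect(1)[symmetric] by argo
  show ?thesis
   unfolding ring_tangle_def o q by (rule pat_cong) (rule refl, drule y, simp only:)
 qed
 have m: "map_tangle (prod_map f g) (trace_product b) = ring_tangle ?L ?U b"
  unfolding r
  by (rule map_pat_prod[OF f(1) g(1), where J = "{(3/8, 21/8, 11/10, 7/5), (3/8, 21/8, 8/5, 19/10)}" and P = "%_. True" and P' = "%_. True"
     and Q = "%z. Re z < 1" and Q' = "%z. Re z < -4"])
   (simp_all only: XY, simp_all add: f1 ff gg)
 show thesis
  by (rule that[OF isotopic_prod_map[OF f(1) g(1)] m]) (simp_all add: prod_map_rect[OF f(1) g(1)] ff gg)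
qed

lemma map_tangle_comp: "map_tangle h (map_tangle k T) = map_tangle (%z. h (k z)) T"
 by (simp add: map_tangle_def image_image)

lemma map_tangle_ident: "map_tangle (%z. z) T = T"
 by (cases T) (simp add: map_tangle_def)

context planar_algebra
begin

lemma act_map_two:
 assumes "planar_tangle T" "isotopic_to_id h" "map_tangle h T = T'" "inner_discs T = {D1, D2}"
  and "g D1 \<in> disc_space A T D1" "g D2 \<in> disc_space A T D2" "f (h ` D1) = g D1" "f (h ` D2) = g D2"
 shows "act A T' f = act A T g"
 by (rule act_map_eq[OF assms(1-3)]) (use assms(4-8) in auto)

end

context planar_algebra
begin

text \<open>The boxes of the trace, moved by \<open>carry\<close>, and the discs of \<open>T\<close>, moved by \<open>squeeze\<close>, fill
 the same sectors of the rings.\<close>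

lemma opposite_discs:
 defines "T == %s. ring_tangle right_disc left_disc (s = Pos)"
 shows "planar_tangle (T s)" "disc_space A (T s) right_disc = box_space A 2 s" "disc_space A (T s) left_disc = box_space A 2 s"
  "f right_disc \<in> box_space A 2 s ==> f left_disc \<in> box_space A 2 s ==>
    act A (T s) f = act A (trace_tangle 2 s) (%_. box_mult A 2 s (f left_disc) (f right_disc))"
proof -
 let ?L = "rect (- 9/2) (- 3/2) (- 9/8) (- 3/8)" and ?U = "rect (- 9/2) (- 3/2) (3/8) (9/8)"
 let ?C1 = "{z \<in> sector. 0 < Re z}" and ?C2 = "{z \<in> sector. Re z < 0}" and ?b = "s = Pos"
 note trace_product_spaces = product_glued[OF glue_trace_product(2,1) trace_tangle_inner]
 obtain h where h: "isotopic_to_id h" "map_tangle h (trace_product ?b) = ring_tangle ?L ?U ?b"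
  "h ` lower_factor = ?L" "h ` upper_factor = ?U" by (rule trace_product_ring)
 note sq = isotopic_squeeze isotopic_homeo[OF isotopic_squeeze]
 let ?c = "%z. carry (h z)"
 have c: "isotopic_to_id ?c" by (rule isotopic_to_id_comp[OF isotopic_carry h(1)])
 have mc: "map_tangle ?c (trace_product ?b) = ring_tangle ?C1 ?C2 ?b"
  using ring_tangle_moved(1)[of ?b] unfolding h(2)[symmetric] map_tangle_comp .
 have im: "?c ` lower_factor = ?C1" "?c ` upper_factor = ?C2" "squeeze ` right_disc = ?C1" "squeeze ` left_disc = ?C2"
  using h(3,4) carry_sides squeeze_ends
   homeo_image_eq[OF isotopic_homeo[OF isotopic_carry], of ?C1 ?L] homeo_image_eq[OF isotopic_homeo[OF isotopic_carry], of ?C2 ?U]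
   homeo_image_eq[OF sq(2), of ?C1 right_disc] homeo_image_eq[OF sq(2), of ?C2 left_disc]
  by (simp_all flip: image_image[of carry h])
 have sp: "planar_tangle (ring_tangle ?C1 ?C2 ?b)" "disc_space A (ring_tangle ?C1 ?C2 ?b) ?C1 = box_space A 2 s"
  "disc_space A (ring_tangle ?C1 ?C2 ?b) ?C2 = box_space A 2 s"
  using planar_disc_space_map(1)[OF trace_product_spaces(1) c mc]
   planar_disc_space_map(2)[OF trace_product_spaces(1) c mc, of lower_factor] planar_disc_space_map(2)[OF trace_product_spaces(1) c mc, of upper_factor]
  unfolding im trace_product_spaces .
 obtain k where k: "homeomorphism UNIV UNIV squeeze k" using sq(2) unfolding plane_homeo_def by blast
 have ks: "plane_homeo k" "k (squeeze z) = z" for z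
  using k homeomorphism_symD[OF k] by (auto simp: plane_homeo_def homeomorphism_apply1)
 have pullback: "map_tangle k (ring_tangle ?C1 ?C2 ?b) = T s"
  unfolding T_def ring_tangle_moved(2)[of ?b, symmetric] map_tangle_comp ks(2) by (rule map_tangle_ident)
 show pl: "planar_tangle (T s)" using planar_map_tangle[OF ks(1) sp(1)] unfolding pullback .
 have m: "map_tangle squeeze (T s) = ring_tangle ?C1 ?C2 ?b" unfolding T_def by (rule ring_tangle_moved(2))
 show d: "disc_space A (T s) right_disc = box_space A 2 s" "disc_space A (T s) left_disc = box_space A 2 s"
  using planar_disc_space_map(2)[OF pl sq(1) m, of right_disc, symmetric] planar_disc_space_map(2)[OF pl sq(1) m, of left_disc, symmetric]
  unfolding im sp .
 assume f: "f right_disc \<in> box_space A 2 s" "f left_disc \<in> box_space A 2 s"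
 have ne: "?C1 ~= ?C2"
 proof
  have w: "Complex 2 0 \<in> ?C1" "Complex 2 0 ~: ?C2" by (simp_all add: sup_norm_def)
  assume "?C1 = ?C2"
  thus False using w by argo
 qed
 let ?g = "%D. if D = ?C1 then f right_disc else f left_disc"
 let ?e = "%D. if D = lower_factor then f right_disc else f left_disc"
 have "act A (T s) f = act A (ring_tangle ?C1 ?C2 ?b) ?g"
 proof (rule act_map_two[OF pl sq(1) m, symmetric])
  show "inner_discs (T s) = {right_disc, left_disc}" by (simp add: T_def ring_tangle_def)
 qed (simp_all only: d f im if_True if_False simp_thms ne[symmetric])
 also have "... = act A (trace_product ?b) ?e"
 proof (rule act_map_two[OF trace_product_spaces(1) c mc])
  show "inner_discs (trace_product (s = Pos)) = {lower_factor, upper_factor}" by simp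
 qed (simp_all only: trace_product_spaces(2,3) f im if_True if_False simp_thms ne[symmetric] lower_upper(1)[symmetric])
 also have "... = act A (trace_tangle 2 s) (%_. box_mult A 2 s (f left_disc) (f right_disc))"
  using trace_product_spaces(4)[of ?e] f lower_upper(1) by auto
 finally show "act A (T s) f = act A (trace_tangle 2 s) (%_. box_mult A 2 s (f left_disc) (f right_disc))" .
qed

end

subsection \<open>Annuli with strings at the corners\<close>

text \<open>
 The identity tangle, the rotation and its inverse differ in the marked interval of the inner disc only:
 it is on the left, on the top or on the bottom. Once the strings end at the corners of a square, the
 boundary intervals are its sides, and a quarter turn that makes the strings horizontal moves
 the mark to the next side.
\<close>

definition annulus :: "bool => (complex => bool) => tangle" where
 "annulus b P = pat (rect (1/8) (23/8) 0 3) {stack_box 2 0} (line_curves 2) (line_colour 2) b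
   ({z \<in> bd (rect (1/8) (23/8) 0 3). Re z < 1} Un {z \<in> bd (stack_box 2 0). P z})"

lemma stack_annulus: "stack_tangle 2 s 1 = annulus (s = Pos) (%z. Re z < 1)"
proof -
 have i: "stack_intervals 1 = [(1, 2)]" by (simp add: stack_intervals_def One_nat_def)
 show ?thesis
  unfolding stack_tangle_col annulus_def i
  by (simp add: col_def col_box_def stack_box_def) (auto intro!: arg_cong[where f = "pat _ _ _ _ _"])
qed

lemma rotation_annulus: "rotation_tangle s = annulus (s = Pos) (%z. Im z = 2 & 1 < Re z & Re z < 2)"
 unfolding rotation_tangle_def stack_annulus by (simp add: annulus_def pat_def)

lemma planar_annulus:
 assumes "y = 1 | y = 2"
 shows "planar_tangle (annulus b (%z. Im z = y & 1 < Re z & Re z < 2))"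
proof -
 define s where "s = (if b then Pos else Neg)"
 hence b: "b <-> s = Pos" by simp
 let ?T = "annulus b (%z. Re z < 1)" and ?O = "rect (1/8) (23/8) 0 3" and ?P = "%z. Im z = y & 1 < Re z & Re z < 2"
 let ?M = "{z \<in> bd ?O. Re z < 1} Un {z \<in> bd (stack_box 2 0). ?P z}"
 have T: "planar_tangle ?T" using planar_stack_tangle[of 2 s 1] unfolding stack_annulus b .
 have fd: "bd ?O Int bd (stack_box 2 0) = {}" by (auto simp: stack_box_def rect_simps)
 have "planar_tangle (?T\<lparr>marked := ?M\<rparr>)"
 proof (rule planar_change_marked[OF T])
  fix D assume "D \<in> discs ?T"
  then consider "D = ?O" | "D = stack_box 2 0" by (auto simp: discs_def annulus_def)
  thus "?M Int bd D \<in> components (bd D - strings ?T)"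
  proof cases
   case 1
   have "?M Int bd ?O = marked ?T Int bd ?O" using fd by (auto simp: annulus_def)
   thus ?thesis unfolding 1 using planar_tangleD(11)[OF T, of ?O] by (simp add: discs_def annulus_def)
  next
   case 2
   let ?S = "bd (stack_box 2 0) - strings ?T" and ?C = "(%t. Complex t y) ` {1<..<2}"
   have C: "?M Int bd (stack_box 2 0) = ?C"
    using fd assms by (auto simp: stack_box_def rect_simps complex_eq_iff image_iff)
   have S: "z \<in> ?S <-> z \<in> bd (rect (1/4) (11/4) 1 2) & Re z ~= 1 & Re z ~= 2" for z
    by (auto simp: annulus_def line_curves_2 stack_box_def rect_simps)
   have CS: "z \<in> ?C <-> Im z = y & 1 < Re z & Re z < 2" for z by (auto simp: complex_eq_iff image_iff)
   show ?thesis unfolding 2 C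
   proof (rule component_if_separated)
    show "connected ?C"
     by (intro connected_continuous_image continuous_on_Complex continuous_on_const continuous_on_id) simp
    show "?C = ?S Int {z. 1 < Re z & Re z < 2 & \<bar>Im z - y\<bar> < 1/2}"
     using assms by (intro set_eqI) (simp only: Int_iff S CS mem_Collect_eq, simp add: in_bd_rect in_rect, argo)
    show "open {z. 1 < Re z & Re z < 2 & \<bar>Im z - y\<bar> < 1/2}"
     by (intro open_Collect_conj open_Collect_less continuous_intros)
    show "?C = ?S Int {z. 1 <= Re z & Re z <= 2 & \<bar>Im z - y\<bar> <= 1/2}"
     using assms by (intro set_eqI) (simp only: Int_iff S CS mem_Collect_eq, simp add: in_bd_rect in_rect, argo)
    show "closed {z. 1 <= Re z & Re z <= 2 & \<bar>Im z - y\<bar> <= 1/2}"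
     by (intro closed_Collect_conj closed_Collect_le continuous_intros)
   qed simp
  qed
 qed (auto simp: discs_def annulus_def)
 thus ?thesis by (simp add: annulus_def pat_def)
qed

lemma annulus_disc:
 "inner_discs (annulus b P) = {stack_box 2 0}" "outer_disc (annulus b P) = rect (1/8) (23/8) 0 3"
 by (simp_all add: annulus_def)

lemma annulus_sizes:
 "disc_size (annulus b P) (stack_box 2 0) = 2" "disc_size (annulus b P) (rect (1/8) (23/8) 0 3) = 2"
proof -
 have e: "strings (annulus b P) = strings (stack_tangle 2 Pos 1)" unfolding stack_annulus by (simp add: annulus_def)
 show "disc_size (annulus b P) (stack_box 2 0) = 2" "disc_size (annulus b P) (rect (1/8) (23/8) 0 3) = 2"
  using base_disc_size(1)[of False 1 2 True] base_disc_size(2)[where r = False and k = 1 and n = 2 and i = 0 and b = True] unfolding disc_size_def e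
  by (simp_all add: stack_tangle_base base_out_def base_box_stack_box)
qed

lemma annulus_signs:
 "disc_sign (annulus (s = Pos) P) (rect (1/8) (23/8) 0 3) = s"
 "y = 1 | y = 2 ==> disc_sign (annulus (s = Pos) (%z. Im z = y & 1 < Re z & Re z < 2)) (stack_box 2 0) = opp s"
proof -
 have fd: "bd (rect (1/8) (23/8) 0 3) Int bd (stack_box 2 0) = {}" by (auto simp: stack_box_def rect_simps)
 show "disc_sign (annulus (s = Pos) P) (rect (1/8) (23/8) 0 3) = s"
 proof -
  have m: "marked (annulus (s = Pos) P) Int bd (rect (1/8) (23/8) 0 3) = {z \<in> bd (rect (1/8) (23/8) 0 3). Re z < 1}"
   using fd by (auto simp: annulus_def)
  have "z \<in> shaded (annulus (s = Pos) P) <-> s ~= Pos" if "z \<in> bd (rect (1/8) (23/8) 0 3)" "Re z < 1" for z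
   using that by (auto simp: annulus_def line_curves_2 line_colour_2 stack_box_def rect_simps)
  moreover have "Complex (1/8) 0 \<in> {z \<in> bd (rect (1/8) (23/8) 0 3). Re z < 1}" by (simp add: in_bd_rect in_rect)
  ultimately have "marked (annulus (s = Pos) P) Int bd (rect (1/8) (23/8) 0 3) \<subseteq> shaded (annulus (s = Pos) P) <-> s ~= Pos"
   unfolding m by blast
  thus ?thesis by (cases s) (simp_all add: disc_sign_def)
 qed
 assume y: "y = 1 | y = 2"
 let ?A = "annulus (s = Pos) (%z. Im z = y & 1 < Re z & Re z < 2)" and ?C = "{z \<in> bd (stack_box 2 0). Im z = y & 1 < Re z & Re z < 2}"
 have m: "marked ?A Int bd (stack_box 2 0) = ?C" using fd by (auto simp: annulus_def)
 have "z \<in> shaded ?A <-> s = Pos" if "z \<in> ?C" for z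
  using that y by (auto simp: annulus_def line_curves_2 line_colour_2 stack_box_def rect_simps)
 moreover have "Complex (3/2) y \<in> ?C" using y by (auto simp: stack_box_def rect_simps)
 ultimately have "marked ?A Int bd (stack_box 2 0) \<subseteq> shaded ?A <-> s = Pos" unfolding m by blast
 thus "disc_sign ?A (stack_box 2 0) = opp s" by (cases s) (simp_all add: disc_sign_def)
qed

abbreviation "left_mark == %z::complex. Re z < 1"
abbreviation "side_mark y == %z::complex. Im z = y & 1 < Re z & Re z < 2"

context star_planar_algebra
begin

lemma annulus_spaces:
 "disc_space A (annulus (s = Pos) P) (rect (1/8) (23/8) 0 3) = box_space A 2 s"
 "y = 1 | y = 2 ==> disc_space A (annulus (opp s = Pos) (side_mark y)) (stack_box 2 0) = box_space A 2 s"
 "disc_space A (annulus (s = Pos) left_mark) (stack_box 2 0) = box_space A 2 s"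
 using annulus_signs(2)[of y "opp s"] labelling_stackI[where k = 1 and n = 2 and s = s]
  stack_disc_size_sign[of 0 1 2 s]
 by (simp_all add: disc_space_def annulus_sizes annulus_signs(1) opp_opp stack_annulus)

lemma act_annulus_left: "x \<in> box_space A 2 s ==> act A (annulus (s = Pos) left_mark) (%_. x) = x"
 using act_identity[of x 2 s] by (simp add: stack_annulus)

lemma act_annulus_top: "act A (annulus (opp s = Pos) (side_mark 2)) (%_. x) = fourier A s x"
 by (simp add: fourier_def rotation_annulus)

lemma fourier_closed:
 assumes x: "x \<in> box_space A 2 s"
 shows "fourier A s x \<in> box_space A 2 (opp s)"
 using act_closed[OF planar_annulus[of 2 "opp s = Pos"], of "%_. x"] x
 by (simp add: act_annulus_top labelling_def annulus_disc annulus_spaces)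

text \<open>The mirror image of the rotation tangle rotates counterclockwise.\<close>

lemma act_annulus_bottom:
 assumes x: "x \<in> box_space A 2 s"
 shows "act A (annulus (opp s = Pos) (side_mark 1)) (%_. adj A 2 s x) = adj A 2 (opp s) (fourier A s x)"
proof -
 let ?T = "annulus (opp s = Pos) (side_mark 2)" and ?B = "annulus (opp s = Pos) (side_mark 1)" and ?O = "rect (1/8) (23/8) 0 3"
 have T: "planar_tangle ?T" by (rule planar_annulus) simp
 have B: "planar_tangle ?B" by (rule planar_annulus) simp
 define h where "h = (%z. 1 * z + Complex 0 (- 3))"
 have h: "isotopic_to_id h" unfolding h_def by (rule isotopic_affine) simp
 note pl = isotopic_homeo[OF h]
 have hr: "h ` rect a b c d = rect a b (c - 3) (d - 3)" for a b c d
  by (rule homeo_image_eq[OF pl]) (auto simp: h_def in_rect)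
 have hf: "h ` bd (rect a b c d) = bd (rect a b (c - 3) (d - 3))" for a b c d
  unfolding hr[symmetric] by (rule frontier_homeo_image[OF pl, symmetric])
 have cf: "cnj ` bd (rect a b c d) = bd (rect a b (- d) (- c))" for a b c d
  unfolding cnj_rect[symmetric] by (rule frontier_homeo_image[OF plane_homeo_cnj, symmetric])
 let ?M = "{z \<in> bd (rect (1/8) (23/8) (- 3) 0). Re z < 1} Un {z \<in> bd (rect (1/4) (11/4) (- 2) (- 1)). Im z = - 2 & 1 < Re z & Re z < 2}"
 let ?P = "pat (rect (1/8) (23/8) (- 3) 0) {rect (1/4) (11/4) (- 2) (- 1)} (line_curves 2) (line_colour 2) (opp s = Pos) ?M"
 have m1: "map_tangle cnj ?T = ?P"
  unfolding annulus_def
 proof (rule map_pat[OF plane_homeo_cnj])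
  have "cnj ` {z \<in> S. Re z < 1} = {z \<in> cnj ` S. Re z < 1}" "cnj ` {z \<in> S. side_mark 2 z} = {z \<in> cnj ` S. Im z = - 2 & 1 < Re z & Re z < 2}" for S
   by (auto simp: image_iff)
  thus "cnj ` ({z \<in> bd ?O. Re z < 1} Un {z \<in> bd (stack_box 2 0). side_mark 2 z}) = ?M"
   by (simp add: image_Un cf stack_box_def)
 qed (simp_all add: cnj_rect stack_box_def line_curves_2 line_colour_2)
 have m2: "map_tangle h ?B = ?P"
  unfolding annulus_def
 proof (rule map_pat[OF pl])
  have "h ` {z \<in> S. Re z < 1} = {z \<in> h ` S. Re z < 1}" "h ` {z \<in> S. side_mark 1 z} = {z \<in> h ` S. Im z = - 2 & 1 < Re z & Re z < 2}" for S
   by (auto simp: h_def)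
  thus "h ` ({z \<in> bd ?O. Re z < 1} Un {z \<in> bd (stack_box 2 0). side_mark 1 z}) = ?M"
   by (simp add: image_Un hf stack_box_def)
 qed (simp_all add: hr stack_box_def line_curves_2 line_colour_2, simp_all add: h_def)
 let ?g = "%D. adj A (disc_size ?T (cnj ` D)) (disc_sign ?T (cnj ` D)) x"
 have c: "cnj ` rect (1/4) (11/4) (- 2) (- 1) = stack_box 2 0" by (simp add: cnj_rect stack_box_def)
 have g: "?g (rect (1/4) (11/4) (- 2) (- 1)) = adj A 2 s x"
  unfolding c using annulus_signs(2)[of 2 "opp s"] by (simp add: annulus_sizes opp_opp)
 have "adj A 2 (opp s) (fourier A s x) = act A ?P ?g"
  unfolding m1[symmetric] act_annulus_top[symmetric]
  using adj_act[OF T, of "%_. x"] x by (simp add: labelling_def annulus_disc annulus_spaces annulus_sizes annulus_signs(1))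
 also have "... = act A ?B (%_. adj A 2 s x)"
 proof (rule act_map_eq[OF B h m2])
  fix D assume D: "D \<in> inner_discs ?B"
  thus "adj A 2 s x \<in> disc_space A ?B D" using adj_closed[OF x] by (simp add: annulus_disc annulus_spaces)
  have "h ` D = rect (1/4) (11/4) (- 2) (- 1)" using D by (simp add: annulus_disc stack_box_def hr)
  thus "?g (h ` D) = adj A 2 s x" using g by simp
 qed
 finally show ?thesis by simp
qed

end

definition corner_annulus :: "bool => (complex => bool) => tangle" where
 "corner_annulus b P = pat (rect (- 3/2) (3/2) (- 3/2) (3/2)) {rect (- 1) 1 (- 1) 1} {z. \<bar>Re z\<bar> = 1 & 1 <= \<bar>Im z\<bar>} {z. \<bar>Re z\<bar> < 1} b
   ({z \<in> bd (rect (- 3/2) (3/2) (- 3/2) (3/2)). Re z < - 1} Un {z \<in> bd (rect (- 1) 1 (- 1) 1). P z})"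

text \<open>The gauge of a box that is twice as wide as it is high; the radial map \<open>to_square\<close> turns it into
 a square and moves the ends of the strings to the corners.\<close>

definition flat_norm :: "complex => real" where
 "flat_norm z = max (\<bar>Re z\<bar> / 2) \<bar>Im z\<bar>"

definition to_square :: "complex => complex" where
 "to_square z = of_real (flat_norm z / sup_norm z) * z"

lemma isotopic_to_square: "isotopic_to_id to_square"
 unfolding to_square_def
proof (rule isotopic_radial)
 show "continuous_on UNIV flat_norm" unfolding flat_norm_def by (intro continuous_intros) simp
 show "continuous_on UNIV sup_norm" using sup_norm_continuous[of UNIV "%z. z"] by simp
 show "0 < flat_norm z" if "z ~= 0" for z using that by (auto simp: flat_norm_def less_max_iff_disj complex_eq_iff)
 show "0 < sup_norm z" if "z ~= 0" for z by (rule sup_norm_pos[OF that])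
 fix r :: real and z assume r: "0 < r"
 show "sup_norm (of_real r * z) = r * sup_norm z" using r by (simp add: sup_norm_scale)
 show "flat_norm (of_real r * z) = r * flat_norm z" using r by (simp add: flat_norm_def abs_mult max_mult_distrib_left)
qed

lemma to_square_steep: "\<bar>Re z\<bar> <= \<bar>Im z\<bar> ==> to_square z = z"
proof -
 assume "\<bar>Re z\<bar> <= \<bar>Im z\<bar>"
 hence "flat_norm z = sup_norm z" by (auto simp: flat_norm_def sup_norm_def max_def)
 thus ?thesis using sup_norm_pos[of z] by (cases "z = 0") (simp_all add: to_square_def)
qed

lemma to_square_flat:
 assumes "\<bar>Im z\<bar> < \<bar>Re z\<bar>"
 shows "\<bar>Re (to_square z)\<bar> = flat_norm z" "\<bar>Im (to_square z)\<bar> < flat_norm z" "0 < Re (to_square z) <-> 0 < Re z"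
proof -
 define t where "t = flat_norm z / sup_norm z"
 have s: "sup_norm z = \<bar>Re z\<bar>" using assms by (simp add: sup_norm_def)
 have p: "0 < flat_norm z" "0 < \<bar>Re z\<bar>" using assms by (auto simp: flat_norm_def less_max_iff_disj)
 have t: "0 < t" "t * \<bar>Re z\<bar> = flat_norm z" using p by (simp_all add: t_def s)
 have w: "Re (to_square z) = t * Re z" "Im (to_square z) = t * Im z" by (simp_all add: to_square_def t_def)
 show "\<bar>Re (to_square z)\<bar> = flat_norm z" "0 < Re (to_square z) <-> 0 < Re z"
  using t by (simp_all add: w abs_mult zero_less_mult_iff)
 have "t * \<bar>Im z\<bar> < t * \<bar>Re z\<bar>" using assms t(1) by simp
 thus "\<bar>Im (to_square z)\<bar> < flat_norm z" using t by (simp add: w abs_mult)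
qed

lemma abs_eq: "(0 <= a & \<bar>a\<bar> = a) | (a < 0 & \<bar>a\<bar> = - a)" for a :: real
 by auto

lemma to_square_facts:
 defines "X == %z. Re (to_square z)" and "Y == %z. Im (to_square z)"
 shows "to_square z \<in> rect (- r) r (- r) r <-> z \<in> rect (- (2 * r)) (2 * r) (- r) r"
  and "1 <= flat_norm z ==> \<bar>X z\<bar> = 1 & 1 <= \<bar>Y z\<bar> <-> \<bar>Re z\<bar> = 1"
  and "1 <= flat_norm z ==> \<bar>X z\<bar> < 1 <-> \<bar>Re z\<bar> < 1"
  and "flat_norm z = 3/2 ==> X z < - 1 <-> Re z < - 1"
  and "flat_norm z = 1 ==> X z = - 1 & \<bar>Y z\<bar> < 1 <-> Re z < - 1"
  and "flat_norm z = 1 ==> Y z = 1 & \<bar>X z\<bar> < 1 <-> Im z = 1 & \<bar>Re z\<bar> < 1"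
  and "flat_norm z = 1 ==> Y z = - 1 & \<bar>X z\<bar> < 1 <-> Im z = - 1 & \<bar>Re z\<bar> < 1"
proof -
 have c: "\<bar>Re z\<bar> <= \<bar>Im z\<bar> & X z = Re z & Y z = Im z |
   \<bar>Im z\<bar> < \<bar>Re z\<bar> & \<bar>X z\<bar> = flat_norm z & \<bar>Y z\<bar> < flat_norm z & (0 < X z <-> 0 < Re z)"
  unfolding X_def Y_def using to_square_steep[of z] to_square_flat[of z] by (cases "\<bar>Re z\<bar> <= \<bar>Im z\<bar>") auto
 have f: "\<bar>Re z\<bar> / 2 <= flat_norm z" "\<bar>Im z\<bar> <= flat_norm z" "flat_norm z = \<bar>Re z\<bar> / 2 | flat_norm z = \<bar>Im z\<bar>"
  by (auto simp: flat_norm_def max_def)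
 note f = f abs_eq[of "Re z"] abs_eq[of "Im z"] abs_eq[of "X z"] abs_eq[of "Y z"]
 show "to_square z \<in> rect (- r) r (- r) r <-> z \<in> rect (- (2 * r)) (2 * r) (- r) r"
 proof -
  have "to_square z \<in> rect (- r) r (- r) r <-> \<bar>X z\<bar> <= r & \<bar>Y z\<bar> <= r"
   "z \<in> rect (- (2 * r)) (2 * r) (- r) r <-> flat_norm z <= r"
   by (auto simp: in_rect X_def Y_def flat_norm_def)
  thus ?thesis using c f(1-3) by argo
 qed
 show "1 <= flat_norm z ==> \<bar>X z\<bar> = 1 & 1 <= \<bar>Y z\<bar> <-> \<bar>Re z\<bar> = 1"
  "1 <= flat_norm z ==> \<bar>X z\<bar> < 1 <-> \<bar>Re z\<bar> < 1"
  "flat_norm z = 3/2 ==> X z < - 1 <-> Re z < - 1"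
  "flat_norm z = 1 ==> X z = - 1 & \<bar>Y z\<bar> < 1 <-> Re z < - 1"
  "flat_norm z = 1 ==> Y z = 1 & \<bar>X z\<bar> < 1 <-> Im z = 1 & \<bar>Re z\<bar> < 1"
  "flat_norm z = 1 ==> Y z = - 1 & \<bar>X z\<bar> < 1 <-> Im z = - 1 & \<bar>Re z\<bar> < 1"
  using c f unfolding X_def Y_def by argo+
qed

lemma corner_from_annulus:
 obtains h where "isotopic_to_id h" "map_tangle h (annulus b left_mark) = corner_annulus b (%z. Re z = - 1 & \<bar>Im z\<bar> < 1)"
  "map_tangle h (annulus b (side_mark 2)) = corner_annulus b (%z. Im z = 1 & \<bar>Re z\<bar> < 1)"
  "map_tangle h (annulus b (side_mark 1)) = corner_annulus b (%z. Im z = - 1 & \<bar>Re z\<bar> < 1)"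
  "h ` stack_box 2 0 = rect (- 1) 1 (- 1) 1" "h ` rect (1/8) (23/8) 0 3 = rect (- 3/2) (3/2) (- 3/2) (3/2)"
proof -
 obtain f where f: "incr_homeo f" "map f [1/8, 1/4, 1, 2, 11/4, 23/8] = [-3, -2, -1, 1, 2, 3]" by (rule incr_homeo_obtain, erule (1) that) auto
 obtain g where g: "incr_homeo g" "map g [0, 1, 2, 3] = [-3/2, -1, 1, 3/2]" by (rule incr_homeo_obtain, erule (1) that) auto
 note ff = f(2)[unfolded list.map list.inject] and gg = g(2)[unfolded list.map list.inject]
 let ?p = "prod_map f g" and ?h = "%z. to_square (prod_map f g z)"
 let ?O = "rect (1/8) (23/8) 0 3" and ?O' = "rect (- 3/2) (3/2) (- 3/2) (3/2)" and ?B' = "rect (- 1) 1 (- 1) 1"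
 have h: "isotopic_to_id ?h" by (rule isotopic_to_id_comp[OF isotopic_to_square isotopic_prod_map[OF f(1) g(1)]])
 note pl = isotopic_homeo[OF h]
 have fx: "Re (?p z) < - 1 <-> Re z < 1" "- 1 < Re (?p z) <-> 1 < Re z" "Re (?p z) < 1 <-> Re z < 2" "1 < Re (?p z) <-> 2 < Re z"
  "Im (?p z) = 1 <-> Im z = 2" "Im (?p z) = - 1 <-> Im z = 1" for z
  using incr_homeo_compare(1)[OF f(1), of "Re z" 1] incr_homeo_compare(1)[OF f(1), of 1 "Re z"]
   incr_homeo_compare(1)[OF f(1), of "Re z" 2] incr_homeo_compare(1)[OF f(1), of 2 "Re z"]
   incr_homeo_compare(3)[OF g(1), of "Im z" 2] incr_homeo_compare(3)[OF g(1), of "Im z" 1] by (simp_all add: ff gg)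
 have box: "?p z \<in> rect (- 2) 2 (- 1) 1 <-> z \<in> stack_box 2 0" "?p z \<in> bd (rect (- 2) 2 (- 1) 1) <-> z \<in> bd (stack_box 2 0)" for z
  unfolding stack_box_def by (rule prod_map_in_rect[OF f(1) g(1)]; simp add: ff gg)+
 have out: "?p z \<in> rect (- 3) 3 (- 3/2) (3/2) <-> z \<in> ?O" "?p z \<in> bd (rect (- 3) 3 (- 3/2) (3/2)) <-> z \<in> bd ?O" for z
  by (rule prod_map_in_rect[OF f(1) g(1)]; simp add: ff gg)+
 have fl: "flat_norm w = r" if "w \<in> bd (rect (- (2 * r)) (2 * r) (- r) r)" for w r
  using that by (auto simp: flat_norm_def in_bd_rect in_rect max_def abs_if split: if_splits)
 have imB: "?h ` stack_box 2 0 = ?B'" by (rule homeo_image_eq[OF pl]) (use to_square_facts(1)[where r = 1] box(1) in simp)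
 have imO: "?h ` ?O = ?O'" by (rule homeo_image_eq[OF pl]) (use to_square_facts(1)[where r = "3/2"] out(1) in simp)
 have frB: "?h ` bd (stack_box 2 0) = bd ?B'" and frO: "?h ` bd ?O = bd ?O'"
  unfolding imB[symmetric] imO[symmetric] by (rule frontier_homeo_image[OF pl, symmetric])+
 have im: "?h ` {z \<in> S. R z} = {z \<in> ?h ` S. R' z}" if "!!z. z \<in> S ==> R' (?h z) <-> R z" for S R R' using that by auto
 have m: "map_tangle ?h (annulus b P) = corner_annulus b P'" if P: "!!z. flat_norm (?p z) = 1 ==> P' (?h z) <-> P z" for b P P'
  unfolding annulus_def corner_annulus_def
 proof (rule map_pat[OF pl imO])
  show "(`) ?h ` {stack_box 2 0} = {?B'}" using imB by simp
  have "?h ` {z \<in> bd ?O. Re z < 1} = {z \<in> bd ?O'. Re z < - 1}"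
   unfolding frO[symmetric]
   by (rule im) (use out(2) fl[where r = "3/2"] to_square_facts(4) fx(1) in simp)
  moreover have "?h ` {z \<in> bd (stack_box 2 0). P z} = {z \<in> bd ?B'. P' z}"
   unfolding frB[symmetric]
   by (rule im, rule P) (use box(2) fl[where r = 1] in simp)
  ultimately show "?h ` ({z \<in> bd ?O. Re z < 1} Un {z \<in> bd (stack_box 2 0). P z}) =
   {z \<in> bd ?O'. Re z < - 1} Un {z \<in> bd ?B'. P' z}"
   by (simp only: image_Un)
  fix z assume "z ~: interiors ({stack_box 2 0})"
  hence "?p z ~: interior (rect (- 2) 2 (- 1) 1)"
   using box[of z] closed_rect[of "1/4" "11/4" 1 2] closed_rect[of "-2" 2 "-1" 1]
    interior_subset[of "rect (-2) 2 (-1) 1"] by (auto simp: frontier_def stack_box_def)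
  hence g1: "1 <= flat_norm (?p z)" by (auto simp: in_int_rect flat_norm_def not_less le_max_iff_disj abs_if)
  have X: "\<bar>Re (?p z)\<bar> = 1 <-> z \<in> line_curves 2" using fx(1-4)[of z] by (auto simp: line_curves_2)
  show "?h z \<in> {z. \<bar>Re z\<bar> = 1 & 1 <= \<bar>Im z\<bar>} <-> z \<in> line_curves 2"
   using to_square_facts(2)[OF g1] X by simp
  show "?h z \<in> {z. \<bar>Re z\<bar> < 1} <-> z \<in> line_colour 2" if "z ~: line_curves 2"
   using to_square_facts(3)[OF g1] fx(1-4)[of z] that by (auto simp: line_curves_2 line_colour_2)
 qed
 show thesis
 proof (rule that[OF h m m m imB imO])
  fix z assume e: "flat_norm (?p z) = 1"
  show "Re (?h z) = - 1 & \<bar>Im (?h z)\<bar> < 1 <-> Re z < 1" using to_square_facts(5)[OF e] fx(1)[of z] by simp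
  show "Im (?h z) = 1 & \<bar>Re (?h z)\<bar> < 1 <-> side_mark 2 z" using to_square_facts(6)[OF e] fx[of z] by auto
  show "Im (?h z) = - 1 & \<bar>Re (?h z)\<bar> < 1 <-> side_mark 1 z" using to_square_facts(7)[OF e] fx[of z] by auto
 qed
qed

context planar_algebra
begin

text \<open>The pattern \<open>X\<close>, \<open>Y\<close> describes the strings on the three pieces at once, and the inner discs are
 filled one after the other.\<close>

lemma fill_two:
 fixes out D1 D2 E1 E2 X1 X2 X3 Y1 Y2 Y3 X Y M N1 N2 M' b1 b2 b3 b
 defines "T == pat out {D1, D2} X1 Y1 b1 M" and "S1 == pat D1 {E1} X2 Y2 b2 N1" and "S2 == pat D2 {E2} X3 Y3 b3 N2"
  and "G == pat out {E1, E2} X Y b M'"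
 assumes D: "D1 Int D2 = {}" and pl: "planar_tangle T" "planar_tangle S1" "planar_tangle S2"
  and X1: "!!z. z \<in> out ==> z ~: interior D1 ==> z ~: interior D2 ==> (z \<in> X1 <-> z \<in> X) & (z ~: X --> (z \<in> Y1 <-> b1) = (z \<in> Y <-> b))"
  and X2: "!!z. z \<in> D1 ==> z ~: interior E1 ==> (z \<in> X2 <-> z \<in> X) & (z ~: X --> (z \<in> Y2 <-> b2) = (z \<in> Y <-> b))"
  and X3: "!!z. z \<in> D2 ==> z ~: interior E2 ==> (z \<in> X3 <-> z \<in> X) & (z ~: X --> (z \<in> Y3 <-> b3) = (z \<in> Y <-> b))"
  and M: "M Int bd D1 = N1 Int bd D1" "M Int bd D2 = N2 Int bd D2" "M' = (M Un N1 Un N2) - bd D1 - bd D2"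
 shows "planar_tangle G" "disc_space A G E1 = disc_space A S1 E1" "disc_space A G E2 = disc_space A S2 E2"
  "f E1 \<in> disc_space A S1 E1 ==> f E2 \<in> disc_space A S2 E2 ==> act A S2 f \<in> disc_space A T D2 ==>
   act A G f = act A T (%D. if D = D1 then act A S1 f else act A S2 f)"
proof -
 have sub: "D1 \<subseteq> interior out" "D2 \<subseteq> interior out" "E1 \<subseteq> interior D1" "E2 \<subseteq> interior D2"
  using planar_tangleD(4)[OF pl(1), of D1] planar_tangleD(4)[OF pl(1), of D2] planar_tangleD(4)[OF pl(2), of E1]
   planar_tangleD(4)[OF pl(3), of E2] by (simp_all add: T_def S1_def S2_def)
 note out = sub(1,2)[THEN subset_trans, OF interior_subset]
 have cl: "closed D1" "closed D2" "closed E1" "closed E2"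
  using planar_disc_closed[OF pl(1), of D1] planar_disc_closed[OF pl(1), of D2] planar_disc_closed[OF pl(2), of E1]
   planar_disc_closed[OF pl(3), of E2] by (simp_all add: T_def S1_def S2_def discs_def)
 note int = interior_subset[of D1] interior_subset[of D2] sub(3,4)[THEN subset_trans, OF interior_subset]
 have fr: "bd D1 \<subseteq> D1" "bd D2 \<subseteq> D2" "bd E1 \<subseteq> E1" "bd E2 \<subseteq> E2"
  using cl by (simp_all add: frontier_subset_closed)
 have "N1 \<subseteq> bd D1 Un bd E1" "N2 \<subseteq> bd D2 Un bd E2"
  using planar_tangleD(10)[OF pl(2)] planar_tangleD(10)[OF pl(3)] by (simp_all add: S1_def S2_def discs_def)
 hence ND: "N1 \<subseteq> D1" "N2 \<subseteq> D2" using fr int by blast+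
 have ne: "D1 ~= {}" "D2 ~= {}" "E1 ~= {}" "E2 ~= {}"
  using planar_tangleD(1)[OF pl(1), of D1] planar_tangleD(1)[OF pl(1), of D2] planar_tangleD(1)[OF pl(2), of E1] planar_tangleD(1)[OF pl(3), of E2]
  by (auto simp: T_def S1_def S2_def discs_def homeomorphic_empty)
 have neq: "E1 ~= D2" "E2 ~= D1" "E1 ~= E2" "D1 ~= D2" using int D ne by blast+
 let ?G1 = "pat out {E1, D2} X Y b ((M Un N1) - bd D1)"
 have x1: "z \<in> X1 <-> z \<in> X" "z ~: X ==> (z \<in> Y1 <-> b1) <-> (z \<in> Y <-> b)" if "z \<in> out" "z ~: interiors ({D1, D2})" for z
  using X1[of z] that by simp_all
 have x2: "z \<in> X2 <-> z \<in> X" "z ~: X ==> (z \<in> Y2 <-> b2) <-> (z \<in> Y <-> b)" if "z \<in> D1" "z ~: interiors ({E1})" for z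
  using X2[of z] that by simp_all
 have x3: "z \<in> X3 <-> z \<in> X" "z ~: X ==> (z \<in> Y3 <-> b3) <-> (z \<in> Y <-> b)" if "z \<in> D2" "z ~: interiors ({E2})" for z
  using X3[of z] that by simp_all
 have I1: "{E1, D2} = {D1, D2} - {D1} Un {E1}" and I2: "{E1, E2} = {E1, D2} - {D2} Un {E2}" using neq by blast+
 have d1: "E Int D1 = {}" if "E \<in> {D1, D2}" "E ~= D1" for E using that D by blast
 have d2: "E Int D2 = {}" if "E \<in> {E1, D2}" "E ~= D2" for E using that D int by blast
 have j1: "E \<subseteq> interior D1" if "E \<in> {E1}" for E using that sub by simp
 have j2: "E \<subseteq> interior D2" if "E \<in> {E2}" for E using that sub by simp
 note pl' = pl[unfolded T_def S1_def S2_def] and D1 = insertI1[of D1 "{D2}"] and D2 = insertI2[OF singletonI, of D2 E1]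
 have g1: "glue T D1 S1 = ?G1" "gluable T D1 S1"
  unfolding T_def S1_def
  by (rule glue_pat(1)[where I = "{D1, D2}" and J = "{E1}"]; (rule refl | fact))
   (rule glue_pat(2)[where I = "{D1, D2}" and J = "{E1}" and X = X and Y = Y and b = b]; (rule refl | fact))
 interpret G1: gluing T D1 S1 by unfold_locales (rule g1(2))
 note pl1 = G1.planar_G[unfolded g1(1)]
 have m2: "((M Un N1) - bd D1) Int bd D2 = N2 Int bd D2" using M(2) ND D fr(1,2) by blast
 have M': "M' = ((M Un N1) - bd D1 Un N2) - bd D2" using M(3) ND D fr(1,2) by blast
 have g2: "glue ?G1 D2 S2 = G" "gluable ?G1 D2 S2"
  unfolding S2_def G_def
  by (rule glue_pat(1)[where I = "{E1, D2}" and J = "{E2}"]; (rule refl | fact))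
   (rule glue_pat(2)[where I = "{E1, D2}" and J = "{E2}" and X = X and Y = Y and b = b]; (rule refl | fact))
 interpret G2: gluing ?G1 D2 S2 by unfold_locales (rule g2(2))
 show "planar_tangle G" using G2.planar_G unfolding g2(1) .
 have d1: "disc_space A ?G1 E1 = disc_space A S1 E1"
  using G1.disc_space_glue(2)[of E1 A] unfolding g1(1) by (simp add: S1_def)
 show "disc_space A G E1 = disc_space A S1 E1"
  using G2.disc_space_glue(1)[of E1 A] neq(1) d1 unfolding g2(1) by (simp add: discs_def)
 show "disc_space A G E2 = disc_space A S2 E2"
  using G2.disc_space_glue(2)[of E2 A] unfolding g2(1) by (simp add: S2_def)
 assume f: "f E1 \<in> disc_space A S1 E1" "f E2 \<in> disc_space A S2 E2" "act A S2 f \<in> disc_space A T D2"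
 let ?f = "%D. if D = D2 then act A S2 f else f D"
 have "act A G f = act A ?G1 ?f"
  by (rule act_glue_eq[OF g2(2,1)]) (use f d1 neq in \<open>auto simp: S2_def\<close>)
 also have "... = act A T (%D. if D = D1 then act A S1 f else act A S2 f)"
 proof (rule act_glue_eq[OF g1(2,1)])
  show "act A S1 ?f = (if D1 = D1 then act A S1 f else act A S2 f)"
   using f neq by (auto simp: S1_def labelling_def intro!: act_cong pl(2)[unfolded S1_def])
 qed (use f neq in \<open>auto simp: S1_def T_def\<close>)
 finally show "act A G f = act A T (%D. if D = D1 then act A S1 f else act A S2 f)" .
qed

end

text \<open>Corner annuli around the centres of the two discs, in two positions.\<close>

abbreviation "right_small == rect 2 4 (- 1) 1"
abbreviation "left_small == rect (- 4) (- 2) (- 1) 1"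
abbreviation "bottom_mark == %z. Im z = - 1 & 2 < \<bar>Re z\<bar> & \<bar>Re z\<bar> < 4"

lemma map_corner_annulus:
 assumes h: "isotopic_to_id h" "h ` rect (- 3/2) (3/2) (- 3/2) (3/2) = D" "h ` rect (- 1) 1 (- 1) 1 = E"
  and X: "!!z. h z \<in> X <-> \<bar>Re z\<bar> = 1 & 1 <= \<bar>Im z\<bar>" "!!z. h z \<in> Y <-> \<bar>Re z\<bar> < 1"
  and M: "!!z. z \<in> rect (- 3/2) (3/2) (- 3/2) (3/2) ==> Q (h z) <-> Re z < - 1"
   "!!z. z \<in> rect (- 1) 1 (- 1) 1 ==> R (h z) <-> P z"
 shows "map_tangle h (corner_annulus b P) = pat D {E} X Y b ({z \<in> bd D. Q z} Un {z \<in> bd E. R z})"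
 unfolding corner_annulus_def
proof (rule map_pat[OF isotopic_homeo[OF h(1)] h(2)])
 have fr: "h ` bd (rect (- 3/2) (3/2) (- 3/2) (3/2)) = bd D" "h ` bd (rect (- 1) 1 (- 1) 1) = bd E"
  using frontier_homeo_image[OF isotopic_homeo[OF h(1)]] h(2,3) by metis+
 have sub: "bd (rect a b c d) \<subseteq> rect a b c d" for a b c d by (simp add: closed_rect frontier_subset_closed)
 show "h ` ({z \<in> bd (rect (- 3/2) (3/2) (- 3/2) (3/2)). Re z < - 1} Un {z \<in> bd (rect (- 1) 1 (- 1) 1). P z}) =
  {z \<in> bd D. Q z} Un {z \<in> bd E. R z}"
  unfolding fr[symmetric] using M sub by (auto simp: image_Un subset_iff)
qed (use h X in auto)

context planar_algebra
begin

lemma placed_annulus: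
 assumes "planar_tangle (annulus b P)" "isotopic_to_id h" "map_tangle h (annulus b P) = S"
  "h ` stack_box 2 0 = E" "h ` rect (1/8) (23/8) 0 3 = D"
 shows "planar_tangle S" "disc_space A S E = disc_space A (annulus b P) (stack_box 2 0)"
  "disc_space A S D = disc_space A (annulus b P) (rect (1/8) (23/8) 0 3)"
  "f E = x ==> x \<in> disc_space A (annulus b P) (stack_box 2 0) ==> act A S f = act A (annulus b P) (%_. x)"
 using planar_disc_space_map[OF assms(1-3)] assms(4,5) by (auto simp: annulus_disc intro!: act_map_eq[OF assms(1-3)])

end

definition vertical_annulus :: "real => bool => tangle" where
 "vertical_annulus r b = pat (rect (3 * r - 3/2) (3 * r + 3/2) (- 3/2) (3/2)) {rect (3 * r - 1) (3 * r + 1) (- 1) 1}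
   {z. \<bar>Re z - 3 * r\<bar> = 1 & 1 <= \<bar>Im z\<bar>} {z. \<bar>Re z - 3 * r\<bar> < 1} b
   ({z \<in> bd (rect (3 * r - 3/2) (3 * r + 3/2) (- 3/2) (3/2)). 4 < \<bar>Re z\<bar>} Un
   {z \<in> bd (rect (3 * r - 1) (3 * r + 1) (- 1) 1). bottom_mark z})"

definition horizontal_annulus :: "real => bool => tangle" where
 "horizontal_annulus r b = pat (rect (3 * r - 3/2) (3 * r + 3/2) (- 3/2) (3/2)) {rect (3 * r - 1) (3 * r + 1) (- 1) 1}
   {z. \<bar>Im z\<bar> = 1 & 1 <= \<bar>Re z - 3 * r\<bar>} {z. \<bar>Im z\<bar> < 1} b
   ({z \<in> bd (rect (3 * r - 3/2) (3 * r + 3/2) (- 3/2) (3/2)). Im z < - 1} Un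
   {z \<in> bd (rect (3 * r - 1) (3 * r + 1) (- 1) 1). bottom_mark z})"

lemma vertical_annulus:
 assumes r: "r = 1 & y = 2 | r = - 1 & y = 1"
 obtains h where "isotopic_to_id h" "map_tangle h (annulus b (side_mark y)) = vertical_annulus r b"
  "h ` stack_box 2 0 = rect (3 * r - 1) (3 * r + 1) (- 1) 1"
  "h ` rect (1/8) (23/8) 0 3 = rect (3 * r - 3/2) (3 * r + 3/2) (- 3/2) (3/2)"
proof -
 obtain k where k: "isotopic_to_id k"
  "map_tangle k (annulus b left_mark) = corner_annulus b (%z. Re z = - 1 & \<bar>Im z\<bar> < 1)"
  "map_tangle k (annulus b (side_mark 2)) = corner_annulus b (%z. Im z = 1 & \<bar>Re z\<bar> < 1)"
  "map_tangle k (annulus b (side_mark 1)) = corner_annulus b (%z. Im z = - 1 & \<bar>Re z\<bar> < 1)"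
  "k ` stack_box 2 0 = rect (- 1) 1 (- 1) 1" "k ` rect (1/8) (23/8) 0 3 = rect (- 3/2) (3/2) (- 3/2) (3/2)"
  by (rule corner_from_annulus)
 let ?m = "%z. of_real (- r) * z + of_real (3 * r) :: complex"
 have m: "isotopic_to_id ?m" by (rule isotopic_affine) (use r in auto)
 have im: "?m ` rect (- 3/2) (3/2) (- 3/2) (3/2) = rect (3 * r - 3/2) (3 * r + 3/2) (- 3/2) (3/2)"
  "?m ` rect (- 1) 1 (- 1) 1 = rect (3 * r - 1) (3 * r + 1) (- 1) 1"
  by (rule homeo_image_eq[OF isotopic_homeo[OF m]]; use r in \<open>auto simp: in_rect\<close>)+
 have kk: "(%z. ?m (k z)) ` S = ?m ` (k ` S)" for S by (simp only: image_image)
 have T: "map_tangle ?m (corner_annulus b (%z. Im z = r & \<bar>Re z\<bar> < 1)) = vertical_annulus r b"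
  unfolding vertical_annulus_def
  by (rule map_corner_annulus[OF m im]) (use r in \<open>auto simp: in_rect abs_if\<close>)
 have c: "map_tangle k (annulus b (side_mark y)) = corner_annulus b (%z. Im z = r & \<bar>Re z\<bar> < 1)" using r k(3,4) by auto
 have mk: "map_tangle (%z. ?m (k z)) (annulus b (side_mark y)) = vertical_annulus r b"
  by (simp only: map_tangle_comp[of ?m k, symmetric] c T)
 show thesis by (rule that[OF isotopic_to_id_comp[OF m k(1)] mk]) (simp_all only: kk k im)
qed

lemma horizontal_annulus:
 assumes r: "r = 1 | r = - 1"
 obtains h where "isotopic_to_id h" "map_tangle h (annulus b left_mark) = horizontal_annulus r b"
  "h ` stack_box 2 0 = rect (3 * r - 1) (3 * r + 1) (- 1) 1"
  "h ` rect (1/8) (23/8) 0 3 = rect (3 * r - 3/2) (3 * r + 3/2) (- 3/2) (3/2)"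
proof -
 obtain k where k: "isotopic_to_id k"
  "map_tangle k (annulus b left_mark) = corner_annulus b (%z. Re z = - 1 & \<bar>Im z\<bar> < 1)"
  "map_tangle k (annulus b (side_mark 2)) = corner_annulus b (%z. Im z = 1 & \<bar>Re z\<bar> < 1)"
  "map_tangle k (annulus b (side_mark 1)) = corner_annulus b (%z. Im z = - 1 & \<bar>Re z\<bar> < 1)"
  "k ` stack_box 2 0 = rect (- 1) 1 (- 1) 1" "k ` rect (1/8) (23/8) 0 3 = rect (- 3/2) (3/2) (- 3/2) (3/2)"
  by (rule corner_from_annulus)
 let ?m = "%z. \<i> * z + of_real (3 * r) :: complex"
 have m: "isotopic_to_id ?m" by (rule isotopic_affine) simp
 have im: "?m ` rect (- 3/2) (3/2) (- 3/2) (3/2) = rect (3 * r - 3/2) (3 * r + 3/2) (- 3/2) (3/2)"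
  "?m ` rect (- 1) 1 (- 1) 1 = rect (3 * r - 1) (3 * r + 1) (- 1) 1"
  by (rule homeo_image_eq[OF isotopic_homeo[OF m]]; use r in \<open>auto simp: in_rect\<close>)+
 have kk: "(%z. ?m (k z)) ` S = ?m ` (k ` S)" for S by (simp only: image_image)
 have T: "map_tangle ?m (corner_annulus b (%z. Re z = - 1 & \<bar>Im z\<bar> < 1)) = horizontal_annulus r b"
  unfolding horizontal_annulus_def
  by (rule map_corner_annulus[OF m im]) (use r in \<open>auto simp: in_rect abs_if\<close>)
 have mk: "map_tangle (%z. ?m (k z)) (annulus b left_mark) = horizontal_annulus r b"
  by (simp only: map_tangle_comp[of ?m k, symmetric] k(2) T)
 show thesis by (rule that[OF isotopic_to_id_comp[OF m k(1)] mk]) (simp_all only: kk k im)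
qed

lemma sup_norm_facts: "\<bar>Re z\<bar> <= sup_norm z" "\<bar>Im z\<bar> <= sup_norm z" "sup_norm z = \<bar>Re z\<bar> | sup_norm z = \<bar>Im z\<bar>"
 by (auto simp: sup_norm_def max_def)

abbreviation "square8 == {z. sup_norm z <= 8}"
abbreviation "small_marks == {z. sup_norm z = 8} Un {z \<in> bd right_small Un bd left_small. bottom_mark z}"

abbreviation "ring_curves == {z. (sup_norm z = 2 | sup_norm z = 4) & (\<bar>Im z\<bar> < 1 --> \<bar>Re z\<bar> ~= 2 & \<bar>Re z\<bar> ~= 4)}"

text \<open>The rings of the trace of a product after both factors have been replaced by rotations of
 the contents of the small discs: the strings end at the corners of these discs.\<close>

definition rotated_rings :: "bool => tangle" where
 "rotated_rings b = pat square8 {right_small, left_small}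
   ring_curves {z. 2 < sup_norm z & sup_norm z < 4} b small_marks"

abbreviation "upper_loop == rect (- 5) 5 1 4"
abbreviation "lower_loop == rect (- 11/2) (11/2) (- 4) (- 1)"

definition two_loops :: "bool => tangle" where
 "two_loops b = pat square8 {right_small, left_small}
   {z \<in> bd upper_loop Un bd lower_loop. \<bar>Im z\<bar> = 1 --> \<not> (2 < \<bar>Re z\<bar> & \<bar>Re z\<bar> < 4)} (upper_loop Un lower_loop) b small_marks"

lemma vertical_annulus_sides:
 "vertical_annulus 1 b = pat right_disc {right_small} {z. \<bar>Re z - 3\<bar> = 1 & 1 <= \<bar>Im z\<bar>} {z. \<bar>Re z - 3\<bar> < 1} b
   ({z \<in> bd right_disc. 4 < \<bar>Re z\<bar>} Un {z \<in> bd right_small. bottom_mark z})"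
 "vertical_annulus (- 1) b = pat left_disc {left_small} {z. \<bar>Re z + 3\<bar> = 1 & 1 <= \<bar>Im z\<bar>} {z. \<bar>Re z + 3\<bar> < 1} b
   ({z \<in> bd left_disc. 4 < \<bar>Re z\<bar>} Un {z \<in> bd left_small. bottom_mark z})"
 by (simp_all add: vertical_annulus_def)

lemma horizontal_annulus_sides:
 "horizontal_annulus 1 b = pat right_disc {right_small} {z. \<bar>Im z\<bar> = 1 & 1 <= \<bar>Re z - 3\<bar>} {z. \<bar>Im z\<bar> < 1} b
   ({z \<in> bd right_disc. Im z < - 1} Un {z \<in> bd right_small. bottom_mark z})"
 "horizontal_annulus (- 1) b = pat left_disc {left_small} {z. \<bar>Im z\<bar> = 1 & 1 <= \<bar>Re z + 3\<bar>} {z. \<bar>Im z\<bar> < 1} b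
   ({z \<in> bd left_disc. Im z < - 1} Un {z \<in> bd left_small. bottom_mark z})"
 by (simp_all add: horizontal_annulus_def)

lemma small_marks_glued:
 assumes P: "!!z. z \<in> bd right_disc Un bd left_disc ==> P z = Q z" "{z. sup_norm z = 8} = K"
 defines "M == K Un {z \<in> bd right_disc Un bd left_disc. P z}"
  and "N1 == {z \<in> bd right_disc. Q z} Un {z \<in> bd right_small. bottom_mark z}"
  and "N2 == {z \<in> bd left_disc. Q z} Un {z \<in> bd left_small. bottom_mark z}"
 shows "M Int bd right_disc = N1 Int bd right_disc" "M Int bd left_disc = N2 Int bd left_disc"
  "small_marks = (M Un N1 Un N2) - bd right_disc - bd left_disc"
proof -
 have d: "K Int bd right_disc = {}" "K Int bd left_disc = {}" "bd right_disc Int bd left_disc = {}"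
  "bd right_small Int bd right_disc = {}" "bd right_small Int bd left_disc = {}"
  "bd left_small Int bd right_disc = {}" "bd left_small Int bd left_disc = {}"
  unfolding P(2)[symmetric] disjoint_iff mem_Collect_eq in_bd_rect in_rect
  subgoal by (auto simp: sup_norm_def max_def abs_if split: if_splits)
  subgoal by (auto simp: sup_norm_def max_def abs_if split: if_splits)
  by (intro allI; argo)+
 show "M Int bd right_disc = N1 Int bd right_disc" "M Int bd left_disc = N2 Int bd left_disc"
  unfolding M_def N1_def N2_def using d P(1) by blast+
 show "small_marks = (M Un N1 Un N2) - bd right_disc - bd left_disc"
  unfolding M_def N1_def N2_def P(2) using d P(1) by blast
qed

context star_planar_algebra
begin

lemma rotated_rings:
 assumes x: "x \<in> box_space A 2 s"
 shows "planar_tangle (rotated_rings (opp s = Pos))"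
  "disc_space A (rotated_rings (opp s = Pos)) right_small = box_space A 2 s" "disc_space A (rotated_rings (opp s = Pos)) left_small = box_space A 2 s"
  "f right_small = x ==> f left_small = adj A 2 s x ==> act A (rotated_rings (opp s = Pos)) f =
    act A (trace_tangle 2 (opp s)) (%_. box_mult A 2 (opp s) (adj A 2 (opp s) (fourier A s x)) (fourier A s x))"
proof -
 let ?b = "opp s = Pos"
 obtain h where h: "isotopic_to_id h" "map_tangle h (annulus ?b (side_mark 2)) = vertical_annulus 1 ?b" "h ` stack_box 2 0 = right_small"
  "h ` rect (1/8) (23/8) 0 3 = right_disc" by (rule vertical_annulus[of 1 2 ?b]) auto
 obtain k where k: "isotopic_to_id k" "map_tangle k (annulus ?b (side_mark 1)) = vertical_annulus (- 1) ?b" "k ` stack_box 2 0 = left_small"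
  "k ` rect (1/8) (23/8) 0 3 = left_disc" by (rule vertical_annulus[of "- 1" 1 ?b]) auto
 note S1 = placed_annulus[OF planar_annulus h] and S2 = placed_annulus[OF planar_annulus k]
 note T = opposite_discs[where s = "opp s"]
 note ring = ring_tangle_def[of right_disc left_disc ?b]
 have arith: "!!z. z \<in> square8 ==> z ~: interior right_disc ==> z ~: interior left_disc ==>
   (z \<in> {z. sup_norm z = 2 | sup_norm z = 4} <-> z \<in> ring_curves) &
   (z ~: ring_curves -->
    (z \<in> {z. 2 <= sup_norm z & sup_norm z <= 4} <-> ?b) = (z \<in> {z. 2 < sup_norm z & sup_norm z < 4} <-> ?b))"
  "!!z. z \<in> right_disc ==> z ~: interior right_small ==>
   (z \<in> {z. \<bar>Re z - 3\<bar> = 1 & 1 <= \<bar>Im z\<bar>} <-> z \<in> ring_curves) &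
   (z ~: ring_curves -->
    (z \<in> {z. \<bar>Re z - 3\<bar> < 1} <-> ?b) = (z \<in> {z. 2 < sup_norm z & sup_norm z < 4} <-> ?b))"
  "!!z. z \<in> left_disc ==> z ~: interior left_small ==>
   (z \<in> {z. \<bar>Re z + 3\<bar> = 1 & 1 <= \<bar>Im z\<bar>} <-> z \<in> ring_curves) &
   (z ~: ring_curves -->
    (z \<in> {z. \<bar>Re z + 3\<bar> < 1} <-> ?b) = (z \<in> {z. 2 < sup_norm z & sup_norm z < 4} <-> ?b))"
  subgoal for z using sup_norm_facts[of z] abs_eq[of "Re z"] abs_eq[of "Im z"] unfolding in_int_rect mem_Collect_eq by argo
  subgoal for z using sup_norm_facts[of z] abs_eq[of "Re z"] abs_eq[of "Im z"] abs_eq[of "Re z - 3"] unfolding in_int_rect in_rect mem_Collect_eq by argo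
  subgoal for z using sup_norm_facts[of z] abs_eq[of "Re z"] abs_eq[of "Im z"] abs_eq[of "Re z + 3"] unfolding in_int_rect in_rect mem_Collect_eq by argo
  done
 have mk: "4 < sup_norm z <-> 4 < \<bar>Re z\<bar>" if "z \<in> bd right_disc Un bd left_disc" for z
  using that by (auto simp: in_bd_rect in_rect sup_norm_def max_def)
 note fill = fill_two[OF right_left(1) T(1)[unfolded ring] S1(1)[unfolded vertical_annulus_sides] S2(1)[unfolded vertical_annulus_sides] arith
   small_marks_glued[OF mk refl], folded ring vertical_annulus_sides rotated_rings_def]
 show "planar_tangle (rotated_rings ?b)" by (rule fill(1)) simp_all
 have e: "disc_space A (vertical_annulus 1 ?b) right_small = box_space A 2 s" "disc_space A (vertical_annulus (- 1) ?b) left_small = box_space A 2 s"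
  using S1(2) S2(2) annulus_spaces(2) by simp_all
 show "disc_space A (rotated_rings ?b) right_small = box_space A 2 s" "disc_space A (rotated_rings ?b) left_small = box_space A 2 s"
  using fill(2,3) e by simp_all
 assume f: "f right_small = x" "f left_small = adj A 2 s x"
 have a: "act A (vertical_annulus 1 ?b) f = fourier A s x" "act A (vertical_annulus (- 1) ?b) f = adj A 2 (opp s) (fourier A s x)"
  using S1(4)[of f x] S2(4)[of f "adj A 2 s x"] f x adj_closed[OF x] by (simp_all add: annulus_spaces act_annulus_top act_annulus_bottom)
 note F = fourier_closed[OF x] adj_closed[OF fourier_closed[OF x]]
 have "act A (rotated_rings ?b) f = act A (ring_tangle right_disc left_disc ?b) (%D. if D = right_disc then fourier A s x else adj A 2 (opp s) (fourier A s x))"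
  using fill(4)[of f] F x adj_closed[OF x] unfolding e a f T(3) by blast
 also have "... = act A (trace_tangle 2 (opp s)) (%_. box_mult A 2 (opp s) (adj A 2 (opp s) (fourier A s x)) (fourier A s x))"
  using T(4)[of "%D. if D = right_disc then fourier A s x else adj A 2 (opp s) (fourier A s x)"] F right_left(2) by simp
 finally show "act A (rotated_rings ?b) f = act A (trace_tangle 2 (opp s)) (%_. box_mult A 2 (opp s) (adj A 2 (opp s) (fourier A s x)) (fourier A s x))" .
qed

end

abbreviation "left_trace_2 s == pat (rect (-1) 4 (-2) 5) {stack_box 2 0} (bd (rect 0 1 (-1) 4) Un bd (rect 2 3 0 3))
  (rect 0 1 (-1) 4 Un rect 2 3 0 3) (opp s = Pos) (bd (rect (-1) 4 (-2) 5) Un {z \<in> bd (stack_box 2 0). Re z < 1})"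

abbreviation "left_trace_product s == pat (rect (-1) 4 (-2) 5) {lower_factor, upper_factor} (bd (rect 0 1 (-1) 4) Un bd (rect 2 3 0 3))
  (rect 0 1 (-1) 4 Un rect 2 3 0 3) (opp s = Pos) (bd (rect (-1) 4 (-2) 5) Un {z \<in> bd lower_factor Un bd upper_factor. Re z < 1})"

abbreviation "crossed_loops b == pat (rect (-8) 8 (-8) 8) {right_disc, left_disc} (bd upper_loop Un bd lower_loop)
  (upper_loop Un lower_loop) b (bd (rect (-8) 8 (-8) 8) Un {z \<in> bd right_disc Un bd left_disc. Im z < - 1})"

lemma left_trace_2_isotopy:
 obtains h where "isotopic_to_id h" "map_tangle h (left_closed_expectation s) = left_trace_2 s"
  "h ` rect (3/8) (11/8) (7/5) (8/5) = stack_box 2 0"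
proof -
 obtain f where f: "incr_homeo f" "map f [-1, 0, 3/8, 1, 5/4, 11/8, 3/2, 2] = [-1, 0, 1/4, 1, 2, 11/4, 3, 4]" by (rule incr_homeo_obtain, erule (1) that) auto
 obtain g where g: "incr_homeo g" "map g [-1, 0, 11/10, 7/5, 8/5, 19/10, 3, 4] = [-2, -1, 0, 1, 2, 3, 4, 5]" by (rule incr_homeo_obtain, erule (1) that) auto
 note ff = f(2)[unfolded list.map list.inject] and gg = g(2)[unfolded list.map list.inject]
 have f1: "f x < 1 <-> x < 1" for x using incr_homeo_compare(1)[OF f(1), of x 1] ff by simp
 have "prod_map f g z \<in> bd (rect 0 1 (-1) 4) <-> z \<in> bd (rect 0 1 0 3)"
  "prod_map f g z \<in> rect 0 1 (-1) 4 <-> z \<in> rect 0 1 0 3"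
  "prod_map f g z \<in> bd (rect 2 3 0 3) <-> z \<in> bd (rect (5/4) (3/2) (11/10) (19/10))"
  "prod_map f g z \<in> rect 2 3 0 3 <-> z \<in> rect (5/4) (3/2) (11/10) (19/10)" for z
  by (rule prod_map_in_rect[OF f(1) g(1)]; simp add: ff gg)+
 hence XY: "prod_map f g z \<in> bd (rect 0 1 (-1) 4) Un bd (rect 2 3 0 3) <->
   z \<in> bd (rect 0 1 0 3) Un bd (rect (5/4) (3/2) (11/10) (19/10))"
  "prod_map f g z \<in> rect 0 1 (-1) 4 Un rect 2 3 0 3 <-> z \<in> rect 0 1 0 3 Un rect (5/4) (3/2) (11/10) (19/10)" for z by simp_all
 have m: "map_tangle (prod_map f g) (left_closed_expectation s) = left_trace_2 s"
  by (rule map_pat_prod[OF f(1) g(1), where J = "{(3/8, 11/8, 7/5, 8/5)}" and P = "%_. True" and P' = "%_. True"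
     and Q = "%z. Re z < 1" and Q' = "%z. Re z < 1"])
   (simp_all only: XY, simp_all add: f1 ff gg stack_box_def)
 show thesis
  by (rule that[OF isotopic_prod_map[OF f(1) g(1)] m]) (simp add: prod_map_rect[OF f(1) g(1)] ff gg stack_box_def)
qed

lemma crossed_loops_isotopy:
 obtains h where "isotopic_to_id h" "map_tangle h (left_trace_product s) = crossed_loops (opp s = Pos)"
  "h ` lower_factor = right_disc" "h ` upper_factor = left_disc"
proof -
 obtain f where f: "incr_homeo f" "map f [-1, 0, 3/8, 1, 2, 21/8, 3, 4] = [-8, -4, -3/2, -1, 1, 3/2, 4, 8]" by (rule incr_homeo_obtain, erule (1) that) auto
 obtain g where g: "incr_homeo g" "map g [-2, -1, 0, 11/10, 7/5, 8/5, 19/10, 3, 4, 5] = [-8, -11/2, -5, -9/2, -3/2, 3/2, 9/2, 5, 11/2, 8]" by (rule incr_homeo_obtain, erule (1) that) auto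
 note ff = f(2)[unfolded list.map list.inject] and gg = g(2)[unfolded list.map list.inject]
 have f1: "f x < - 1 <-> x < 1" for x using incr_homeo_compare(1)[OF f(1), of x 1] ff by simp
 let ?h = "%z. \<i> * prod_map f g z + 0"
 have h: "isotopic_to_id ?h" by (rule isotopic_to_id_comp[OF isotopic_affine isotopic_prod_map[OF f(1) g(1)]]) simp
 note pl = isotopic_homeo[OF h]
 have r: "\<i> * w + 0 \<in> rect a b c d <-> w \<in> rect c d (- b) (- a)" "\<i> * w + 0 \<in> bd (rect a b c d) <-> w \<in> bd (rect c d (- b) (- a))"
  for w a b c d by (auto simp: in_rect in_bd_rect)
 have "?h z \<in> right_disc <-> z \<in> lower_factor" "?h z \<in> left_disc <-> z \<in> upper_factor"
  "?h z \<in> rect (-8) 8 (-8) 8 <-> z \<in> rect (-1) 4 (-2) 5"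
  "?h z \<in> upper_loop <-> z \<in> rect 2 3 0 3" "?h z \<in> lower_loop <-> z \<in> rect 0 1 (-1) 4"
  "?h z \<in> bd upper_loop <-> z \<in> bd (rect 2 3 0 3)" "?h z \<in> bd lower_loop <-> z \<in> bd (rect 0 1 (-1) 4)" for z
  unfolding r by (rule prod_map_in_rect[OF f(1) g(1)]; simp add: ff gg)+
 note hh = this
 have im: "?h ` lower_factor = right_disc" "?h ` upper_factor = left_disc" "?h ` rect (-1) 4 (-2) 5 = rect (-8) 8 (-8) 8"
  by (rule homeo_image_eq[OF pl hh(1)], rule homeo_image_eq[OF pl hh(2)], rule homeo_image_eq[OF pl hh(3)])
 have "map_tangle ?h (left_trace_product s) = crossed_loops (opp s = Pos)"
 proof (rule map_pat[OF pl im(3)])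
  show "(`) ?h ` {lower_factor, upper_factor} = {right_disc, left_disc}" using im by simp
  have fr: "?h ` bd lower_factor = bd right_disc" "?h ` bd upper_factor = bd left_disc"
   "?h ` bd (rect (-1) 4 (-2) 5) = bd (rect (-8) 8 (-8) 8)"
   unfolding im[symmetric] by (rule frontier_homeo_image[OF pl, symmetric])+
  have "?h ` {z \<in> S. Re z < 1} = {z \<in> ?h ` S. Im z < - 1}" for S by (auto simp: f1)
  thus "?h ` (bd (rect (-1) 4 (-2) 5) Un {z \<in> bd lower_factor Un bd upper_factor. Re z < 1}) =
   bd (rect (-8) 8 (-8) 8) Un {z \<in> bd right_disc Un bd left_disc. Im z < - 1}"
   by (simp only: image_Un fr)
 qed (simp_all only: Un_iff hh disj_commute)
 thus thesis by (rule that[OF h _ im(1,2)])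
qed

context subfactor_planar_algebra
begin

lemma left_trace_2:
 "planar_tangle (left_trace_2 s)" "disc_space A (left_trace_2 s) (stack_box 2 0) = box_space A 2 s"
 "x \<in> box_space A 2 s ==> act A (left_trace_2 s) (%_. x) = scl A (box_trace A 2 s x) (box_unit A 0 (opp s))"
proof -
 obtain h where h: "isotopic_to_id h" "map_tangle h (left_closed_expectation s) = left_trace_2 s"
  "h ` rect (3/8) (11/8) (7/5) (8/5) = stack_box 2 0" by (rule left_trace_2_isotopy)
 show "planar_tangle (left_trace_2 s)" "disc_space A (left_trace_2 s) (stack_box 2 0) = box_space A 2 s"
  using planar_disc_space_map(1)[OF left_closed_expectation(1) h(1,2)]
   planar_disc_space_map(2)[OF left_closed_expectation(1) h(1,2), of "rect (3/8) (11/8) (7/5) (8/5)"]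
  unfolding h(3) left_closed_expectation(2) .
 assume x: "x \<in> box_space A 2 s"
 have "act A (left_trace_2 s) (%_. x) = act A (left_closed_expectation s) (%_. x)"
  by (rule act_map_eq[OF left_closed_expectation(1) h(1,2)])
   (use x in \<open>simp_all only: pat_sel singleton_iff left_closed_expectation(2)\<close>)
 thus "act A (left_trace_2 s) (%_. x) = scl A (box_trace A 2 s x) (box_unit A 0 (opp s))"
  using left_closed_expectation(3)[OF x] by simp
qed

lemma glue_left_trace_product:
 "glue (left_trace_2 s) (stack_box 2 0) (product_col (s = Pos)) = left_trace_product s"
 "gluable (left_trace_2 s) (stack_box 2 0) (product_col (s = Pos))"
proof -
 have B: "stack_box 2 0 \<subseteq> interior (rect (-1) 4 (-2) 5)" "closed (stack_box 2 0)"
  by (auto simp: stack_box_def in_rect in_int_rect closed_rect)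
 have d: "bd (rect (-1) 4 (-2) 5) Int stack_box 2 0 = {}"
  "{z \<in> bd lower_factor Un bd upper_factor. Re z < 1} Int bd (stack_box 2 0) = {}"
  by (auto simp: stack_box_def rect_simps)
 note g = glue_pat_single[OF B left_trace_2(1)[of s] planar_col[OF planar_product_col, of 2 "s = Pos", unfolded product_col]
   refl d(1) refl d(2),
  where X = "bd (rect 0 1 (-1) 4) Un bd (rect 2 3 0 3)" and Y = "rect 0 1 (-1) 4 Un rect 2 3 0 3" and b = "opp s = Pos"]
 show "glue (left_trace_2 s) (stack_box 2 0) (product_col (s = Pos)) = left_trace_product s"
  unfolding product_col
  by (rule g(1); simp add: stack_box_def rect_simps line_colour_2 line_curves_2 opp_Pos; argo)
 show "gluable (left_trace_2 s) (stack_box 2 0) (product_col (s = Pos))"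
  unfolding product_col
  by (rule g(2); simp add: stack_box_def rect_simps line_colour_2 line_curves_2 opp_Pos; argo)
qed

lemma crossed_loops:
 defines "T == %s. crossed_loops (opp s = Pos)"
 shows "planar_tangle (T s)" "disc_space A (T s) right_disc = box_space A 2 s" "disc_space A (T s) left_disc = box_space A 2 s"
  "f right_disc \<in> box_space A 2 s ==> f left_disc \<in> box_space A 2 s ==>
    act A (T s) f = scl A (box_trace A 2 s (box_mult A 2 s (f left_disc) (f right_disc))) (box_unit A 0 (opp s))"
proof -
 obtain h where h: "isotopic_to_id h" "map_tangle h (left_trace_product s) = crossed_loops (opp s = Pos)"
  "h ` lower_factor = right_disc" "h ` upper_factor = left_disc" by (rule crossed_loops_isotopy)
 note G = product_glued[OF glue_left_trace_product(2,1) pat_sel(2)]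
 show "planar_tangle (T s)" "disc_space A (T s) right_disc = box_space A 2 s" "disc_space A (T s) left_disc = box_space A 2 s"
  using planar_disc_space_map(1)[OF G(1) h(1,2)] planar_disc_space_map(2)[OF G(1) h(1,2), of lower_factor]
   planar_disc_space_map(2)[OF G(1) h(1,2), of upper_factor] unfolding h(3,4) G(2,3) T_def .
 assume f: "f right_disc \<in> box_space A 2 s" "f left_disc \<in> box_space A 2 s"
 let ?e = "%D. if D = lower_factor then f right_disc else f left_disc"
 have "act A (T s) f = act A (left_trace_product s) ?e"
  unfolding T_def
  by (rule act_map_two[OF G(1) h(1,2) pat_sel(2)]) (simp_all only: G(2,3) h(3,4) f if_True if_False simp_thms lower_upper(1)[symmetric])
 also have "... = act A (left_trace_2 s) (%_. box_mult A 2 s (f left_disc) (f right_disc))"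
  using G(4)[of ?e] f unfolding if_P[OF refl, of lower_factor] if_not_P[OF lower_upper(1)[symmetric]] by simp
 finally show "act A (T s) f = scl A (box_trace A 2 s (box_mult A 2 s (f left_disc) (f right_disc))) (box_unit A 0 (opp s))"
  using left_trace_2(3)[OF box_mult_closed[OF f(2,1)]] by simp
qed

text \<open>Here sphericality enters: the loops are closed on different sides of the product.\<close>

lemma two_loops:
 assumes x: "x \<in> box_space A 2 s"
 shows "planar_tangle (two_loops (opp s = Pos))"
  "disc_space A (two_loops (opp s = Pos)) right_small = box_space A 2 s" "disc_space A (two_loops (opp s = Pos)) left_small = box_space A 2 s"
  "f right_small = x ==> f left_small = adj A 2 s x ==> act A (two_loops (opp s = Pos)) f =
    scl A (box_trace A 2 s (box_mult A 2 s (adj A 2 s x) x)) (box_unit A 0 (opp s))"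
proof -
 let ?b = "s = Pos" and ?X = "{z \<in> bd upper_loop Un bd lower_loop. \<bar>Im z\<bar> = 1 --> \<not> (2 < \<bar>Re z\<bar> & \<bar>Re z\<bar> < 4)}"
 have pl0: "planar_tangle (annulus ?b left_mark)" using planar_stack_tangle[of 2 s 1] unfolding stack_annulus .
 obtain h where h: "isotopic_to_id h" "map_tangle h (annulus ?b left_mark) = horizontal_annulus 1 ?b" "h ` stack_box 2 0 = right_small"
  "h ` rect (1/8) (23/8) 0 3 = right_disc" by (rule horizontal_annulus[of 1 ?b]) auto
 obtain k where k: "isotopic_to_id k" "map_tangle k (annulus ?b left_mark) = horizontal_annulus (- 1) ?b" "k ` stack_box 2 0 = left_small"
  "k ` rect (1/8) (23/8) 0 3 = left_disc" by (rule horizontal_annulus[of "- 1" ?b]) auto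
 note S1 = placed_annulus[OF pl0 h] and S2 = placed_annulus[OF pl0 k]
 note T = crossed_loops[where s = s]
 have sq: "rect (-8) 8 (-8) 8 = square8" "bd (rect (-8) 8 (-8) 8) = {z. sup_norm z = 8}"
  using sup_norm_rect[of _ 8] by auto
 have arith: "!!z. z \<in> rect (-8) 8 (-8) 8 ==> z ~: interior right_disc ==> z ~: interior left_disc ==>
   (z \<in> bd upper_loop Un bd lower_loop <-> z \<in> ?X) &
   (z ~: ?X --> (z \<in> upper_loop Un lower_loop <-> opp s = Pos) = (z \<in> upper_loop Un lower_loop <-> opp s = Pos))"
  "!!z. z \<in> right_disc ==> z ~: interior right_small ==> (z \<in> {z. \<bar>Im z\<bar> = 1 & 1 <= \<bar>Re z - 3\<bar>} <-> z \<in> ?X) &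
   (z ~: ?X --> (z \<in> {z. \<bar>Im z\<bar> < 1} <-> ?b) = (z \<in> upper_loop Un lower_loop <-> opp s = Pos))"
  "!!z. z \<in> left_disc ==> z ~: interior left_small ==> (z \<in> {z. \<bar>Im z\<bar> = 1 & 1 <= \<bar>Re z + 3\<bar>} <-> z \<in> ?X) &
   (z ~: ?X --> (z \<in> {z. \<bar>Im z\<bar> < 1} <-> ?b) = (z \<in> upper_loop Un lower_loop <-> opp s = Pos))"
  subgoal for z using abs_eq[of "Re z"] abs_eq[of "Im z"] unfolding in_int_rect mem_Collect_eq Un_iff in_bd_rect in_rect by argo
  subgoal for z using abs_eq[of "Re z"] abs_eq[of "Im z"] abs_eq[of "Re z - 3"] unfolding in_int_rect in_bd_rect in_rect mem_Collect_eq Un_iff opp_Pos by argo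
  subgoal for z using abs_eq[of "Re z"] abs_eq[of "Im z"] abs_eq[of "Re z + 3"] unfolding in_int_rect in_bd_rect in_rect mem_Collect_eq Un_iff opp_Pos by argo
  done
 note fill = fill_two[OF right_left(1) T(1) S1(1)[unfolded horizontal_annulus_sides] S2(1)[unfolded horizontal_annulus_sides] arith
   small_marks_glued[OF refl sq(2)[symmetric]], folded horizontal_annulus_sides, unfolded sq(1), folded two_loops_def, folded sq(1)]
 show "planar_tangle (two_loops (opp s = Pos))" by (rule fill(1)) simp_all
 have e: "disc_space A (horizontal_annulus 1 ?b) right_small = box_space A 2 s" "disc_space A (horizontal_annulus (- 1) ?b) left_small = box_space A 2 s"
  using S1(2) S2(2) annulus_spaces(3) by simp_all
 show "disc_space A (two_loops (opp s = Pos)) right_small = box_space A 2 s" "disc_space A (two_loops (opp s = Pos)) left_small = box_space A 2 s"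
  using fill(2,3) e by simp_all
 assume f: "f right_small = x" "f left_small = adj A 2 s x"
 have a: "act A (horizontal_annulus 1 ?b) f = x" "act A (horizontal_annulus (- 1) ?b) f = adj A 2 s x"
  using S1(4)[of f x] S2(4)[of f "adj A 2 s x"] f x adj_closed[OF x] by (simp_all add: annulus_spaces act_annulus_left)
 have "act A (two_loops (opp s = Pos)) f = act A (crossed_loops (opp s = Pos)) (%D. if D = right_disc then x else adj A 2 s x)"
  using fill(4)[of f] x adj_closed[OF x] unfolding e a f T(3) by blast
 thus "act A (two_loops (opp s = Pos)) f = scl A (box_trace A 2 s (box_mult A 2 s (adj A 2 s x) x)) (box_unit A 0 (opp s))"
  using T(4)[of "%D. if D = right_disc then x else adj A 2 s x"] x adj_closed[OF x] right_left(2) by simp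
qed

end

text \<open>
 The arcs of \<open>rotated_rings\<close> and of \<open>two_loops\<close> join the same corners. A horizontal shear \<open>tilt\<close> makes the
 vertical sides of the rings slanted, a vertical shear \<open>raise\<close> does this for the horizontal sides of the loops;
 both leave the discs fixed and produce \<open>common_curves\<close>. The factor 3/2 in the lower half
 occurs because the lower loop of \<open>two_loops\<close> extends to 11/2 and the upper one to 5.
\<close>

definition ramp :: "real => real" where
 "ramp t = max 0 (min 1 t)"

lemma ramp_continuous [continuous_intros]: "continuous_on S f ==> continuous_on S (%x. ramp (f x))"
 unfolding ramp_def by (intro continuous_intros)

lemma ramp_facts: "0 <= ramp t" "ramp t <= 1" "t <= 0 ==> ramp t = 0" "0 <= t & t <= 1 ==> ramp t = t" "1 <= t ==> ramp t = 1"
 by (auto simp: ramp_def)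

lemma strict_mono_abs:
 fixes f :: "real => real"
 assumes "strict_mono f" "f t = T" "f (- t) = - T"
 shows "\<bar>f x\<bar> <= T <-> \<bar>x\<bar> <= t" "\<bar>f x\<bar> < T <-> \<bar>x\<bar> < t"
 using strict_mono_less_eq[OF assms(1), of x t] strict_mono_less_eq[OF assms(1), of "- t" x]
  strict_mono_less[OF assms(1), of x t] strict_mono_less[OF assms(1), of "- t" x] assms(2,3)
 unfolding abs_le_iff abs_less_iff by argo+

definition spread :: "real => real" where
 "spread y = ramp (y - 1) + 3/2 * ramp (- y - 1)"

definition tilt_profile :: "real => real" where
 "tilt_profile x = - 1/2 * clip 2 x + (clip 4 x - clip 2 x) - 1/3 * (clip 7 x - clip 4 x)"

definition tilt :: "complex => complex" where
 "tilt z = Complex (Re z + spread (Im z) * tilt_profile (Re z)) (Im z)"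

lemma spread_facts: "0 <= spread y" "spread y <= 3/2"
 using ramp_facts(1,2)[of "y - 1"] ramp_facts(1,2)[of "- y - 1"] ramp_facts(3)[of "y - 1"] ramp_facts(3)[of "- y - 1"]
 unfolding spread_def by argo+

lemma tilt_profile_values: "tilt_profile 2 = - 1" "tilt_profile (- 2) = 1" "tilt_profile 4 = 1" "tilt_profile (- 4) = - 1"
 by (simp_all add: tilt_profile_def clip_def)

lemma tilt_profile_outside: "7 <= \<bar>x\<bar> ==> tilt_profile x = 0"
 by (auto simp: tilt_profile_def clip_def max_def min_def)

lemma tilt_mono:
 assumes m: "0 <= m" "m <= 3/2"
 shows "strict_mono (%x. x + m * tilt_profile x)"
proof (rule strict_monoI)
 fix x x' :: real assume x: "x < x'"
 define p q r t where "p = clip 2 x' - clip 2 x" and "q = (clip 4 x' - clip 2 x') - (clip 4 x - clip 2 x)"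
  and "r = (clip 7 x' - clip 4 x') - (clip 7 x - clip 4 x)" and "t = (x' - clip 7 x') - (x - clip 7 x)"
 have n: "0 <= p" "0 <= q" "0 <= r" "0 <= t" and s: "p + q + r + t = x' - x"
  using x by (auto simp: p_def q_def r_def t_def clip_def max_def min_def)
 have "1/4 <= 1 - m / 2" "1/4 <= 1 + m" "1/4 <= 1 - m / 3" using m by simp_all
 hence "1/4 * p <= (1 - m / 2) * p" "1/4 * q <= (1 + m) * q" "1/4 * r <= (1 - m / 3) * r"
  using n by (simp_all only: mult_right_mono)
 moreover have "(x' + m * tilt_profile x') - (x + m * tilt_profile x) = (1 - m / 2) * p + (1 + m) * q + (1 - m / 3) * r + t"
  by (simp add: tilt_profile_def p_def q_def r_def t_def field_simps)
 ultimately show "x + m * tilt_profile x < x' + m * tilt_profile x'" using n s x by linarith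
qed

lemma isotopic_tilt: "isotopic_to_id tilt"
proof -
 let ?f = "%z. Re z + spread (Im z) * tilt_profile (Re z)"
 have "isotopic_to_id (%z. Complex (?f z) (Im z))"
 proof (rule isotopic_level_map)
  show "continuous_on UNIV ?f" unfolding spread_def tilt_profile_def by (intro continuous_intros)
  show "?f (Complex x y) < ?f (Complex x' y)" if "x < x'" for x x' y
   using strict_monoD[OF tilt_mono[OF spread_facts[of y]] that] by simp
  show "\<exists>x. M <= ?f (Complex x y)" for M y
   by (rule exI[of _ "max M 7"]) (simp add: tilt_profile_outside)
  show "\<exists>x. ?f (Complex x y) <= M" for M y
   by (rule exI[of _ "min M (- 7)"]) (simp add: tilt_profile_outside)
 qed
 thus ?thesis unfolding tilt_def .
qed

lemma tilt_facts:
 defines "u == %z. \<bar>Re (tilt z)\<bar>" and "m == %z. spread (Im z)"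
 shows "u z <= 2 - m z <-> \<bar>Re z\<bar> <= 2" "u z < 2 - m z <-> \<bar>Re z\<bar> < 2" "u z <= 4 + m z <-> \<bar>Re z\<bar> <= 4" "u z < 4 + m z <-> \<bar>Re z\<bar> < 4"
  "u z <= 8 <-> \<bar>Re z\<bar> <= 8" "u z < 8 <-> \<bar>Re z\<bar> < 8"
proof -
 note M = tilt_mono[OF spread_facts[of "Im z"]]
 have u: "u z = \<bar>Re z + m z * tilt_profile (Re z)\<bar>" by (simp add: u_def tilt_def m_def)
 show "u z <= 2 - m z <-> \<bar>Re z\<bar> <= 2" "u z < 2 - m z <-> \<bar>Re z\<bar> < 2" "u z <= 4 + m z <-> \<bar>Re z\<bar> <= 4" "u z < 4 + m z <-> \<bar>Re z\<bar> < 4"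
  "u z <= 8 <-> \<bar>Re z\<bar> <= 8" "u z < 8 <-> \<bar>Re z\<bar> < 8"
  unfolding u
  using strict_mono_abs[OF M, of 2 "2 - m z" "Re z"] strict_mono_abs[OF M, of 4 "4 + m z" "Re z"] strict_mono_abs[OF M, of 8 8 "Re z"]
  by (simp_all add: tilt_profile_values tilt_profile_outside m_def)
qed

definition raise_profile :: "real => real" where
 "raise_profile y = max 0 (min 1 y) - 1/3 * (max 1 (min 4 y) - 1)"

definition upper_raise :: "real => real" where
 "upper_raise x = ramp (max (2 - \<bar>x\<bar>) (\<bar>x\<bar> - 4))"

definition lower_raise :: "real => real" where
 "lower_raise x = ramp (2/3 * max (2 - \<bar>x\<bar>) (\<bar>x\<bar> - 4))"

definition raise :: "complex => complex" where
 "raise z = Complex (Re z) (Im z + upper_raise (Re z) * raise_profile (Im z) - lower_raise (Re z) * raise_profile (- Im z))"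

lemma raise_facts: "0 <= upper_raise x" "upper_raise x <= 1" "0 <= lower_raise x" "lower_raise x <= 1"
 by (simp_all add: upper_raise_def lower_raise_def ramp_facts)

lemma raise_profile_values: "raise_profile 1 = 1" "raise_profile 4 = 0" "y <= 0 ==> raise_profile y = 0" "4 <= y ==> raise_profile y = 0"
 by (simp_all add: raise_profile_def)

lemma raise_mono:
 assumes m: "0 <= m" "m <= 1" "0 <= n" "n <= 1"
 shows "strict_mono (%y. y + m * raise_profile y - n * raise_profile (- y))"
proof (rule strict_monoI)
 fix y y' :: real assume y: "y < y'"
 define p q p' q' t where "p = max 0 (min 1 y') - max 0 (min 1 y)" and "q = max 1 (min 4 y') - max 1 (min 4 y)"
  and "p' = max 0 (min 1 (- y)) - max 0 (min 1 (- y'))" and "q' = max 1 (min 4 (- y)) - max 1 (min 4 (- y'))"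
  and "t = (y' - y) - p - q - p' - q'"
 have k: "0 <= p" "0 <= q" "0 <= p'" "0 <= q'" "0 <= t"
  using y by (auto simp: p_def q_def p'_def q'_def t_def max_def min_def)
 have "2/3 <= 1 + m" "2/3 <= 1 - m / 3" "2/3 <= 1 + n" "2/3 <= 1 - n / 3" using m by simp_all
 hence "2/3 * p <= (1 + m) * p" "2/3 * q <= (1 - m / 3) * q" "2/3 * p' <= (1 + n) * p'" "2/3 * q' <= (1 - n / 3) * q'"
  using k by (simp_all only: mult_right_mono)
 moreover have "(y' + m * raise_profile y' - n * raise_profile (- y')) - (y + m * raise_profile y - n * raise_profile (- y)) =
   (1 + m) * p + (1 - m / 3) * q + (1 + n) * p' + (1 - n / 3) * q' + t"
  by (simp add: raise_profile_def p_def q_def p'_def q'_def t_def field_simps)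
 moreover have "p + q + p' + q' + t = y' - y" by (simp add: t_def)
 ultimately show "y + m * raise_profile y - n * raise_profile (- y) < y' + m * raise_profile y' - n * raise_profile (- y')"
  using k y by linarith
qed

lemma isotopic_raise: "isotopic_to_id raise"
proof -
 let ?f = "%z. Im z + upper_raise (Re z) * raise_profile (Im z) - lower_raise (Re z) * raise_profile (- Im z)"
 have "isotopic_to_id (%z. Complex (Re z) (?f z))"
 proof (rule isotopic_vertical_map)
  show "continuous_on UNIV ?f" unfolding upper_raise_def lower_raise_def raise_profile_def by (intro continuous_intros)
  show "?f (Complex x y) < ?f (Complex x y')" if "y < y'" for x y y'
   using strict_monoD[OF raise_mono[OF raise_facts] that] by simp
  show "\<exists>y. M <= ?f (Complex x y)" for M x
   by (rule exI[of _ "max M 4"]) (simp add: raise_profile_values)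
  show "\<exists>y. ?f (Complex x y) <= M" for M x
   by (rule exI[of _ "min M (- 4)"]) (simp add: raise_profile_values)
 qed
 thus ?thesis unfolding raise_def .
qed

lemma raise_compare:
 defines "v == %z. Im (raise z)" and "a == %z. upper_raise (Re z)" and "b == %z. lower_raise (Re z)"
 shows "v z <= 1 + a z <-> Im z <= 1" "1 + a z <= v z <-> 1 <= Im z" "v z <= - (1 + b z) <-> Im z <= - 1" "- (1 + b z) <= v z <-> - 1 <= Im z"
  "4 <= r ==> \<bar>v z\<bar> <= r <-> \<bar>Im z\<bar> <= r" "4 <= r ==> \<bar>v z\<bar> < r <-> \<bar>Im z\<bar> < r"
proof -
 note M = raise_mono[OF raise_facts, of "Re z" "Re z"]
 have v: "v z = Im z + a z * raise_profile (Im z) - b z * raise_profile (- Im z)" by (simp add: v_def raise_def a_def b_def)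
 show "v z <= 1 + a z <-> Im z <= 1" "1 + a z <= v z <-> 1 <= Im z" "v z <= - (1 + b z) <-> Im z <= - 1" "- (1 + b z) <= v z <-> - 1 <= Im z"
  unfolding v
  using strict_mono_less_eq[OF M, of "Im z" 1] strict_mono_less_eq[OF M, of 1 "Im z"]
   strict_mono_less_eq[OF M, of "Im z" "- 1"] strict_mono_less_eq[OF M, of "- 1" "Im z"]
  by (simp_all add: raise_profile_values a_def b_def)
 show "\<bar>v z\<bar> <= r <-> \<bar>Im z\<bar> <= r" "\<bar>v z\<bar> < r <-> \<bar>Im z\<bar> < r" if "4 <= r"
  unfolding v using strict_mono_abs[OF M, of r r "Im z"] that by (simp_all add: raise_profile_values a_def b_def)
qed

lemma deform_small_discs:
 assumes h: "plane_homeo h" and s: "!!z. sup_norm (h z) <= 8 <-> sup_norm z <= 8" "!!z. sup_norm (h z) = 8 <-> sup_norm z = 8"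
  and f: "!!z. z \<in> right_small Un left_small ==> h z = z"
  and X: "!!z. z ~: interior right_small ==> z ~: interior left_small ==> h z \<in> X' <-> z \<in> X"
  and Y: "!!z. z ~: interior right_small ==> z ~: interior left_small ==> z ~: X ==> h z \<in> Y' <-> z \<in> Y"
 shows "map_tangle h (pat square8 {right_small, left_small} X Y b small_marks) = pat square8 {right_small, left_small} X' Y' b small_marks"
  "h ` right_small = right_small" "h ` left_small = left_small"
proof -
 have fx: "h ` S = S" if "S \<subseteq> right_small Un left_small" for S using f that by force
 show i: "h ` right_small = right_small" "h ` left_small = left_small" by (rule fx; blast)+
 have "bd right_small \<subseteq> right_small" "bd left_small \<subseteq> left_small" by (simp_all add: closed_rect frontier_subset_closed)
 hence "h ` {z \<in> bd right_small Un bd left_small. bottom_mark z} = {z \<in> bd right_small Un bd left_small. bottom_mark z}"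
  by (intro fx) blast
 moreover have "h ` {z. sup_norm z = 8} = {z. sup_norm z = 8}" "h ` square8 = square8"
  by (rule homeo_image_eq[OF h]; simp add: s)+
 ultimately show "map_tangle h (pat square8 {right_small, left_small} X Y b small_marks) = pat square8 {right_small, left_small} X' Y' b small_marks"
  using i X Y by (intro map_pat[OF h]) (simp_all add: image_Un)
qed

definition common_curves :: "complex set" where
 "common_curves = {z. \<bar>Re z\<bar> <= 5 & 1 + upper_raise (Re z) <= Im z & Im z <= 4 &
   (\<bar>Re z\<bar> = 5 | Im z = 1 + upper_raise (Re z) | Im z = 4) & (Im z = 1 --> \<not> (2 < \<bar>Re z\<bar> & \<bar>Re z\<bar> < 4)) |
  \<bar>Re z\<bar> <= 11/2 & 1 + lower_raise (Re z) <= - Im z & - Im z <= 4 &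
   (\<bar>Re z\<bar> = 11/2 | - Im z = 1 + lower_raise (Re z) | - Im z = 4) & (Im z = - 1 --> \<not> (2 < \<bar>Re z\<bar> & \<bar>Re z\<bar> < 4))}"

definition common_colour :: "complex set" where
 "common_colour = {z. \<bar>Re z\<bar> <= 5 & 1 + upper_raise (Re z) <= Im z & Im z <= 4 |
  \<bar>Re z\<bar> <= 11/2 & 1 + lower_raise (Re z) <= - Im z & - Im z <= 4}"

abbreviation "common_tangle b == pat square8 {right_small, left_small} common_curves common_colour b small_marks"

lemma raise_values:
 "upper_raise x = 0 <-> 2 <= \<bar>x\<bar> & \<bar>x\<bar> <= 4" "lower_raise x = 0 <-> 2 <= \<bar>x\<bar> & \<bar>x\<bar> <= 4"
 by (auto simp: upper_raise_def lower_raise_def ramp_def max_def min_def)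

lemma raise_two_loops: "map_tangle raise (two_loops b) = common_tangle b" "raise ` right_small = right_small" "raise ` left_small = left_small"
proof -
 let ?X = "{z \<in> bd upper_loop Un bd lower_loop. \<bar>Im z\<bar> = 1 --> \<not> (2 < \<bar>Re z\<bar> & \<bar>Re z\<bar> < 4)}"
 have R: "Re (raise z) = Re z" for z by (simp add: raise_def)
 have s: "sup_norm (raise z) <= 8 <-> sup_norm z <= 8" "sup_norm (raise z) = 8 <-> sup_norm z = 8" for z
  using raise_compare(5,6)[where r = 8 and z = z] R[of z] sup_norm_facts[of z] sup_norm_facts[of "raise z"] by (simp, argo)+
 have f: "raise z = z" if "z \<in> right_small Un left_small" for z
 proof -
  have "2 <= \<bar>Re z\<bar> & \<bar>Re z\<bar> <= 4" using that by (auto simp: in_rect)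
  hence "upper_raise (Re z) = 0" "lower_raise (Re z) = 0" by (simp_all add: raise_values)
  thus ?thesis by (simp add: raise_def)
 qed
 have X: "raise z \<in> common_curves <-> z \<in> ?X" for z
  using raise_compare(1-4)[of z] raise_compare(5,6)[OF order_refl, of z] raise_facts[of "Re z"] raise_values[of "Re z"] abs_eq[of "Re z"] abs_eq[of "Im z"] abs_eq[of "Im (raise z)"]
  unfolding common_curves_def mem_Collect_eq R Un_iff in_bd_rect in_rect by argo
 have Y: "raise z \<in> common_colour <-> z \<in> upper_loop Un lower_loop" for z
  using raise_compare(1-4)[of z] raise_compare(5,6)[OF order_refl, of z] raise_facts[of "Re z"] raise_values[of "Re z"] abs_eq[of "Re z"] abs_eq[of "Im z"] abs_eq[of "Im (raise z)"]
  unfolding common_colour_def mem_Collect_eq R Un_iff in_rect by argo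
 note d = deform_small_discs[OF isotopic_homeo[OF isotopic_raise] s f X Y]
 show "map_tangle raise (two_loops b) = common_tangle b" unfolding two_loops_def by (rule d(1))
 show "raise ` right_small = right_small" by (rule d(2))
 show "raise ` left_small = left_small" by (rule d(3))
qed

lemma upper_raise_cases:
 assumes "u = \<bar>x\<bar>"
 shows "2 <= u & u <= 4 & upper_raise x = 0 | 1 <= u & u <= 2 & upper_raise x = 2 - u | u <= 1 & upper_raise x = 1 |
  4 <= u & u <= 5 & upper_raise x = u - 4 | 5 <= u & upper_raise x = 1"
 unfolding assms by (simp add: upper_raise_def ramp_def max_def min_def)

lemma lower_raise_cases:
 assumes "u = \<bar>x\<bar>"
 shows "2 <= u & u <= 4 & lower_raise x = 0 | 1/2 <= u & u <= 2 & lower_raise x = 2/3 * (2 - u) | u <= 1/2 & lower_raise x = 1 |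
  4 <= u & u <= 11/2 & lower_raise x = 2/3 * (u - 4) | 11/2 <= u & lower_raise x = 1"
 unfolding assms by (simp add: lower_raise_def ramp_def max_def min_def)

lemma spread_cases:
 "- 1 <= y & y <= 1 & spread y = 0 | 1 <= y & y <= 2 & spread y = y - 1 | 2 <= y & spread y = 1 |
  - 2 <= y & y <= - 1 & spread y = 3/2 * (- y - 1) | y <= - 2 & spread y = 3/2"
 unfolding spread_def ramp_def max_def min_def by argo

lemma tilt_rotated_rings: "map_tangle tilt (rotated_rings b) = common_tangle b" "tilt ` right_small = right_small" "tilt ` left_small = left_small"
proof -
 let ?X = ring_curves
 have I: "Im (tilt z) = Im z" for z by (simp add: tilt_def)
 have s: "sup_norm (tilt z) <= 8 <-> sup_norm z <= 8" "sup_norm (tilt z) = 8 <-> sup_norm z = 8" for z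
  using tilt_facts(5,6)[of z] I[of z] sup_norm_facts[of z] sup_norm_facts[of "tilt z"] by (simp, argo)+
 have f: "tilt z = z" if "z \<in> right_small Un left_small" for z
 proof -
  have "- 1 <= Im z & Im z <= 1" using that by (auto simp: in_rect)
  hence "spread (Im z) = 0" by (simp add: spread_def ramp_def)
  thus ?thesis by (simp add: tilt_def)
 qed
 have X: "tilt z \<in> common_curves <-> z \<in> ?X" and Y: "z ~: ?X ==> tilt z \<in> common_colour <-> z \<in> {z. 2 < sup_norm z & sup_norm z < 4}"
  if "z ~: interior right_small" "z ~: interior left_small" for z
 proof -
  define u p y m a c q where d: "u = \<bar>Re (tilt z)\<bar>" "p = \<bar>Re z\<bar>" "y = Im z" "m = spread y" "a = upper_raise (Re (tilt z))"
   "c = lower_raise (Re (tilt z))" "q = sup_norm z"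
  have t: "u <= 2 - m <-> p <= 2" "u < 2 - m <-> p < 2" "u <= 4 + m <-> p <= 4" "u < 4 + m <-> p < 4"
   unfolding d by (rule tilt_facts)+
  have up: "2 <= u & u <= 4 & a = 0 | 1 <= u & u <= 2 & a = 2 - u | u <= 1 & a = 1 | 4 <= u & u <= 5 & a = u - 4 | 5 <= u & a = 1"
   unfolding d by (rule upper_raise_cases) simp
  have lo: "2 <= u & u <= 4 & c = 0 | 1/2 <= u & u <= 2 & c = 2/3 * (2 - u) | u <= 1/2 & c = 1 |
    4 <= u & u <= 11/2 & c = 2/3 * (u - 4) | 11/2 <= u & c = 1"
   unfolding d by (rule lower_raise_cases) simp
  note sp = spread_cases[of y, folded d(4)]
  have q: "p <= q" "y <= q" "- y <= q" "q = p | q = y | q = - y" by (auto simp: d sup_norm_def max_def)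
  have int: "\<not> (- 1 < y & y < 1 & 2 < p & p < 4)" using that unfolding in_int_rect d by (auto simp: abs_if split: if_splits)
  have p: "0 <= p" "0 <= u" by (simp_all add: d)
  have C: "tilt z \<in> common_curves <-> u <= 5 & 1 + a <= y & y <= 4 & (u = 5 | y = 1 + a | y = 4) & (y = 1 --> \<not> (2 < u & u < 4)) |
    u <= 11/2 & 1 + c <= - y & - y <= 4 & (u = 11/2 | - y = 1 + c | - y = 4) & (y = - 1 --> \<not> (2 < u & u < 4))"
   unfolding common_curves_def mem_Collect_eq I d ..
  have K: "tilt z \<in> common_colour <-> u <= 5 & 1 + a <= y & y <= 4 | u <= 11/2 & 1 + c <= - y & - y <= 4"
   unfolding common_colour_def mem_Collect_eq I d ..
  have Z: "z \<in> ?X <-> (q = 2 | q = 4) & (- 1 < y & y < 1 --> p ~= 2 & p ~= 4)"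
   unfolding mem_Collect_eq d abs_less_iff by argo
  have ac: "0 <= a" "0 <= c" by (simp_all add: d raise_facts)
  consider (middle) "- 1 < y" "y < 1" | (top) "1 <= y" | (bottom) "y <= - 1" by linarith
  hence "(tilt z \<in> common_curves <-> z \<in> ?X) & (z ~: ?X --> tilt z \<in> common_colour <-> 2 < q & q < 4)"
  proof cases
   case middle
   thus ?thesis using q int p ac unfolding C K Z by argo
  next
   case top
   hence "1 <= y & y <= 2 & m = y - 1 | 2 <= y & m = 1" using sp by argo
   thus ?thesis using top t up q p ac unfolding C K Z by argo
  next
   case bottom
   hence "- 2 <= y & y <= - 1 & m = 3/2 * (- y - 1) | y <= - 2 & m = 3/2" using sp by argo
   thus ?thesis using bottom t lo q p ac unfolding C K Z by argo
  qed
  thus "tilt z \<in> common_curves <-> z \<in> ?X"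
   and "z ~: ?X ==> tilt z \<in> common_colour <-> z \<in> {z. 2 < sup_norm z & sup_norm z < 4}"
   unfolding d(7) by blast+
 qed
 note d = deform_small_discs[OF isotopic_homeo[OF isotopic_tilt] s f X Y]
 show "map_tangle tilt (rotated_rings b) = common_tangle b" unfolding rotated_rings_def by (rule d(1))
 show "tilt ` right_small = right_small" by (rule d(2))
 show "tilt ` left_small = left_small" by (rule d(3))
qed

context subfactor_planar_algebra
begin

theorem fourier_isometry:
 assumes x: "x \<in> box_space A 2 s"
 shows "box_trace A 2 (opp s) (box_mult A 2 (opp s) (adj A 2 (opp s) (fourier A s x)) (fourier A s x)) =
  box_trace A 2 s (box_mult A 2 s (adj A 2 s x) x)"
proof -
 let ?f = "%D. if D = right_small then x else adj A 2 s x" and ?b = "opp s = Pos"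
 have "Complex 3 0 \<in> right_small" "Complex 3 0 ~: left_small" by (simp_all add: in_rect)
 hence ne: "left_small ~= right_small" by metis
 note R = rotated_rings[OF x] and L = two_loops[OF x]
 note V = x adj_closed[OF x]
 have f: "?f right_small = x" "?f left_small = adj A 2 s x" using ne by simp_all
 have "act A (common_tangle ?b) ?f = act A (rotated_rings ?b) ?f"
  by (rule act_map_two[OF R(1) isotopic_tilt tilt_rotated_rings(1)], simp add: rotated_rings_def)
   (simp_all only: tilt_rotated_rings R(2,3) f V)
 moreover have "act A (common_tangle ?b) ?f = act A (two_loops ?b) ?f"
  by (rule act_map_two[OF L(1) isotopic_raise raise_two_loops(1)], simp add: two_loops_def)
   (simp_all only: raise_two_loops L(2,3) f V)
 ultimately show ?thesis using R(4)[of ?f] L(4)[of ?f] f by (simp add: box_trace_def[of A 2 "opp s"] scalar_of_scl)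
qed

end

section \<open>Norms\<close>

context subfactor_planar_algebra
begin

lemma positive_star_algebra_box:
 "positive_star_algebra (scl A) (box_space A 2 s) (box_mult A 2 s) (adj A 2 s) (box_unit A 2 s) (box_trace A 2 s)"
proof -
 interpret vector_space "scl A" by (rule vector_space_scl)
 show ?thesis
  by unfold_locales
   (auto simp: subspace_box_space box_mult_closed box_mult_linear_left box_mult_linear_right box_mult_assoc box_unit_closed
    box_mult_unit_left box_mult_unit_right adj_closed adj_adj adj_add adj_scale adj_box_mult box_trace_linear
    finite_dimensional positive_definite)
qed

lemma norm_formulas:
 assumes irr: "irreducible_planar_algebra A" and x: "x \<in> box_space A 2 s"
 obtains I :: "real set" and w where "finite I" "I ~= {}" "\<forall>t\<in>I. 0 <= t & 0 < w t"
  "Re (box_trace A 2 s (box_mult A 2 s (adj A 2 s x) x)) = (\<Sum>t\<in>I. t * w t)"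
  "\<forall>p>0. p_norm A s (ereal p) x = (\<Sum>t\<in>I. t powr (p / 2) * w t) powr (1 / p)"
  "p_norm A s \<infinity> x = sqrt (Max I)" "sum w I = (loop_value A)\<^sup>2"
  "multiple_of_unitary A 2 s x <-> (\<forall>t\<in>I. \<forall>u\<in>I. t = u)"
proof -
 interpret positive_star_algebra "scl A" "box_space A 2 s" "box_mult A 2 s" "adj A 2 s" "box_unit A 2 s" "box_trace A 2 s"
  by (rule positive_star_algebra_box)
 let ?a = "box_mult A 2 s (adj A 2 s x) x" and ?u = "box_unit A 2 s"
 obtain L e where L: "orth_decomp L e" and a: "?a = (\<Sum>t\<in>L. scl A (of_real t) (e t))" and pos: "!!t. t \<in> L ==> 0 <= t"
  using spectral_decomposition[OF x] by metis
 define I where "I = {t \<in> L. e t ~= 0}"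
 define w where "w = (%t. Re (box_trace A 2 s (e t)))"
 have fin: "finite L" "finite I" using L by (simp_all add: orth_decomp_def I_def)
 have w: "0 < w t" if "t \<in> I" for t using tr_projection(3)[OF L, of t] that by (simp add: I_def w_def)
 have res: "(\<Sum>t\<in>L. f t * w t) = (\<Sum>t\<in>I. f t * w t)" for f :: "real => real"
  by (rule sum.mono_neutral_right[OF fin(1)]) (auto simp: I_def w_def)
 have W: "Re (box_trace A 2 s ?u) = (loop_value A)\<^sup>2"
  by (simp add: box_trace_2_unit loop_value[OF irr] power2_eq_square)
 have u: "?u ~= 0"
 proof
  assume "?u = 0"
  thus False using W loop_value(2)[OF irr] by simp
 qed
 have sw: "sum w I = (loop_value A)\<^sup>2"
 proof -
  have "?u = (\<Sum>t\<in>L. scl A (of_real 1) (e t))" using L by (simp add: orth_decomp_def)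
  hence "Re (box_trace A 2 s ?u) = (\<Sum>t\<in>L. 1 * w t)" unfolding w_def using tr_fun_calc[OF L, of "%_. 1"] by simp
  thus ?thesis using res[of "%_. 1"] W by simp
 qed
 have "(\<Sum>t\<in>L. e t) ~= 0" using L u by (simp add: orth_decomp_def)
 hence ne: "I ~= {}" unfolding I_def by (metis (mono_tags, lifting) empty_iff mem_Collect_eq sum.neutral)
 let ?abs = "\<Sum>t\<in>L. scl A (of_real (sqrt t)) (e t)"
 have abs: "abs_elem A 2 s x = ?abs"
  unfolding abs_elem_def fun_calc_def by (rule the_fun_calc[OF L a])
 have inj: "inj_on sqrt L" by (simp add: inj_on_def)
 let ?f = "%t. e (the_inv_into L sqrt t)"
 have re: "(\<Sum>t\<in>sqrt ` L. scl A (of_real (\<phi> t)) (?f t)) = (\<Sum>t\<in>L. scl A (of_real (\<phi> (sqrt t))) (e t))" for \<phi>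
  by (simp add: sum.reindex[OF inj] the_inv_into_f_f[OF inj])
 have calc: "fun_calc A 2 s \<phi> (abs_elem A 2 s x) = (\<Sum>t\<in>L. scl A (of_real (\<phi> (sqrt t))) (e t))" for \<phi>
  unfolding abs re[symmetric] re[of "%t. t", symmetric] fun_calc_def
  by (rule the_fun_calc[OF orth_decomp_reindex[OF L inj] refl])
 have half: "sqrt t powr p = t powr (p / 2)" if "0 <= t" for t p :: real
  using that by (simp add: powr_half_sqrt[symmetric] powr_powr)
 show thesis
 proof (rule that[of I w])
  show "Re (box_trace A 2 s ?a) = (\<Sum>t\<in>I. t * w t)"
   unfolding a tr_fun_calc[OF L, of "%t. t"] using res[of "%t. t"] by (simp add: w_def)
  have "Re (box_trace A 2 s (\<Sum>t\<in>L. scl A (of_real (sqrt t powr p)) (e t))) = (\<Sum>t\<in>I. t powr (p / 2) * w t)" for p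
   using tr_fun_calc[OF L, of "%t. sqrt t powr p"] res[of "%t. t powr (p / 2)"] pos half by (simp add: w_def)
  thus "\<forall>p>0. p_norm A s (ereal p) x = (\<Sum>t\<in>I. t powr (p / 2) * w t) powr (1 / p)"
   by (simp add: p_norm_def calc)
  show "p_norm A s \<infinity> x = sqrt (Max I)"
   using operator_norm_eq_Max[OF x L u a] by (simp add: p_norm_def op_norm_def hilbert_norm_def I_def)
  show "multiple_of_unitary A 2 s x <-> (\<forall>t\<in>I. \<forall>u\<in>I. t = u)"
   using multiple_of_unitary_iff[OF x] scalar_iff_single_eigenvalue[OF L a u]
   unfolding multiple_of_unitary_def unitary_elem_def I_def by blast
 qed (use fin ne w sw pos in \<open>auto simp: I_def\<close>)
qed

lemma
 assumes irr: "irreducible_planar_algebra A" and x: "x \<in> box_space A 2 s"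
 shows p_norm_2: "p_norm A s 2 x = sqrt (Re (box_trace A 2 s (box_mult A 2 s (adj A 2 s x) x)))"
  and two_norm_equality: "!!p. 0 < p ==> p ~= 2 ==>
   p_norm A s 2 x = loop_value A powr (1 - 2 / p) * p_norm A s (ereal p) x <-> multiple_of_unitary A 2 s x"
  and two_norm_equality_infinity: "p_norm A s 2 x = loop_value A * p_norm A s \<infinity> x <-> multiple_of_unitary A 2 s x"
proof -
 obtain I :: "real set" and w where I: "finite I" "I ~= {}" "\<forall>t\<in>I. 0 <= t & 0 < w t"
  "Re (box_trace A 2 s (box_mult A 2 s (adj A 2 s x) x)) = (\<Sum>t\<in>I. t * w t)"
  "\<forall>p>0. p_norm A s (ereal p) x = (\<Sum>t\<in>I. t powr (p / 2) * w t) powr (1 / p)"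
  "p_norm A s \<infinity> x = sqrt (Max I)" "sum w I = (loop_value A)\<^sup>2"
  "multiple_of_unitary A 2 s x <-> (\<forall>t\<in>I. \<forall>u\<in>I. t = u)"
  by (rule norm_formulas[OF irr x])
 have "0 <= (\<Sum>t\<in>I. t * w t)" using I(3) by (intro sum_nonneg) (simp add: less_imp_le)
 moreover have "(\<Sum>t\<in>I. t powr 1 * w t) = (\<Sum>t\<in>I. t * w t)" using I(3) by (intro sum.cong) auto
 ultimately show p_norm_2: "p_norm A s 2 x = sqrt (Re (box_trace A 2 s (box_mult A 2 s (adj A 2 s x) x)))"
  using I(5)[rule_format, of 2] by (simp add: I(4) powr_half_sqrt)
 show "p_norm A s 2 x = loop_value A powr (1 - 2 / p) * p_norm A s (ereal p) x <-> multiple_of_unitary A 2 s x"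
  if p: "0 < p" "p ~= 2" for p
 proof -
  let ?d = "loop_value A" and ?S = "\<Sum>t\<in>I. t * w t" and ?B = "\<Sum>t\<in>I. t powr (p / 2) * w t"
  have d: "0 < ?d" using loop_value(2)[OF irr] .
  have S: "0 <= ?S" and B: "0 <= ?B" using I(3) by (auto intro!: sum_nonneg simp: less_imp_le)
  have sq: "(?d powr (1 - 2 / p) * ?B powr (1 / p))\<^sup>2 = (sum w I) powr (1 - 1 / (p / 2)) * ?B powr (1 / (p / 2))"
  proof -
   have "(?d powr (1 - 2 / p))\<^sup>2 = (sum w I) powr (1 - 1 / (p / 2))"
    unfolding I(7) power2_eq_square using powr_mult[of ?d ?d "1 - 2 / p"] d by simp
   moreover have "(?B powr (1 / p))\<^sup>2 = ?B powr (1 / (p / 2))"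
    unfolding power2_eq_square powr_add[symmetric] by simp
   ultimately show ?thesis by (simp add: power_mult_distrib)
  qed
  have "p_norm A s 2 x = ?d powr (1 - 2 / p) * p_norm A s (ereal p) x <-> sqrt ?S = ?d powr (1 - 2 / p) * ?B powr (1 / p)"
   unfolding p_norm_2 I(4) I(5)[rule_format, OF p(1)] ..
  also have "... <-> ?S = (?d powr (1 - 2 / p) * ?B powr (1 / p))\<^sup>2"
  proof -
   have "sqrt a = z <-> a = z\<^sup>2" if "0 <= z" for a z :: real using that real_sqrt_eq_iff[of a "z\<^sup>2"] by simp
   thus ?thesis by simp
  qed
  also have "... <-> (\<forall>t\<in>I. \<forall>u\<in>I. t = u)"
   unfolding sq by (rule Jensen_powr_equality) (use I(1-3) p in auto)
  finally show ?thesis unfolding I(8) .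
 qed
 show "p_norm A s 2 x = loop_value A * p_norm A s \<infinity> x <-> multiple_of_unitary A 2 s x"
 proof -
  have le: "t <= Max I" if "t \<in> I" for t using I(1) that by simp
  have "loop_value A * sqrt (Max I) = sqrt (sum w I * Max I)"
   unfolding I(7) using loop_value(2)[OF irr] by (simp add: real_sqrt_mult)
  hence "p_norm A s 2 x = loop_value A * p_norm A s \<infinity> x <-> (\<Sum>t\<in>I. t * w t) = sum w I * Max I"
   unfolding p_norm_2 I(4,6) by simp
  also have "... <-> (\<Sum>t\<in>I. (Max I - t) * w t) = 0"
  proof -
   have "(\<Sum>t\<in>I. (Max I - t) * w t) = sum w I * Max I - (\<Sum>t\<in>I. t * w t)"
    by (simp only: left_diff_distrib sum_subtractf sum_distrib_left mult.commute[of "sum w I"])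
   thus ?thesis by auto
  qed
  also have "... <-> (\<forall>t\<in>I. (Max I - t) * w t = 0)"
   using I(1,3) le by (intro sum_nonneg_eq_0_iff) (auto intro!: mult_nonneg_nonneg simp: less_imp_le)
  also have "... <-> (\<forall>t\<in>I. t = Max I)" using I(3) by (auto simp: less_le)
  also have "... <-> (\<forall>t\<in>I. \<forall>u\<in>I. t = u)" using Max_in[OF I(1,2)] by metis
  finally show ?thesis unfolding I(8) .
 qed
qed

lemma Fourier_2_norm:
 assumes irr: "irreducible_planar_algebra A" and x: "x \<in> box_space A 2 s"
 shows "p_norm A (opp s) 2 (fourier A s x) = p_norm A s 2 x"
 unfolding p_norm_2[OF irr x] p_norm_2[OF irr fourier_closed[OF x]] fourier_isometry[OF x] ..

end

theorem proposition3p12: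
  fixes A :: "'a::ab_group_add planar_data" and s :: sign and x :: 'a
  assumes "subfactor_planar_algebra A"
    and "irreducible_planar_algebra A"
    and "x \<in> box_space A 2 s"
  shows "(\<forall>p :: ereal. 0 < p \<longrightarrow> p \<le> \<infinity> \<longrightarrow> 1 / p < 1 / 2 \<longrightarrow>
            (p_norm A (opp s) 2 (fourier A s x) =
               loop_value A powr real_of_ereal (1 - 2 / p) * p_norm A s p x
             \<longleftrightarrow> multiple_of_unitary A 2 s x)) \<and>
         (\<forall>q :: ereal. 0 < q \<longrightarrow> q \<le> \<infinity> \<longrightarrow> 1 / q > 1 / 2 \<longrightarrow>
            (p_norm A (opp s) q (fourier A s x) =
               loop_value A powr real_of_ereal (2 / q - 1) * p_norm A s 2 x
             \<longleftrightarrow> multiple_of_unitary A 2 (opp s) (fourier A s x)))"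
proof -
 interpret subfactor_planar_algebra A by (rule assms(1))
 note irr = assms(2) and x = assms(3)
 have half: "1 / 2 = ereal (1 / 2)" by (simp add: one_ereal_def)
 have r: "1 / ereal t = ereal (1 / t)" "2 / ereal t = ereal (2 / t)" if "0 < t" for t
  using that by (simp_all add: one_ereal_def divide_ereal_def inverse_eq_divide)
 have d: "0 < loop_value A" by (rule loop_value(2)[OF irr])
 show ?thesis
 proof (intro conjI allI impI)
  fix p :: ereal assume p: "0 < p" "1 / p < 1 / 2"
  show "p_norm A (opp s) 2 (fourier A s x) = loop_value A powr real_of_ereal (1 - 2 / p) * p_norm A s p x
    <-> multiple_of_unitary A 2 s x"
  proof (cases p)
   case (real t)
   hence t: "0 < t" "1 / t < 1 / 2" using p r(1)[of t] unfolding half by simp_all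
   hence "t ~= 2" by auto
   have "real_of_ereal (1 - 2 / p) = 1 - 2 / t" unfolding real r(2)[OF t(1)] by (simp add: one_ereal_def)
   thus ?thesis using two_norm_equality[OF irr x t(1) \<open>t ~= 2\<close>] unfolding Fourier_2_norm[OF irr x] real by simp
  next
   case PInf
   thus ?thesis using two_norm_equality_infinity[OF irr x] d unfolding Fourier_2_norm[OF irr x] by simp
  qed (use p in auto)
 next
  fix q :: ereal assume q: "0 < q" "1 / q > 1 / 2"
  show "p_norm A (opp s) q (fourier A s x) = loop_value A powr real_of_ereal (2 / q - 1) * p_norm A s 2 x
    <-> multiple_of_unitary A 2 (opp s) (fourier A s x)"
  proof (cases q)
   case (real t)
   hence t: "0 < t" "1 / t > 1 / 2" using q r(1)[of t] unfolding half by simp_all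
   hence "t ~= 2" by auto
   have e: "real_of_ereal (2 / ereal t - 1) = 2 / t - 1" unfolding r(2)[OF t(1)] by (simp add: one_ereal_def)
   let ?c = "loop_value A powr (2 / t - 1)"
   have c: "0 < ?c" "loop_value A powr (1 - 2 / t) = 1 / ?c" using d by (simp_all add: powr_minus_divide[symmetric])
   have k: "u = ?c * v <-> v = 1 / ?c * u" for u v using c(1) by (auto simp: field_simps)
   show ?thesis
    unfolding real e Fourier_2_norm[OF irr x, symmetric] k
    by (rule two_norm_equality[OF irr fourier_closed[OF x] t(1) \<open>t ~= 2\<close>, unfolded c(2)])
  next
   case PInf
   hence "ereal (1 / 2) < 0" using q(2) unfolding half by simp
   thus ?thesis by simp
  qed (use q in auto)
 qed
qed

end
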